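(* Let $R_0$ be a commutative unital ring, $V$ a free $R_0$-module of finite rank $n$, and $E=\Lambda^*V$. If $\mathcal{A}$ is a superfiltered $A_\infty$-deformation of $E$ with disc potential $\mathfrak{P}\in R$, then there is a canonical isomorphism of unital $R_0$-algebras $$\operatorname{HH}^*(\mathcal{A})\cong\operatorname{H}^*\big(C\ell(-\tfrac12\operatorname{Hess}(\mathfrak{P})),\,-\mathrm{d}\mathfrak{P}\lrcorner\bullet\big),$$ where $C\ell$ is the Clifford algebra over $R$ on the module $V_R=R\otimes_{R_0}V$, $\operatorname{Hess}(\mathfrak{P})$ is the Hessian quadratic form of $\mathfrak{P}$ over $R$, and the differential $-\mathrm{d}\mathfrak{P}\lrcorner\bullet$ is contraction with $-\mathrm{d}\mathfrak{P}$.
   Context: Tensor products are over $R_0$. A superfiltered module is a module $X$ with a $\mathbb{Z}/2$-grading and an increasing Hausdorff exhaustive filtration $(F^pX)_{p\in\mathbb{Z}}$ with $F^pX=(F^pX\cap X^0)\oplus(F^pX\cap X^1)$ and $F^{p+1}X\cap X^p=F^pX\cap X^p$. A map is superfiltered of degree $r$ if it has degree $r$ mod 2 and sends $F^p$ into $F^{p+r}$; its leading term is the induced degree $r$ map on $\operatorname{gr}$. $A_\infty$-algebras (Seidel's signs): degree 1 operations $\mu^k:\mathcal{A}[1]^{\otimes k}\to\mathcal{A}[1]$, $\sum(-1)^{\maltese_i}\mu^{k-j+1}(a_k,\dots,\mu^j(a_{i+j},\dots,a_{i+1}),a_i,\dots,a_1)=0$, $\maltese_i=|a_1|+\dots+|a_i|-i$.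 Minimal: $\mu^1=0$. Strict unit: $\mu^2(a,1)=a=(-1)^{|a|}\mu^2(1,a)$, and $\mu^{k\ne2}$ vanishes if some input is $1$. A superfiltered $A_\infty$-deformation of $E$ is a strictly unital minimal $\mathbb{Z}/2$-graded $A_\infty$-algebra $\mathcal{A}$ over $R_0$ on a superfiltered module, with every $\mu^k$ superfiltered of degree 1 on shifted modules (unit in $F^0$), with an isomorphism of graded modules $\operatorname{gr}\mathcal{A}\cong E$ under which the leading terms of the $\mu^k$ become the standard operations of $E$ (only $\mu^2(a_2,a_1)=(-1)^{|a_1|}a_2\wedge a_1$ nonzero). Then $F^0\mathcal{A}\cong R_0$, $F^1\mathcal{A}\cap\mathcal{A}^1\cong V$. $R=R_0[[x_1,\dots,x_n]]$ is the ring of formal functions on $V$, $x_i$ dual coordinates to a basis $v_i$. Disc potential: $\mathfrak{P}=\sum_{k\ge2}\sum_{i_1,\dots,i_k}\mu^k(v_{i_k},\dots,v_{i_1})x_{i_1}\cdots x_{i_k}\in R$. Hochschild cohomology: $\operatorname{HH}^*(\mathcal{A})$ is the cohomology of $CC^t(\mathcal{A})=\prod_{r\ge0}\operatorname{Hom}^t_{R_0}(\mathcal{A}[1]^{\otimes r},\mathcal{A})$ ($t\in\mathbb{Z}/2$) with $(\mathrm{d}\phi)(a_k,\dots,a_1)=\sum(-1)^{(t-1)\maltese_i}\mu^{k-j+1}(a_k,\dots,\phi^j(a_{i+j},\dots,a_{i+1}),a_i,\dots,a_1)-\sum(-1)^{\maltese_i+t-1}\phi^{k-j+1}(a_k,\dots,\mu^j(a_{i+j},\dots,a_{i+1}),a_i,\dots,a_1)$;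 equivalently of the reduced subcomplex of $\phi$ vanishing when some input is a scalar multiple of the unit. With $(\phi\smile\psi)^k(a_k,\dots,a_1)=\sum(-1)^{(|\phi|-1)\maltese_l+(|\psi|-1)\maltese_i}\mu(a_k,\dots,\phi^m(a_{l+m},\dots,a_{l+1}),a_l,\dots,\psi^j(a_{i+j},\dots,a_{i+1}),a_i,\dots,a_1)$, the product of $\phi$ and $\psi$ is $(-1)^{|\psi|}\phi\smile\psi$; the unit is $1_{\mathcal{A}}$ in length zero. Clifford algebra: $C\ell(Q)$ is the tensor algebra over $R$ on $V_R$ modulo $v\otimes v-Q(v)$. $\tfrac12\operatorname{Hess}(\mathfrak{P})(\sum_ia_iv_i)=\sum_ia_i^2\,\tfrac12\partial_i^2\mathfrak{P}+\sum_{i<j}a_ia_j\,\partial_i\partial_j\mathfrak{P}$, where $\tfrac12\partial_i^2$ multiplies $x_i^{m}$ to $\tfrac{m(m-1)}2x_i^{m-2}$ (meaningful even if 2 is not invertible). The differential $-\mathrm{d}\mathfrak{P}\lrcorner\bullet$ is the unique $R$-linear odd derivation with $v_i\mapsto-\partial\mathfrak{P}/\partial x_i$. *)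

theory Defs
  imports Complex_Main "HOL-Library.Poly_Mapping" "HOL-Library.Multiset" "HOL-Algebra.QuotRing" "HOL-Algebra.Module"
begin

section \<open>Formal power series in several commuting variables\<close>

text \<open>
  The variables are \<open>x\<^sub>i\<close> for \<open>i :: nat\<close>; a monomial is the multiset of its variables.  The ring
  \<open>R = R\<^sub>0[[x\<^sub>i : i < n]]\<close> is the subring \<open>mfps_vars n\<close> below.
\<close>

typedef 'r mfps = "UNIV :: (nat multiset \<Rightarrow> 'r) set"
  morphisms mfps_coeff Abs_mfps ..

lemma mfps_coeff_Abs [simp]: "mfps_coeff (Abs_mfps f) = f"
  by (simp add: Abs_mfps_inverse)

lemma mfps_eqI: "(\<And>m. mfps_coeff f m = mfps_coeff g m) \<Longrightarrow> f = g"
  by (metis ext mfps_coeff_inject)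

lemma finite_submultisets [simp]: "finite {a. a \<subseteq># (m :: 'a multiset)}"
proof (induction m)
  case (add x m)
  have "{a. a \<subseteq># add_mset x m} \<subseteq> {a. a \<subseteq># m} \<union> add_mset x ` {a. a \<subseteq># m}"
  proof
    fix a assume a: "a \<in> {a. a \<subseteq># add_mset x m}"
    show "a \<in> {a. a \<subseteq># m} \<union> add_mset x ` {a. a \<subseteq># m}"
    proof (cases "x \<in># a")
      case True
      then obtain b where "a = add_mset x b" by (metis multi_member_split)
      with a show ?thesis by auto
    next
      case False
      with a show ?thesis
        by (metis CollectD CollectI UnI1 diff_single_trivial subset_eq_diff_conv add_mset_add_single)
    qed
  qed
  with add show ?case by (meson finite_UnI finite_imageI finite_subset)
qed simp

instantiation mfps :: (comm_ring_1) comm_ring_1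
begin

definition "0 = Abs_mfps (\<lambda>_. 0)"
definition "1 = Abs_mfps (\<lambda>m. if m = {#} then 1 else 0)"
definition "f + g = Abs_mfps (\<lambda>m. mfps_coeff f m + mfps_coeff g m)"
definition "f - g = Abs_mfps (\<lambda>m. mfps_coeff f m - mfps_coeff g m)"
definition "- f = Abs_mfps (\<lambda>m. - mfps_coeff f m)"
definition "f * g = Abs_mfps (\<lambda>m. \<Sum>a | a \<subseteq># m. mfps_coeff f a * mfps_coeff g (m - a))"

instance
proof
  fix f g h :: "'a mfps"
  show "f * g * h = f * (g * h)"
  proof (rule mfps_eqI)
    fix m
    have diff_diff: "m - b - (a - b) = m - a" if "b \<subseteq># a" for a b :: "nat multiset"
      by (metis that diff_diff_add_mset subset_mset.add_diff_inverse)
    let ?f = "mfps_coeff f" and ?g = "mfps_coeff g" and ?h = "mfps_coeff h"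
    have "mfps_coeff (f * g * h) m
        = (\<Sum>(a, b)\<in>Sigma {a. a \<subseteq># m} (\<lambda>a. {b. b \<subseteq># a}). ?f b * ?g (a - b) * ?h (m - a))"
      by (simp add: times_mfps_def sum_distrib_right sum.Sigma)
    also have "\<dots> = (\<Sum>(b, c)\<in>Sigma {b. b \<subseteq># m} (\<lambda>b. {c. c \<subseteq># m - b}).
        ?f b * (?g c * ?h (m - b - c)))"
      by (rule sum.reindex_bij_witness[where i = "\<lambda>(b, c). (b + c, b)" and j = "\<lambda>(a, b). (b, a - b)"])
        (auto simp: mult.assoc diff_diff subset_mset.le_diff_conv2 add.commute
          intro: subset_mset.order_trans diff_subset_eq_self mset_subset_eq_mono_add)
    also have "\<dots> = mfps_coeff (f * (g * h)) m"
      by (simp add: times_mfps_def sum_distrib_left sum.Sigma)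
    finally show "mfps_coeff (f * g * h) m = mfps_coeff (f * (g * h)) m" .
  qed
  show "f * g = g * f"
  proof (rule mfps_eqI)
    fix m
    show "mfps_coeff (f * g) m = mfps_coeff (g * f) m"
      unfolding times_mfps_def mfps_coeff_Abs
      by (rule sum.reindex_bij_witness[where i = "\<lambda>a. m - a" and j = "\<lambda>a. m - a"])
        (auto simp: mult.commute subset_mset.diff_diff_right)
  qed
  show "1 * f = f"
  proof (rule mfps_eqI)
    fix m
    have "mfps_coeff (1 * f) m
        = (\<Sum>a\<in>{a. a \<subseteq># m}. if a = {#} then mfps_coeff f (m - a) else 0)"
      unfolding times_mfps_def one_mfps_def mfps_coeff_Abs
      by (intro sum.cong refl) simp
    also have "\<dots> = mfps_coeff f m"
      by (subst sum.delta) simp_all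
    finally show "mfps_coeff (1 * f) m = mfps_coeff f m" .
  qed
  show "(f + g) * h = f * h + g * h"
    by (rule mfps_eqI) (simp add: times_mfps_def plus_mfps_def distrib_right sum.distrib)
  show "(0 :: 'a mfps) \<noteq> 1"
  proof
    assume "(0 :: 'a mfps) = 1"
    then have "mfps_coeff (0 :: 'a mfps) {#} = mfps_coeff 1 {#}"
      by (rule arg_cong)
    then show False
      by (simp add: zero_mfps_def one_mfps_def)
  qed
qed (rule mfps_eqI; simp add: plus_mfps_def minus_mfps_def uminus_mfps_def zero_mfps_def
      algebra_simps)+

end

definition mfps_const :: "'r::comm_ring_1 \<Rightarrow> 'r mfps" where
  "mfps_const c = Abs_mfps (\<lambda>m. if m = {#} then c else 0)"

definition mfps_vars :: "nat \<Rightarrow> 'r::comm_ring_1 mfps set" where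
  "mfps_vars n = {f. \<forall>m. mfps_coeff f m \<noteq> 0 \<longrightarrow> set_mset m \<subseteq> {..<n}}"

definition mfps_deriv :: "nat \<Rightarrow> 'r::comm_ring_1 mfps \<Rightarrow> 'r mfps" where
  "mfps_deriv i f = Abs_mfps (\<lambda>m. of_nat (count m i + 1) * mfps_coeff f (add_mset i m))"

text \<open>
  The operator \<open>\<partial>\<^sub>i\<^sup>2/2\<close>, sending \<open>x\<^sub>i\<^sup>k\<close> to \<open>(k(k-1)/2) x\<^sub>i\<^sup>k\<^sup>-\<^sup>2\<close>.  The quotient by 2 is taken in the
  natural numbers, where it is exact, so 2 need not be invertible in the ground ring.
\<close>
definition mfps_half_deriv2 :: "nat \<Rightarrow> 'r::comm_ring_1 mfps \<Rightarrow> 'r mfps" where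
  "mfps_half_deriv2 i f = Abs_mfps (\<lambda>m.
     of_nat ((count m i + 2) * (count m i + 1) div 2) * mfps_coeff f (add_mset i (add_mset i m)))"

text \<open>The value of \<open>Hess(f)/2\<close> on the vector with coordinates \<open>a i\<close>, \<open>i < n\<close>.\<close>
definition half_Hess :: "nat \<Rightarrow> 'r::comm_ring_1 mfps \<Rightarrow> (nat \<Rightarrow> 'r mfps) \<Rightarrow> 'r mfps" where
  "half_Hess n f a =
     (\<Sum>i<n. a i * a i * mfps_half_deriv2 i f)
     + (\<Sum>j<n. \<Sum>i<j. a i * a j * mfps_deriv i (mfps_deriv j f))"


section \<open>Tensor, Clifford and exterior algebras of a free module\<close>

datatype 'i free_mon = Word (letters: "'i list")

instantiation free_mon :: (type) monoid_add
begin
definition "0 = Word []"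
definition "u + v = Word (letters u @ letters v)"
instance by standard (auto simp: zero_free_mon_def plus_free_mon_def)
end

text \<open>
  Over a ring \<open>K\<close> (given as a subring of a type \<open>'k\<close>), the tensor algebra of the free module with
  basis \<open>v\<^sub>i\<close>, \<open>i < n\<close>, is the algebra of finite \<open>K\<close>-linear combinations of words in the letters
  \<open>i < n\<close>, multiplied by concatenation.
\<close>
definition tensor_ring :: "'k::comm_ring_1 set \<Rightarrow> nat \<Rightarrow> (nat free_mon \<Rightarrow>\<^sub>0 'k) ring" where
  "tensor_ring K n =
     \<lparr>carrier = {f. \<forall>w. Poly_Mapping.lookup f w \<in> K \<and>
                      (Poly_Mapping.lookup f w \<noteq> 0 \<longrightarrow> set (letters w) \<subseteq> {..<n})},
      mult = (*), one = 1, zero = 0, add = (+)\<rparr>"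

definition tensor_scalar :: "'k::comm_ring_1 \<Rightarrow> (nat free_mon \<Rightarrow>\<^sub>0 'k)" where
  "tensor_scalar c = Poly_Mapping.single 0 c"

definition tensor_gen :: "nat \<Rightarrow> (nat free_mon \<Rightarrow>\<^sub>0 'k::comm_ring_1)" where
  "tensor_gen i = Poly_Mapping.single (Word [i]) 1"

definition tensor_vec :: "nat \<Rightarrow> (nat \<Rightarrow> 'k::comm_ring_1) \<Rightarrow> (nat free_mon \<Rightarrow>\<^sub>0 'k)" where
  "tensor_vec n a = (\<Sum>i<n. Poly_Mapping.single (Word [i]) (a i))"

text \<open>The quadratic form \<open>Q\<close> is a function of the coordinates of a vector.\<close>
definition clifford_ideal ::
    "'k::comm_ring_1 set \<Rightarrow> nat \<Rightarrow> ((nat \<Rightarrow> 'k) \<Rightarrow> 'k) \<Rightarrow> (nat free_mon \<Rightarrow>\<^sub>0 'k) set" where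
  "clifford_ideal K n Q =
     Idl\<^bsub>tensor_ring K n\<^esub>
       {tensor_vec n a * tensor_vec n a - tensor_scalar (Q a) | a. \<forall>i<n. a i \<in> K}"

definition clifford_ring ::
    "'k::comm_ring_1 set \<Rightarrow> nat \<Rightarrow> ((nat \<Rightarrow> 'k) \<Rightarrow> 'k) \<Rightarrow> (nat free_mon \<Rightarrow>\<^sub>0 'k) set ring" where
  "clifford_ring K n Q = tensor_ring K n Quot clifford_ideal K n Q"

definition clifford_class ::
    "'k::comm_ring_1 set \<Rightarrow> nat \<Rightarrow> ((nat \<Rightarrow> 'k) \<Rightarrow> 'k) \<Rightarrow>
      (nat free_mon \<Rightarrow>\<^sub>0 'k) \<Rightarrow> (nat free_mon \<Rightarrow>\<^sub>0 'k) set" where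
  "clifford_class K n Q f = clifford_ideal K n Q +>\<^bsub>tensor_ring K n\<^esub> f"

text \<open>The Clifford algebra as an algebra over \<open>'s\<close>, along a ring homomorphism \<open>h\<close> from \<open>'s\<close> to \<open>K\<close>.\<close>
definition clifford_alg ::
    "('s \<Rightarrow> 'k::comm_ring_1) \<Rightarrow> 'k set \<Rightarrow> nat \<Rightarrow> ((nat \<Rightarrow> 'k) \<Rightarrow> 'k) \<Rightarrow>
      ('s, (nat free_mon \<Rightarrow>\<^sub>0 'k) set) module" where
  "clifford_alg h K n Q = (let A = clifford_ring K n Q in
     \<lparr>carrier = carrier A, mult = mult A, one = one A, zero = zero A, add = add A,
      smult = (\<lambda>c x. clifford_class K n Q (tensor_scalar (h c)) \<otimes>\<^bsub>A\<^esub> x)\<rparr>)"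

definition clifford_part ::
    "'k::comm_ring_1 set \<Rightarrow> nat \<Rightarrow> ((nat \<Rightarrow> 'k) \<Rightarrow> 'k) \<Rightarrow> int \<Rightarrow> (nat free_mon \<Rightarrow>\<^sub>0 'k) set set" where
  "clifford_part K n Q t = clifford_class K n Q `
     {f \<in> carrier (tensor_ring K n).
        \<forall>w. Poly_Mapping.lookup f w \<noteq> 0 \<longrightarrow> even (int (length (letters w)) - t)}"

text \<open>
  A function on the Clifford algebra is determined only on the carrier; extensionality
  makes the derivation below unique as a HOL function.
\<close>
definition is_contraction ::
    "'k::comm_ring_1 set \<Rightarrow> nat \<Rightarrow> ((nat \<Rightarrow> 'k) \<Rightarrow> 'k) \<Rightarrow> (nat \<Rightarrow> 'k) \<Rightarrow>
      ((nat free_mon \<Rightarrow>\<^sub>0 'k) set \<Rightarrow> (nat free_mon \<Rightarrow>\<^sub>0 'k) set) \<Rightarrow> bool" where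
  "is_contraction K n Q g D \<longleftrightarrow> (let A = clifford_ring K n Q; cl = clifford_class K n Q in
     D \<in> carrier A \<rightarrow>\<^sub>E carrier A \<and>
     (\<forall>x\<in>carrier A. \<forall>y\<in>carrier A. D (x \<oplus>\<^bsub>A\<^esub> y) = D x \<oplus>\<^bsub>A\<^esub> D y) \<and>
     (\<forall>r\<in>K. \<forall>x\<in>carrier A.
        D (cl (tensor_scalar r) \<otimes>\<^bsub>A\<^esub> x) = cl (tensor_scalar r) \<otimes>\<^bsub>A\<^esub> D x) \<and>
     (\<forall>t. D ` clifford_part K n Q t \<subseteq> clifford_part K n Q (t + 1)) \<and>
     (\<forall>t. \<forall>x\<in>clifford_part K n Q t. \<forall>y\<in>carrier A.
        D (x \<otimes>\<^bsub>A\<^esub> y) =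
          (if even t then D x \<otimes>\<^bsub>A\<^esub> y \<oplus>\<^bsub>A\<^esub> x \<otimes>\<^bsub>A\<^esub> D y
           else D x \<otimes>\<^bsub>A\<^esub> y \<ominus>\<^bsub>A\<^esub> x \<otimes>\<^bsub>A\<^esub> D y)) \<and>
     (\<forall>i<n. D (cl (tensor_gen i)) = cl (tensor_scalar (g i))))"

definition contraction ::
    "'k::comm_ring_1 set \<Rightarrow> nat \<Rightarrow> ((nat \<Rightarrow> 'k) \<Rightarrow> 'k) \<Rightarrow> (nat \<Rightarrow> 'k) \<Rightarrow>
      (nat free_mon \<Rightarrow>\<^sub>0 'k) set \<Rightarrow> (nat free_mon \<Rightarrow>\<^sub>0 'k) set" where
  "contraction K n Q g = (THE D. is_contraction K n Q g D)"

definition exterior_alg ::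
    "nat \<Rightarrow> ('r::comm_ring_1, (nat free_mon \<Rightarrow>\<^sub>0 'r) set) module" where
  "exterior_alg n = clifford_alg (\<lambda>c. c) UNIV n (\<lambda>_. 0)"

definition exterior_gen :: "nat \<Rightarrow> nat \<Rightarrow> (nat free_mon \<Rightarrow>\<^sub>0 'r::comm_ring_1) set" where
  "exterior_gen n i = clifford_class UNIV n (\<lambda>_. 0) (tensor_gen i)"

definition exterior_part :: "nat \<Rightarrow> int \<Rightarrow> (nat free_mon \<Rightarrow>\<^sub>0 'r::comm_ring_1) set set" where
  "exterior_part n p = clifford_class UNIV n (\<lambda>_. 0) `
     {f \<in> carrier (tensor_ring UNIV n).
        \<forall>w. Poly_Mapping.lookup f w \<noteq> 0 \<longrightarrow> int (length (letters w)) = p}"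


section \<open>Superfiltered modules\<close>

text \<open>
  The \<open>\<int>/2\<close>-grading \<open>X\<close> is indexed by all integers, 2-periodically.
\<close>
locale superfiltered_module = Modules.module scale
  for scale :: "'r::comm_ring_1 \<Rightarrow> 'a::ab_group_add \<Rightarrow> 'a"  (infixr \<open>*s\<close> 75) +
  fixes X :: "int \<Rightarrow> 'a set" and F :: "int \<Rightarrow> 'a set"
  assumes grading_periodic: "X (p + 2) = X p"
    and grading_subspace: "subspace (X p)"
    and grading_disjoint: "X 0 \<inter> X 1 = {0}"
    and grading_span: "\<exists>b\<in>X 0. \<exists>c\<in>X 1. a = b + c"
    and filtration_subspace: "subspace (F p)"
    and filtration_increasing: "F p \<subseteq> F (p + 1)"
    and filtration_Hausdorff: "(\<Inter>p. F p) = {0}"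
    and filtration_exhaustive: "(\<Union>p. F p) = UNIV"
    and filtration_graded: "F p = {b + c | b c. b \<in> F p \<inter> X 0 \<and> c \<in> F p \<inter> X 1}"
    and filtration_parity: "F (p + 1) \<inter> X p = F p \<inter> X p"

definition gr_class :: "(int \<Rightarrow> 'a::ab_group_add set) \<Rightarrow> int \<Rightarrow> 'a \<Rightarrow> 'a set" where
  "gr_class F p a = {a + b | b. b \<in> F (p - 1)}"

definition gr_part :: "(int \<Rightarrow> 'a::ab_group_add set) \<Rightarrow> int \<Rightarrow> 'a set set" where
  "gr_part F p = gr_class F p ` F p"


section \<open>Multilinear operations\<close>

text \<open>
  A map \<open>f :: 'a list \<Rightarrow> 'a\<close> stands for the family of its restrictions to lists of
  length \<open>k\<close>, \<open>k \<ge> 0\<close>.  A linear map on the \<open>k\<close>-fold tensor power is a \<open>k\<close>-multilinear map.  The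
  list \<open>[a\<^sub>k, \<dots>, a\<^sub>1]\<close> is the argument tuple \<open>(a\<^sub>k, \<dots>, a\<^sub>1)\<close>, in the same order.
\<close>

definition multilinear ::
    "('r::comm_ring_1 \<Rightarrow> 'a::ab_group_add \<Rightarrow> 'a) \<Rightarrow> ('a list \<Rightarrow> 'a) \<Rightarrow> bool" where
  "multilinear scale f \<longleftrightarrow>
     (\<forall>ls rs a b. f (ls @ [a + b] @ rs) = f (ls @ [a] @ rs) + f (ls @ [b] @ rs)) \<and>
     (\<forall>ls rs c a. f (ls @ [scale c a] @ rs) = scale c (f (ls @ [a] @ rs)))"

text \<open>
  For a family \<open>S\<close> of submodules (a grading or a filtration of \<open>\<A>\<close>): every component of \<open>f\<close> has
  degree \<open>t\<close> as a map from a tensor power of \<open>\<A>[1]\<close> to \<open>\<A>\<close>.  Degree 1 as a map to \<open>\<A>[1]\<close> is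
  degree 2 as a map to \<open>\<A>\<close>.
\<close>
definition has_shifted_degree ::
    "(int \<Rightarrow> 'a set) \<Rightarrow> int \<Rightarrow> ('a list \<Rightarrow> 'a) \<Rightarrow> bool" where
  "has_shifted_degree S t f \<longleftrightarrow>
     (\<forall>as ps. list_all2 (\<lambda>a p. a \<in> S p) as ps \<longrightarrow>
        f as \<in> S (sum_list ps - int (length as) + t))"

text \<open>
  The linear map \<open>a \<mapsto> (-1)\<^bsup>|a| - 1\<^esup> a\<close>.  A sign \<open>(-1)\<^sup>\<maltese>\<close> with exponent the
  reduced degree \<open>\<maltese>\<^sub>i = |a\<^sub>1| + \<dots> + |a\<^sub>i| - i\<close> is rendered by applying this map to each of
  \<open>a\<^sub>1, \<dots>, a\<^sub>i\<close>; this agrees with the sign on homogeneous elements and is multilinear.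
\<close>
definition twist :: "(int \<Rightarrow> 'a::ab_group_add set) \<Rightarrow> 'a \<Rightarrow> 'a" where
  "twist X a = (THE d. \<exists>b\<in>X 0. \<exists>c\<in>X 1. a = b + c \<and> d = c - b)"

text \<open>The map \<open>a \<mapsto> (-1)\<^bsup>s(|a| - 1)\<^esup> a\<close>.\<close>
definition twist_by :: "(int \<Rightarrow> 'a::ab_group_add set) \<Rightarrow> int \<Rightarrow> 'a \<Rightarrow> 'a" where
  "twist_by X s = (if even s then id else twist X)"

lemma (in superfiltered_module) twist_eq:
  assumes "b \<in> X 0" "c \<in> X 1"
  shows "twist X (b + c) = c - b"
  unfolding twist_def
proof (rule the_equality)
  fix d assume "\<exists>b'\<in>X 0. \<exists>c'\<in>X 1. b + c = b' + c' \<and> d = c' - b'"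
  then obtain b' c' where *: "b' \<in> X 0" "c' \<in> X 1" "b + c = b' + c'" "d = c' - b'" by blast
  have 1: "b - b' \<in> X 0" and 2: "c' - c \<in> X 1"
    using assms * grading_subspace subspace_diff by blast+
  have 3: "b - b' = c' - c"
    using *(3) by (simp add: algebra_simps)
  with 1 2 have "b - b' \<in> X 0 \<inter> X 1" by simp
  then have "b - b' = 0"
    by (simp only: grading_disjoint singleton_iff)
  with * 3 show "d = c - b" by simp
qed (use assms in blast)


section \<open>Superfiltered \<open>A\<^sub>\<infinity>\<close>-deformations of the exterior algebra\<close>

definition splits3 :: "'a list \<Rightarrow> ('a list \<times> 'a list \<times> 'a list) set" where
  "splits3 xs = {(ls, ms, rs). ls @ ms @ rs = xs}"

text \<open>
  The free module \<open>V\<close> of rank \<open>n\<close> is given by its basis, and \<open>E\<close> is \<open>exterior_alg n\<close>.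
  The map \<open>\<theta> p\<close> is the degree \<open>p\<close> part of the isomorphism from \<open>gr \<A>\<close> to \<open>E\<close>.  As \<open>A\<^sub>\<infinity>\<close>-algebras
  are uncurved, \<open>\<mu>\<close> vanishes on the empty list.
\<close>
locale superfiltered_deformation = superfiltered_module scale X F
  for scale :: "'r::comm_ring_1 \<Rightarrow> 'a::ab_group_add \<Rightarrow> 'a"  (infixr \<open>*s\<close> 75)
    and X :: "int \<Rightarrow> 'a set" and F :: "int \<Rightarrow> 'a set" +
  fixes n :: nat
    and \<mu> :: "'a list \<Rightarrow> 'a"
    and unit :: 'a
    and \<theta> :: "int \<Rightarrow> 'a set \<Rightarrow> (nat free_mon \<Rightarrow>\<^sub>0 'r) set"
  assumes multilinear: "multilinear scale \<mu>"
    and uncurved: "\<mu> [] = 0"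
    and graded: "has_shifted_degree X 2 \<mu>"
    and filtered: "has_shifted_degree F 2 \<mu>"
    and A_infinity: "(\<Sum>(ls, ms, rs)\<in>splits3 as. \<mu> (ls @ [\<mu> ms] @ map (twist X) rs)) = 0"
    and minimal: "\<mu> [a] = 0"
    and unit_degree: "unit \<in> X 0"
    and unit_filtration: "unit \<in> F 0"
    and unit_right: "\<mu> [a, unit] = a"
    and unit_left: "a \<in> X p \<Longrightarrow> (if even p then \<mu> [unit, a] else - \<mu> [unit, a]) = a"
    and unit_strict: "unit \<in> set as \<Longrightarrow> length as \<noteq> 2 \<Longrightarrow> \<mu> as = 0"
    and gr_bij: "bij_betw (\<theta> p) (gr_part F p) (exterior_part n p)"
    and gr_add: "a \<in> F p \<Longrightarrow> b \<in> F p \<Longrightarrow>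
      \<theta> p (gr_class F p (a + b))
        = \<theta> p (gr_class F p a) \<oplus>\<^bsub>exterior_alg n\<^esub> \<theta> p (gr_class F p b)"
    and gr_scale: "a \<in> F p \<Longrightarrow>
      \<theta> p (gr_class F p (c *s a)) = c \<odot>\<^bsub>exterior_alg n\<^esub> \<theta> p (gr_class F p a)"
    and leading_term_2: "a \<in> F p \<Longrightarrow> b \<in> F q \<Longrightarrow>
      \<theta> (p + q) (gr_class F (p + q) (\<mu> [a, b]))
        = (let y = \<theta> p (gr_class F p a) \<otimes>\<^bsub>exterior_alg n\<^esub> \<theta> q (gr_class F q b)
           in if even q then y else \<ominus>\<^bsub>exterior_alg n\<^esub> y)"
    and leading_term_other: "list_all2 (\<lambda>a p. a \<in> F p) as ps \<Longrightarrow> length as \<noteq> 2 \<Longrightarrow>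
      r = sum_list ps - int (length as) + 2 \<Longrightarrow>
      \<theta> r (gr_class F r (\<mu> as)) = \<zero>\<^bsub>exterior_alg n\<^esub>"

text \<open>The basis element \<open>v\<^sub>i\<close> of \<open>V\<close>, regarded as an element of \<open>F\<^sup>1\<A> \<inter> \<A>\<^sup>1\<close>.\<close>
definition basis_lift ::
    "(int \<Rightarrow> 'a::ab_group_add set) \<Rightarrow> (int \<Rightarrow> 'a set) \<Rightarrow> nat \<Rightarrow>
      (int \<Rightarrow> 'a set \<Rightarrow> (nat free_mon \<Rightarrow>\<^sub>0 'r::comm_ring_1) set) \<Rightarrow> nat \<Rightarrow> 'a" where
  "basis_lift X F n \<theta> i =
     (THE a. a \<in> F 1 \<inter> X 1 \<and> \<theta> 1 (gr_class F 1 a) = exterior_gen n i)"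

text \<open>
  An individual \<open>\<mu>\<^sup>2(v\<^sub>j, v\<^sub>i)\<close> need not lie in \<open>F\<^sup>0\<A> = R\<^sub>0 1\<close>; the sum of all terms contributing to
  a given monomial does.
\<close>
definition disc_potential ::
    "('r::comm_ring_1 \<Rightarrow> 'a::ab_group_add \<Rightarrow> 'a) \<Rightarrow> (int \<Rightarrow> 'a set) \<Rightarrow> (int \<Rightarrow> 'a set) \<Rightarrow> nat \<Rightarrow>
      ('a list \<Rightarrow> 'a) \<Rightarrow> 'a \<Rightarrow> (int \<Rightarrow> 'a set \<Rightarrow> (nat free_mon \<Rightarrow>\<^sub>0 'r) set) \<Rightarrow> 'r mfps" where
  "disc_potential scale X F n \<mu> unit \<theta> = Abs_mfps (\<lambda>m.
     if size m \<ge> 2 \<and> set_mset m \<subseteq> {..<n}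
     then THE c. scale c unit = (\<Sum>w | mset w = m. \<mu> (map (basis_lift X F n \<theta>) w))
     else 0)"


section \<open>Hochschild cochains\<close>

definition hochschild_cochains ::
    "('r::comm_ring_1 \<Rightarrow> 'a::ab_group_add \<Rightarrow> 'a) \<Rightarrow> (int \<Rightarrow> 'a set) \<Rightarrow> int \<Rightarrow> ('a list \<Rightarrow> 'a) set" where
  "hochschild_cochains scale X t = {\<phi>. multilinear scale \<phi> \<and> has_shifted_degree X t \<phi>}"

definition hochschild_diff ::
    "(int \<Rightarrow> 'a::ab_group_add set) \<Rightarrow> ('a list \<Rightarrow> 'a) \<Rightarrow> int \<Rightarrow> ('a list \<Rightarrow> 'a) \<Rightarrow> 'a list \<Rightarrow> 'a" where
  "hochschild_diff X \<mu> t \<phi> as =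
     (\<Sum>(ls, ms, rs)\<in>splits3 as. \<mu> (ls @ [\<phi> ms] @ map (twist_by X (t - 1)) rs))
     - (let s = (\<Sum>(ls, ms, rs)\<in>splits3 as. \<phi> (ls @ [\<mu> ms] @ map (twist X) rs))
        in if even (t - 1) then s else - s)"

definition splits5 ::
    "'a list \<Rightarrow> ('a list \<times> 'a list \<times> 'a list \<times> 'a list \<times> 'a list) set" where
  "splits5 xs = {(ls, us, ms, vs, rs). ls @ us @ ms @ vs @ rs = xs}"

text \<open>
  Here \<open>s = |\<phi>|\<close> and \<open>t = |\<psi>|\<close>.  The sign attached to \<open>\<phi>\<close> involves all inputs to its right,
  including those of \<open>\<psi>\<close>.
\<close>
definition cup_product ::
    "(int \<Rightarrow> 'a::ab_group_add set) \<Rightarrow> ('a list \<Rightarrow> 'a) \<Rightarrow> int \<Rightarrow> int \<Rightarrow>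
      ('a list \<Rightarrow> 'a) \<Rightarrow> ('a list \<Rightarrow> 'a) \<Rightarrow> 'a list \<Rightarrow> 'a" where
  "cup_product X \<mu> s t \<phi> \<psi> as =
     (\<Sum>(ls, us, ms, vs, rs)\<in>splits5 as.
        \<mu> (ls @ [\<phi> us] @ map (twist_by X (s - 1)) ms @
            [\<psi> (map (twist_by X (s - 1)) vs)] @
            map (twist_by X (s - 1) \<circ> twist_by X (t - 1)) rs))"

definition hochschild_product ::
    "(int \<Rightarrow> 'a::ab_group_add set) \<Rightarrow> ('a list \<Rightarrow> 'a) \<Rightarrow> int \<Rightarrow> int \<Rightarrow>
      ('a list \<Rightarrow> 'a) \<Rightarrow> ('a list \<Rightarrow> 'a) \<Rightarrow> 'a list \<Rightarrow> 'a" where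
  "hochschild_product X \<mu> s t \<phi> \<psi> as =
     (if even t then cup_product X \<mu> s t \<phi> \<psi> as else - cup_product X \<mu> s t \<phi> \<psi> as)"

text \<open>
  The total complex: a pair \<open>(\<phi>\<^sub>0, \<phi>\<^sub>1)\<close> is the sum of an even and an odd cochain.
  The product of cochains is in general only associative up to homotopy.
\<close>
definition hochschild_alg ::
    "('r::comm_ring_1 \<Rightarrow> 'a::ab_group_add \<Rightarrow> 'a) \<Rightarrow> (int \<Rightarrow> 'a set) \<Rightarrow> ('a list \<Rightarrow> 'a) \<Rightarrow> 'a \<Rightarrow>
      ('r, ('a list \<Rightarrow> 'a) \<times> ('a list \<Rightarrow> 'a)) module" where
  "hochschild_alg scale X \<mu> unit =
     \<lparr>carrier = hochschild_cochains scale X 0 \<times> hochschild_cochains scale X 1,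
      mult = (\<lambda>(\<phi>0, \<phi>1) (\<psi>0, \<psi>1).
        (\<lambda>as. hochschild_product X \<mu> 0 0 \<phi>0 \<psi>0 as + hochschild_product X \<mu> 1 1 \<phi>1 \<psi>1 as,
         \<lambda>as. hochschild_product X \<mu> 0 1 \<phi>0 \<psi>1 as + hochschild_product X \<mu> 1 0 \<phi>1 \<psi>0 as)),
      one = (\<lambda>as. if as = [] then unit else 0, \<lambda>as. 0),
      zero = (\<lambda>as. 0, \<lambda>as. 0),
      add = (\<lambda>(\<phi>0, \<phi>1) (\<psi>0, \<psi>1). (\<lambda>as. \<phi>0 as + \<psi>0 as, \<lambda>as. \<phi>1 as + \<psi>1 as)),
      smult = (\<lambda>c (\<phi>0, \<phi>1). (\<lambda>as. scale c (\<phi>0 as), \<lambda>as. scale c (\<phi>1 as)))\<rparr>"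

definition hochschild_total_diff ::
    "(int \<Rightarrow> 'a::ab_group_add set) \<Rightarrow> ('a list \<Rightarrow> 'a) \<Rightarrow>
      ('a list \<Rightarrow> 'a) \<times> ('a list \<Rightarrow> 'a) \<Rightarrow> ('a list \<Rightarrow> 'a) \<times> ('a list \<Rightarrow> 'a)" where
  "hochschild_total_diff X \<mu> = (\<lambda>(\<phi>0, \<phi>1). (hochschild_diff X \<mu> 1 \<phi>1, hochschild_diff X \<mu> 0 \<phi>0))"

definition hochschild_part ::
    "('r::comm_ring_1 \<Rightarrow> 'a::ab_group_add \<Rightarrow> 'a) \<Rightarrow> (int \<Rightarrow> 'a set) \<Rightarrow> int \<Rightarrow>
      (('a list \<Rightarrow> 'a) \<times> ('a list \<Rightarrow> 'a)) set" where
  "hochschild_part scale X t =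
     (if even t then hochschild_cochains scale X 0 \<times> {\<lambda>as. 0}
      else {\<lambda>as. 0} \<times> hochschild_cochains scale X 1)"


section \<open>Cohomology algebras\<close>

text \<open>
  Here \<open>M\<close> is a module with a (possibly non-associative) unital multiplication and \<open>d\<close> a
  differential on it.  Operations on classes are formed as in \<^const>\<open>FactRing\<close>.
\<close>
definition cocycles :: "('r, 'c) module \<Rightarrow> ('c \<Rightarrow> 'c) \<Rightarrow> 'c set" where
  "cocycles M d = {z \<in> carrier M. d z = \<zero>\<^bsub>M\<^esub>}"

definition coboundaries :: "('r, 'c) module \<Rightarrow> ('c \<Rightarrow> 'c) \<Rightarrow> 'c set" where
  "coboundaries M d = d ` carrier M"

definition cohomology_class :: "('r, 'c) module \<Rightarrow> ('c \<Rightarrow> 'c) \<Rightarrow> 'c \<Rightarrow> 'c set" where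
  "cohomology_class M d z = coboundaries M d +>\<^bsub>M\<^esub> z"

definition cohomology_alg :: "('r, 'c) module \<Rightarrow> ('c \<Rightarrow> 'c) \<Rightarrow> ('r, 'c set) module" where
  "cohomology_alg M d =
     \<lparr>carrier = cohomology_class M d ` cocycles M d,
      mult = rcoset_mult M (coboundaries M d),
      one = cohomology_class M d \<one>\<^bsub>M\<^esub>,
      zero = coboundaries M d,
      add = set_add M,
      smult = (\<lambda>c Z. \<Union>z\<in>Z. cohomology_class M d (c \<odot>\<^bsub>M\<^esub> z))\<rparr>"

definition cohomology_part ::
    "('r, 'c) module \<Rightarrow> ('c \<Rightarrow> 'c) \<Rightarrow> (int \<Rightarrow> 'c set) \<Rightarrow> int \<Rightarrow> 'c set set" where
  "cohomology_part M d G t = cohomology_class M d ` (cocycles M d \<inter> G t)"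


section \<open>The two cohomology algebras\<close>

definition HH_alg ::
    "('r::comm_ring_1 \<Rightarrow> 'a::ab_group_add \<Rightarrow> 'a) \<Rightarrow> (int \<Rightarrow> 'a set) \<Rightarrow> ('a list \<Rightarrow> 'a) \<Rightarrow> 'a \<Rightarrow>
      ('r, (('a list \<Rightarrow> 'a) \<times> ('a list \<Rightarrow> 'a)) set) module" where
  "HH_alg scale X \<mu> unit =
     cohomology_alg (hochschild_alg scale X \<mu> unit) (hochschild_total_diff X \<mu>)"

definition HH_part ::
    "('r::comm_ring_1 \<Rightarrow> 'a::ab_group_add \<Rightarrow> 'a) \<Rightarrow> (int \<Rightarrow> 'a set) \<Rightarrow> ('a list \<Rightarrow> 'a) \<Rightarrow> 'a \<Rightarrow>
      int \<Rightarrow> (('a list \<Rightarrow> 'a) \<times> ('a list \<Rightarrow> 'a)) set set" where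
  "HH_part scale X \<mu> unit =
     cohomology_part (hochschild_alg scale X \<mu> unit) (hochschild_total_diff X \<mu>)
       (hochschild_part scale X)"

definition Hess_clifford_alg ::
    "nat \<Rightarrow> 'r::comm_ring_1 mfps \<Rightarrow> ('r, (nat free_mon \<Rightarrow>\<^sub>0 'r mfps) set) module" where
  "Hess_clifford_alg n f = clifford_alg mfps_const (mfps_vars n) n (\<lambda>a. - half_Hess n f a)"

definition Hess_clifford_diff ::
    "nat \<Rightarrow> 'r::comm_ring_1 mfps \<Rightarrow>
      (nat free_mon \<Rightarrow>\<^sub>0 'r mfps) set \<Rightarrow> (nat free_mon \<Rightarrow>\<^sub>0 'r mfps) set" where
  "Hess_clifford_diff n f =
     contraction (mfps_vars n) n (\<lambda>a. - half_Hess n f a) (\<lambda>i. - mfps_deriv i f)"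

definition Hess_clifford_part ::
    "nat \<Rightarrow> 'r::comm_ring_1 mfps \<Rightarrow> int \<Rightarrow> (nat free_mon \<Rightarrow>\<^sub>0 'r mfps) set set" where
  "Hess_clifford_part n f = clifford_part (mfps_vars n) n (\<lambda>a. - half_Hess n f a)"

text \<open>Isomorphisms of unital algebras that preserve the grading by \<open>\<int>/2\<close>.\<close>
definition graded_alg_iso ::
    "('r, 'b) module \<Rightarrow> (int \<Rightarrow> 'b set) \<Rightarrow> ('r, 'c) module \<Rightarrow> (int \<Rightarrow> 'c set) \<Rightarrow> ('b \<Rightarrow> 'c) set" where
  "graded_alg_iso M G N H =
     {\<Psi> \<in> ring_iso M N.
        (\<forall>c. \<forall>x\<in>carrier M. \<Psi> (c \<odot>\<^bsub>M\<^esub> x) = c \<odot>\<^bsub>N\<^esub> \<Psi> x) \<and> (\<forall>t. \<Psi> ` G t = H t)}"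

end

theory Submission
  imports Defs "HOL-Library.Function_Algebras"
begin

text \<open>
  The algebra \<open>\<A>[[x\<^sub>1, \<dots>, x\<^sub>n]]\<close>, twisted by the bounding cochain \<open>b = \<Sum>\<^sub>i x\<^sub>i v\<^sub>i\<close>, is weakly unobstructed
  with curvature the disc potential, and inserting \<open>b\<close> everywhere maps Hochschild cochains to it,
  multiplicatively. On reduced cochains this is a quasi-isomorphism: with respect to the length
  and the filtration, the leading part of the Hochschild complex is that of the exterior algebra, where
  an acyclic matching on words in the monomials leaves only the words in the generators with weakly
  decreasing indices, that is, the monomials in the \<open>x\<^sub>i\<close>.

  Twisted left multiplications \<open>L\<^sub>i\<close> by the \<open>v\<^sub>i\<close> satisfy \<open>[D, L\<^sub>i] = - \<partial>\<^sub>i P\<close> and, up to homotopy, the Clifford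
  relations of the Hessian. Ordered products of the \<open>L\<^sub>i\<close> applied to the unit form an \<open>R\<close>-basis, which
  identifies the twisted complex with the Clifford algebra and its contraction; the homotopies show
  that the identification is multiplicative on cohomology.
\<close>

section \<open>Clifford algebras as operators on the exterior algebra\<close>

text \<open>Since 2 need not be invertible, the Hessian form has no symmetric polarisation to work
  with. A triangular bilinear form \<beta> with \<beta>(v, v) = Q(v) takes its place: its Clifford
  operators send ordered monomials to ordered monomials, and its diagonal is integral because half a
  second derivative counts unordered pairs of marked letters in a word. The ordering of the
  generators also shapes the rest: the monomials \<open>e S\<close>, the matching and the recursions
  for homotopies all peel off the least index.

  Inserting the bounding cochain creates a curvature, a multiple of the unit, which is killed only
  by reduced cochains. Hence a separate normalisation, by a second matching; it is stated for
  cochains whose differential is merely reduced, so that it also normalises primitives. No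
  convergence is at stake, as each monomial receives terms from finitely many words.

  Reduced representatives and primitives involve choices, so cocycles of the two sides are compared
  by a relation, and only their classes by a map.\<close>

definition ksgn :: "nat => nat set => 'k::comm_ring_1" where
  "ksgn i S = (-1) ^ card {s \<in> S. s < i}"

text \<open>Functions on finite sets are coordinate vectors of the exterior algebra:
  \<open>f S\<close> is the coefficient of the increasing monomial of \<open>S\<close>. In these
  coordinates \<open>wedge i\<close> is exterior multiplication by the generator \<open>i\<close>
  and \<open>iota i\<close> contraction with its dual; \<open>ksgn\<close> is the sign of moving
  \<open>i\<close> to its place.\<close>

definition wedge :: "nat => (nat set => 'k::comm_ring_1) => nat set => 'k" where
  "wedge i f S = (if i \<in> S then ksgn i S * f (S - {i}) else 0)"

definition iota :: "nat => (nat set => 'k::comm_ring_1) => nat set => 'k" where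
  "iota i f S = (if i \<in> S then 0 else ksgn i S * f (insert i S))"

text \<open>Chevalley's operators: exterior multiplication by a generator plus contraction with
  \<beta>(v, -), for a bilinear form with \<beta>(v, v) = Q(v). The form is triangular, so it exists
  without dividing by 2, and only contractions with indices up to \<open>i\<close> occur.\<close>

definition cliff :: "(nat => nat => 'k) => nat => (nat set => 'k::comm_ring_1) => nat set => 'k" where
  "cliff \<beta> i f S = wedge i f S + (\<Sum>j\<le>i. \<beta> i j * iota j f S)"

definition contr :: "nat => (nat => 'k) => (nat set => 'k::comm_ring_1) => nat set => 'k" where
  "contr n g f S = (\<Sum>j<n. g j * iota j f S)"

definition basis_fun :: "nat set => nat set => 'k::comm_ring_1" where
  "basis_fun S = (\<lambda>W. if W = S then 1 else 0)"

lemma ksgn_square [simp]: "ksgn i S * ksgn i S = 1"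
  unfolding ksgn_def by (simp flip: power_mult_distrib)

lemma ksgn_square_left [simp]: "ksgn i S * (ksgn i S * x) = x"
  by (simp flip: mult.assoc)

lemma ksgn_insert:
  "ksgn j (insert i S) = (if i \<notin> S \<and> i < j then - ksgn j S else ksgn j S)"
proof -
  have *: "{s \<in> insert i S. s < j} = (if i < j then insert i {s \<in> S. s < j} else {s \<in> S. s < j})" by auto
  show ?thesis unfolding ksgn_def * by (auto simp: insert_absorb)
qed

lemma ksgn_remove:
  "ksgn j (S - {i}) = (if i \<in> S \<and> i < j then - ksgn j S else ksgn j S)"
proof (cases "i \<in> S")
  case True
  hence "ksgn j S = (if i < j then - ksgn j (S - {i}) else ksgn j (S - {i}))"
    using ksgn_insert[of j i "S - {i}"] by (simp add: insert_absorb)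
  with True show ?thesis by (metis minus_minus)
qed simp

lemma wedge_wedge: "wedge i (wedge j f) S = - wedge j (wedge i f) S"
  by (cases i j rule: linorder_cases)
    (auto simp: wedge_def ksgn_remove algebra_simps Diff_insert2[symmetric] insert_commute)

lemma wedge_self: "wedge i (wedge i f) S = 0"
  by (simp add: wedge_def)

lemma iota_iota: "iota i (iota j f) S = - iota j (iota i f) S"
  by (cases i j rule: linorder_cases)
    (auto simp: iota_def ksgn_insert algebra_simps insert_commute)

lemma iota_self: "iota i (iota i f) S = 0"
  by (simp add: iota_def)

lemma iota_wedge: "iota i (wedge j f) S = (if i = j then f S else 0) - wedge j (iota i f) S"
proof (cases i j rule: linorder_cases)
  case equal
  thus ?thesis
    by (auto simp: iota_def wedge_def ksgn_insert ksgn_remove insert_absorb)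
next
  case less
  hence "insert i S - {j} = insert i (S - {j})" by auto
  with less show ?thesis
    by (auto simp: iota_def wedge_def ksgn_insert ksgn_remove)
next
  case greater
  hence "insert i S - {j} = insert i (S - {j})" by auto
  with greater show ?thesis
    by (auto simp: iota_def wedge_def ksgn_insert ksgn_remove)
qed

lemma wedge_add: "wedge i (\<lambda>S. f S + g S) S = wedge i f S + wedge i g S"
  and iota_add: "iota i (\<lambda>S. f S + g S) S = iota i f S + iota i g S"
  and wedge_scale: "wedge i (\<lambda>S. c * f S) S = c * wedge i f S"
  and iota_scale: "iota i (\<lambda>S. c * f S) S = c * iota i f S"
  and wedge_sum: "wedge i (\<lambda>S. \<Sum>a\<in>A. h a S) S = (\<Sum>a\<in>A. wedge i (h a) S)"
  and iota_sum: "iota i (\<lambda>S. \<Sum>a\<in>A. h a S) S = (\<Sum>a\<in>A. iota i (h a) S)"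
  by (simp_all add: wedge_def iota_def algebra_simps sum_distrib_left)

lemma cliff_add: "cliff \<beta> i (\<lambda>S. f S + g S) S = cliff \<beta> i f S + cliff \<beta> i g S"
  and cliff_scale: "cliff \<beta> i (\<lambda>S. c * f S) S = c * cliff \<beta> i f S"
  by (simp_all add: cliff_def wedge_add iota_add wedge_scale iota_scale algebra_simps
      sum.distrib sum_distrib_left)

lemma contr_add: "contr n g (\<lambda>S. f S + h S) S = contr n g f S + contr n g h S"
  and contr_scale: "contr n g (\<lambda>S. c * f S) S = c * contr n g f S"
  by (simp_all add: contr_def iota_add iota_scale algebra_simps sum.distrib sum_distrib_left)

text \<open>The contraction anticommutes with every \<open>iota l\<close>, and its anticommutator
  with \<open>wedge i\<close> is the scalar \<open>g i\<close>. This is the odd derivation rule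
  against a generator.\<close>

lemma contr_cliff:
  "contr n g (cliff \<beta> i f) S = (if i < n then g i * f S else 0) - cliff \<beta> i (contr n g f) S"
proof -
  have "contr n g (cliff \<beta> i f) S =
      (\<Sum>j<n. g j * (iota j (wedge i f) S + (\<Sum>l\<le>i. \<beta> i l * iota j (iota l f) S)))"
    by (simp add: contr_def cliff_def[abs_def] iota_add iota_sum iota_scale)
  also have "\<dots> = (\<Sum>j<n. (if j = i then g i * f S else 0))
      - (\<Sum>j<n. g j * wedge i (iota j f) S) - (\<Sum>j<n. \<Sum>l\<le>i. g j * \<beta> i l * iota l (iota j f) S)"
    unfolding sum_subtractf[symmetric]
    by (intro sum.cong refl, subst iota_wedge, subst iota_iota)
      (simp add: algebra_simps sum_distrib_left sum_negf)
  also have "\<dots> = (if i < n then g i * f S else 0)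
      - (wedge i (contr n g f) S + (\<Sum>l\<le>i. \<beta> i l * iota l (contr n g f) S))"
    unfolding contr_def
    by (simp add: wedge_sum iota_sum wedge_scale iota_scale sum_distrib_left mult.assoc
        mult.left_commute sum.swap[of _ "{..i}"])
  finally show ?thesis by (simp add: cliff_def)
qed

lemma sum_iota_iota:
  "(\<Sum>j\<in>A. \<Sum>l\<in>B. c j * d l * iota j (iota l f) S) = - (\<Sum>l\<in>B. \<Sum>j\<in>A. d l * c j * iota l (iota j f) S)"
  by (subst sum.swap, subst iota_iota) (simp add: sum_negf mult.commute)

lemma sum_iota_iota_self: "(\<Sum>j\<in>A. \<Sum>l\<in>A. c j * c l * iota j (iota l f) S) = 0"
  if "finite A"
  using that
proof induction
  case (insert a A)
  have *: "(\<Sum>l\<in>A. c a * c l * iota a (iota l f) S) + (\<Sum>j\<in>A. c j * c a * iota j (iota a f) S) = 0"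
    by (simp add: sum.distrib[symmetric] iota_iota[of a] mult.commute)
  have "(\<Sum>j\<in>insert a A. \<Sum>l\<in>insert a A. c j * c l * iota j (iota l f) S) =
     c a * c a * iota a (iota a f) S +
     ((\<Sum>l\<in>A. c a * c l * iota a (iota l f) S) + (\<Sum>j\<in>A. c j * c a * iota j (iota a f) S))
     + (\<Sum>j\<in>A. \<Sum>l\<in>A. c j * c l * iota j (iota l f) S)"
    using insert.hyps by (simp add: sum.distrib)
  with * insert.IH show ?case by (simp add: iota_self)
qed simp

lemma cliff_cliff_expand:
  "cliff \<beta> i (cliff \<beta> k f) S = wedge i (wedge k f) S + (if k \<le> i then \<beta> i k * f S else 0)
     + (\<Sum>l\<le>k. \<beta> k l * wedge i (iota l f) S) - (\<Sum>j\<le>i. \<beta> i j * wedge k (iota j f) S)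
     + (\<Sum>j\<le>i. \<Sum>l\<le>k. \<beta> i j * \<beta> k l * iota j (iota l f) S)"
proof -
  have "(\<Sum>j\<le>i. \<beta> i j * iota j (wedge k f) S) =
      (\<Sum>j\<le>i. if j = k then \<beta> i k * f S else 0) - (\<Sum>j\<le>i. \<beta> i j * wedge k (iota j f) S)"
    unfolding sum_subtractf[symmetric]
    by (intro sum.cong refl) (simp add: iota_wedge algebra_simps)
  also have "(\<Sum>j\<le>i. if j = k then \<beta> i k * f S else 0) = (if k \<le> i then \<beta> i k * f S else 0)"
    by simp
  finally show ?thesis
    by (simp add: cliff_def[abs_def] wedge_add iota_add wedge_sum iota_sum wedge_scale iota_scale
        sum.distrib sum_distrib_left ring_distribs mult.assoc)
qed

lemma cliff_anticomm:
  assumes "i \<noteq> k"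
  shows "cliff \<beta> i (cliff \<beta> k f) S + cliff \<beta> k (cliff \<beta> i f) S
    = (if k \<le> i then \<beta> i k else \<beta> k i) * f S"
  using assms unfolding cliff_cliff_expand
  by (subst (2) sum_iota_iota, subst (2) wedge_wedge) (auto simp: mult.commute)

lemma cliff_square: "cliff \<beta> i (cliff \<beta> i f) S = \<beta> i i * f S"
  unfolding cliff_cliff_expand by (simp add: wedge_self sum_iota_iota_self)

text \<open>The contractions in \<open>cliff \<beta> i\<close> involve indices up to
  \<open>i\<close>, none of which lies in \<open>S\<close>. Hence ordered products of these
  operators, applied to the vacuum, give basis functions without correction terms.\<close>

lemma cliff_basis:
  assumes "\<And>s. s \<in> S ==> i < s"
  shows "cliff \<beta> i (basis_fun S) = basis_fun (insert i S)"
proof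
  fix W
  have i: "i \<notin> S" using assms by blast
  have "iota j (basis_fun S) W = (0 :: 'a)" if "j \<le> i" for j
    using that assms by (force simp: iota_def basis_fun_def)
  moreover have "wedge i (basis_fun S) W = (basis_fun (insert i S) W :: 'a)"
  proof (cases "W = insert i S")
    case True
    have "{s \<in> insert i S. s < i} = {}" using assms by fastforce
    hence "ksgn i (insert i S) = (1 :: 'a)" unfolding ksgn_def by (simp only: card.empty power_0)
    with True i show ?thesis by (simp add: wedge_def basis_fun_def)
  next
    case False
    thus ?thesis by (auto simp: wedge_def basis_fun_def)
  qed
  ultimately show "cliff \<beta> i (basis_fun S) W = (basis_fun (insert i S) W :: 'a)"
    by (simp add: cliff_def)
qed

lemma contr_cliff_insert:
  assumes "\<And>s. s \<in> S ==> i < s" "i < n"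
  shows "contr n g (basis_fun (insert i S)) W = g i * basis_fun S W - cliff \<beta> i (contr n g (basis_fun S)) W"
  using contr_cliff[of n g \<beta> i "basis_fun S" W] assms by (simp add: cliff_basis)

lemma cliff_plus: "cliff \<beta> i (\<lambda>S. f S + g S) = (\<lambda>S. cliff \<beta> i f S + cliff \<beta> i g S)"
  and cliff_times: "cliff \<beta> i (\<lambda>S. c * f S) = (\<lambda>S. c * cliff \<beta> i f S)"
  by (simp_all add: fun_eq_iff cliff_add cliff_scale)

lemma cliff_zero [simp]: "cliff \<beta> i (\<lambda>_. 0) = (\<lambda>_. 0)"
  using cliff_times[of \<beta> i 0 "\<lambda>_. 0"] by simp

lemma cliff_sum: "cliff \<beta> i (\<lambda>S. \<Sum>a\<in>A. h a S) = (\<lambda>S. \<Sum>a\<in>A. cliff \<beta> i (h a) S)"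
  by (induction A rule: infinite_finite_induct) (simp_all add: cliff_plus)

lemma cliff_support:
  assumes "\<And>S. f S \<noteq> 0 ==> S \<subseteq> B" "cliff \<beta> i f S \<noteq> 0"
  shows "S \<subseteq> insert i B"
proof (rule ccontr)
  assume S: "\<not> S \<subseteq> insert i B"
  hence "f (S - {i}) = 0" "\<And>j. f (insert j S) = 0" using assms(1) by blast+
  hence "cliff \<beta> i f S = 0" by (auto simp: cliff_def wedge_def iota_def intro!: sum.neutral)
  with assms(2) show False by simp
qed

lemma basis_fun_support: "basis_fun S W \<noteq> 0 ==> W \<subseteq> S"
  by (auto simp: basis_fun_def split: if_splits)

lemma cliff_words_plus:
  "foldr (cliff \<beta>) w (\<lambda>S. f S + g S) = (\<lambda>S. foldr (cliff \<beta>) w f S + foldr (cliff \<beta>) w g S)"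
  by (induction w) (simp_all add: cliff_plus)

lemma cliff_words_times: "foldr (cliff \<beta>) w (\<lambda>S. c * f S) = (\<lambda>S. c * foldr (cliff \<beta>) w f S)"
  by (induction w) (simp_all add: cliff_times)

lemma cliff_words_sum:
  "foldr (cliff \<beta>) w (\<lambda>S. \<Sum>a\<in>A. h a S) = (\<lambda>S. \<Sum>a\<in>A. foldr (cliff \<beta>) w (h a) S)"
  by (induction w) (simp_all add: cliff_sum)

lemma cliff_words_basis:
  "sorted_wrt (<) w ==> foldr (cliff \<beta>) w (basis_fun {}) = basis_fun (set w)"
  by (induction w) (simp_all add: cliff_basis)

section \<open>The tensor algebra acting on coordinate functions\<close>

definition act :: "(nat => nat => 'k) => (nat free_mon \<Rightarrow>\<^sub>0 'k) => (nat set => 'k::comm_ring_1) => nat set => 'k" where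
  "act \<beta> t f S = (\<Sum>w\<in>Poly_Mapping.keys t. Poly_Mapping.lookup t w * foldr (cliff \<beta>) (letters w) f S)"

lemma act_superset:
  "finite A ==> Poly_Mapping.keys t \<subseteq> A ==>
    act \<beta> t f S = (\<Sum>w\<in>A. Poly_Mapping.lookup t w * foldr (cliff \<beta>) (letters w) f S)"
  unfolding act_def by (rule sum.mono_neutral_left) (auto simp: in_keys_iff)

lemma act_add: "act \<beta> (s + t) f S = act \<beta> s f S + act \<beta> t f S"
proof -
  let ?A = "Poly_Mapping.keys s \<union> Poly_Mapping.keys t"
  have "Poly_Mapping.keys (s + t) \<subseteq> ?A" by (rule keys_add)
  thus ?thesis
    by (simp add: act_superset[of ?A] lookup_add distrib_right sum.distrib)
qed

lemma act_0 [simp]: "act \<beta> 0 f = (\<lambda>_. 0)"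
  by (simp add: act_def fun_eq_iff)

lemma act_minus: "act \<beta> (s - t) f S = act \<beta> s f S - act \<beta> t f S"
  using act_add[of \<beta> "s - t" t f S] by simp

lemma act_single: "act \<beta> (Poly_Mapping.single w c) f S = c * foldr (cliff \<beta>) (letters w) f S"
  by (subst act_superset[of "{w}"]) auto

lemma act_sum: "act \<beta> (sum h A) f S = (\<Sum>a\<in>A. act \<beta> (h a) f S)"
  by (induction A rule: infinite_finite_induct) (simp_all add: act_add)

lemma act_vec_times: "act \<beta> t (\<lambda>S. c * f S) S = c * act \<beta> t f S"
  by (simp add: act_def cliff_words_times sum_distrib_left mult.left_commute)

lemma poly_mapping_sum_single:
  "t = (\<Sum>w\<in>Poly_Mapping.keys t. Poly_Mapping.single w (Poly_Mapping.lookup t w))"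
  by (rule poly_mapping_eqI) (auto simp: lookup_sum lookup_single when_def in_keys_iff)

lemma act_mult: "act \<beta> (s * t) f = act \<beta> s (act \<beta> t f)"
proof
  fix S
  have single: "act \<beta> (Poly_Mapping.single u a * t) f S = act \<beta> (Poly_Mapping.single u a) (act \<beta> t f) S"
    for u a
  proof -
    have "act \<beta> (Poly_Mapping.single u a * t) f S =
        (\<Sum>w\<in>Poly_Mapping.keys t. act \<beta> (Poly_Mapping.single (u + w) (a * Poly_Mapping.lookup t w)) f S)"
      by (subst poly_mapping_sum_single[of t]) (simp add: sum_distrib_left act_sum mult_single)
    also have "\<dots> = a * foldr (cliff \<beta>) (letters u) (act \<beta> t f) S"
    proof -
      have "act \<beta> t f = (\<lambda>S. \<Sum>w\<in>Poly_Mapping.keys t.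
          Poly_Mapping.lookup t w * foldr (cliff \<beta>) (letters w) f S)"
        by (rule ext) (rule act_def)
      thus ?thesis
        by (simp add: act_single plus_free_mon_def cliff_words_sum cliff_words_times
          sum_distrib_left mult.assoc)
    qed
    finally show ?thesis by (simp add: act_single)
  qed
  have "act \<beta> (s * t) f S =
      act \<beta> ((\<Sum>u\<in>Poly_Mapping.keys s. Poly_Mapping.single u (Poly_Mapping.lookup s u)) * t) f S"
    by (simp flip: poly_mapping_sum_single)
  also have "\<dots> = act \<beta> (\<Sum>u\<in>Poly_Mapping.keys s. Poly_Mapping.single u (Poly_Mapping.lookup s u)) (act \<beta> t f) S"
    unfolding sum_distrib_right act_sum by (simp add: single)
  finally show "act \<beta> (s * t) f S = act \<beta> s (act \<beta> t f) S"
    by (simp flip: poly_mapping_sum_single)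
qed

text \<open>Pairs (i, k) with (k, i), because the Clifford relations speak of squares and
  anticommutators.\<close>

lemma sum_square_triangle:
  fixes G :: "nat => nat => 'k::comm_ring_1"
  shows "(\<Sum>i<n. \<Sum>k<n. G i k) = (\<Sum>i<n. G i i + (\<Sum>k<i. G i k + G k i))"
  by (induction n) (simp_all add: sum.distrib algebra_simps)

section \<open>Normal forms and a faithful representation of the Clifford algebra\<close>

locale clifford_data =
  fixes K :: "'k::comm_ring_1 set" and n :: nat and \<beta> :: "nat => nat => 'k" and Q :: "(nat => 'k) => 'k"
  assumes K_one: "1 \<in> K" and K_add: "\<And>a b. a \<in> K ==> b \<in> K ==> a + b \<in> K"
    and K_uminus: "\<And>a. a \<in> K ==> - a \<in> K" and K_mult: "\<And>a b. a \<in> K ==> b \<in> K ==> a * b \<in> K"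
    and \<beta>_K: "\<And>i j. i < n ==> j < n ==> \<beta> i j \<in> K"
    and Q_eq: "\<And>a. Q a = (\<Sum>i<n. \<Sum>j\<le>i. \<beta> i j * (a i * a j))"
begin

abbreviation "T \<equiv> tensor_ring K n"
abbreviation "I \<equiv> clifford_ideal K n Q"
abbreviation "A \<equiv> clifford_ring K n Q"
abbreviation "cl \<equiv> clifford_class K n Q"

lemma K_zero: "0 \<in> K" using K_add[OF K_one K_uminus[OF K_one]] by simp

lemma K_sum: "(\<And>a. a \<in> B ==> h a \<in> K) ==> sum h B \<in> K"
  by (induction B rule: infinite_finite_induct) (auto simp: K_zero K_add)

lemma T_simps [simp]: "mult T = (*)" "add T = (+)" "one T = 1" "zero T = 0"
  by (simp_all add: tensor_ring_def)

lemma T_carrier: "t \<in> carrier T \<longleftrightarrow> (\<forall>w. Poly_Mapping.lookup t w \<in> K \<and>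
    (Poly_Mapping.lookup t w \<noteq> 0 \<longrightarrow> set (letters w) \<subseteq> {..<n}))"
  by (simp add: tensor_ring_def)

lemma T_add: "s \<in> carrier T ==> t \<in> carrier T ==> s + t \<in> carrier T"
  unfolding T_carrier lookup_add by (metis K_add add.right_neutral add.left_neutral)

lemma T_zero: "0 \<in> carrier T" by (simp add: T_carrier K_zero)

lemma T_uminus: "s \<in> carrier T ==> - s \<in> carrier T"
  by (simp add: T_carrier K_uminus)

lemma T_minus: "s \<in> carrier T ==> t \<in> carrier T ==> s - t \<in> carrier T"
  using T_add[of s "- t"] T_uminus by simp

lemma T_single: "c \<in> K ==> set w \<subseteq> {..<n} ==> Poly_Mapping.single (Word w) c \<in> carrier T"
  by (auto simp: T_carrier lookup_single when_def K_zero)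

lemma T_sum: "(\<And>a. a \<in> B ==> h a \<in> carrier T) ==> sum h B \<in> carrier T"
  by (induction B rule: infinite_finite_induct) (auto simp: T_zero T_add)

lemma T_induct [consumes 1, case_names zero add single]:
  assumes "t \<in> carrier T"
    and "P 0" "\<And>s t. s \<in> carrier T ==> t \<in> carrier T ==> P s ==> P t ==> P (s + t)"
    and "\<And>w c. c \<in> K ==> set w \<subseteq> {..<n} ==> P (Poly_Mapping.single (Word w) c)"
  shows "P t"
proof -
  let ?h = "\<lambda>w. Poly_Mapping.single w (Poly_Mapping.lookup t w)"
  have h: "?h w \<in> carrier T \<and> P (?h w)" for w
  proof (cases "Poly_Mapping.lookup t w = 0")
    case False
    with assms(1) have "Poly_Mapping.lookup t w \<in> K" "set (letters w) \<subseteq> {..<n}" by (auto simp: T_carrier)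
    thus ?thesis using assms(4)[of _ "letters w"] T_single[of _ "letters w"] by simp
  qed (simp add: T_zero assms)
  have "sum ?h B \<in> carrier T \<and> P (sum ?h B)" for B
    by (induction B rule: infinite_finite_induct) (auto simp: T_zero T_add assms h)
  thus ?thesis using poly_mapping_sum_single[of t] by metis
qed

lemma T_mult: "s \<in> carrier T ==> t \<in> carrier T ==> s * t \<in> carrier T"
proof (induction s rule: T_induct)
  case (single u a)
  from single(3,1,2) show ?case
  proof (induction t rule: T_induct)
    case (single w c)
    thus ?case by (auto simp: mult_single plus_free_mon_def intro!: T_single K_mult)
  qed (auto simp: distrib_left T_add T_zero)
qed (auto simp: distrib_right T_add T_zero)

lemma T_one: "1 \<in> carrier T"
  using T_single[OF K_one, of "[]"] by (simp add: single_one[symmetric] zero_free_mon_def del: single_one)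

lemma ring_T: "ring T"
proof (rule ringI)
  show "abelian_group T"
    by (rule abelian_groupI) (auto simp: T_add T_zero add_ac intro: bexI[of _ "- _"] T_uminus)
  show "monoid T" by (rule monoidI) (auto simp: T_mult T_one mult.assoc)
qed (auto simp: algebra_simps)

lemma tensor_scalar_T: "c \<in> K ==> tensor_scalar c \<in> carrier T"
  unfolding tensor_scalar_def zero_free_mon_def by (rule T_single) auto

lemma tensor_gen_T: "i < n ==> tensor_gen i \<in> carrier T"
  unfolding tensor_gen_def by (rule T_single) (auto simp: K_one)

lemma tensor_vec_T: "(\<And>i. i < n ==> a i \<in> K) ==> tensor_vec n a \<in> carrier T"
  unfolding tensor_vec_def by (rule T_sum, rule T_single) auto

lemma Q_K: "(\<And>i. i < n ==> a i \<in> K) ==> Q a \<in> K"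
  unfolding Q_eq by (intro K_sum K_mult \<beta>_K) auto

abbreviation "rels \<equiv> {tensor_vec n a * tensor_vec n a - tensor_scalar (Q a) | a. \<forall>i<n. a i \<in> K}"

lemma rels_T: "rels \<subseteq> carrier T"
  by (auto intro!: T_minus T_mult tensor_vec_T tensor_scalar_T Q_K)

lemma ideal_I: "ideal I T"
  unfolding clifford_ideal_def by (rule ring.genideal_ideal[OF ring_T rels_T])

lemma rels_I: "(\<And>i. i < n ==> a i \<in> K) ==> tensor_vec n a * tensor_vec n a - tensor_scalar (Q a) \<in> I"
  unfolding clifford_ideal_def using ring.genideal_self[OF ring_T rels_T] by blast

lemma I_zero: "0 \<in> I" using additive_subgroup.zero_closed[OF ideal.axioms(1)[OF ideal_I]] by simp
lemma I_add: "x \<in> I ==> y \<in> I ==> x + y \<in> I"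
  using additive_subgroup.a_closed[OF ideal.axioms(1)[OF ideal_I]] by simp
lemma I_lmult: "t \<in> carrier T ==> x \<in> I ==> t * x \<in> I"
  using ideal.I_l_closed[OF ideal_I] by simp
lemma I_rmult: "t \<in> carrier T ==> x \<in> I ==> x * t \<in> I"
  using ideal.I_r_closed[OF ideal_I] by simp
lemma I_uminus: "x \<in> I ==> - x \<in> I" using I_lmult[of "-1" x] T_uminus[OF T_one] by simp
lemma I_diff: "x \<in> I ==> y \<in> I ==> x - y \<in> I" using I_add[of x "- y"] I_uminus[of y] by simp
lemma I_sum: "(\<And>a. a \<in> B ==> h a \<in> I) ==> sum h B \<in> I"
  by (induction B rule: infinite_finite_induct) (auto simp: I_zero I_add)

lemma act_vec: "act \<beta> (tensor_vec n a) f = (\<lambda>S. \<Sum>i<n. a i * cliff \<beta> i f S)"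
  by (rule ext) (simp add: tensor_vec_def act_sum act_single)

text \<open>After pairing the terms of the square, \<open>cliff_square\<close> and
  \<open>cliff_anticomm\<close> turn it into the scalar given by the triangular form, which is
  \<open>Q a\<close>.\<close>

lemma act_rel: "act \<beta> (tensor_vec n a * tensor_vec n a - tensor_scalar (Q a)) f S = 0"
proof -
  have "act \<beta> (tensor_vec n a * tensor_vec n a) f S =
      (\<Sum>i<n. \<Sum>k<n. a i * a k * cliff \<beta> i (cliff \<beta> k f) S)"
    by (simp add: act_mult act_vec cliff_sum cliff_times sum_distrib_left mult.assoc)
  also have "\<dots> = (\<Sum>i<n. a i * a i * cliff \<beta> i (cliff \<beta> i f) S + (\<Sum>k<i. a i * a k *
      (cliff \<beta> i (cliff \<beta> k f) S + cliff \<beta> k (cliff \<beta> i f) S)))"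
    by (subst sum_square_triangle) (simp add: algebra_simps)
  also have "\<dots> = (\<Sum>i<n. \<Sum>k\<le>i. \<beta> i k * (a i * a k)) * f S"
    by (simp add: cliff_square cliff_anticomm lessThan_Suc_atMost[symmetric] distrib_right
        sum_distrib_right sum_distrib_left algebra_simps)
  finally show ?thesis by (simp add: act_minus tensor_scalar_def act_single zero_free_mon_def Q_eq)
qed

lemma act_I: "x \<in> I ==> act \<beta> x f = (\<lambda>_. 0)"
proof -
  \<comment> \<open>The tensors acting by zero form a two-sided ideal containing the relations,
    hence the ideal that these generate.\<close>
  let ?Z = "{t \<in> carrier T. \<forall>f. act \<beta> t f = (\<lambda>_. 0)}"
  have "ideal ?Z T"
  proof (rule idealI[OF ring_T])
    have inv: "inv\<^bsub>add_monoid T\<^esub> x = - x" if "x \<in> carrier T" for x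
      using abelian_group.minus_equality[OF ring.is_abelian_group[OF ring_T], of "- x" x] that T_uminus
      unfolding a_inv_def by simp
    show "subgroup ?Z (add_monoid T)"
    proof
      fix x assume x: "x \<in> ?Z"
      hence "x \<in> carrier T" by blast
      thus "inv\<^bsub>add_monoid T\<^esub> x \<in> ?Z"
        unfolding inv[OF \<open>x \<in> carrier T\<close>] using x act_minus[of \<beta> 0 x] by (auto simp: T_uminus fun_eq_iff)
    qed (auto simp: T_add T_zero act_add fun_eq_iff)
  next
    fix a x assume "a \<in> ?Z" "x \<in> carrier T"
    thus "x \<otimes>\<^bsub>T\<^esub> a \<in> ?Z" "a \<otimes>\<^bsub>T\<^esub> x \<in> ?Z"
      using act_vec_times[of \<beta> x 0 "\<lambda>_. 0"] by (auto simp: T_mult act_mult)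
  qed
  moreover have "rels \<subseteq> ?Z" using rels_T by (auto simp: act_rel)
  ultimately have "I \<subseteq> ?Z"
    unfolding clifford_ideal_def by (rule ring.genideal_minimal[OF ring_T])
  thus "x \<in> I ==> act \<beta> x f = (\<lambda>_. 0)" by blast
qed

definition FK :: "(nat set => 'k) set" where
  "FK = {f. \<forall>S. f S \<in> K \<and> (f S \<noteq> 0 \<longrightarrow> S \<subseteq> {..<n})}"

text \<open>The combination of strictly increasing words with coefficients \<open>f\<close>. Acting
  on the vacuum inverts it (\<open>act_vac_nform\<close>, and \<open>nform_act_vac\<close> modulo
  the ideal), so the Clifford algebra is free on the increasing words.\<close>

definition nform :: "(nat set => 'k) => (nat free_mon \<Rightarrow>\<^sub>0 'k)" where
  "nform f = (\<Sum>S\<in>Pow {..<n}. Poly_Mapping.single (Word (sorted_list_of_set S)) (f S))"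

lemma FK_add: "f \<in> FK ==> g \<in> FK ==> (\<lambda>S. f S + g S) \<in> FK"
  unfolding FK_def by (auto simp: K_add) (metis add.right_neutral add.left_neutral subsetD lessThan_iff)+

lemma FK_times: "c \<in> K ==> f \<in> FK ==> (\<lambda>S. c * f S) \<in> FK"
  unfolding FK_def by (auto simp: K_mult) (metis mult_zero_right subsetD lessThan_iff)

lemma FK_zero: "(\<lambda>_. 0) \<in> FK" by (simp add: FK_def K_zero)

lemma FK_sum: "(\<And>a. a \<in> B ==> h a \<in> FK) ==> (\<lambda>S. \<Sum>a\<in>B. h a S) \<in> FK"
  by (induction B rule: infinite_finite_induct) (auto simp: FK_zero FK_add)

lemma FK_basis: "S \<subseteq> {..<n} ==> basis_fun S \<in> FK"
  by (auto simp: FK_def basis_fun_def K_one K_zero)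

lemma ksgn_K: "ksgn i S \<in> K"
proof -
  have "(-1) ^ m \<in> K" for m by (induction m) (auto simp: K_one K_uminus)
  thus ?thesis by (simp add: ksgn_def)
qed

lemma FK_iota: "f \<in> FK ==> iota i f \<in> FK"
proof -
  assume "f \<in> FK"
  hence "f S \<in> K" "f S = 0 \<or> S \<subseteq> {..<n}" for S by (auto simp: FK_def)
  hence "iota i f S \<in> K" "iota i f S = 0 \<or> S \<subseteq> {..<n}" for S
    using \<open>\<And>S. f S = 0 \<or> S \<subseteq> {..<n}\<close>[of "insert i S"]
    by (auto simp: iota_def K_zero intro!: K_mult ksgn_K)
  thus ?thesis by (auto simp: FK_def)
qed

lemma FK_wedge: "i < n ==> f \<in> FK ==> wedge i f \<in> FK"
proof -
  assume i: "i < n" and "f \<in> FK"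
  hence "f S \<in> K" "f S = 0 \<or> S \<subseteq> {..<n}" for S by (auto simp: FK_def)
  hence "wedge i f S \<in> K" "wedge i f S = 0 \<or> S \<subseteq> {..<n}" for S
  proof -
    show "wedge i f S \<in> K"
      using \<open>\<And>S. f S \<in> K\<close> by (auto simp: wedge_def K_zero intro!: K_mult ksgn_K)
    show "wedge i f S = 0 \<or> S \<subseteq> {..<n}"
      using \<open>\<And>S. f S = 0 \<or> S \<subseteq> {..<n}\<close>[of "S - {i}"] i by (cases "f (S - {i}) = 0") (auto simp: wedge_def)
  qed
  thus ?thesis by (auto simp: FK_def)
qed

lemma FK_contr: "(\<And>i. i < n ==> g i \<in> K) ==> f \<in> FK ==> contr n g f \<in> FK"
  unfolding contr_def[abs_def] by (rule FK_sum, rule FK_times) (auto simp: FK_iota)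

lemma FK_cliff: "i < n ==> f \<in> FK ==> cliff \<beta> i f \<in> FK"
  unfolding cliff_def[abs_def] by (rule FK_add, rule FK_wedge, assumption+, rule FK_sum, rule FK_times)
    (auto simp: FK_iota \<beta>_K)

lemma FK_expand: "f \<in> FK ==> f = (\<lambda>W. \<Sum>S\<in>Pow {..<n}. f S * basis_fun S W)"
  by (auto simp: FK_def basis_fun_def fun_eq_iff if_distrib[of "(*) _"] cong: if_cong)

lemma nform_T: "f \<in> FK ==> nform f \<in> carrier T"
  unfolding nform_def by (intro T_sum T_single) (auto simp: FK_def finite_subset)

lemma nform_add: "nform (\<lambda>S. f S + g S) = nform f + nform g"
  by (simp add: nform_def single_add sum.distrib)

lemma nform_minus: "nform (\<lambda>S. f S - g S) = nform f - nform g"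
  by (simp add: nform_def single_diff sum_subtractf)

lemma nform_sum: "nform (\<lambda>S. \<Sum>a\<in>B. h a S) = (\<Sum>a\<in>B. nform (h a))"
  by (induction B rule: infinite_finite_induct) (simp_all add: nform_add, simp_all add: nform_def)

lemma nform_times: "nform (\<lambda>S. c * f S) = tensor_scalar c * nform f"
  by (simp add: nform_def tensor_scalar_def sum_distrib_left mult_single)

lemma nform_basis: "S \<subseteq> {..<n} ==> nform (basis_fun S) = Poly_Mapping.single (Word (sorted_list_of_set S)) 1"
proof -
  assume "S \<subseteq> {..<n}"
  hence "nform (basis_fun S) = (\<Sum>W\<in>{S}. Poly_Mapping.single (Word (sorted_list_of_set W)) (basis_fun S W))"
    unfolding nform_def by (intro sum.mono_neutral_right) (auto simp: basis_fun_def)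
  thus ?thesis by (simp add: basis_fun_def)
qed

lemma scalar_commute: "tensor_scalar c * t = t * tensor_scalar c"
proof -
  have *: "tensor_scalar c * Poly_Mapping.single w a = Poly_Mapping.single w a * tensor_scalar c" for w a
    by (simp add: tensor_scalar_def mult_single mult.commute)
  show ?thesis
    by (subst (1 2) poly_mapping_sum_single[of t]) (simp add: sum_distrib_left sum_distrib_right *)
qed

lemma scalar_left: "t * (tensor_scalar c * s) = tensor_scalar c * (t * s)"
  by (metis mult.assoc scalar_commute)

lemma nform_insert:
  assumes "\<And>s. s \<in> S ==> m < s" "m < n" "S \<subseteq> {..<n}"
  shows "tensor_gen m * nform (basis_fun S) = nform (basis_fun (insert m S))"
proof -
  have "sorted_list_of_set (insert m S) = m # sorted_list_of_set S"
    using assms finite_subset[OF assms(3)]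
    by (intro sorted_list_of_set.sorted_key_list_of_set_unique[THEN iffD1])
      (auto simp: card_insert_if sorted_list_of_set.idem_if_sorted_distinct order.strict_implies_order)
  with assms show ?thesis
    by (simp add: nform_basis tensor_gen_def mult_single plus_free_mon_def)
qed

lemma nform_cliff_above:
  assumes "h \<in> FK" "\<And>S. h S \<noteq> 0 ==> \<forall>s\<in>S. m < s" "m < n"
  shows "tensor_gen m * nform h = nform (cliff \<beta> m h)"
proof -
  have eq: "tensor_gen m * (tensor_scalar (h S) * nform (basis_fun S))
      = tensor_scalar (h S) * nform (cliff \<beta> m (basis_fun S))" if "S \<in> Pow {..<n}" for S
  proof (cases "h S = 0")
    case False
    with assms(2) have "\<And>s. s \<in> S ==> m < s" by blast
    with that assms(3) show ?thesis by (simp add: scalar_left nform_insert cliff_basis)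
  qed (simp add: tensor_scalar_def)
  have "tensor_gen m * nform h = tensor_gen m * nform (\<lambda>W. \<Sum>S\<in>Pow {..<n}. h S * basis_fun S W)"
    using FK_expand[OF assms(1)] by simp
  also have "\<dots> = nform (\<lambda>W. \<Sum>S\<in>Pow {..<n}. h S * cliff \<beta> m (basis_fun S) W)"
    unfolding nform_sum nform_times sum_distrib_left by (rule sum.cong[OF refl eq])
  also have "(\<lambda>W. \<Sum>S\<in>Pow {..<n}. h S * cliff \<beta> m (basis_fun S) W) = cliff \<beta> m h"
    by (subst (2) FK_expand[OF assms(1)]) (simp add: cliff_sum cliff_times)
  finally show ?thesis .
qed

lemma Q_unit: "i < n ==> Q (\<lambda>k. if k = i then 1 else 0) = \<beta> i i"
proof -
  assume i: "i < n"
  have "Q (\<lambda>k. if k = i then 1 else 0) = (\<Sum>k<n. if k = i then \<beta> i i else 0)"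
    unfolding Q_eq by (rule sum.cong) (auto simp: if_distrib[of "(*) _"] cong: if_cong)
  with i show ?thesis by simp
qed

lemma Q_pair: "k < i ==> i < n ==> Q (\<lambda>j. if j = i \<or> j = k then 1 else 0) = \<beta> i i + \<beta> k k + \<beta> i k"
proof -
  assume ik: "k < i" "i < n"
  have "Q (\<lambda>j. if j = i \<or> j = k then 1 else 0) =
      (\<Sum>l<n. (if l = i then (\<Sum>j\<in>{i,k}. \<beta> i j) else 0) + (if l = k then \<beta> k k else 0))"
    unfolding Q_eq
  proof (rule sum.cong[OF refl])
    fix l
    have "(\<Sum>j\<le>l. \<beta> l j * ((if l = i \<or> l = k then 1 else 0) * (if j = i \<or> j = k then 1 else 0)))
       = (\<Sum>j\<in>{..l} \<inter> {i,k}. \<beta> l j * (if l = i \<or> l = k then 1 else 0))"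
      by (rule sum.mono_neutral_cong_right) auto
    also have "{..l} \<inter> {i,k} = (if l = i then {i,k} else if l = k then {k} else {..l} \<inter> {i,k})"
      using ik by auto
    finally show "(\<Sum>j\<le>l. \<beta> l j * ((if l = i \<or> l = k then 1 else 0) * (if j = i \<or> j = k then 1 else 0)))
       = (if l = i then (\<Sum>j\<in>{i,k}. \<beta> i j) else 0) + (if l = k then \<beta> k k else 0)"
      using ik by auto
  qed
  with ik show ?thesis by (simp add: sum.distrib)
qed

lemma vec_unit: "i < n ==> tensor_vec n (\<lambda>k. if k = i then 1 else 0) = tensor_gen i"
  unfolding tensor_vec_def tensor_gen_def
  by (subst sum.mono_neutral_right[of _ "{i}"]) auto

lemma vec_pair: "k \<noteq> i ==> i < n ==> k < n ==>
    tensor_vec n (\<lambda>j. if j = i \<or> j = k then 1 else 0) = tensor_gen i + tensor_gen k"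
  unfolding tensor_vec_def tensor_gen_def
  by (subst sum.mono_neutral_right[of _ "{i, k}"]) auto

lemma gen_square: "i < n ==> tensor_gen i * tensor_gen i - tensor_scalar (\<beta> i i) \<in> I"
  using rels_I[of "\<lambda>k. if k = i then 1 else 0"] by (simp add: vec_unit Q_unit K_one K_zero)

lemma scalar_add: "tensor_scalar (a + b) = tensor_scalar a + tensor_scalar b"
  by (simp add: tensor_scalar_def single_add)

text \<open>Polarisation: the relation for the sum of two generators minus the relations for each.
  No division by 2 occurs.\<close>

lemma gen_anticomm:
  assumes "k < i" "i < n"
  shows "tensor_gen i * tensor_gen k + tensor_gen k * tensor_gen i - tensor_scalar (\<beta> i k) \<in> I"
proof -
  have "(tensor_gen i + tensor_gen k) * (tensor_gen i + tensor_gen k)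
      - tensor_scalar (\<beta> i i + \<beta> k k + \<beta> i k) \<in> I"
    using rels_I[of "\<lambda>j. if j = i \<or> j = k then 1 else 0"] assms
    by (simp add: vec_pair Q_pair K_one K_zero)
  from I_diff[OF I_diff[OF this gen_square[of i]] gen_square[of k]] assms
  show ?thesis by (simp add: algebra_simps scalar_add)
qed

text \<open>Straightening by induction on the length of the monomial, whose least index
  \<open>m\<close> is peeled off. For i < m the product is already ordered, for i = m the square
  relation applies, and for i > m the generator is moved past \<open>m\<close> by the anticommutator
  and meets a shorter monomial.\<close>

lemma cliff_nform_basis:
  assumes "finite W"
  shows "W \<subseteq> {..<n} ==> i < n ==>
    tensor_gen i * nform (basis_fun W) - nform (cliff \<beta> i (basis_fun W)) \<in> I"
  using assms
proof (induction "card W" arbitrary: W i)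
  case 0
  hence "W = {}" by simp
  moreover have "cliff \<beta> i (basis_fun {}) = basis_fun {i}" by (rule cliff_basis) simp
  ultimately show ?case using 0 nform_insert[of "{}" i] by (simp add: I_zero)
next
  case (Suc c)
  hence "W \<noteq> {}" by auto
  have MinW: "Min W \<in> W" using Suc.prems \<open>W \<noteq> {}\<close> by simp
  define m where "m = Min W"
  define W' where "W' = W - {m}"
  have m: "m \<in> W" "\<And>s. s \<in> W' ==> m < s" "W = insert m W'" "m < n" "W' \<subseteq> {..<n}" "c = card W'" "finite W'"
    using Suc.prems Suc.hyps(2) MinW Min_le[of W]
    by (auto simp: m_def W'_def intro: le_neq_implies_less)
  have W: "nform (basis_fun W) = tensor_gen m * nform (basis_fun W')"
    using nform_insert[of W' m] m by simp
  have W2: "basis_fun W = cliff \<beta> m (basis_fun W')" using m by (simp add: cliff_basis)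
  have nT: "nform (basis_fun W') \<in> carrier T" using m by (intro nform_T FK_basis)
  show ?case
  proof (cases i m rule: linorder_cases)
    case less
    hence "\<And>s. s \<in> W ==> i < s" using m by fastforce
    with nform_insert[of W i] Suc.prems show ?thesis by (simp add: cliff_basis I_zero)
  next
    case equal
    have "nform (cliff \<beta> i (basis_fun W)) = tensor_scalar (\<beta> m m) * nform (basis_fun W')"
      unfolding W2 equal nform_times[symmetric] by (rule arg_cong[of _ _ nform]) (simp add: fun_eq_iff cliff_square)
    with I_rmult[OF nT gen_square[OF m(4)]] W equal show ?thesis
      by (simp add: algebra_simps)
  next
    case greater
    define h where "h = cliff \<beta> i (basis_fun W')"
    have IH: "tensor_gen i * nform (basis_fun W') - nform h \<in> I"
      unfolding h_def using Suc.hyps(1) Suc.prems m by auto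
    \<comment> \<open>All indices occurring in \<open>h\<close> exceed \<open>m\<close>, so
      multiplying by the generator \<open>m\<close> again gives ordered words.\<close>
    have "S \<subseteq> insert i W'" if "h S \<noteq> 0" for S
      using that cliff_support[of "basis_fun W'" W'] basis_fun_support[of W'] unfolding h_def by metis
    hence "tensor_gen m * nform h = nform (cliff \<beta> m h)"
      using m greater Suc.prems by (intro nform_cliff_above) (auto simp: h_def FK_cliff FK_basis)
    moreover have "cliff \<beta> i (basis_fun W) = (\<lambda>S. \<beta> i m * basis_fun W' S - cliff \<beta> m h S)"
      unfolding h_def W2 using cliff_anticomm[of i m \<beta> "basis_fun W'"] greater
      by (auto simp: fun_eq_iff algebra_simps)
    ultimately have "nform (cliff \<beta> i (basis_fun W)) =
        tensor_scalar (\<beta> i m) * nform (basis_fun W') - tensor_gen m * nform h"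
      by (simp add: nform_minus nform_times)
    moreover note I_diff[OF I_rmult[OF nT gen_anticomm[OF greater \<open>i < n\<close>]]
        I_lmult[OF tensor_gen_T[OF m(4)] IH]]
    ultimately show ?thesis unfolding W by (simp add: ring_distribs mult.assoc diff_diff_eq2 diff_add_eq)
  qed
qed

lemma cliff_nform:
  assumes "f \<in> FK" "i < n"
  shows "tensor_gen i * nform f - nform (cliff \<beta> i f) \<in> I"
proof -
  have "tensor_gen i * nform f - nform (cliff \<beta> i f) =
     (\<Sum>S\<in>Pow {..<n}. tensor_scalar (f S) * (tensor_gen i * nform (basis_fun S) - nform (cliff \<beta> i (basis_fun S))))"
    by (subst (1 2) FK_expand[OF assms(1)])
      (simp add: nform_sum nform_times cliff_sum cliff_times sum_distrib_left algebra_simps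
        sum_subtractf scalar_left)
  also have "\<dots> \<in> I"
    using assms by (intro I_sum I_lmult cliff_nform_basis tensor_scalar_T)
      (auto simp: FK_def intro: finite_subset[OF _ finite_lessThan])
  finally show ?thesis .
qed

lemma act_nform: "t \<in> carrier T ==> f \<in> FK ==> act \<beta> t f \<in> FK \<and> t * nform f - nform (act \<beta> t f) \<in> I"
proof (induction t rule: T_induct)
  case zero
  thus ?case by (simp add: FK_zero I_zero nform_def)
next
  case (add s t)
  hence "act \<beta> (s + t) f = (\<lambda>S. act \<beta> s f S + act \<beta> t f S)" by (simp add: act_add fun_eq_iff)
  with add I_add[of "s * nform f - nform (act \<beta> s f)" "t * nform f - nform (act \<beta> t f)"] show ?case
    by (simp add: FK_add nform_add algebra_simps)
next
  case (single w c)
  have *: "foldr (cliff \<beta>) w f \<in> FK \<and>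
      Poly_Mapping.single (Word w) 1 * nform f - nform (foldr (cliff \<beta>) w f) \<in> I"
    using single(2)
  proof (induction w)
    case Nil
    have "Poly_Mapping.single (Word []) 1 = (1 :: nat free_mon \<Rightarrow>\<^sub>0 'k)"
      by (simp flip: zero_free_mon_def)
    with single(3) show ?case by (simp add: I_zero)
  next
    case (Cons i w)
    hence IH: "foldr (cliff \<beta>) w f \<in> FK"
        "Poly_Mapping.single (Word w) 1 * nform f - nform (foldr (cliff \<beta>) w f) \<in> I" and i: "i < n" by auto
    have "Poly_Mapping.single (Word (i # w)) (1 :: 'k) = tensor_gen i * Poly_Mapping.single (Word w) 1"
      by (simp add: tensor_gen_def mult_single plus_free_mon_def)
    with IH i I_add[OF I_lmult[OF tensor_gen_T[OF i] IH(2)] cliff_nform[OF IH(1) i]]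
    show ?case by (simp add: FK_cliff algebra_simps)
  qed
  have "act \<beta> (Poly_Mapping.single (Word w) c) f = (\<lambda>S. c * foldr (cliff \<beta>) w f S)"
    by (simp add: act_single fun_eq_iff)
  moreover have "Poly_Mapping.single (Word w) c = tensor_scalar c * Poly_Mapping.single (Word w) 1"
    by (simp add: tensor_scalar_def mult_single)
  ultimately show ?case
    using * I_lmult[OF tensor_scalar_T[OF single(1)], of "Poly_Mapping.single (Word w) 1 * nform f - nform (foldr (cliff \<beta>) w f)"] single
    by (simp add: FK_times nform_times algebra_simps)
qed

lemma nform_vac: "nform (basis_fun {}) = 1"
  by (simp add: nform_basis) (simp flip: zero_free_mon_def)

lemma nform_act_vac: "t \<in> carrier T ==> t - nform (act \<beta> t (basis_fun {})) \<in> I"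
  using act_nform[of t "basis_fun {}"] by (simp add: nform_vac FK_basis)

lemma act_vac_nform: "f \<in> FK ==> act \<beta> (nform f) (basis_fun {}) = f"
proof
  fix W assume f: "f \<in> FK"
  have "act \<beta> (nform f) (basis_fun {}) W = (\<Sum>S\<in>Pow {..<n}. f S * basis_fun S W)"
    unfolding nform_def act_sum act_single
    by (intro sum.cong refl) (auto simp: cliff_words_basis finite_subset[OF _ finite_lessThan])
  with FK_expand[OF f] show "act \<beta> (nform f) (basis_fun {}) W = f W" by metis
qed

lemma cl_eq_iff: "s \<in> carrier T ==> t \<in> carrier T ==> cl s = cl t \<longleftrightarrow> s - t \<in> I"
proof -
  assume st: "s \<in> carrier T" "t \<in> carrier T"
  interpret abelian_subgroup I T 
    by (rule abelian_subgroupI3[OF ideal.axioms(1)[OF ideal_I] ring.is_abelian_group[OF ring_T]])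
  have "s \<ominus>\<^bsub>T\<^esub> t = s - t"
    using st abelian_group.minus_equality[OF ring.is_abelian_group[OF ring_T], of "- t" t] T_uminus
    by (simp add: a_minus_def)
  with st show ?thesis
    using a_rcos_module_minus[OF ring_T, of t s] a_repr_independence' a_rcos_self[of s]
    unfolding clifford_class_def by (metis a_repr_independence a_subgroup)
qed

lemma cl_hom: "cl \<in> ring_hom T A"
  unfolding clifford_class_def clifford_ring_def using ideal.rcos_ring_hom[OF ideal_I] .

lemma ring_A: "ring A"
  unfolding clifford_ring_def by (rule ideal.quotient_is_ring[OF ideal_I])

lemma cl_mult: "s \<in> carrier T ==> t \<in> carrier T ==> cl s \<otimes>\<^bsub>A\<^esub> cl t = cl (s * t)"
  using ring_hom_mult[OF cl_hom] by simp

lemma cl_add: "s \<in> carrier T ==> t \<in> carrier T ==> cl s \<oplus>\<^bsub>A\<^esub> cl t = cl (s + t)"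
  using ring_hom_add[OF cl_hom] by simp

lemma cl_one: "\<one>\<^bsub>A\<^esub> = cl 1"
  using ring_hom_one[OF cl_hom] by simp

lemma cl_zero: "\<zero>\<^bsub>A\<^esub> = cl 0"
  using ring_hom_zero[OF cl_hom ring_T ring_A] by simp

lemma A_carrier: "carrier A = cl ` carrier T"
  unfolding clifford_ring_def FactRing_def A_RCOSETS_def RCOSETS_def clifford_class_def a_r_coset_def
  by auto

text \<open>The linear isomorphism from coordinate functions to the Clifford algebra; injectivity
  comes from the action on the vacuum. \<open>star\<close> is the Clifford product read through
  it.\<close>

definition J :: "(nat set => 'k) => (nat free_mon \<Rightarrow>\<^sub>0 'k) set" where
  "J f = cl (nform f)"

definition star :: "(nat set => 'k) => (nat set => 'k) => nat set => 'k" where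
  "star f g = act \<beta> (nform f) g"

lemma J_act: "t \<in> carrier T ==> f \<in> FK ==> cl t \<otimes>\<^bsub>A\<^esub> J f = J (act \<beta> t f)"
  using act_nform[of t f] by (simp add: J_def cl_mult nform_T cl_eq_iff T_mult)

lemma J_cl: "t \<in> carrier T ==> cl t = J (act \<beta> t (basis_fun {}))"
  using nform_act_vac[of t] act_nform[of t "basis_fun {}"]
  by (simp add: J_def cl_eq_iff nform_T FK_basis)

lemma J_inj: "f \<in> FK ==> g \<in> FK ==> J f = J g ==> f = g"
proof -
  assume fg: "f \<in> FK" "g \<in> FK" "J f = J g"
  hence "act \<beta> (nform f - nform g) (basis_fun {}) = (\<lambda>_. 0)"
    by (intro act_I) (simp add: J_def cl_eq_iff nform_T)
  hence "act \<beta> (nform f) (basis_fun {}) = act \<beta> (nform g) (basis_fun {})"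
    by (simp add: fun_eq_iff act_minus)
  with fg show "f = g" by (simp add: act_vac_nform)
qed

lemma J_carrier: "carrier A = J ` FK"
  unfolding A_carrier using J_cl act_nform FK_basis[of "{}"] nform_T by (auto simp: J_def image_iff)

lemma J_add: "f \<in> FK ==> g \<in> FK ==> J f \<oplus>\<^bsub>A\<^esub> J g = J (\<lambda>S. f S + g S)"
  by (simp add: J_def cl_add nform_T nform_add)

lemma J_minus: "f \<in> FK ==> g \<in> FK ==> J f \<ominus>\<^bsub>A\<^esub> J g = J (\<lambda>S. f S - g S)"
proof -
  assume fg: "f \<in> FK" "g \<in> FK"
  interpret ring A by (rule ring_A)
  have g': "(\<lambda>S. - g S) \<in> FK" using FK_times[of "-1" g] fg K_uminus[OF K_one] by simp
  have "J (\<lambda>S. - g S) \<oplus>\<^bsub>A\<^esub> J g = \<zero>\<^bsub>A\<^esub>"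
    using fg g' by (simp add: J_add) (simp add: J_def nform_def cl_zero)
  hence "\<ominus>\<^bsub>A\<^esub> J g = J (\<lambda>S. - g S)"
    using fg g' J_carrier by (intro minus_equality) auto
  with fg g' show ?thesis by (simp add: a_minus_def J_add)
qed

lemma J_one: "\<one>\<^bsub>A\<^esub> = J (basis_fun {})"
  by (simp add: J_def nform_vac cl_one)

lemma J_zero: "\<zero>\<^bsub>A\<^esub> = J (\<lambda>_. 0)"
  by (simp add: J_def nform_def cl_zero)

lemma star_FK: "f \<in> FK ==> g \<in> FK ==> star f g \<in> FK"
  using act_nform[OF nform_T] by (simp add: star_def)

lemma J_star: "f \<in> FK ==> g \<in> FK ==> J f \<otimes>\<^bsub>A\<^esub> J g = J (star f g)"
  unfolding star_def by (subst (1) J_def) (rule J_act[OF nform_T])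

lemma J_scalar: "c \<in> K ==> f \<in> FK ==> cl (tensor_scalar c) \<otimes>\<^bsub>A\<^esub> J f = J (\<lambda>S. c * f S)"
  by (simp add: J_act tensor_scalar_T) (simp add: tensor_scalar_def act_single[abs_def] zero_free_mon_def)

lemma J_gen: "i < n ==> cl (tensor_gen i) = J (basis_fun {i})"
  by (simp add: J_def tensor_gen_def nform_basis)

lemma star_expand: "star f g S = (\<Sum>W\<in>Pow {..<n}. f W * foldr (cliff \<beta>) (sorted_list_of_set W) g S)"
  by (simp add: star_def nform_def act_sum act_single)

lemma star_add_left: "star (\<lambda>S. f S + f' S) g S = star f g S + star f' g S"
  and star_times_left: "star (\<lambda>S. c * f S) g S = c * star f g S"
  and star_add_right: "star f (\<lambda>S. g S + g' S) S = star f g S + star f g' S"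
  and star_times_right: "star f (\<lambda>S. c * g S) S = c * star f g S"
  by (simp_all add: star_expand cliff_words_plus cliff_words_times algebra_simps sum.distrib sum_distrib_left)

lemma star_basis_left: "W \<subseteq> {..<n} ==> star (basis_fun W) g = foldr (cliff \<beta>) (sorted_list_of_set W) g"
  by (simp add: star_def nform_basis act_single fun_eq_iff)

lemma star_vac_left: "star (basis_fun {}) g = g"
  by (simp add: star_basis_left)

text \<open>Associativity against a generator: \<open>tensor_gen i * nform f\<close> differs from
  its normal form by an element of the ideal, which acts by zero.\<close>

lemma star_cliff: "i < n ==> f \<in> FK ==> star (cliff \<beta> i f) g = cliff \<beta> i (star f g)"
proof
  fix S assume i: "i < n" and f: "f \<in> FK"
  have "act \<beta> (tensor_gen i * nform f - nform (cliff \<beta> i f)) g S = 0"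
    using act_I[OF cliff_nform[OF f i]] by (simp add: fun_eq_iff)
  thus "star (cliff \<beta> i f) g S = cliff \<beta> i (star f g) S"
    by (simp add: act_minus act_mult star_def) (simp add: tensor_gen_def act_single)
qed

end

section \<open>Parity and the contraction as a derivation of the Clifford algebra\<close>

context clifford_data begin

lemma even_Suc_shift: "even (int a - t) ==> Suc a = b ==> even (int b - (t + 1))"
  by auto

lemma even_trans: "even (a - b) ==> even (b - t) ==> even (a - t)" for a b t :: int
  by presburger

lemma even_add_trans: "even (a - (t + b)) ==> even (b - s) ==> even (a - (s + t))" for a b s t :: int
  by presburger

definition par :: "int => (nat set => 'k) => bool" where
  "par t f \<longleftrightarrow> (\<forall>S. f S \<noteq> 0 \<longrightarrow> even (int (card S) - t))"

lemma par_cliff: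
  assumes f: "f \<in> FK" and t: "par t f"
  shows "par (t + 1) (cliff \<beta> i f)"
  unfolding par_def
proof (intro allI impI)
  fix S assume "cliff \<beta> i f S \<noteq> 0"
  then consider "wedge i f S \<noteq> 0" | j where "iota j f S \<noteq> 0"
    unfolding cliff_def by (metis (no_types, lifting) add.right_neutral mult_zero_right sum.neutral)
  thus "even (int (card S) - (t + 1))"
  proof cases
    case 1
    hence *: "i \<in> S" "f (S - {i}) \<noteq> 0" by (auto simp: wedge_def split: if_splits)
    with f have "S - {i} \<subseteq> {..<n}" unfolding FK_def by blast
    hence "finite (S - {i})" by (rule finite_subset) simp
    hence "Suc (card (S - {i})) = card S" using * by (intro card_Suc_Diff1) auto
    moreover have "even (int (card (S - {i})) - t)" using * t unfolding par_def by blast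
    ultimately show ?thesis by (rule even_Suc_shift[rotated])
  next
    case 2
    hence *: "j \<notin> S" "f (insert j S) \<noteq> 0" by (auto simp: iota_def split: if_splits)
    with f have "insert j S \<subseteq> {..<n}" by (auto simp: FK_def)
    hence "finite S" by (meson finite_insert finite_lessThan finite_subset)
    with * t show ?thesis by (auto simp: par_def)
  qed
qed

lemma par_words: "set w \<subseteq> {..<n} ==> f \<in> FK ==> par t f ==>
    foldr (cliff \<beta>) w f \<in> FK \<and> par (t + int (length w)) (foldr (cliff \<beta>) w f)"
proof (induction w)
  case (Cons i w)
  hence "par (t + int (length w) + 1) (cliff \<beta> i (foldr (cliff \<beta>) w f))"
    by (intro par_cliff) auto
  with Cons show ?case by (simp add: FK_cliff algebra_simps)
qed simp

lemma par_sum: "(\<And>a. a \<in> B ==> par t (h a)) ==> par t (\<lambda>S. \<Sum>a\<in>B. h a S)"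
  unfolding par_def by (metis (mono_tags, lifting) sum.neutral)

lemma par_basis: "par (int (card S)) (basis_fun S)"
  by (auto simp: par_def basis_fun_def)

lemma par_star:
  assumes "f \<in> FK" "g \<in> FK" "par s f" "par t g"
  shows "par (s + t) (star f g)"
  unfolding star_expand[abs_def]
proof (rule par_sum)
  fix W assume W: "W \<in> Pow {..<n}"
  hence fin: "finite W" by (auto intro: finite_subset[OF _ finite_lessThan])
  have *: "par (t + int (card W)) (foldr (cliff \<beta>) (sorted_list_of_set W) g)"
    using par_words[of "sorted_list_of_set W" g t] assms fin W by auto
  show "par (s + t) (\<lambda>S. f W * foldr (cliff \<beta>) (sorted_list_of_set W) g S)"
  proof (cases "f W = 0")
    case False
    with assms(3) have "even (int (card W) - s)" by (auto simp: par_def)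
    have "even (int (card S) - (s + t))" if "f W * foldr (cliff \<beta>) (sorted_list_of_set W) g S \<noteq> 0" for S
    proof -
      from that have "foldr (cliff \<beta>) (sorted_list_of_set W) g S \<noteq> 0" by auto
      with * have "even (int (card S) - (t + int (card W)))" unfolding par_def by blast
      from even_add_trans[OF this \<open>even (int (card W) - s)\<close>] show ?thesis .
    qed
    thus ?thesis by (simp add: par_def)
  qed (simp add: par_def)
qed

text \<open>Each \<open>cliff \<beta> i\<close> changes cardinalities by one, up or down. Passing to
  normal forms therefore preserves the parity of word lengths, though not the lengths
  themselves.\<close>

lemma clifford_part_J: "clifford_part K n Q t = J ` {f \<in> FK. par t f}"
proof (intro equalityI subsetI)
  fix x assume "x \<in> clifford_part K n Q t"
  then obtain s where s: "s \<in> carrier T" "x = cl s"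
      "\<And>w. Poly_Mapping.lookup s w \<noteq> 0 ==> even (int (length (letters w)) - t)"
    by (auto simp: clifford_part_def)
  have "par t (act \<beta> s (basis_fun {}))"
    unfolding act_def[abs_def]
  proof (rule par_sum)
    fix w assume "w \<in> Poly_Mapping.keys s"
    hence w: "Poly_Mapping.lookup s w \<noteq> 0" by (simp add: in_keys_iff)
    with s(1) have "set (letters w) \<subseteq> {..<n}" by (auto simp: T_carrier)
    hence "par (int (length (letters w))) (foldr (cliff \<beta>) (letters w) (basis_fun {}))"
      using par_words[of "letters w" "basis_fun {}" 0] par_basis[of "{}"] by (simp add: FK_basis)
    hence *: "even (int (card S) - int (length (letters w)))"
      if "foldr (cliff \<beta>) (letters w) (basis_fun {}) S \<noteq> 0" for S
      using that unfolding par_def by blast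
    show "par t (\<lambda>S. Poly_Mapping.lookup s w * foldr (cliff \<beta>) (letters w) (basis_fun {}) S)"
      unfolding par_def
    proof (intro allI impI)
      fix S assume "Poly_Mapping.lookup s w * foldr (cliff \<beta>) (letters w) (basis_fun {}) S \<noteq> 0"
      hence "foldr (cliff \<beta>) (letters w) (basis_fun {}) S \<noteq> 0" by auto
      from even_trans[OF *[OF this] s(3)[OF w]] show "even (int (card S) - t)" .
    qed
  qed
  with s show "x \<in> J ` {f \<in> FK. par t f}"
    using act_nform[of s "basis_fun {}"] by (simp add: J_cl FK_basis)
next
  fix x assume "x \<in> J ` {f \<in> FK. par t f}"
  then obtain f where f: "f \<in> FK" "par t f" "x = cl (nform f)" by (auto simp: J_def)
  have "even (int (length (letters w)) - t)" if w: "Poly_Mapping.lookup (nform f) w \<noteq> 0" for w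
  proof -
    from w obtain S where "S \<in> Pow {..<n}"
        "Poly_Mapping.lookup (Poly_Mapping.single (Word (sorted_list_of_set S)) (f S)) w \<noteq> 0"
      unfolding nform_def lookup_sum by (meson sum.neutral)
    hence "w = Word (sorted_list_of_set S)" "f S \<noteq> 0" "finite S"
      by (auto simp: lookup_single when_def finite_subset[OF _ finite_lessThan] split: if_splits)
    with f(2) show ?thesis by (simp add: par_def)
  qed
  with f show "x \<in> clifford_part K n Q t"
    unfolding clifford_part_def by (auto simp: nform_T)
qed

lemma contr_sum: "contr n g (\<lambda>S. \<Sum>a\<in>B. h a S) S = (\<Sum>a\<in>B. contr n g (h a) S)"
  unfolding contr_def iota_sum sum_distrib_left by (rule sum.swap)

lemma contr_vac: "contr n g (basis_fun {}) = (\<lambda>_. 0)"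
  by (rule ext) (auto simp: contr_def iota_def basis_fun_def intro!: sum.neutral)

lemma contr_zero: "contr n g (\<lambda>_. 0) = (\<lambda>_. 0)"
  by (rule ext) (auto simp: contr_def iota_def intro!: sum.neutral)

lemma par_contr: "f \<in> FK ==> par t f ==> par (t + 1) (contr n g f)"
  unfolding contr_def[abs_def]
proof (rule par_sum, unfold par_def, intro allI impI)
  fix j S assume *: "f \<in> FK" "\<forall>S. f S \<noteq> 0 \<longrightarrow> even (int (card S) - t)" "g j * iota j f S \<noteq> 0"
  hence i: "j \<notin> S" "f (insert j S) \<noteq> 0" by (auto simp: iota_def split: if_splits)
  with * have "insert j S \<subseteq> {..<n}" by (auto simp: FK_def)
  hence "finite S" by (meson finite_insert finite_lessThan finite_subset)
  with * i show "even (int (card S) - (t + 1))" by auto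
qed

lemma star_sum: "f \<in> FK ==> star f h S = (\<Sum>W\<in>Pow {..<n}. f W * star (basis_fun W) h S)"
  unfolding star_expand[of f] by (rule sum.cong) (auto simp: star_basis_left)

lemma star_sum_left:
  "star (\<lambda>W. \<Sum>S\<in>B. c S * u S W) h V = (\<Sum>S\<in>B. c S * star (u S) h V)"
proof (induction B rule: infinite_finite_induct)
  case (insert a B)
  thus ?case using star_add_left[of "\<lambda>W. c a * u a W"] by (simp add: star_times_left)
qed (simp_all add: star_expand)

lemma star_zero_left: "star (\<lambda>_. 0) g S = 0"
  by (simp add: star_expand)

lemma star_minus_left: "star (\<lambda>S. f S - f' S) g S = star f g S - star f' g S"
  by (simp add: star_expand algebra_simps sum_subtractf)

text \<open>The set is built from its largest element downwards, so every new index is below those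
  present, which is the situation of \<open>cliff_basis\<close>.\<close>

lemma sorted_basis_induct [consumes 1, case_names empty insert]:
  assumes "W \<subseteq> {..<n}" "P {}"
    "\<And>i W. i < n ==> W \<subseteq> {..<n} ==> (\<And>s. s \<in> W ==> i < s) ==> P W ==> P (insert i W)"
  shows "P W"
proof -
  have "sorted_wrt (<) w ==> set w \<subseteq> {..<n} ==> P (set w)" for w
    by (induction w) (auto intro: assms)
  from this[of "sorted_list_of_set W"] show ?thesis using assms(1) by (auto simp: finite_subset[OF _ finite_lessThan])
qed

text \<open>Peeling off the least index reduces the derivation rule to \<open>contr_cliff\<close>;
  each generator passed contributes one sign, whence the exponent \<open>card W\<close>.\<close>

lemma contr_star_basis:
  assumes g: "\<And>i. i < n ==> g i \<in> K" and W: "W \<subseteq> {..<n}"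
  shows "contr n g (star (basis_fun W) h) S =
    star (contr n g (basis_fun W)) h S + (-1) ^ card W * star (basis_fun W) (contr n g h) S"
  using W
proof (induction arbitrary: S rule: sorted_basis_induct)
  case empty
  show ?case by (simp add: star_vac_left contr_vac star_zero_left)
next
  case (insert i W)
  let ?b = "basis_fun W"
  have fin: "finite W" "i \<notin> W"
    using finite_subset[OF insert.hyps(2)] insert.hyps(3)[of i] by auto
  have b: "basis_fun (insert i W) = cliff \<beta> i ?b" using insert.hyps(3) by (simp add: cliff_basis)
  have bF: "?b \<in> FK" by (rule FK_basis) fact
  have IH: "contr n g (star ?b h) = (\<lambda>S. star (contr n g ?b) h S + (-1) ^ card W * star ?b (contr n g h) S)"
    using insert.IH by blast
  have "star (cliff \<beta> i (contr n g ?b)) h S = cliff \<beta> i (star (contr n g ?b) h) S"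
    using star_cliff[OF insert.hyps(1) FK_contr[OF g bF]] by simp
  moreover have "contr n g (cliff \<beta> i ?b) = (\<lambda>S. g i * ?b S - cliff \<beta> i (contr n g ?b) S)"
    by (simp add: fun_eq_iff contr_cliff insert.hyps)
  moreover have "contr n g (star (cliff \<beta> i ?b) h) S = g i * star ?b h S - cliff \<beta> i (contr n g (star ?b h)) S"
    by (simp add: star_cliff[OF insert.hyps(1) bF] contr_cliff insert.hyps(1))
  moreover have "cliff \<beta> i (contr n g (star ?b h)) S = cliff \<beta> i (star (contr n g ?b) h) S
      + (-1) ^ card W * star (cliff \<beta> i ?b) (contr n g h) S"
    unfolding IH by (simp only: cliff_plus cliff_times star_cliff[OF insert.hyps(1) bF])
  moreover have "card (insert i W) = Suc (card W)" using fin by simp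
  ultimately show ?case
    unfolding b by (simp add: star_minus_left star_times_left)
qed

lemma contr_star:
  assumes "f \<in> FK" "par t f" and g: "\<And>i. i < n ==> g i \<in> K"
  shows "contr n g (star f h) S =
    star (contr n g f) h S + (if even t then 1 else - 1) * star f (contr n g h) S"
proof -
  have "contr n g (star f h) S = contr n g (\<lambda>S. \<Sum>W\<in>Pow {..<n}. f W * star (basis_fun W) h S) S"
    by (simp add: star_sum[OF assms(1), abs_def])
  also have "\<dots> = (\<Sum>W\<in>Pow {..<n}. f W * star (contr n g (basis_fun W)) h S
      + (if even t then 1 else - 1) * (f W * star (basis_fun W) (contr n g h) S))"
    unfolding contr_sum contr_scale
  proof (rule sum.cong[OF refl])
    fix W assume "W \<in> Pow {..<n}"
    moreover have "f W \<noteq> 0 ==> (-1 :: 'k) ^ card W = (if even t then 1 else - 1)"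
      using assms(2) by (auto simp: par_def)
    ultimately show "f W * contr n g (star (basis_fun W) h) S =
        f W * star (contr n g (basis_fun W)) h S
      + (if even t then 1 else - 1) * (f W * star (basis_fun W) (contr n g h) S)"
      by (cases "f W = 0") (auto simp: contr_star_basis[OF g] algebra_simps)
  qed
  also have "\<dots> = star (\<lambda>V. \<Sum>W\<in>Pow {..<n}. f W * contr n g (basis_fun W) V) h S
      + (if even t then 1 else - 1) * star f (contr n g h) S"
    by (simp only: star_sum[OF assms(1), of "contr n g h"] star_sum_left sum.distrib sum_distrib_left)
  also have "(\<lambda>V. \<Sum>W\<in>Pow {..<n}. f W * contr n g (basis_fun W) V) = contr n g f"
    by (subst (2) FK_expand[OF assms(1)]) (simp add: fun_eq_iff contr_sum contr_scale)
  finally show ?thesis .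
qed

lemma is_contractionI:
  assumes g: "\<And>i. i < n ==> g i \<in> K"
  shows "is_contraction K n Q g (restrict (\<lambda>x. J (contr n g (inv_into FK J x))) (carrier A))"
    (is "is_contraction K n Q g ?D")
proof -
  have inv: "inv_into FK J (J f) = f" if "f \<in> FK" for f
    using that J_inj by (intro inv_into_f_f) (auto simp: inj_on_def)
  have DJ: "?D (J f) = J (contr n g f)" if "f \<in> FK" for f
    using that by (simp add: J_carrier inv)
  have cF: "contr n g f \<in> FK" if "f \<in> FK" for f using FK_contr[of g f] g that by blast
  have 1: "?D \<in> carrier A \<rightarrow>\<^sub>E carrier A"
    unfolding J_carrier using cF by (auto simp: inv)
  have 2: "?D (x \<oplus>\<^bsub>A\<^esub> y) = ?D x \<oplus>\<^bsub>A\<^esub> ?D y" if "x \<in> carrier A" "y \<in> carrier A" for x y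
  proof -
    from that obtain f h where "f \<in> FK" "h \<in> FK" "x = J f" "y = J h" by (auto simp: J_carrier)
    thus ?thesis
      by (simp only: J_add DJ FK_add cF contr_add[abs_def])
  qed
  have 3: "?D (cl (tensor_scalar r) \<otimes>\<^bsub>A\<^esub> x) = cl (tensor_scalar r) \<otimes>\<^bsub>A\<^esub> ?D x"
    if "r \<in> K" "x \<in> carrier A" for r x
  proof -
    from that obtain f where "f \<in> FK" "x = J f" by (auto simp: J_carrier)
    with that show ?thesis by (simp only: J_scalar DJ FK_times cF contr_scale[abs_def])
  qed
  have 4: "?D ` clifford_part K n Q t \<subseteq> clifford_part K n Q (t + 1)" for t
  proof
    fix x assume "x \<in> ?D ` clifford_part K n Q t"
    then obtain f where f: "f \<in> FK" "par t f" "x = ?D (J f)" by (auto simp only: clifford_part_J)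
    hence "x = J (contr n g f)" by (simp only: DJ)
    with f show "x \<in> clifford_part K n Q (t + 1)" unfolding clifford_part_J using cF par_contr by blast
  qed
  have 5: "?D (x \<otimes>\<^bsub>A\<^esub> y) = (if even t then ?D x \<otimes>\<^bsub>A\<^esub> y \<oplus>\<^bsub>A\<^esub> x \<otimes>\<^bsub>A\<^esub> ?D y
           else ?D x \<otimes>\<^bsub>A\<^esub> y \<ominus>\<^bsub>A\<^esub> x \<otimes>\<^bsub>A\<^esub> ?D y)"
    if x: "x \<in> clifford_part K n Q t" and y: "y \<in> carrier A" for x y t
  proof -
    from x y obtain f h where f: "f \<in> FK" "par t f" "h \<in> FK" "x = J f" "y = J h"
      by (auto simp: J_carrier clifford_part_J)
    show ?thesis
    proof (cases "even t")
      case True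
      hence "contr n g (star f h) = (\<lambda>S. star (contr n g f) h S + star f (contr n g h) S)"
        using contr_star[OF f(1,2), of g h] g by (simp add: fun_eq_iff)
      with True f show ?thesis by (simp only: DJ J_star star_FK cF J_add if_True)
    next
      case False
      hence "contr n g (star f h) = (\<lambda>S. star (contr n g f) h S - star f (contr n g h) S)"
        using contr_star[OF f(1,2), of g h] g by (simp add: fun_eq_iff)
      with False f show ?thesis by (simp only: DJ J_star star_FK cF J_minus if_False)
    qed
  qed
  have 6: "?D (cl (tensor_gen i)) = cl (tensor_scalar (g i))" if i: "i < n" for i
  proof -
    have "contr n g (basis_fun {i}) = (\<lambda>S. g i * basis_fun {} S)"
      using contr_cliff_insert[where S = "{}" and i = i and n = n and g = g and \<beta> = \<beta>] i by (simp add: fun_eq_iff contr_vac)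
    hence *: "J (contr n g (basis_fun {i})) = J (\<lambda>S. g i * basis_fun {} S)" by (rule arg_cong)
    have "act \<beta> (tensor_scalar (g i)) (basis_fun {}) = (\<lambda>S. g i * basis_fun {} S)"
      by (rule ext) (simp add: tensor_scalar_def act_single zero_free_mon_def)
    hence **: "cl (tensor_scalar (g i)) = J (\<lambda>S. g i * basis_fun {} S)"
      using J_cl[OF tensor_scalar_T[OF g[OF i]]] by argo
    have "?D (J (basis_fun {i})) = J (contr n g (basis_fun {i}))"
      by (rule DJ, rule FK_basis) (use i in simp)
    thus ?thesis unfolding J_gen[OF i] ** * .
  qed
  show ?thesis
    unfolding is_contraction_def Let_def by (intro conjI ballI allI impI 1 2 3 4 5 6)
qed

text \<open>Uniqueness: an odd linear derivation is determined on ordered monomials by its values on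
  generators, and then everywhere by linearity. Together with \<open>is_contractionI\<close> this
  evaluates the definite description in \<open>contraction\<close>.\<close>

lemma is_contraction_J:
  assumes D: "is_contraction K n Q g D" and g: "\<And>i. i < n ==> g i \<in> K" and f: "f \<in> FK"
  shows "D (J f) = J (contr n g f)"
proof -
  have add: "D (x \<oplus>\<^bsub>A\<^esub> y) = D x \<oplus>\<^bsub>A\<^esub> D y" if "x \<in> carrier A" "y \<in> carrier A" for x y
    using D that by (simp add: is_contraction_def Let_def)
  have car: "D x \<in> carrier A" if "x \<in> carrier A" for x
    using D that by (auto simp: is_contraction_def Let_def)
  have scal: "D (cl (tensor_scalar r) \<otimes>\<^bsub>A\<^esub> x) = cl (tensor_scalar r) \<otimes>\<^bsub>A\<^esub> D x"
    if "r \<in> K" "x \<in> carrier A" for r x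
    using D that by (simp add: is_contraction_def Let_def)
  have der: "D (x \<otimes>\<^bsub>A\<^esub> y) = (if even t then D x \<otimes>\<^bsub>A\<^esub> y \<oplus>\<^bsub>A\<^esub> x \<otimes>\<^bsub>A\<^esub> D y
           else D x \<otimes>\<^bsub>A\<^esub> y \<ominus>\<^bsub>A\<^esub> x \<otimes>\<^bsub>A\<^esub> D y)"
    if "x \<in> clifford_part K n Q t" "y \<in> carrier A" for x y t
    using D that unfolding is_contraction_def Let_def by blast
  have gen: "D (cl (tensor_gen i)) = cl (tensor_scalar (g i))" if "i < n" for i
    using D that by (simp add: is_contraction_def Let_def)
  have JF: "J f \<in> carrier A" if "f \<in> FK" for f using that by (simp add: J_carrier)
  have cF: "contr n g f \<in> FK" if "f \<in> FK" for f using FK_contr[of g f] g that by blast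
  interpret R: ring A by (rule ring_A)
  have vac: "D (J (basis_fun {})) = J (contr n g (basis_fun {}))"
  proof -
    have "J (basis_fun {}) \<in> clifford_part K n Q 0"
      unfolding clifford_part_J using par_basis[of "{}"] by (auto simp: FK_basis)
    \<comment> \<open>The derivation rule for 1 times 1 forces the value at the unit to
      vanish.\<close>
    from der[OF this JF[OF FK_basis[of "{}"]]]
    have "D \<one>\<^bsub>A\<^esub> = D \<one>\<^bsub>A\<^esub> \<oplus>\<^bsub>A\<^esub> D \<one>\<^bsub>A\<^esub>"
      using car[OF R.one_closed] unfolding J_one[symmetric] by simp
    hence "D \<one>\<^bsub>A\<^esub> = \<zero>\<^bsub>A\<^esub>" using car[OF R.one_closed] by (metis R.add.l_cancel_one')
    thus ?thesis by (simp add: contr_vac J_one J_zero)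
  qed
  have basis: "D (J (basis_fun W)) = J (contr n g (basis_fun W))" if "W \<subseteq> {..<n}" for W
    using that
  proof (induction rule: sorted_basis_induct)
    case (insert i W)
    have b: "basis_fun W \<in> FK" using insert by (simp add: FK_basis)
    have i: "basis_fun {i} \<in> FK" using insert by (simp add: FK_basis)
    have W: "basis_fun (insert i W) = cliff \<beta> i (basis_fun W)" using insert by (simp add: cliff_basis)
    have e: "cl (tensor_gen i) \<otimes>\<^bsub>A\<^esub> J h = J (cliff \<beta> i h)" if "h \<in> FK" for h
      using that insert.hyps by (simp add: J_act tensor_gen_T) (simp add: tensor_gen_def act_single[abs_def])
    have "cl (tensor_gen i) \<in> clifford_part K n Q 1"
      unfolding clifford_part_J J_gen[OF insert.hyps(1)] using i par_basis[of "{i}"] by auto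
    from der[OF this JF[OF b]]
    have "D (J (basis_fun (insert i W))) = D (cl (tensor_gen i)) \<otimes>\<^bsub>A\<^esub> J (basis_fun W)
        \<ominus>\<^bsub>A\<^esub> cl (tensor_gen i) \<otimes>\<^bsub>A\<^esub> D (J (basis_fun W))"
      by (simp add: W e b)
    also have "\<dots> = J (\<lambda>S. g i * basis_fun W S - cliff \<beta> i (contr n g (basis_fun W)) S)"
      using b insert.hyps insert.IH g by (simp add: gen J_scalar e cF J_minus FK_times FK_cliff)
    finally show ?case using contr_cliff_insert[where S = W and i = i and n = n and g = g and \<beta> = \<beta>] insert.hyps by (simp add: fun_eq_iff)
  qed (rule vac)
  have fK: "f S \<in> K" for S using f by (simp add: FK_def)
  have "D (J (\<lambda>W. \<Sum>S\<in>B. f S * basis_fun S W)) = J (contr n g (\<lambda>W. \<Sum>S\<in>B. f S * basis_fun S W))"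
    if "B \<subseteq> Pow {..<n}" for B
    using finite_subset[OF that finite_Pow_iff[THEN iffD2, OF finite_lessThan]] that
  proof (induction rule: finite_induct)
    case empty
    have "D (cl (tensor_scalar 0) \<otimes>\<^bsub>A\<^esub> J (\<lambda>_. 0)) = J (\<lambda>_. 0)"
      using scal[of 0 "J (\<lambda>_. 0)"] JF[OF FK_zero] car[OF JF[OF FK_zero]]
      by (auto simp: K_zero J_carrier J_scalar)
    thus ?case by (simp add: J_scalar K_zero FK_zero contr_zero)
  next
    case (insert S B)
    have S: "basis_fun S \<in> FK" "S \<subseteq> {..<n}" "f S \<in> K" using insert.prems fK by (auto intro: FK_basis)
    have B: "(\<lambda>W. \<Sum>S\<in>B. f S * basis_fun S W) \<in> FK"
      using insert.prems fK by (intro FK_sum FK_times FK_basis) auto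
    have carX: "cl (tensor_scalar (f S)) \<otimes>\<^bsub>A\<^esub> J (basis_fun S) \<in> carrier A"
      using S by (simp add: J_scalar JF FK_times)
    have e: "J (\<lambda>W. \<Sum>S\<in>insert S B. f S * basis_fun S W)
        = cl (tensor_scalar (f S)) \<otimes>\<^bsub>A\<^esub> J (basis_fun S) \<oplus>\<^bsub>A\<^esub> J (\<lambda>W. \<Sum>S\<in>B. f S * basis_fun S W)"
      unfolding J_scalar[OF S(3) S(1)] J_add[OF FK_times[OF S(3) S(1)] B] using insert.hyps by simp
    have "D (J (\<lambda>W. \<Sum>S\<in>insert S B. f S * basis_fun S W))
        = cl (tensor_scalar (f S)) \<otimes>\<^bsub>A\<^esub> J (contr n g (basis_fun S))
          \<oplus>\<^bsub>A\<^esub> J (contr n g (\<lambda>W. \<Sum>S\<in>B. f S * basis_fun S W))"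
      unfolding e add[OF carX JF[OF B]] scal[OF S(3) JF[OF S(1)]] basis[OF S(2)]
      using insert.IH insert.prems by simp
    also have "\<dots> = J (\<lambda>V. f S * contr n g (basis_fun S) V + contr n g (\<lambda>W. \<Sum>S\<in>B. f S * basis_fun S W) V)"
      by (simp only: J_scalar[OF S(3) cF[OF S(1)]] J_add[OF FK_times[OF S(3) cF[OF S(1)]] cF[OF B]])
    also have "(\<lambda>V. f S * contr n g (basis_fun S) V + contr n g (\<lambda>W. \<Sum>S\<in>B. f S * basis_fun S W) V)
        = contr n g (\<lambda>W. f S * basis_fun S W + (\<Sum>S\<in>B. f S * basis_fun S W))"
      by (rule ext) (simp only: contr_add contr_scale)
    finally show ?case using insert.hyps by simp
  qed
  from this[of "Pow {..<n}"] show ?thesis using FK_expand[OF f] by simp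
qed

lemma contraction_J:
  assumes g: "\<And>i. i < n ==> g i \<in> K" and f: "f \<in> FK"
  shows "contraction K n Q g (J f) = J (contr n g f)"
proof -
  have "is_contraction K n Q g (contraction K n Q g)"
    unfolding contraction_def
  proof (rule theI'[where P = "is_contraction K n Q g"])
    show "\<exists>!D. is_contraction K n Q g D"
    proof (rule ex_ex1I)
      show "\<exists>D. is_contraction K n Q g D" using is_contractionI g by metis
    next
      fix D E assume DE: "is_contraction K n Q g D" "is_contraction K n Q g E"
      hence PE: "D \<in> carrier A \<rightarrow>\<^sub>E carrier A" "E \<in> carrier A \<rightarrow>\<^sub>E carrier A"
        by (simp_all only: is_contraction_def Let_def)
      show "D = E"
      proof (rule PiE_ext[OF PE])
        fix x assume "x \<in> carrier A"
        then obtain h where "h \<in> FK" "x = J h" by (auto simp: J_carrier)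
        thus "D x = E x" using is_contraction_J[OF DE(1) g] is_contraction_J[OF DE(2) g] by metis
      qed
    qed
  qed
  thus ?thesis by (rule is_contraction_J) (use assms in auto)
qed

end

section \<open>Sums over the splittings of a list\<close>

text \<open>Sums over the cuts of a list into two parts; nesting gives cuts into more parts. The
  recursive form lets sums over concatenated or mapped lists be expanded by rewriting, which is how
  the brace identities are proved.\<close>

primrec ss :: "'a list => ('a list => 'a list => 'b::comm_monoid_add) => 'b" where
  "ss [] f = f [] []"
| "ss (a # as) f = f [] (a # as) + ss as (\<lambda>u v. f (a # u) v)"

lemma finite_splits: "finite {p. fst p @ snd p = as}"
proof (rule finite_subset)
  show "{p. fst p @ snd p = as} \<subseteq> (\<lambda>k. (take k as, drop k as)) ` {..length as}"
  proof
    fix p assume "p \<in> {p. fst p @ snd p = as}"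
    then obtain u v where "p = (u, v)" "as = u @ v" by (cases p) simp
    hence "p = (take (length u) as, drop (length u) as)" "length u \<in> {..length as}" by simp_all
    thus "p \<in> (\<lambda>k. (take k as, drop k as)) ` {..length as}" by blast
  qed
qed simp

lemma ss_sum:
  fixes as :: "'a list"
  shows "ss as f = (\<Sum>p | fst p @ snd p = as. f (fst p) (snd p))"
proof (induction as arbitrary: f)
  case Nil
  have *: "{p :: 'a list \<times> 'a list. fst p @ snd p = []} = {([], [])}" by auto
  show ?case unfolding * by simp
next
  case (Cons a as)
  have *: "{p. fst p @ snd p = a # as} = insert ([], a # as) ((\<lambda>p. (a # fst p, snd p)) ` {p. fst p @ snd p = as})"
    by (auto simp: Cons_eq_append_conv append_eq_Cons_conv image_iff)
  have "inj_on (\<lambda>p. (a # fst p, snd p)) B" for B :: "('a list \<times> 'a list) set"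
    by (auto simp: inj_on_def)
  thus ?case unfolding *
    by (subst sum.insert) (auto simp: finite_splits Cons sum.reindex)
qed

lemma sum_splits3: "(\<Sum>(l, m, r)\<in>splits3 as. f l m r) = ss as (\<lambda>l x. ss x (\<lambda>m r. f l m r))"
proof -
  have "(\<Sum>(l, m, r)\<in>splits3 as. f l m r) =
      (\<Sum>z\<in>(SIGMA p:{p. fst p @ snd p = as}. {q. fst q @ snd q = snd p}). f (fst (fst z)) (fst (snd z)) (snd (snd z)))"
    by (rule sum.reindex_bij_witness[where i = "\<lambda>((l, x), (m, r)). (l, m, r)" and j = "\<lambda>(l, m, r). ((l, m @ r), (m, r))"])
      (auto simp: splits3_def)
  also have "\<dots> = (\<Sum>p | fst p @ snd p = as. \<Sum>q | fst q @ snd q = snd p. f (fst p) (fst q) (snd q))"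
    by (subst sum.Sigma) (auto simp: finite_splits split_beta)
  finally show ?thesis by (simp add: ss_sum)
qed

lemma finite_splits3: "finite (splits3 as)"
proof (rule finite_subset)
  show "splits3 as \<subseteq> (\<lambda>z. (fst (fst z), fst (snd z), snd (snd z))) `
      (SIGMA p:{p. fst p @ snd p = as}. {q. fst q @ snd q = snd p})"
  proof
    fix z assume "z \<in> splits3 as"
    then obtain l m r where "z = (l, m, r)" "l @ m @ r = as" by (auto simp: splits3_def)
    thus "z \<in> (\<lambda>z. (fst (fst z), fst (snd z), snd (snd z))) `
      (SIGMA p:{p. fst p @ snd p = as}. {q. fst q @ snd q = snd p})"
      by (intro image_eqI[of _ _ "((l, m @ r), (m, r))"]) auto
  qed
qed (intro finite_imageI finite_SigmaI finite_splits)

lemma sum_splits5: "(\<Sum>(l, u, m, v, r)\<in>splits5 as. f l u m v r) =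
    ss as (\<lambda>l x. ss x (\<lambda>u x. ss x (\<lambda>m x. ss x (\<lambda>v r. f l u m v r))))"
proof -
  have "(\<Sum>(l, u, m, v, r)\<in>splits5 as. f l u m v r) =
      (\<Sum>((l, u, x), (m, v, r))\<in>(SIGMA p:splits3 as. splits3 (snd (snd p))). f l u m v r)"
    by (rule sum.reindex_bij_witness[where i = "\<lambda>((l, u, x), (m, v, r)). (l, u, m, v, r)"
          and j = "\<lambda>(l, u, m, v, r). ((l, u, m @ v @ r), (m, v, r))"])
      (auto simp: splits3_def splits5_def)
  also have "\<dots> = (\<Sum>p\<in>splits3 as. \<Sum>(m, v, r)\<in>splits3 (snd (snd p)). f (fst p) (fst (snd p)) m v r)"
    by (subst sum.Sigma) (auto simp: finite_splits3 split_beta)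
  also have "\<dots> = (\<Sum>(l, u, x)\<in>splits3 as. ss x (\<lambda>m x. ss x (\<lambda>v r. f l u m v r)))"
    by (rule sum.cong[OF refl]) (auto simp: sum_splits3)
  finally show ?thesis by (simp only: sum_splits3)
qed

lemma ss_cong: "(\<And>u v. u @ v = as ==> f u v = g u v) ==> ss as f = ss as g"
  unfolding ss_sum by (rule sum.cong) auto

lemma ss_add: "ss as (\<lambda>u v. f u v + g u v) = ss as f + ss as g"
  by (simp add: ss_sum split_beta sum.distrib)

lemma ss_0 [simp]: "ss as (\<lambda>u v. 0) = 0"
  by (simp add: ss_sum)

lemma ss_uminus: "ss as (\<lambda>u v. - f u v) = - ss as f" for f :: "'a list => 'a list => 'b::ab_group_add"
  by (simp add: ss_sum split_beta sum_negf)

lemma ss_diff: "ss as (\<lambda>u v. f u v - g u v) = ss as f - ss as g"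
  for f :: "'a list => 'a list => 'b::ab_group_add"
  by (simp add: ss_sum split_beta sum_subtractf)

lemma ss_hom: "h 0 = 0 ==> (\<And>x y. h (x + y) = h x + h y) ==> h (ss as f) = ss as (\<lambda>u v. h (f u v))"
  by (induction as arbitrary: f) simp_all

lemma ss_map: "ss (map h as) f = ss as (\<lambda>u v. f (map h u) (map h v))"
  by (induction as arbitrary: f) simp_all

lemma ss_swap: "ss as (\<lambda>u v. ss bs (\<lambda>x y. G u v x y)) = ss bs (\<lambda>x y. ss as (\<lambda>u v. G u v x y))"
  unfolding ss_sum split_beta by (rule sum.swap)

lemma ss_append: "ss (xs @ a # ys) f = ss xs (\<lambda>u v. f u (v @ a # ys)) + ss ys (\<lambda>u v. f (xs @ a # u) v)"
  by (induction xs arbitrary: f) (simp_all add: add.assoc)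

text \<open>Cutting the left part once more is the same as cutting off two parts in succession. With
  the variants below, in which the rest has been cut further, all nested sums take the shape in
  which each cut is made in the rest left by the previous one.\<close>

lemma ss_assoc: "ss as (\<lambda>l R. ss l (\<lambda>a b. H a b R)) = ss as (\<lambda>a y. ss y (\<lambda>b R. H a b R))"
  by (induction as arbitrary: H) (simp_all add: ss_add add.assoc)

lemma ss_assoc1: "ss as (\<lambda>l R. ss R (\<lambda>m R'. ss l (\<lambda>a b. H a b m R'))) =
    ss as (\<lambda>a y. ss y (\<lambda>b R. ss R (\<lambda>m R'. H a b m R')))"
  by (subst ss_swap) (rule ss_assoc)

lemma ss_assoc2: "ss as (\<lambda>l R. ss R (\<lambda>m R'. ss R' (\<lambda>k R''. ss l (\<lambda>a b. H a b m k R'')))) =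
    ss as (\<lambda>a y. ss y (\<lambda>b R. ss R (\<lambda>m R'. ss R' (\<lambda>k R''. H a b m k R''))))"
proof -
  have "ss as (\<lambda>l R. ss R (\<lambda>m R'. ss R' (\<lambda>k R''. ss l (\<lambda>a b. H a b m k R'')))) =
    ss as (\<lambda>l R. ss R (\<lambda>m R'. ss l (\<lambda>a b. ss R' (\<lambda>k R''. H a b m k R''))))"
    by (rule ss_cong, rule ss_cong, rule ss_swap)
  thus ?thesis by (simp only: ss_assoc1)
qed

lemma ss_assoc3: "ss as (\<lambda>l R. ss R (\<lambda>m R'. ss R' (\<lambda>k R''. ss R'' (\<lambda>j S. ss l (\<lambda>a b. H a b m k j S))))) =
    ss as (\<lambda>a y. ss y (\<lambda>b R. ss R (\<lambda>m R'. ss R' (\<lambda>k R''. ss R'' (\<lambda>j S. H a b m k j S)))))"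
proof -
  have "ss as (\<lambda>l R. ss R (\<lambda>m R'. ss R' (\<lambda>k R''. ss R'' (\<lambda>j S. ss l (\<lambda>a b. H a b m k j S))))) =
    ss as (\<lambda>l R. ss R (\<lambda>m R'. ss R' (\<lambda>k R''. ss l (\<lambda>a b. ss R'' (\<lambda>j S. H a b m k j S)))))"
    by (rule ss_cong, rule ss_cong, rule ss_cong, rule ss_swap)
  thus ?thesis by (simp only: ss_assoc2)
qed

lemmas ss_nest = ss_assoc ss_assoc1 ss_assoc2 ss_assoc3

section \<open>The Hochschild complex\<close>

definition sg :: "int => 'a::ab_group_add => 'a" where
  "sg p x = (if even p then x else - x)"

lemma sg_sg [simp]: "sg p (sg q x) = sg (p + q) x"
  by (simp add: sg_def)

lemma sg_add: "sg p (x + y) = sg p x + sg p y"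
  and sg_diff: "sg p (x - y) = sg p x - sg p y"
  and sg_0 [simp]: "sg p 0 = 0"
  by (simp_all add: sg_def)

lemma ss_sg: "ss as (\<lambda>u v. sg p (f u v)) = sg p (ss as f)"
  by (simp add: sg_def ss_uminus)

context superfiltered_module
begin

abbreviation "tw \<equiv> twist X"
abbreviation "T \<equiv> twist_by X"

lemma X_even: "even p ==> X p = X 0" and X_odd: "odd p ==> X p = X 1"
proof -
  have 1: "X (q + 2 * int k) = X q" for q k
  proof (induction k)
    case (Suc k)
    have "q + 2 * int (Suc k) = q + 2 * int k + 2" by simp
    thus ?case using Suc grading_periodic[of "q + 2 * int k"] by (simp only:)
  qed simp
  have "X (q + 2 * k) = X q" for q k
    using 1[of q "nat k"] 1[of "q + 2 * k" "nat (- k)"] by (cases "k \<ge> 0") auto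
  from this[of 0 "p div 2"] this[of 1 "p div 2"]
  show "even p ==> X p = X 0" "odd p ==> X p = X 1"
    by (simp_all add: add.commute[of 1])
qed

lemma X_cong: "even (p - q) ==> X p = X q"
  using X_even[of p] X_even[of q] X_odd[of p] X_odd[of q] by (cases "even p"; cases "even q") simp_all

lemma X_0: "0 \<in> X p" and X_plus: "a \<in> X p ==> b \<in> X p ==> a + b \<in> X p"
  and X_scale: "a \<in> X p ==> c *s a \<in> X p" and X_minus: "a \<in> X p ==> - a \<in> X p"
  and X_diff: "a \<in> X p ==> b \<in> X p ==> a - b \<in> X p"
  using grading_subspace[of p] by (simp_all add: subspace_0 subspace_add subspace_scale subspace_neg subspace_diff)

lemma X_sg: "a \<in> X p ==> sg q a \<in> X p"
  by (simp add: sg_def X_minus)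

lemma X_ss: "(\<And>u v. u @ v = as ==> f u v \<in> X p) ==> ss as f \<in> X p"
  by (induction as arbitrary: f) (auto intro!: X_plus)

lemma tw_even: "a \<in> X p ==> even p ==> tw a = - a"
  using twist_eq[of a 0] X_0[of 1] by (simp add: X_even[of p])

lemma tw_odd: "a \<in> X p ==> odd p ==> tw a = a"
  using twist_eq[of 0 a] X_0[of 0] by (simp add: X_odd[of p])

lemma tw_add: "tw (a + b) = tw a + tw b"
proof -
  obtain a0 a1 b0 b1 where *: "a0 \<in> X 0" "a1 \<in> X 1" "a = a0 + a1" "b0 \<in> X 0" "b1 \<in> X 1" "b = b0 + b1"
    using grading_span by metis
  have "tw (a + b) = tw ((a0 + b0) + (a1 + b1))" by (simp add: * algebra_simps)
  also have "\<dots> = (a1 + b1) - (a0 + b0)" using * by (intro twist_eq X_plus)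
  finally show ?thesis using * by (simp add: twist_eq algebra_simps)
qed

lemma tw_scale: "tw (c *s a) = c *s tw a"
proof -
  obtain a0 a1 where *: "a0 \<in> X 0" "a1 \<in> X 1" "a = a0 + a1" using grading_span by metis
  have "tw (c *s a) = tw (c *s a0 + c *s a1)" by (simp add: * scale_right_distrib)
  also have "\<dots> = c *s a1 - c *s a0" using * by (intro twist_eq X_scale)
  finally show ?thesis using * by (simp add: twist_eq scale_right_diff_distrib)
qed

lemma tw_tw [simp]: "tw (tw a) = a"
proof -
  obtain a0 a1 where *: "a0 \<in> X 0" "a1 \<in> X 1" "a = a0 + a1" using grading_span by metis
  hence "tw (tw a) = tw ((- a0) + a1)" by (simp add: twist_eq)
  also have "\<dots> = a" using * by (subst twist_eq) (auto simp: X_minus)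
  finally show ?thesis .
qed

lemma tw_0 [simp]: "tw 0 = 0" using tw_even[OF X_0[of 0]] by simp

lemma tw_X: "a \<in> X p ==> tw a \<in> X p"
  by (cases "even p") (auto simp: tw_even tw_odd X_minus)

lemma T_0 [simp]: "T 0 = id" and T_1 [simp]: "T 1 = tw"
  by (simp_all add: twist_by_def)

lemma T_even: "even p ==> T p = id" and T_odd: "odd p ==> T p = tw"
  by (simp_all add: twist_by_def)

lemma T_T [simp]: "T p (T q a) = T (p + q) a"
  by (simp add: twist_by_def)

lemma T_comp [simp]: "T p \<circ> T q = T (p + q)"
  by (simp add: fun_eq_iff)

lemma T_add: "T p (a + b) = T p a + T p b" and T_scale: "T p (c *s a) = c *s T p a"
  by (simp_all add: twist_by_def tw_add tw_scale)

lemma T_X: "a \<in> X p ==> T q a \<in> X p"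
  by (simp add: twist_by_def tw_X)

lemma T_homog: "a \<in> X p ==> T q a = sg (q * (p - 1)) a"
  by (cases "even q"; cases "even p") (auto simp: T_even T_odd tw_even tw_odd sg_def)

lemma map_T_X: "list_all2 (\<lambda>a p. a \<in> X p) as ps ==> list_all2 (\<lambda>a p. a \<in> X p) (map (T q) as) ps"
  by (simp add: list_all2_conv_all_nth T_X)

lemma multilinear_add: "multilinear scale f ==> f (l @ (a + b) # r) = f (l @ a # r) + f (l @ b # r)"
  and multilinear_scale: "multilinear scale f ==> f (l @ (c *s a) # r) = c *s f (l @ a # r)"
  by (simp_all add: Defs.multilinear_def)

lemma multilinear_zero: "multilinear scale f ==> f (l @ 0 # r) = 0"
  using multilinear_scale[of f l 0 0 r] by simp

lemma multilinear_minus: "multilinear scale f ==> f (l @ (- a) # r) = - f (l @ a # r)"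
  using multilinear_scale[of f l "-1" a r] by simp

lemma multilinear_sg: "multilinear scale f ==> f (l @ sg p a # r) = sg p (f (l @ a # r))"
  by (simp add: sg_def multilinear_minus)

lemma multilinear_ss: "multilinear scale f ==> f (l @ ss as g # r) = ss as (\<lambda>u v. f (l @ g u v # r))"
  by (rule ss_hom[of "\<lambda>x. f (l @ x # r)"]) (simp_all add: multilinear_zero multilinear_add)

lemma multilinearI:
  "(\<And>l r a b. f (l @ (a + b) # r) = f (l @ a # r) + f (l @ b # r)) ==>
   (\<And>l r c a. f (l @ (c *s a) # r) = c *s f (l @ a # r)) ==> multilinear scale f"
  by (simp add: Defs.multilinear_def)

abbreviation "CC \<equiv> hochschild_cochains scale X"

lemma CC_multilinear: "\<phi> \<in> CC t ==> multilinear scale \<phi>"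
  by (simp add: hochschild_cochains_def)

lemma CC_degree: "\<phi> \<in> CC t ==> list_all2 (\<lambda>a p. a \<in> X p) as ps ==> \<phi> as \<in> X (sum_list ps - int (length as) + t)"
  by (simp add: hochschild_cochains_def has_shifted_degree_def)

lemma CC_cong: "even (s - t) ==> CC s = CC t"
proof -
  assume "even (s - t)"
  hence "X (p + s) = X (p + t)" for p by (intro X_cong) simp
  thus ?thesis by (simp add: hochschild_cochains_def has_shifted_degree_def)
qed

lemma homog_T_list:
  assumes "multilinear scale \<phi>"
  shows "list_all2 (\<lambda>a p. a \<in> X p) as ps ==>
    \<phi> (l @ map (T q) as @ r) = sg (q * (sum_list ps - int (length as))) (\<phi> (l @ as @ r))"
proof (induction as ps arbitrary: l rule: list_all2_induct)
  case (Cons a as p ps)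
  have "\<phi> (l @ map (T q) (a # as) @ r) = sg (q * (p - 1)) (\<phi> ((l @ [a]) @ map (T q) as @ r))"
    using Cons(1) assms by (simp add: T_homog multilinear_sg)
  thus ?case unfolding Cons.IH by (simp add: algebra_simps)
qed (simp add: sg_def)

text \<open>For homogeneous inputs this compares the degree of the value with the degrees of the
  inputs. It trades a twist of a value, which arises when cochains are nested, for twists of the
  inputs and a global sign.\<close>

lemma T_cochain:
  assumes \<phi>: "\<phi> \<in> CC t"
  shows "T q (\<phi> as) = sg (q * (t - 1)) (\<phi> (map (T q) as))"
proof -
  \<comment> \<open>The inputs in \<open>l\<close> are already homogeneous; the next one is split
    into its even and odd parts.\<close>
  have "T q (\<phi> (l @ as)) = sg (q * (t - 1)) (\<phi> (map (T q) (l @ as)))"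
    if "list_all2 (\<lambda>a p. a \<in> X p) l ps" for l ps
    using that
  proof (induction as arbitrary: l ps)
    case Nil
    have "\<phi> l \<in> X (sum_list ps - int (length l) + t)" by (rule CC_degree[OF \<phi> Nil])
    hence "T q (\<phi> l) = sg (q * (sum_list ps - int (length l) + t - 1)) (\<phi> l)" by (rule T_homog)
    moreover have "\<phi> (map (T q) l) = sg (q * (sum_list ps - int (length l))) (\<phi> l)"
      using homog_T_list[OF CC_multilinear[OF \<phi>] Nil, of "[]" q "[]"] by simp
    ultimately show ?case by (simp add: algebra_simps)
  next
    case (Cons a as)
    obtain b c where bc: "b \<in> X 0" "c \<in> X 1" "a = b + c" using grading_span by metis
    have 1: "list_all2 (\<lambda>a p. a \<in> X p) (l @ [b]) (ps @ [0])" "list_all2 (\<lambda>a p. a \<in> X p) (l @ [c]) (ps @ [1])"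
      using Cons.prems bc by (auto intro: list_all2_appendI)
    show ?case
      using Cons.IH[OF 1(1)] Cons.IH[OF 1(2)]
      by (simp add: bc multilinear_add[OF CC_multilinear[OF \<phi>]] T_add sg_add)
  qed
  from this[of "[]" "[]"] show ?thesis by simp
qed

section \<open>Brace operations on cochains\<close>

text \<open>Gerstenhaber's insertion of \<phi> into \<open>f\<close>; \<open>brace\<close> and
  \<open>brace3\<close> below insert two and three cochains from left to right. The parameters
  \<open>p\<close>, \<open>q\<close>, \<open>s\<close> stand for reduced degrees, and every input to
  the right of an inserted cochain is twisted by its reduced degree.\<close>

definition circ :: "('a list => 'a) => int => ('a list => 'a) => 'a list => 'a" where
  "circ f p \<phi> as = ss as (\<lambda>l x. ss x (\<lambda>m r. f (l @ \<phi> m # map (T p) r)))"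

definition brace :: "('a list => 'a) => int => ('a list => 'a) => int => ('a list => 'a) => 'a list => 'a" where
  "brace f p \<phi> q \<psi> as = ss as (\<lambda>l x. ss x (\<lambda>u x. ss x (\<lambda>m x. ss x (\<lambda>v r.
      f (l @ \<phi> u # map (T p) m @ \<psi> (map (T p) v) # map (T (p + q)) r)))))"

definition brace3 :: "('a list => 'a) => int => ('a list => 'a) => int => ('a list => 'a) => int => ('a list => 'a) => 'a list => 'a" where
  "brace3 f p \<phi> q \<psi> s \<chi> as = ss as (\<lambda>l x. ss x (\<lambda>u x. ss x (\<lambda>m x. ss x (\<lambda>v x. ss x (\<lambda>k x. ss x (\<lambda>w r.
      f (l @ \<phi> u # map (T p) m @ \<psi> (map (T p) v) # map (T (p + q)) k @ \<chi> (map (T (p + q)) w)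
         # map (T (p + q + s)) r)))))))"

lemma map_T_T: "map (T p) (map (T q) as) = map (T (p + q)) as"
  by simp

text \<open>The cochain \<psi> lands inside \<phi>, to its left or to its right. Only in the last
  position is it twisted by the reduced degree of \<phi>, which costs the sign.\<close>

lemma circ_circ:
  assumes f: "multilinear scale f" and \<psi>: "\<psi> \<in> CC (q + 1)"
  shows "circ (circ f p \<phi>) q \<psi> as =
    circ f (p + q) (circ \<phi> q \<psi>) as + brace f q \<psi> p \<phi> as + sg (p * q) (brace f p \<phi> q \<psi> as)"
proof -
  have app: "l @ a # m @ b # r = (l @ a # m) @ b # r" for l m r and a b :: 'a by simp
  show ?thesis
    unfolding circ_def[of "circ f p \<phi>"] circ_def[of f] brace_def
    apply (simp only: ss_append ss_map map_append list.map append_assoc append_Cons map_T_T ss_add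
        T_cochain[OF \<psi>] circ_def[of \<phi>])
    apply (simp add: multilinear_ss[OF f] ss_nest ss_add ss_sg add_ac)
    apply (subst app, subst multilinear_sg[OF f])
    apply (simp add: ss_sg)
    done
qed

lemma multilinear_sg2: "multilinear scale f ==> f (l @ x # m @ sg p a # r) = sg p (f (l @ x # m @ a # r))"
  using multilinear_sg[of f "l @ x # m" p a r] by simp

lemma multilinear_sg3: "multilinear scale f ==>
    f (l @ x # m @ y # k @ sg p a # r) = sg p (f (l @ x # m @ y # k @ a # r))"
  using multilinear_sg[of f "l @ x # m @ y # k" p a r] by simp

lemma multilinear_ss2: "multilinear scale f ==>
    f (l @ x # m @ ss as g # r) = ss as (\<lambda>u v. f (l @ x # m @ g u v # r))"
  using multilinear_ss[of f "l @ x # m" as g r] by simp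

lemmas multilinear_push = multilinear_sg multilinear_sg2 multilinear_sg3 multilinear_ss multilinear_ss2

text \<open>The five places for \<chi>: inside \<phi>, inside \<psi>, or in one of the three gaps
  around them.\<close>

lemma circ_brace:
  assumes f: "multilinear scale f" and \<psi>: "multilinear scale \<psi>" and \<chi>: "\<chi> \<in> CC (r + 1)"
  shows "circ (brace f p \<phi> q \<psi>) r \<chi> as =
    brace f (p + r) (circ \<phi> r \<chi>) q \<psi> as + sg (p * r) (brace f p \<phi> (q + r) (circ \<psi> r \<chi>) as)
    + brace3 f r \<chi> p \<phi> q \<psi> as + sg (p * r) (brace3 f p \<phi> r \<chi> q \<psi> as)
    + sg ((p + q) * r) (brace3 f p \<phi> q \<psi> r \<chi> as)"
  unfolding circ_def[of "brace f p \<phi> q \<psi>"] brace_def brace3_def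
  apply (simp only: ss_append ss_map map_append list.map append_assoc append_Cons map_T_T ss_add
        T_cochain[OF \<chi>] circ_def[of \<phi>] circ_def[of \<psi>])
  apply (simp add: multilinear_push[OF f] multilinear_push[OF \<psi>] ss_nest ss_add ss_sg add_ac)
  done

text \<open>The inner \<chi> takes in both of \<phi> and \<psi>, one of them, or neither. The three
  triple braces, where it takes in neither, cancel against those of \<open>circ_brace\<close> in the
  Leibniz rule.\<close>

lemma brace_circ:
  assumes f: "multilinear scale f" and \<chi>: "multilinear scale \<chi>"
    and \<phi>: "\<phi> \<in> CC (p + 1)" and \<psi>: "\<psi> \<in> CC (q + 1)"
  shows "brace (circ f r \<chi>) p \<phi> q \<psi> as =
    sg (r * (p + q)) (brace3 f r \<chi> p \<phi> q \<psi> as) + sg (r * q) (brace f (p + r) (circ \<chi> p \<phi>) q \<psi> as)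
    + circ f (p + q + r) (brace \<chi> p \<phi> q \<psi>) as + sg (r * q) (brace3 f p \<phi> r \<chi> q \<psi> as)
    + brace f p \<phi> (q + r) (circ \<chi> q \<psi>) as + brace3 f p \<phi> q \<psi> r \<chi> as"
  unfolding brace_def[of "circ f r \<chi>"] brace_def[of f] circ_def[of f] brace3_def
  apply (simp only: ss_append ss_map map_append list.map append_assoc append_Cons map_T_T ss_add
        T_cochain[OF \<phi>] T_cochain[OF \<psi>] circ_def[of \<chi>] brace_def[of \<chi>])
  apply (simp add: multilinear_push[OF f] multilinear_push[OF \<chi>] ss_nest ss_add ss_sg add_ac sg_add distrib_left)
  done

lemma circ_diff_left: "circ (\<lambda>as. f as - g as) p \<phi> as = circ f p \<phi> as - circ g p \<phi> as"
  and circ_sg_left: "circ (\<lambda>as. sg s (f as)) p \<phi> as = sg s (circ f p \<phi> as)"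
  by (simp_all add: circ_def ss_diff ss_sg)

lemma multilinear_diff: "multilinear scale f ==> f (l @ (a - b) # r) = f (l @ a # r) - f (l @ b # r)"
  using multilinear_add[of f l a "- b" r] multilinear_minus[of f l b r] by simp

lemma circ_diff_right: "multilinear scale f ==> circ f p (\<lambda>as. \<phi> as - \<psi> as) as = circ f p \<phi> as - circ f p \<psi> as"
  and circ_sg_right: "multilinear scale f ==> circ f p (\<lambda>as. sg s (\<phi> as)) as = sg s (circ f p \<phi> as)"
  and circ_zero_right: "multilinear scale f ==> circ f p (\<lambda>as. 0) as = 0"
  by (simp_all add: circ_def ss_diff ss_sg multilinear_diff multilinear_sg multilinear_zero)

lemma circ_zero_left [simp]: "circ (\<lambda>as. 0) p \<phi> as = 0"
  by (simp add: circ_def)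

lemma brace_diff_left: "multilinear scale f ==>
      brace f p (\<lambda>as. \<phi> as - \<phi>' as) q \<psi> as = brace f p \<phi> q \<psi> as - brace f p \<phi>' q \<psi> as"
  and brace_sg_left: "multilinear scale f ==>
      brace f p (\<lambda>as. sg s (\<phi> as)) q \<psi> as = sg s (brace f p \<phi> q \<psi> as)"
  by (simp_all add: brace_def ss_diff ss_sg multilinear_diff multilinear_sg)

lemma brace_diff_right: "multilinear scale f ==>
      brace f p \<phi> q (\<lambda>as. \<psi> as - \<psi>' as) as = brace f p \<phi> q \<psi> as - brace f p \<phi> q \<psi>' as"
  and brace_sg_right: "multilinear scale f ==>
      brace f p \<phi> q (\<lambda>as. sg s (\<psi> as)) as = sg s (brace f p \<phi> q \<psi> as)"
  using multilinear_diff[of f "_ @ _ # _"]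
  by (simp_all add: brace_def ss_diff ss_sg multilinear_sg2)

lemma T_cong: "even (p - q) ==> T p = T q"
  by (auto simp: twist_by_def)

lemma circ_cong: "even (p - q) ==> circ f p \<phi> = circ f q \<phi>"
  using T_cong[of p q] by (simp add: circ_def[abs_def])

lemma multilinear_circ:
  assumes f: "multilinear scale f" and \<phi>: "multilinear scale \<phi>"
  shows "multilinear scale (circ f p \<phi>)"
proof (rule multilinearI)
  fix l r a b
  have hom: "c *s ss as g = ss as (\<lambda>u v. c *s g u v)" for c as g
    by (rule ss_hom) (simp_all add: scale_right_distrib)
  note push = multilinear_add[OF f] multilinear_add[OF \<phi>] multilinear_scale[OF f] multilinear_scale[OF \<phi>]
     multilinear_add[OF f, of "_ @ _ # _", simplified] multilinear_scale[OF f, of "_ @ _ # _", simplified]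
  show "circ f p \<phi> (l @ (a + b) # r) = circ f p \<phi> (l @ a # r) + circ f p \<phi> (l @ b # r)"
    unfolding circ_def
    by (simp only: ss_append ss_map map_append list.map append_assoc append_Cons T_add ss_add push add_ac)
  fix c
  show "circ f p \<phi> (l @ (c *s a) # r) = c *s circ f p \<phi> (l @ a # r)"
    unfolding circ_def
    by (simp only: ss_append ss_map map_append list.map append_assoc append_Cons T_scale ss_add push
        hom[symmetric] scale_right_distrib)
qed

lemma multilinear_brace:
  assumes f: "multilinear scale f" and \<phi>: "multilinear scale \<phi>" and \<psi>: "multilinear scale \<psi>"
  shows "multilinear scale (brace f p \<phi> q \<psi>)"
proof (rule multilinearI)
  fix l r a b
  have hom: "c *s ss as g = ss as (\<lambda>u v. c *s g u v)" for c as g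
    by (rule ss_hom) (simp_all add: scale_right_distrib)
  note push = multilinear_add[OF f] multilinear_add[OF \<phi>] multilinear_scale[OF f] multilinear_scale[OF \<phi>]
     multilinear_add[OF \<psi>] multilinear_scale[OF \<psi>]
     multilinear_add[OF f, of "_ @ _ # _", simplified] multilinear_scale[OF f, of "_ @ _ # _", simplified]
     multilinear_add[OF f, of "_ @ _ # _ @ _ # _", simplified] multilinear_scale[OF f, of "_ @ _ # _ @ _ # _", simplified]
  show "brace f p \<phi> q \<psi> (l @ (a + b) # r) = brace f p \<phi> q \<psi> (l @ a # r) + brace f p \<phi> q \<psi> (l @ b # r)"
    unfolding brace_def
    by (simp only: ss_append ss_map map_append list.map append_assoc append_Cons T_add ss_add push add_ac)
  fix c
  show "brace f p \<phi> q \<psi> (l @ (c *s a) # r) = c *s brace f p \<phi> q \<psi> (l @ a # r)"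
    unfolding brace_def
    by (simp only: ss_append ss_map map_append list.map append_assoc append_Cons T_scale ss_add push
        hom[symmetric] scale_right_distrib)
qed

lemma CC_I: "multilinear scale \<phi> ==>
  (\<And>as ps. list_all2 (\<lambda>a p. a \<in> X p) as ps ==> \<phi> as \<in> X (sum_list ps - int (length as) + t)) ==> \<phi> \<in> CC t"
  by (simp add: hochschild_cochains_def has_shifted_degree_def)

lemma circ_CC:
  assumes f: "f \<in> CC s" and \<phi>: "\<phi> \<in> CC t"
  shows "circ f p \<phi> \<in> CC (s + t - 1 - 1 + 1)"
proof (rule CC_I)
  show "multilinear scale (circ f p \<phi>)" using assms by (intro multilinear_circ CC_multilinear)
  fix as ps assume as: "list_all2 (\<lambda>a p. a \<in> X p) as ps"
  show "circ f p \<phi> as \<in> X (sum_list ps - int (length as) + (s + t - 1 - 1 + 1))"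
    unfolding circ_def
  proof (intro X_ss)
    fix l x m r assume x: "l @ x = as" "m @ r = x"
    then obtain pl pm pr where ps: "ps = pl @ pm @ pr" "list_all2 (\<lambda>a p. a \<in> X p) l pl"
        "list_all2 (\<lambda>a p. a \<in> X p) m pm" "list_all2 (\<lambda>a p. a \<in> X p) r pr"
      using as by (auto simp: list_all2_append1)
    have "f (l @ \<phi> m # map (T p) r) \<in> X (sum_list (pl @ (sum_list pm - int (length m) + t) # pr)
        - int (length (l @ \<phi> m # map (T p) r)) + s)"
      using ps by (intro CC_degree[OF f] list_all2_appendI list.rel_intros CC_degree[OF \<phi>] map_T_X)
    thus "f (l @ \<phi> m # map (T p) r) \<in> X (sum_list ps - int (length as) + (s + t - 1 - 1 + 1))"
      using x ps by (auto simp: algebra_simps)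
  qed
qed

lemma brace_CC:
  assumes f: "f \<in> CC s" and \<phi>: "\<phi> \<in> CC t" and \<psi>: "\<psi> \<in> CC t'"
  shows "brace f p \<phi> q \<psi> \<in> CC (s + t + t' - 2)"
proof (rule CC_I)
  show "multilinear scale (brace f p \<phi> q \<psi>)" using assms by (intro multilinear_brace CC_multilinear)
  fix as ps assume as: "list_all2 (\<lambda>a p. a \<in> X p) as ps"
  show "brace f p \<phi> q \<psi> as \<in> X (sum_list ps - int (length as) + (s + t + t' - 2))"
    unfolding brace_def
  proof (intro X_ss)
    fix l x u y m z v r assume x: "l @ x = as" "u @ y = x" "m @ z = y" "v @ r = z"
    then obtain pl pu pm pv pr where ps: "ps = pl @ pu @ pm @ pv @ pr" "list_all2 (\<lambda>a p. a \<in> X p) l pl"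
        "list_all2 (\<lambda>a p. a \<in> X p) u pu" "list_all2 (\<lambda>a p. a \<in> X p) m pm" "list_all2 (\<lambda>a p. a \<in> X p) v pv"
        "list_all2 (\<lambda>a p. a \<in> X p) r pr"
      using as by (auto simp: list_all2_append1)
    let ?L = "l @ \<phi> u # map (T p) m @ \<psi> (map (T p) v) # map (T (p + q)) r"
    have "f ?L \<in> X (sum_list (pl @ (sum_list pu - int (length u) + t) # pm @
        (sum_list pv - int (length (map (T p) v)) + t') # pr) - int (length ?L) + s)"
      using ps by (intro CC_degree[OF f] list_all2_appendI list.rel_intros CC_degree[OF \<phi>] CC_degree[OF \<psi>] map_T_X)
    thus "f ?L \<in> X (sum_list ps - int (length as) + (s + t + t' - 2))"
      using x ps by (auto simp: algebra_simps)
  qed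
qed

lemma CC_diff: "\<phi> \<in> CC t ==> \<psi> \<in> CC t ==> (\<lambda>as. \<phi> as - \<psi> as) \<in> CC t"
  by (rule CC_I, rule multilinearI)
    (simp_all add: multilinear_add[OF CC_multilinear] multilinear_scale[OF CC_multilinear] CC_degree
      X_diff scale_right_diff_distrib)

lemma CC_add: "\<phi> \<in> CC t ==> \<psi> \<in> CC t ==> (\<lambda>as. \<phi> as + \<psi> as) \<in> CC t"
  by (rule CC_I, rule multilinearI)
    (simp_all add: multilinear_add[OF CC_multilinear] multilinear_scale[OF CC_multilinear] CC_degree
      X_plus scale_right_distrib)

lemma CC_scale: "\<phi> \<in> CC t ==> (\<lambda>as. c *s \<phi> as) \<in> CC t"
  by (rule CC_I, rule multilinearI)
    (simp_all add: multilinear_add[OF CC_multilinear] multilinear_scale[OF CC_multilinear] CC_degree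
      X_scale scale_right_distrib mult.commute)

lemma CC_zero: "(\<lambda>as. 0) \<in> CC t"
  by (rule CC_I, rule multilinearI) (simp_all add: X_0)

lemma CC_sg: "\<phi> \<in> CC t ==> (\<lambda>as. sg s (\<phi> as)) \<in> CC t"
  using CC_scale[of \<phi> t "-1"] by (cases "even s") (simp_all add: sg_def)

end

context superfiltered_deformation
begin

abbreviation "dH \<equiv> hochschild_diff X \<mu>"

lemma \<mu>_CC: "\<mu> \<in> CC (1 + 1)"
  using multilinear graded by (simp add: hochschild_cochains_def)

text \<open>The differential is the graded commutator with \<mu> under insertion, so the brace
  identities apply to it.\<close>

lemma dH_circ: "dH t \<phi> as = circ \<mu> (t - 1) \<phi> as - sg (t - 1) (circ \<phi> 1 \<mu> as)"
  by (simp add: hochschild_diff_def Let_def sum_splits3 circ_def sg_def)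

lemma \<mu>_\<mu>: "circ \<mu> 1 \<mu> = (\<lambda>as. 0)"
  using A_infinity by (auto simp: fun_eq_iff sum_splits3 circ_def)

lemma circ_\<mu>_\<mu>: "multilinear scale f ==> circ (circ f 1 \<mu>) 1 \<mu> as = 0"
  by (simp add: circ_circ[OF _ \<mu>_CC] \<mu>_\<mu> circ_zero_right) (simp add: sg_def)

lemma dH_CC: "\<phi> \<in> CC t ==> dH t \<phi> \<in> CC (t + 1)"
proof -
  assume \<phi>: "\<phi> \<in> CC t"
  have "circ \<mu> (t - 1) \<phi> \<in> CC (t + 1)" "circ \<phi> 1 \<mu> \<in> CC (t + 1)"
    using circ_CC[OF \<mu>_CC \<phi>, of "t - 1"] circ_CC[OF \<phi> \<mu>_CC, of 1] by (simp_all add: algebra_simps)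
  hence "(\<lambda>as. circ \<mu> (t - 1) \<phi> as - sg (t - 1) (circ \<phi> 1 \<mu> as)) \<in> CC (t + 1)"
    by (intro CC_diff CC_sg)
  thus ?thesis by (simp add: dH_circ[abs_def])
qed

lemma dH_cong: "even (s - t) ==> dH s = dH t"
proof -
  assume "even (s - t)"
  hence "T (s - 1) = T (t - 1)" "even (s - 1) \<longleftrightarrow> even (t - 1)" by (auto intro!: T_cong)
  thus ?thesis by (intro ext) (simp add: hochschild_diff_def)
qed

text \<open>The identity \<open>circ_circ\<close> for the triples (\<mu>, \<phi>, \<mu>), (\<mu>,
  \<mu>, \<phi>) and (\<phi>, \<mu>, \<mu>), combined with the vanishing of \<mu> inserted into
  itself; the double braces of \<mu> with \<phi> cancel.\<close>

lemma dH_dH: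
  assumes \<phi>: "\<phi> \<in> CC t"
  shows "dH (t + 1) (dH t \<phi>) as = 0"
proof -
  let ?p = "t - 1"
  have \<phi>': "\<phi> \<in> CC (?p + 1)" using \<phi> by simp
  have d: "dH t \<phi> = (\<lambda>as. circ \<mu> ?p \<phi> as - sg ?p (circ \<phi> 1 \<mu> as))" by (rule ext) (rule dH_circ)
  have 1: "circ (circ \<mu> ?p \<phi>) 1 \<mu> as =
      circ \<mu> t (circ \<phi> 1 \<mu>) as + brace \<mu> 1 \<mu> ?p \<phi> as + sg ?p (brace \<mu> ?p \<phi> 1 \<mu> as)"
    using circ_circ[OF multilinear \<mu>_CC, of ?p \<phi> as] by simp
  have 2: "0 = circ \<mu> t (circ \<mu> ?p \<phi>) as + brace \<mu> ?p \<phi> 1 \<mu> as + sg ?p (brace \<mu> 1 \<mu> ?p \<phi> as)"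
    using circ_circ[OF multilinear \<phi>', of 1 \<mu> as] by (simp add: \<mu>_\<mu>)
  have 3: "circ (circ \<phi> 1 \<mu>) 1 \<mu> as = 0" by (rule circ_\<mu>_\<mu>[OF CC_multilinear[OF \<phi>]])
  show ?thesis
    unfolding d dH_circ circ_diff_left circ_sg_left circ_diff_right[OF multilinear] circ_sg_right[OF multilinear]
    using 1 2 3 by (auto simp: sg_def algebra_simps eq_neg_iff_add_eq_0)
qed

text \<open>The brace of the zero cochain \<open>circ \<mu> 1 \<mu>\<close> is expanded by
  \<open>brace_circ\<close> and subtracted from the differential of the brace, expanded by
  \<open>circ_brace\<close>. What is left are braces of the two differentials; this lets the product
  pass to cohomology.\<close>

lemma brace_\<mu>_Leibniz:
  assumes \<phi>: "\<phi> \<in> CC (p + 1)" and \<psi>: "\<psi> \<in> CC (q + 1)"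
  shows "dH (p + q) (brace \<mu> p \<phi> q \<psi>) as =
    - sg q (brace \<mu> (p + 1) (dH (p + 1) \<phi>) q \<psi> as) - brace \<mu> p \<phi> (q + 1) (dH (q + 1) \<psi>) as"
proof -
  have d: "dH (p + 1) \<phi> = (\<lambda>as. circ \<mu> p \<phi> as - sg p (circ \<phi> 1 \<mu> as))"
    "dH (q + 1) \<psi> = (\<lambda>as. circ \<mu> q \<psi> as - sg q (circ \<psi> 1 \<mu> as))"
    by (rule ext, simp add: dH_circ)+
  have c: "circ \<mu> (p + q - 1) = circ \<mu> (p + q + 1)" by (rule ext, rule circ_cong) simp
  have 0: "brace (circ \<mu> 1 \<mu>) p \<phi> q \<psi> as = 0" by (simp add: \<mu>_\<mu> brace_def)
  show ?thesis
    unfolding d dH_circ c brace_diff_left[OF multilinear] brace_sg_left[OF multilinear]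
      brace_diff_right[OF multilinear] brace_sg_right[OF multilinear]
      circ_brace[OF multilinear CC_multilinear[OF \<psi>] \<mu>_CC]
    using 0[unfolded brace_circ[OF multilinear multilinear \<phi> \<psi>]]
    by (auto simp: sg_def algebra_simps eq_neg_iff_add_eq_0 split: if_splits)
qed

end

section \<open>A homogeneous basis of the deformation\<close>

lemma cliff_0: "cliff (\<lambda>_ _. 0) = wedge"
  by (simp add: cliff_def fun_eq_iff)

context superfiltered_deformation
begin

text \<open>For the zero form \<open>cliff\<close> is plain exterior multiplication, so the Clifford
  results describe \<open>exterior_alg n\<close>.\<close>

sublocale ext: clifford_data "UNIV :: 'r set" n "\<lambda>_ _. 0" "\<lambda>_. 0"
  by unfold_locales simp_all

abbreviation "FE \<equiv> ext.FK"
abbreviation "JE \<equiv> ext.J"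

definition hom_deg :: "int => (nat set => 'r) => bool" where
  "hom_deg p f \<longleftrightarrow> (\<forall>S. f S \<noteq> 0 \<longrightarrow> int (card S) = p)"

lemma hom_deg_basis: "hom_deg (int (card S)) (basis_fun S)"
  by (auto simp: hom_deg_def basis_fun_def)

lemma FE_iff: "f \<in> FE \<longleftrightarrow> (\<forall>S. f S \<noteq> 0 \<longrightarrow> S \<subseteq> {..<n})"
  by (simp add: ext.FK_def)

lemma hom_deg_wedge: "f \<in> FE ==> hom_deg p f ==> hom_deg (p + 1) (wedge i f)"
  unfolding hom_deg_def
proof (intro allI impI)
  fix S assume *: "f \<in> FE" "\<forall>S. f S \<noteq> 0 \<longrightarrow> int (card S) = p" "wedge i f S \<noteq> 0"
  hence S: "i \<in> S" "f (S - {i}) \<noteq> 0" by (auto simp: wedge_def split: if_splits)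
  with * have "S - {i} \<subseteq> {..<n}" unfolding FE_iff by blast
  hence "finite (S - {i})" by (rule finite_subset) simp
  hence "Suc (card (S - {i})) = card S" using S by (intro card_Suc_Diff1) auto
  with S * show "int (card S) = p + 1" by force
qed

lemma hom_deg_words: "set w \<subseteq> {..<n} ==> f \<in> FE ==> hom_deg p f ==>
   foldr (cliff (\<lambda>_ _. 0)) w f \<in> FE \<and> hom_deg (p + int (length w)) (foldr (cliff (\<lambda>_ _. 0)) w f)"
proof (induction w)
  case (Cons i w)
  hence "hom_deg (p + int (length w) + 1) (wedge i (foldr (cliff (\<lambda>_ _. 0)) w f))"
    by (intro hom_deg_wedge) auto
  with Cons show ?case by (simp add: cliff_0 ext.FK_wedge algebra_simps)
qed simp

lemma hom_deg_sum: "(\<And>a. a \<in> B ==> hom_deg p (h a)) ==> hom_deg p (\<lambda>S. \<Sum>a\<in>B. h a S)"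
  unfolding hom_deg_def by (metis (mono_tags, lifting) sum.neutral)

lemma exterior_part_J: "(exterior_part n p :: (nat free_mon \<Rightarrow>\<^sub>0 'r) set set) = JE ` {f \<in> FE. hom_deg p f}"
proof (intro equalityI subsetI)
  fix x :: "(nat free_mon \<Rightarrow>\<^sub>0 'r) set" assume "x \<in> exterior_part n p"
  then obtain s where s: "s \<in> carrier ext.T" "x = ext.cl s"
      "\<And>w. Poly_Mapping.lookup s w \<noteq> 0 ==> int (length (letters w)) = p"
    by (auto simp: exterior_part_def)
  have "hom_deg p (act (\<lambda>_ _. 0) s (basis_fun {}))"
    unfolding act_def[abs_def]
  proof (rule hom_deg_sum)
    fix w assume "w \<in> Poly_Mapping.keys s"
    hence w: "Poly_Mapping.lookup s w \<noteq> 0" by (simp add: in_keys_iff)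
    with s(1) have "set (letters w) \<subseteq> {..<n}" by (auto simp: ext.T_carrier)
    hence "hom_deg (0 + int (length (letters w))) (foldr (cliff (\<lambda>_ _. 0)) (letters w) (basis_fun {}))"
      by (intro hom_deg_words[THEN conjunct2] ext.FK_basis) (auto simp: hom_deg_def basis_fun_def)
    with s(3)[OF w] show "hom_deg p (\<lambda>S. Poly_Mapping.lookup s w * foldr (cliff (\<lambda>_ _. 0)) (letters w) (basis_fun {}) S)"
      unfolding hom_deg_def by (metis add_0 mult_zero_right)
  qed
  with s show "x \<in> JE ` {f \<in> FE. hom_deg p f}"
    using ext.act_nform[of s "basis_fun {}"] by (simp add: ext.J_cl ext.FK_basis)
next
  fix x assume "x \<in> JE ` {f \<in> FE. hom_deg p f}"
  then obtain f where f: "f \<in> FE" "hom_deg p f" "x = ext.cl (ext.nform f)" by (auto simp: ext.J_def)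
  have "int (length (letters w)) = p" if w: "Poly_Mapping.lookup (ext.nform f) w \<noteq> 0" for w
  proof -
    from w obtain S where "S \<in> Pow {..<n}"
        "Poly_Mapping.lookup (Poly_Mapping.single (Word (sorted_list_of_set S)) (f S)) w \<noteq> 0"
      unfolding ext.nform_def lookup_sum by (meson sum.neutral)
    hence "w = Word (sorted_list_of_set S)" "f S \<noteq> 0" "finite S"
      by (auto simp: lookup_single when_def finite_subset[OF _ finite_lessThan] split: if_splits)
    with f(2) show ?thesis by (simp add: hom_deg_def)
  qed
  with f show "x \<in> exterior_part n p"
    unfolding exterior_part_def by (auto simp: ext.nform_T)
qed

lemma exterior_simps:
  "mult (exterior_alg n) = mult ext.A" "add (exterior_alg n) = add ext.A"
  "zero (exterior_alg n) = zero ext.A" "one (exterior_alg n) = one ext.A"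
  "smult (exterior_alg n) c x = ext.cl (tensor_scalar c) \<otimes>\<^bsub>ext.A\<^esub> x"
  "a_inv (exterior_alg n) = a_inv ext.A"
  by (simp_all add: exterior_alg_def clifford_alg_def Let_def a_inv_def m_inv_def fun_eq_iff)

text \<open>The symbol of \<open>a\<close> in degree \<open>p\<close>: its class in the associated
  graded module, carried to the exterior algebra by \<theta> and read in the coordinates of ordered
  monomials.\<close>

definition lead :: "int => 'a => nat set => 'r" where
  "lead p a = inv_into FE JE (\<theta> p (gr_class F p a))"

lemma lead: 
  assumes "a \<in> F p"
  shows lead_FE: "lead p a \<in> FE" and lead_hom_deg: "hom_deg p (lead p a)"
    and J_lead: "JE (lead p a) = \<theta> p (gr_class F p a)"
proof -
  have "\<theta> p (gr_class F p a) \<in> exterior_part n p"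
    using gr_bij[of p] assms by (auto simp: bij_betw_def gr_part_def)
  then obtain f where f: "f \<in> FE" "hom_deg p f" "\<theta> p (gr_class F p a) = JE f" by (auto simp: exterior_part_J)
  hence "lead p a = f"
    unfolding lead_def using ext.J_inj by (simp add: inv_into_f_f inj_on_def)
  with f show "lead p a \<in> FE" "hom_deg p (lead p a)" "JE (lead p a) = \<theta> p (gr_class F p a)" by simp_all
qed

lemma lead_eqI: "f \<in> FE ==> a \<in> F p ==> \<theta> p (gr_class F p a) = JE f ==> lead p a = f"
  using ext.J_inj[of "lead p a" f] lead[of a p] by simp

lemma F_zero: "0 \<in> F p" and F_add: "a \<in> F p ==> b \<in> F p ==> a + b \<in> F p"
  and F_scale: "a \<in> F p ==> c *s a \<in> F p" and F_minus: "a \<in> F p ==> - a \<in> F p"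
  using filtration_subspace[of p] by (simp_all add: subspace_0 subspace_add subspace_scale subspace_neg subspace_diff)

lemma F_sum: "(\<And>i. i \<in> B ==> h i \<in> F p) ==> sum h B \<in> F p"
  by (induction B rule: infinite_finite_induct) (auto simp: F_zero F_add)

lemma F_sg: "a \<in> F p ==> sg q a \<in> F p"
  by (simp add: sg_def F_minus)

lemma F_mono: "p \<le> q ==> F p \<subseteq> F q"
proof -
  have "F p \<subseteq> F (p + int k)" for k
    using filtration_increasing by (induction k) (auto simp: algebra_simps, metis add.assoc add.commute subsetD)
  from this[of "nat (q - p)"] show "p \<le> q ==> F p \<subseteq> F q" by simp
qed

lemma gr_class_eq_iff: "gr_class F p a = gr_class F p b \<longleftrightarrow> a - b \<in> F (p - 1)"
proof
  assume "gr_class F p a = gr_class F p b"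
  moreover have "a \<in> gr_class F p a" using F_zero[of "p - 1"] by (force simp: gr_class_def)
  ultimately obtain c where "c \<in> F (p - 1)" "a = b + c" by (auto simp: gr_class_def)
  thus "a - b \<in> F (p - 1)" by simp
next
  assume *: "a - b \<in> F (p - 1)"
  have sub: "gr_class F p a \<subseteq> gr_class F p b" if "a - b \<in> F (p - 1)" for a b
  proof
    fix x assume "x \<in> gr_class F p a"
    then obtain c where c: "c \<in> F (p - 1)" "x = a + c" by (auto simp: gr_class_def)
    hence "x = b + ((a - b) + c)" by simp
    with c that show "x \<in> gr_class F p b" unfolding gr_class_def using F_add by blast
  qed
  from sub[OF *] sub[of b a] * F_minus[OF *] show "gr_class F p a = gr_class F p b" by simp
qed

lemma lead_add: "a \<in> F p ==> b \<in> F p ==> lead p (a + b) = (\<lambda>S. lead p a S + lead p b S)"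
proof (rule lead_eqI)
  assume a: "a \<in> F p" and b: "b \<in> F p"
  show "\<theta> p (gr_class F p (a + b)) = JE (\<lambda>S. lead p a S + lead p b S)"
    unfolding gr_add[OF a b] exterior_simps J_lead[OF a, symmetric] J_lead[OF b, symmetric]
    by (rule ext.J_add[OF lead_FE[OF a] lead_FE[OF b]])
qed (simp_all add: F_add ext.FK_add lead_FE)

lemma lead_scale: "a \<in> F p ==> lead p (c *s a) = (\<lambda>S. c * lead p a S)"
proof (rule lead_eqI)
  assume a: "a \<in> F p"
  show "\<theta> p (gr_class F p (c *s a)) = JE (\<lambda>S. c * lead p a S)"
    unfolding gr_scale[OF a] exterior_simps J_lead[OF a, symmetric]
    by (rule ext.J_scalar[OF _ lead_FE[OF a]]) simp
qed (simp_all add: F_scale ext.FK_times lead_FE)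

lemma lead_0: "lead p 0 = (\<lambda>S. 0)"
  using lead_scale[OF F_zero, of p 0] by simp

lemma lead_eq_iff: "a \<in> F p ==> b \<in> F p ==> lead p a = lead p b \<longleftrightarrow> a - b \<in> F (p - 1)"
proof -
  assume ab: "a \<in> F p" "b \<in> F p"
  have "lead p a = lead p b \<longleftrightarrow> \<theta> p (gr_class F p a) = \<theta> p (gr_class F p b)"
    using ab ext.J_inj lead_FE J_lead by metis
  also have "\<dots> \<longleftrightarrow> gr_class F p a = gr_class F p b"
    using gr_bij[of p] ab unfolding bij_betw_def gr_part_def by (auto simp: inj_on_def)
  finally show ?thesis by (simp add: gr_class_eq_iff)
qed

lemma lead_zero_iff: "a \<in> F p ==> lead p a = (\<lambda>S. 0) \<longleftrightarrow> a \<in> F (p - 1)"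
  using lead_eq_iff[of a p 0] by (simp add: F_zero lead_0)

lemma lead_surj: "f \<in> FE ==> hom_deg p f ==> \<exists>a\<in>F p. lead p a = f"
proof -
  assume f: "f \<in> FE" "hom_deg p f"
  hence "JE f \<in> \<theta> p ` gr_part F p"
    using gr_bij[of p] unfolding bij_betw_def exterior_part_J by blast
  then obtain a where "a \<in> F p" "\<theta> p (gr_class F p a) = JE f" by (auto simp: gr_part_def)
  with f show ?thesis using lead_eqI by blast
qed

lemma \<mu>_F: "list_all2 (\<lambda>a p. a \<in> F p) as ps ==> \<mu> as \<in> F (sum_list ps - int (length as) + 2)"
  using filtered by (simp add: has_shifted_degree_def)

lemma lead_mult:
  assumes "a \<in> F p" "b \<in> F q"
  shows "\<mu> [a, b] \<in> F (p + q)"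
    and "lead (p + q) (\<mu> [a, b]) = (\<lambda>S. (if even q then 1 else - 1) * ext.star (lead p a) (lead q b) S)"
proof -
  show F: "\<mu> [a, b] \<in> F (p + q)" using \<mu>_F[of "[a, b]" "[p, q]"] assms by simp
  let ?s = "ext.star (lead p a) (lead q b)"
  have s: "?s \<in> FE" "(\<lambda>S. - ?s S) \<in> FE"
    using assms ext.FK_times[of "-1" ?s] by (simp_all add: ext.star_FK lead_FE)
  interpret A: ring ext.A by (rule ext.ring_A)
  have neg: "\<ominus>\<^bsub>ext.A\<^esub> JE ?s = JE (\<lambda>S. - ?s S)"
    using s by (intro A.minus_equality) (auto simp: ext.J_add ext.J_zero ext.J_carrier)
  show "lead (p + q) (\<mu> [a, b]) = (\<lambda>S. (if even q then 1 else - 1) * ?s S)"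
  proof (rule lead_eqI[OF _ F])
    show "(\<lambda>S. (if even q then 1 else - 1) * ?s S) \<in> FE" using s by auto
    show "\<theta> (p + q) (gr_class F (p + q) (\<mu> [a, b])) = JE (\<lambda>S. (if even q then 1 else - 1) * ?s S)"
      unfolding leading_term_2[OF assms] Let_def exterior_simps J_lead[OF assms(1), symmetric]
        J_lead[OF assms(2), symmetric] ext.J_star[OF lead_FE[OF assms(1)] lead_FE[OF assms(2)]]
      using neg by simp
  qed
qed

text \<open>Choose \<open>a\<close> with leading term 1. Then \<mu>[a, unit] = a, while its leading
  term is 1 times that of the unit.\<close>

lemma lead_unit: "lead 0 unit = basis_fun {}"
proof -
  have b: "basis_fun {} \<in> FE" "hom_deg 0 (basis_fun {})"
    using hom_deg_basis[of "{}"] by (simp_all add: ext.FK_basis)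
  obtain a where a: "a \<in> F 0" "lead 0 a = basis_fun {}" using lead_surj[OF b] by blast
  have "lead (0 + 0) (\<mu> [a, unit]) = lead 0 unit"
    using lead_mult(2)[OF a(1) unit_filtration] by (simp add: a ext.star_vac_left)
  thus ?thesis using a by (simp add: unit_right)
qed

text \<open>The exterior algebra lives in degrees 0 to n, so the filtration is constant below 0 and
  above n. Hausdorffness and exhaustiveness then yield \<open>F_neg\<close> and
  \<open>F_top\<close>.\<close>

lemma F_step: "p < 0 \<or> int n < p ==> F p = F (p - 1)"
proof (intro equalityI subsetI)
  fix a assume p: "p < 0 \<or> int n < p" and a: "a \<in> F p"
  have "lead p a S = 0" for S
  proof (rule ccontr)
    assume *: "lead p a S \<noteq> 0"
    hence "S \<subseteq> {..<n}" "int (card S) = p"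
      using lead_FE[OF a] lead_hom_deg[OF a] by (auto simp: FE_iff hom_deg_def)
    with p show False using card_mono[of "{..<n}" S] by auto
  qed
  with a show "a \<in> F (p - 1)" by (simp add: lead_zero_iff[symmetric] fun_eq_iff)
qed (use F_mono[of "p - 1" p] in auto)

lemma F_neg: "p < 0 ==> F p = {0}"
proof -
  have "F (-1) = F (-1 - int k)" for k
  proof (induction k)
    case (Suc k)
    have "F (-1 - int k) = F (-1 - int k - 1)" by (rule F_step) simp
    moreover have "-1 - int k - 1 = -1 - int (Suc k)" by simp
    ultimately show ?case using Suc by argo
  qed simp
  hence "F (-1) \<subseteq> F q" for q
  proof -
    have "F (-1 - int (nat (- q))) \<subseteq> F q" by (rule F_mono) simp
    thus ?thesis using \<open>\<And>k. F (-1) = F (-1 - int k)\<close>[of "nat (- q)"] by argo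
  qed
  hence "F (-1) = {0}" using filtration_Hausdorff by blast
  thus "p < 0 ==> F p = {0}" using F_mono[of p "-1"] F_zero[of p] by auto
qed

lemma F_top: "int n \<le> p ==> F p = UNIV"
proof -
  have "F (int n + int k) = F (int n)" for k
  proof (induction k)
    case (Suc k)
    have "F (int n + int (Suc k)) = F (int n + int (Suc k) - 1)" by (rule F_step) simp
    moreover have "int n + int (Suc k) - 1 = int n + int k" by simp
    ultimately show ?case using Suc by argo
  qed simp
  hence "F q \<subseteq> F (int n)" for q
  proof (cases "q \<le> int n")
    case False
    hence "int n + int (nat (q - int n)) = q" by simp
    with \<open>\<And>k. F (int n + int k) = F (int n)\<close>[of "nat (q - int n)"] show ?thesis by simp
  qed (rule F_mono)
  hence "F (int n) = UNIV" using filtration_exhaustive by blast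
  thus "int n \<le> p ==> F p = UNIV" using F_mono[of "int n" p] by auto
qed

lemma F_X_step: "odd (p - q) ==> a \<in> F p ==> a \<in> X q ==> a \<in> F (p - 1)"
  using filtration_parity[of "p - 1"] X_cong[of q "p - 1"] by auto

lemma v_ex1: "i < n ==> \<exists>!a. a \<in> F 1 \<inter> X 1 \<and> \<theta> 1 (gr_class F 1 a) = exterior_gen n i"
proof (rule ex_ex1I)
  assume i: "i < n"
  have g: "exterior_gen n i = JE (basis_fun {i})" using i by (simp add: exterior_gen_def ext.J_gen)
  have b: "basis_fun {i} \<in> FE" "hom_deg 1 (basis_fun {i})"
    using i hom_deg_basis[of "{i}"] by (simp_all add: ext.FK_basis)
  then obtain a where a: "a \<in> F 1" "lead 1 a = basis_fun {i}" using lead_surj by blast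
  from a(1) obtain b c where bc: "b \<in> F 1" "b \<in> X 0" "c \<in> F 1" "c \<in> X 1" "a = b + c"
    using filtration_graded[of 1, THEN equalityD1, THEN subsetD, OF a(1)] by blast
  have "a - c \<in> F (1 - 1)" using F_X_step[of 1 0 b] bc by simp
  with a bc have "lead 1 c = basis_fun {i}" using lead_eq_iff[of a 1 c] by simp
  thus "\<exists>a. a \<in> F 1 \<inter> X 1 \<and> \<theta> 1 (gr_class F 1 a) = exterior_gen n i"
    using bc g J_lead[of c 1] by auto
next
  fix a b assume i: "i < n" and a: "a \<in> F 1 \<inter> X 1 \<and> \<theta> 1 (gr_class F 1 a) = exterior_gen n i"
    and b: "b \<in> F 1 \<inter> X 1 \<and> \<theta> 1 (gr_class F 1 b) = exterior_gen n i"
  hence "lead 1 a = lead 1 b" by (simp add: lead_def)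
  hence "a - b \<in> F 0" using lead_eq_iff[of a 1 b] a b by simp
  hence "a - b \<in> F (-1)" using F_X_step[of 0 1 "a - b"] a b X_diff by auto
  thus "a = b" using F_neg[of "-1"] by simp
qed

text \<open>Extended by zero, so that words with letters outside the range contribute nothing and
  letters need no side conditions.\<close>

definition v :: "nat => 'a" where
  "v i = (if i < n then basis_lift X F n \<theta> i else 0)"

lemma v: "i < n ==> v i \<in> F 1 \<inter> X 1 \<and> \<theta> 1 (gr_class F 1 (v i)) = exterior_gen n i"
  unfolding v_def basis_lift_def using theI'[OF v_ex1[of i]] by simp

lemma v_X: "v i \<in> X 1"
  using v[of i] X_0[of 1] by (cases "i < n") (auto simp: v_def)

lemma v_F: "v i \<in> F 1"
  using v[of i] F_zero[of 1] by (cases "i < n") (auto simp: v_def)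

lemma lead_v: "i < n ==> lead 1 (v i) = basis_fun {i}"
  using v[of i] by (intro lead_eqI) (simp_all add: ext.FK_basis exterior_gen_def ext.J_gen)

text \<open>The twist and the minus sign undo the sign by which the leading term of \<mu>^2 differs
  from the wedge product. The operators \<open>Lx\<close> on power series have the same form, so
  that their ordered products have the constant terms \<open>e S\<close>.\<close>

primrec el :: "nat list => 'a" where
  "el [] = unit"
| "el (i # w) = - \<mu> [v i, tw (el w)]"

lemma tw_sg: "a \<in> X p ==> tw a = sg (p - 1) a"
  using T_homog[of a p 1] by simp

lemma \<mu>_sg: "\<mu> [a, sg p b] = sg p (\<mu> [a, b])" and \<mu>_sg': "\<mu> [sg p a, b] = sg p (\<mu> [a, b])"
  using multilinear_sg[OF multilinear, of "[a]" p b "[]"] multilinear_sg[OF multilinear, of "[]" p a "[b]"] by simp_all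

lemma \<mu>_X: "list_all2 (\<lambda>a p. a \<in> X p) as ps ==> \<mu> as \<in> X (sum_list ps - int (length as) + 2)"
  using graded by (simp add: has_shifted_degree_def)

lemma el_X: "el w \<in> X (int (length w))"
proof (induction w)
  case (Cons i w)
  have "\<mu> [v i, tw (el w)] \<in> X (1 + int (length w))"
    using \<mu>_X[of "[v i, tw (el w)]" "[1, int (length w)]"] Cons by (simp add: v_X tw_X)
  thus ?case by (simp add: X_minus add.commute)
qed (simp add: unit_degree)

lemma el_F_lead: "sorted_wrt (<) w ==> set w \<subseteq> {..<n} ==>
    el w \<in> F (int (length w)) \<and> lead (int (length w)) (el w) = basis_fun (set w)"
proof (induction w)
  case Nil
  thus ?case by (simp add: unit_filtration lead_unit)
next
  case (Cons i w)
  hence IH: "el w \<in> F (int (length w))" "lead (int (length w)) (el w) = basis_fun (set w)"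
    and w: "i < n" "\<And>s. s \<in> set w ==> i < s" "set w \<subseteq> {..<n}" by auto
  have e: "el (i # w) = sg (int (length w)) (\<mu> [v i, el w])"
    using tw_sg[OF el_X[of w]] by (simp add: \<mu>_sg) (simp add: sg_def)
  note m = lead_mult[OF v_F[of i] IH(1)]
  have b: "ext.star (basis_fun {i}) (basis_fun (set w)) = basis_fun (insert i (set w))"
    using w by (simp add: ext.star_basis_left cliff_basis)
  have "lead (1 + int (length w)) (sg (int (length w)) (\<mu> [v i, el w])) = basis_fun (insert i (set w))"
    using m lead_scale[OF m(1), of "-1"] w IH(2) b by (auto simp: sg_def lead_v)
  with e F_sg[OF m(1)] show ?case by (simp add: add.commute)
qed

section \<open>Coordinates in the basis of ordered products\<close>

definition e :: "nat set => 'a" where "e S = el (sorted_list_of_set S)"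

lemma e_X: "finite S ==> e S \<in> X (int (card S))"
  using el_X[of "sorted_list_of_set S"] by (simp add: e_def)

lemma e_F: "S \<subseteq> {..<n} ==> e S \<in> F (int (card S))"
  and lead_e: "S \<subseteq> {..<n} ==> lead (int (card S)) (e S) = basis_fun S"
  using el_F_lead[of "sorted_list_of_set S"] by (simp_all add: e_def finite_subset[OF _ finite_lessThan])

lemma e_empty: "e {} = unit" by (simp add: e_def)

lemma lead_sum:
  "(\<And>i. i \<in> B ==> h i \<in> F p) ==> lead p (sum h B) = (\<lambda>S. \<Sum>i\<in>B. lead p (h i) S)"
  by (induction B rule: infinite_finite_induct) (auto simp: lead_0 lead_add F_sum)

abbreviation "comb c \<equiv> (\<Sum>S\<in>Pow {..<n}. c S *s e S)"

lemma lead_comb: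
  assumes "\<And>S. S \<subseteq> {..<n} ==> c S \<noteq> 0 ==> int (card S) \<le> p"
  shows "comb c \<in> F p" and "S \<subseteq> {..<n} ==> int (card S) = p ==> lead p (comb c) S = c S"
proof -
  have m: "c S *s e S \<in> F p" if "S \<in> Pow {..<n}" for S
  proof (cases "c S = 0")
    case False
    with that assms have "int (card S) \<le> p" by blast
    with that e_F[of S] F_mono[of "int (card S)" p] show ?thesis by (auto intro: F_scale)
  qed (simp add: F_zero)
  thus "comb c \<in> F p" by (rule F_sum)
  assume S: "S \<subseteq> {..<n}" "int (card S) = p"
  have "lead p (c W *s e W) S = (if W = S then c S else 0)" if "W \<in> Pow {..<n}" for W
  proof (cases "c W = 0 \<or> int (card W) = p")
    case True
    thus ?thesis
    proof
      assume "int (card W) = p"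
      with that have "lead p (c W *s e W) S = c W * basis_fun W S"
        using lead_scale[OF e_F[of W]] lead_e[of W] by auto
      thus ?thesis by (simp add: basis_fun_def)
    qed (auto simp: lead_0)
  next
    case False
    with that assms[of W] have "int (card W) \<le> p - 1" by auto
    hence "c W *s e W \<in> F (p - 1)" using that e_F[of W] F_mono[of "int (card W)" "p - 1"] by (auto intro: F_scale)
    hence "lead p (c W *s e W) = (\<lambda>S. 0)" using m[OF that] by (simp add: lead_zero_iff)
    thus ?thesis using False S by auto
  qed
  hence "(\<Sum>W\<in>Pow {..<n}. lead p (c W *s e W) S) = (\<Sum>W\<in>Pow {..<n}. if W = S then c S else 0)"
    by (rule sum.cong[OF refl])
  moreover have "lead p (comb c) = (\<lambda>S. \<Sum>W\<in>Pow {..<n}. lead p (c W *s e W) S)"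
    by (rule lead_sum[OF m])
  ultimately have "lead p (comb c) S = (\<Sum>W\<in>Pow {..<n}. if W = S then c S else 0)" by simp
  with S show "lead p (comb c) S = c S" by simp
qed

text \<open>In the largest cardinality carrying a nonzero coefficient, the leading term of the
  combination shows that coefficient. Linear independence of the \<open>e S\<close> is the case q =
  -1.\<close>

lemma comb_F_support:
  assumes a: "comb c \<in> F q" and S: "S \<subseteq> {..<n}" "c S \<noteq> 0"
  shows "int (card S) \<le> q"
proof (rule ccontr)
  assume "\<not> int (card S) \<le> q"
  let ?C = "{W. W \<subseteq> {..<n} \<and> c W \<noteq> 0}"
  have fin: "finite ?C" by (rule finite_subset[of _ "Pow {..<n}"]) auto
  define p where "p = Max ((\<lambda>W. int (card W)) ` ?C)"
  have p: "int (card W) \<le> p" if "W \<subseteq> {..<n}" "c W \<noteq> 0" for W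
    unfolding p_def using fin that by (intro Max_ge) auto
  have "p \<in> (\<lambda>W. int (card W)) ` ?C" unfolding p_def using fin S by (intro Max_in) auto
  then obtain W where W: "W \<subseteq> {..<n}" "c W \<noteq> 0" "int (card W) = p" by auto
  have "q \<le> p - 1" using p[OF S] \<open>\<not> int (card S) \<le> q\<close> by simp
  with a have "comb c \<in> F (p - 1)" using F_mono[of q "p - 1"] by auto
  hence "lead p (comb c) = (\<lambda>S. 0)" using lead_comb(1)[of c p] p by (simp add: lead_zero_iff)
  with lead_comb(2)[of c p W] p W show False by auto
qed

lemma comb_unique: "comb c = comb c' ==> S \<subseteq> {..<n} ==> c S = c' S"
proof (rule ccontr)
  assume *: "comb c = comb c'" "S \<subseteq> {..<n}" "c S \<noteq> c' S"
  have "comb (\<lambda>S. c S - c' S) = 0" using * by (simp add: scale_left_diff_distrib sum_subtractf)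
  hence "comb (\<lambda>S. c S - c' S) \<in> F (-1)" by (simp add: F_zero)
  from comb_F_support[OF this *(2)] * show False by simp
qed

text \<open>Subtracting the combination whose coefficients form the leading term moves one step down
  the filtration, which ends at \<open>F (-1)\<close>, the zero module.\<close>

lemma comb_ex: "a \<in> F (int k - 1) ==> \<exists>c. a = comb c"
proof (induction k arbitrary: a)
  case 0
  hence "a = comb (\<lambda>_. 0)" using F_neg[of "-1"] by simp
  thus ?case by (rule exI[of _ "\<lambda>_. 0"])
next
  case (Suc k)
  hence a: "a \<in> F (int k)" by simp
  let ?l = "lead (int k) a"
  have l: "int (card S) = int k" if "?l S \<noteq> 0" for S using lead_hom_deg[OF a] that by (auto simp: hom_deg_def)
  have c: "comb ?l \<in> F (int k)" using l by (intro lead_comb(1)) auto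
  have "lead (int k) (comb ?l) = ?l"
  proof
    fix S
    show "lead (int k) (comb ?l) S = ?l S"
    proof (cases "S \<subseteq> {..<n} \<and> int (card S) = int k")
      case True
      thus ?thesis using l by (intro lead_comb(2)) auto
    next
      case False
      hence "?l S = 0" "lead (int k) (comb ?l) S = 0"
        using lead_FE[OF a] lead_hom_deg[OF a] lead_FE[OF c] lead_hom_deg[OF c] by (auto simp: FE_iff hom_deg_def)
      thus ?thesis by simp
    qed
  qed
  hence "a - comb ?l \<in> F (int k - 1)" using lead_eq_iff[OF a c] by simp
  from Suc.IH[OF this] obtain c where "a - comb ?l = comb c" by blast
  hence "a = comb (\<lambda>S. c S + ?l S)" by (simp add: scale_left_distrib sum.distrib algebra_simps)
  thus ?case by (rule exI[of _ "\<lambda>S. c S + ?l S"])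
qed

definition coord :: "'a => nat set => 'r" where
  "coord a = (SOME c. a = comb c \<and> (\<forall>S. \<not> S \<subseteq> {..<n} \<longrightarrow> c S = 0))"

lemma coord_spec: "a = comb (coord a) \<and> (\<forall>S. \<not> S \<subseteq> {..<n} \<longrightarrow> coord a S = 0)"
  unfolding coord_def
proof (rule someI_ex[where P = "\<lambda>c. a = comb c \<and> (\<forall>S. \<not> S \<subseteq> {..<n} \<longrightarrow> c S = 0)"])
  have "a \<in> F (int (Suc n) - 1)" using F_top[of "int n"] by simp
  from comb_ex[OF this] obtain c where "a = comb c" by blast
  also have "comb c = comb (\<lambda>S. if S \<subseteq> {..<n} then c S else 0)" by (rule sum.cong) auto
  finally have "a = comb (\<lambda>S. if S \<subseteq> {..<n} then c S else 0)" .
  thus "\<exists>c. a = comb c \<and> (\<forall>S. \<not> S \<subseteq> {..<n} \<longrightarrow> c S = 0)"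
    by (intro exI[of _ "\<lambda>S. if S \<subseteq> {..<n} then c S else 0"]) simp
qed

lemma coord_comb: "comb (coord a) = a" using coord_spec[of a] by simp

lemma coord_out: "\<not> S \<subseteq> {..<n} ==> coord a S = 0" using coord_spec[of a] by simp

lemma coord_unique: "a = comb c ==> S \<subseteq> {..<n} ==> coord a S = c S"
  using comb_unique[of "coord a" c S] by (simp add: coord_comb)

lemma coord_add: "coord (a + b) S = coord a S + coord b S"
proof (cases "S \<subseteq> {..<n}")
  case True
  have "a + b = comb (\<lambda>S. coord a S + coord b S)"
    by (simp add: scale_left_distrib sum.distrib coord_comb)
  thus ?thesis by (rule coord_unique) fact
qed (simp add: coord_out)

lemma coord_scale: "coord (c *s a) S = c * coord a S"
proof (cases "S \<subseteq> {..<n}")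
  case True
  have "c *s a = comb (\<lambda>S. c * coord a S)"
    by (subst coord_comb[of a, symmetric]) (simp only: scale_sum_right scale_scale)
  thus ?thesis by (rule coord_unique) fact
qed (simp add: coord_out)

lemma coord_0: "coord 0 S = 0" using coord_scale[of 0 0 S] by simp

lemma coord_e: "W \<subseteq> {..<n} ==> coord (e W) S = (if S = W then 1 else 0)"
proof (cases "S \<subseteq> {..<n}")
  case True
  assume W: "W \<subseteq> {..<n}"
  hence "e W = comb (\<lambda>S. if S = W then 1 else 0)"
    by (simp add: if_distrib[of "\<lambda>c. c *s _"] cong: if_cong)
  thus ?thesis by (rule coord_unique) fact
qed (auto simp: coord_out)

lemma coord_F: "a \<in> F q ==> coord a S \<noteq> 0 ==> int (card S) \<le> q"
  using comb_F_support[of "coord a" q S] coord_out[of S a] by (auto simp: coord_comb)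

lemma coord_lead: "a \<in> F p ==> S \<subseteq> {..<n} ==> int (card S) = p ==> coord a S = lead p a S"
  using lead_comb(2)[of "coord a" p S] coord_F[of a p] by (simp add: coord_comb)

lemma X_sum: "(\<And>i. i \<in> B ==> h i \<in> X p) ==> sum h B \<in> X p"
  by (induction B rule: infinite_finite_induct) (simp_all add: X_0 X_plus)

lemma X_X_zero: "x \<in> X p ==> x \<in> X (p + 1) ==> x = 0"
  using X_even[of p] X_odd[of p] X_even[of "p + 1"] X_odd[of "p + 1"] grading_disjoint
  by (cases "even p") auto

text \<open>The part of the expansion with the wrong parity is both even and odd, hence
  zero.\<close>

lemma coord_X: "a \<in> X p ==> coord a S \<noteq> 0 ==> even (int (card S) - p)"
proof (rule ccontr)
  assume a: "a \<in> X p" and S: "coord a S \<noteq> 0" "\<not> even (int (card S) - p)"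
  let ?h = "\<lambda>q S. if even (int (card S) - q) then coord a S else 0"
  have h: "comb (?h q) \<in> X q" for q
  proof -
    have "?h q S *s e S \<in> X q" if "S \<in> Pow {..<n}" for S
      using e_X[of S] X_cong[of "int (card S)" q] that finite_subset[of S "{..<n}"] by (auto simp: X_0 intro: X_scale)
    thus ?thesis by (rule X_sum)
  qed
  have "a = comb (\<lambda>S. ?h p S + ?h (p + 1) S)"
    by (subst coord_comb[of a, symmetric], rule sum.cong) auto
  hence *: "a = comb (?h p) + comb (?h (p + 1))" by (simp only: scale_left_distrib sum.distrib)
  have diff: "x = y + z ==> z = x - y" for x y z :: 'a by simp
  have "a - comb (?h p) \<in> X p" by (rule X_diff[OF a h[of p]])
  hence "comb (?h (p + 1)) \<in> X p" by (simp only: diff[OF *])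
  from X_X_zero[OF this h[of "p + 1"]] have z: "comb (?h (p + 1)) = 0" .
  have "a = comb (?h p)" by (rule trans[OF *]) (simp only: z add_0_right)
  from coord_unique[OF this, of S] have "S \<subseteq> {..<n} ==> coord a S = ?h p S" .
  with S(2) have "coord a S = 0" using coord_out[of S a] by auto
  with S(1) show False ..
qed

lemma wedge_words_support:
  "foldr (cliff (\<lambda>_ _. 0)) w (basis_fun U) W \<noteq> (0 :: 'r) ==> W = set w \<union> U \<and> set w \<inter> U = {}"
proof (induction w arbitrary: W)
  case (Cons i w)
  have "wedge i (foldr (cliff (\<lambda>_ _. 0)) w (basis_fun U)) W \<noteq> (0 :: 'r)"
    using Cons.prems by (simp add: cliff_0)
  hence "i \<in> W" "foldr (cliff (\<lambda>_ _. 0)) w (basis_fun U) (W - {i}) \<noteq> (0 :: 'r)"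
    unfolding wedge_def by (auto simp only: if_False mult_zero_right split: if_splits)
  with Cons.IH[of "W - {i}"] show ?case by auto
qed (auto simp: basis_fun_def split: if_splits)

text \<open>Coordinates of the top filtration degree are read off from the wedge product; all others
  have smaller cardinality. Besides the exact value in \<open>e_insert\<close>, this triangularity
  is what the Koszul matching uses of \<mu>^2.\<close>

lemma coord_product:
  assumes S: "S \<subseteq> {..<n}" and U: "U \<subseteq> {..<n}" and W: "coord (\<mu> [e S, e U]) W \<noteq> 0"
  shows "card W < card S + card U \<or> W = S \<union> U \<and> S \<inter> U = {}"
proof -
  note m = lead_mult[OF e_F[OF S] e_F[OF U]]
  have "int (card W) \<le> int (card S) + int (card U)" by (rule coord_F[OF m(1) W])
  moreover have "W = S \<union> U \<and> S \<inter> U = {}" if "int (card W) = int (card S) + int (card U)"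
  proof -
    have "lead (int (card S) + int (card U)) (\<mu> [e S, e U]) W \<noteq> 0"
      using coord_lead[OF m(1) _ that] coord_out[of W] W by metis
    hence "ext.star (basis_fun S) (basis_fun U) W \<noteq> 0"
      unfolding m(2) lead_e[OF S] lead_e[OF U] by auto
    thus ?thesis
      using wedge_words_support[of "sorted_list_of_set S" U W] finite_subset[OF S]
      by (simp add: ext.star_basis_left[OF S])
  qed
  ultimately show ?thesis by linarith
qed

lemma e_single: "e {i} = v i"
  using tw_even[OF unit_degree] multilinear_minus[OF multilinear, of "[v i]" unit "[]"] unit_right
  by (simp add: e_def)

lemma e_insert:
  assumes "\<And>s. s \<in> S ==> i < s" "finite S"
  shows "\<mu> [e {i}, e S] = sg (int (card S)) (e (insert i S))"
proof -
  have "sorted_list_of_set (insert i S) = i # sorted_list_of_set S"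
    using assms
    by (intro sorted_list_of_set.sorted_key_list_of_set_unique[THEN iffD1])
      (auto simp: card_insert_if sorted_list_of_set.idem_if_sorted_distinct order.strict_implies_order)
  hence "e (insert i S) = - \<mu> [v i, tw (e S)]" by (simp add: e_def)
  also have "\<dots> = sg (int (card S)) (\<mu> [v i, e S])"
    using tw_sg[OF e_X[OF assms(2)]] by (simp add: \<mu>_sg) (simp add: sg_def)
  finally show ?thesis by (simp add: e_single) (simp add: sg_def)
qed

end

section \<open>Power series with coefficients in the deformation\<close>

text \<open>The coefficient at \<open>m\<close> of a product of power series, while
  \<open>wsum\<close> below collects all noncommutative words that become the monomial
  \<open>m\<close>.\<close>

definition msum :: "nat multiset => (nat multiset => nat multiset => 'b::comm_monoid_add) => 'b" where
  "msum m f = (\<Sum>a | a \<subseteq># m. f a (m - a))"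

definition wsum :: "nat multiset => (nat list => 'b::comm_monoid_add) => 'b" where
  "wsum m f = (\<Sum>w | mset w = m. f w)"

lemma finite_words: "finite {w. mset w = m}"
proof (rule finite_subset)
  show "{w. mset w = m} \<subseteq> {w. set w \<subseteq> set_mset m \<and> length w = size m}" by auto
qed (rule finite_lists_length_eq, simp)

lemma mset_pair_words: "{w. mset w = {#i, j#}} = {[i, j], [j, i]}"
proof (intro equalityI subsetI)
  fix w assume w: "w \<in> {w. mset w = {#i, j#}}"
  hence "size (mset w) = 2" by simp
  then obtain a b where "w = [a, b]" by (auto simp: length_Suc_conv numeral_2_eq_2)
  with w show "w \<in> {[i, j], [j, i]}" by (auto simp: add_eq_conv_ex)
qed (auto simp: add_mset_commute)

lemma msum_assoc: "msum m (\<lambda>a b. msum a (\<lambda>c d. f c d b)) = msum m (\<lambda>c x. msum x (\<lambda>d b. f c d b))"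
proof -
  have diff_diff: "m - b - (a - b) = m - a" if "b \<subseteq># a" for a b :: "nat multiset"
    by (metis that diff_diff_add_mset subset_mset.add_diff_inverse)
  have "msum m (\<lambda>a b. msum a (\<lambda>c d. f c d b)) =
      (\<Sum>(a, b)\<in>Sigma {a. a \<subseteq># m} (\<lambda>a. {b. b \<subseteq># a}). f b (a - b) (m - a))"
    by (simp add: msum_def sum.Sigma)
  also have "\<dots> = (\<Sum>(b, c)\<in>Sigma {b. b \<subseteq># m} (\<lambda>b. {c. c \<subseteq># m - b}). f b c (m - b - c))"
    by (rule sum.reindex_bij_witness[where i = "\<lambda>(b, c). (b + c, b)" and j = "\<lambda>(a, b). (b, a - b)"])
      (auto simp: diff_diff subset_mset.le_diff_conv2 add.commute
        intro: subset_mset.order_trans diff_subset_eq_self mset_subset_eq_mono_add)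
  also have "\<dots> = msum m (\<lambda>c x. msum x (\<lambda>d b. f c d b))"
    by (simp add: msum_def sum.Sigma)
  finally show ?thesis .
qed

lemma msum_commute: "msum m f = msum m (\<lambda>a b. f b a)"
  unfolding msum_def
  by (rule sum.reindex_bij_witness[where i = "\<lambda>a. m - a" and j = "\<lambda>a. m - a"])
    (auto simp: subset_mset.diff_diff_right)

lemma msum_exchange: "msum m (\<lambda>a x. msum x (\<lambda>e y. f a e y)) = msum m (\<lambda>e x. msum x (\<lambda>a y. f a e y))"
proof -
  have "msum m (\<lambda>a x. msum x (\<lambda>e y. f a e y)) = msum m (\<lambda>z y. msum z (\<lambda>a e. f a e y))"
    by (rule msum_assoc[symmetric])
  also have "\<dots> = msum m (\<lambda>z y. msum z (\<lambda>e a. f a e y))"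
    by (subst msum_commute) (rule refl)
  also have "\<dots> = msum m (\<lambda>e x. msum x (\<lambda>a y. f a e y))" by (rule msum_assoc)
  finally show ?thesis .
qed

lemma msum_add: "msum m (\<lambda>a b. f a b + g a b) = msum m f + msum m g"
  and msum_0 [simp]: "msum m (\<lambda>a b. 0) = 0"
  by (simp_all add: msum_def sum.distrib)

lemma msum_hom: "h 0 = 0 ==> (\<And>x y. h (x + y) = h x + h y) ==> h (msum m f) = msum m (\<lambda>a b. h (f a b))"
  unfolding msum_def by (induction "{a. a \<subseteq># m}" rule: infinite_finite_induct)
    (simp_all add: sum_comp_morphism[symmetric] o_def)

lemma msum_cong: "(\<And>a b. a + b = m ==> f a b = g a b) ==> msum m f = msum m g"
  unfolding msum_def by (rule sum.cong) auto

lemma msum_single: "msum m (\<lambda>a b. if a = {#} then f b else 0) = f m"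
  unfolding msum_def by (subst sum.delta) auto

lemma wsum_add: "wsum m (\<lambda>a. f a + g a) = wsum m f + wsum m g"
  and wsum_0 [simp]: "wsum m (\<lambda>a. 0) = 0"
  by (simp_all add: wsum_def sum.distrib)

lemma msum_swap: "msum m (\<lambda>a b. msum x (\<lambda>c d. f a b c d)) = msum x (\<lambda>c d. msum m (\<lambda>a b. f a b c d))"
  and wsum_msum: "wsum m (\<lambda>a. msum x (\<lambda>c d. g a c d)) = msum x (\<lambda>c d. wsum m (\<lambda>a. g a c d))"
  and wsum_swap: "wsum m (\<lambda>a. wsum m' (\<lambda>b. h a b)) = wsum m' (\<lambda>b. wsum m (\<lambda>a. h a b))"
  and ss_msum: "ss as (\<lambda>u v. msum x (\<lambda>c d. k u v c d)) = msum x (\<lambda>c d. ss as (\<lambda>u v. k u v c d))"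
  and ss_wsum: "ss as (\<lambda>u v. wsum m (\<lambda>c. k' u v c)) = wsum m (\<lambda>c. ss as (\<lambda>u v. k' u v c))"
  unfolding msum_def wsum_def ss_sum by (rule sum.swap)+

lemma msum_assoc1: "msum m (\<lambda>A r. msum r (\<lambda>c d. msum A (\<lambda>a x. f a x c d))) =
    msum m (\<lambda>a y. msum y (\<lambda>x r. msum r (\<lambda>c d. f a x c d)))"
  by (subst msum_swap) (rule msum_assoc)

lemma wsum_ss: "wsum m (\<lambda>w. ss w g) = msum m (\<lambda>a b. wsum a (\<lambda>u. wsum b (\<lambda>u'. g u u')))"
proof -
  have "wsum m (\<lambda>w. ss w g) = (\<Sum>z\<in>(SIGMA w:{w. mset w = m}. {p. fst p @ snd p = w}). g (fst (snd z)) (snd (snd z)))"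
    unfolding wsum_def ss_sum by (subst sum.Sigma) (auto simp: finite_words finite_splits split_beta)
  also have "\<dots> = (\<Sum>z\<in>(SIGMA a:{a. a \<subseteq># m}. (SIGMA u:{u. mset u = a}. {u'. mset u' = m - a})). g (fst (snd z)) (snd (snd z)))"
    by (rule sum.reindex_bij_witness[where i = "\<lambda>(a, u, u'). (u @ u', (u, u'))" and j = "\<lambda>(w, (u, u')). (mset u, u, u')"]) auto
  also have "\<dots> = msum m (\<lambda>a b. wsum a (\<lambda>u. wsum b (\<lambda>u'. g u u')))"
    unfolding wsum_def msum_def
    by (simp add: sum.Sigma finite_words split_beta)
  finally show ?thesis .
qed

lemma card_splits_at:
  "finite {(u, u'). u @ i # u' = w} \<and> card {(u, u'). u @ i # u' = w} = count (mset w) i"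
proof (induction w)
  case (Cons a w)
  have "{(u, u'). u @ i # u' = a # w} = (if a = i then {([], w)} else {}) \<union>
      (\<lambda>(u, u'). (a # u, u')) ` {(u, u'). u @ i # u' = w}"
    by (auto simp: append_eq_Cons_conv)
  moreover have "card ((\<lambda>(u, u'). (a # u, u')) ` {(u, u'). u @ i # u' = w}) = count (mset w) i"
    using Cons by (subst card_image) (auto simp: inj_on_def)
  ultimately show ?case using Cons by (auto simp: card_insert_if)
qed simp

definition splits_at2 :: "nat => nat => nat list => (nat list \<times> nat list \<times> nat list) set" where
  "splits_at2 i j w = {(u, u', u''). u @ i # u' @ j # u'' = w}"

lemma splits_at2_Nil: "splits_at2 i j [] = {}"
  by (auto simp: splits_at2_def)

lemma splits_at2_Cons: "splits_at2 i j (a # w) =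
    (if a = i then Pair [] ` {(u, u'). u @ j # u' = w} else {}) \<union> (\<lambda>(u, x). (a # u, x)) ` splits_at2 i j w"
  unfolding splits_at2_def by (auto simp: append_eq_Cons_conv image_iff)

lemma finite_splits_at2: "finite (splits_at2 i j w)"
  by (induction w) (auto simp: splits_at2_Nil splits_at2_Cons card_splits_at)

lemma card_splits_at2_Cons:
  "card (splits_at2 i j (a # w)) = (if a = i then count (mset w) j else 0) + card (splits_at2 i j w)"
proof -
  have "card ((\<lambda>(u, x). (a # u, x)) ` splits_at2 i j w) = card (splits_at2 i j w)"
    by (rule card_image) (auto simp: inj_on_def)
  moreover have "card (Pair ([] :: nat list) ` {(u, u'). u @ j # u' = w}) = count (mset w) j"
    using card_splits_at[of j w] by (subst card_image) (auto simp: inj_on_def)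
  moreover have "card (Pair [] ` {(u, u'). u @ j # u' = w} \<union> (\<lambda>(u, x). (a # u, x)) ` splits_at2 i j w) =
      card (Pair ([] :: nat list) ` {(u, u'). u @ j # u' = w}) + card ((\<lambda>(u, x). (a # u, x)) ` splits_at2 i j w)"
    by (rule card_Un_disjoint) (auto simp: finite_splits_at2 card_splits_at)
  ultimately show ?thesis unfolding splits_at2_Cons by (cases "a = i") simp_all
qed

text \<open>Unordered pairs of occurrences of \<open>i\<close>. This binomial coefficient is the
  integral coefficient in the operator of half the second derivative.\<close>

lemma card_splits_at2_self: "card (splits_at2 i i w) = count (mset w) i * (count (mset w) i - 1) div 2"
proof (induction w)
  case (Cons a w)
  have "(c + 1) * c div 2 = c + c * (c - 1) div 2" for c :: nat
    by (cases c) auto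
  thus ?case by (auto simp: card_splits_at2_Cons Cons algebra_simps)
qed (simp add: splits_at2_Nil)

lemma card_splits_at2_pair: "i \<noteq> j ==>
    card (splits_at2 i j w) + card (splits_at2 j i w) = count (mset w) i * count (mset w) j"
  by (induction w) (auto simp: card_splits_at2_Cons splits_at2_Nil)

context superfiltered_deformation
begin

text \<open>With b the sum of the x_i v_i, this is the coefficient at \<open>m\<close> of
  \<open>f\<close> applied to the series in the list, with any number of copies of b in every gap
  and at both ends. It is a finite sum, because the letters inserted must divide
  \<open>m\<close>.\<close>

primrec SS :: "(nat multiset => 'a) list => nat multiset => ('a list => 'b::comm_monoid_add) => 'b" where
  "SS [] m f = wsum m (\<lambda>w. f (map v w))"
| "SS (\<alpha> # \<alpha>s) m f = msum m (\<lambda>a x. wsum a (\<lambda>u. msum x (\<lambda>c d. SS \<alpha>s d (\<lambda>l. f (map v u @ \<alpha> c # l)))))"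

lemma SS_add: "SS \<alpha>s m (\<lambda>l. f l + g l) = SS \<alpha>s m f + SS \<alpha>s m g"
  by (induction \<alpha>s arbitrary: m f g) (simp_all add: msum_add wsum_add)

lemma SS_0 [simp]: "SS \<alpha>s m (\<lambda>l. 0) = 0"
  by (induction \<alpha>s arbitrary: m) simp_all

lemma SS_hom:
  assumes "h 0 = 0" "\<And>x y. h (x + y) = h x + h y"
  shows "h (SS \<alpha>s m f) = SS \<alpha>s m (\<lambda>l. h (f l))"
proof -
  have sum: "h (sum g B) = (\<Sum>b\<in>B. h (g b))" for g B
    using assms by (induction B rule: infinite_finite_induct) simp_all
  show ?thesis by (induction \<alpha>s arbitrary: m f) (simp_all add: msum_def wsum_def sum)
qed

lemma SS_diff: "SS \<alpha>s m (\<lambda>l. f l - g l) = SS \<alpha>s m f - SS \<alpha>s m g" for f g :: "'a list => 'b::ab_group_add"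
  using SS_add[of \<alpha>s m "\<lambda>l. f l - g l" g] by simp

lemma SS_msum: "SS \<alpha>s m (\<lambda>l. msum x (\<lambda>c d. f l c d)) = msum x (\<lambda>c d. SS \<alpha>s m (\<lambda>l. f l c d))"
  by (induction \<alpha>s arbitrary: m f) (simp_all only: SS.simps wsum_msum msum_swap[of _ x])

lemma SS_wsum: "SS \<alpha>s m (\<lambda>l. wsum x (\<lambda>w. f l w)) = wsum x (\<lambda>w. SS \<alpha>s m (\<lambda>l. f l w))"
  by (induction \<alpha>s arbitrary: m f) (simp_all only: SS.simps wsum_msum wsum_swap[of _ x])

lemma SS_ss: "SS \<alpha>s m (\<lambda>l. ss as (\<lambda>u v. f l u v)) = ss as (\<lambda>u v. SS \<alpha>s m (\<lambda>l. f l u v))"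
  by (induction \<alpha>s arbitrary: m f) (simp_all only: SS.simps ss_msum ss_wsum)

lemma SS_SS: "SS \<alpha>s m (\<lambda>l. SS \<beta>s m' (\<lambda>l'. f l l')) = SS \<beta>s m' (\<lambda>l'. SS \<alpha>s m (\<lambda>l. f l l'))"
  by (induction \<alpha>s arbitrary: m f) (simp_all only: SS.simps SS_msum SS_wsum)

text \<open>Words are group-like for deconcatenation; so are the lists generated by \<^const>\<open>SS\<close>.\<close>
lemma SS_deconcat:
  "SS \<alpha>s m (\<lambda>l. ss l g) = ss \<alpha>s (\<lambda>\<beta> \<gamma>. msum m (\<lambda>a b. SS \<beta> a (\<lambda>l1. SS \<gamma> b (\<lambda>l2. g l1 l2))))"
proof (induction \<alpha>s arbitrary: m g)
  case Nil
  show ?case by (simp add: ss_map wsum_ss)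
next
  case (Cons \<alpha> \<alpha>s)
  have "SS (\<alpha> # \<alpha>s) m (\<lambda>l. ss l g) =
      msum m (\<lambda>a x. wsum a (\<lambda>u. ss u (\<lambda>p q. msum x (\<lambda>c d. SS \<alpha>s d (\<lambda>l. g (map v p) (map v q @ \<alpha> c # l))))))
    + msum m (\<lambda>a x. wsum a (\<lambda>u. msum x (\<lambda>c d. SS \<alpha>s d (\<lambda>l. ss l (\<lambda>p q. g (map v u @ \<alpha> c # p) q)))))"
    by (simp only: SS.simps ss_append ss_map SS_add msum_add wsum_add SS_ss ss_msum)
  also have "msum m (\<lambda>a x. wsum a (\<lambda>u. ss u (\<lambda>p q. msum x (\<lambda>c d. SS \<alpha>s d (\<lambda>l. g (map v p) (map v q @ \<alpha> c # l))))))
      = msum m (\<lambda>a b. SS [] a (\<lambda>l1. SS (\<alpha> # \<alpha>s) b (\<lambda>l2. g l1 l2)))"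
    by (simp only: SS.simps wsum_ss msum_assoc wsum_msum)
  also have "msum m (\<lambda>a x. wsum a (\<lambda>u. msum x (\<lambda>c d. SS \<alpha>s d (\<lambda>l. ss l (\<lambda>p q. g (map v u @ \<alpha> c # p) q)))))
      = ss \<alpha>s (\<lambda>\<beta> \<gamma>. msum m (\<lambda>a b. SS (\<alpha> # \<beta>) a (\<lambda>l1. SS \<gamma> b (\<lambda>l2. g l1 l2))))"
    by (simp only: Cons SS.simps ss_msum[symmetric] ss_wsum[symmetric] msum_assoc wsum_msum[symmetric])
  finally show ?case by simp
qed

lemma SS_concat:
  "SS (\<alpha>s @ \<beta> # \<gamma>s) m f = msum m (\<lambda>a r. msum r (\<lambda>c d. SS \<alpha>s a (\<lambda>l. SS \<gamma>s d (\<lambda>l'. f (l @ \<beta> c # l')))))"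
proof (induction \<alpha>s arbitrary: m f)
  case Nil
  show ?case by (simp add: wsum_msum)
next
  case (Cons \<alpha> \<alpha>s)
  show ?case
    by (simp only: append_Cons SS.simps Cons append_assoc msum_assoc1 wsum_msum[symmetric])
qed

definition tws :: "int => (nat multiset => 'a) => nat multiset => 'a" where
  "tws p \<alpha> m = T p (\<alpha> m)"

lemma T_v [simp]: "T p (v i) = v i"
  using T_homog[OF v_X[of i], of p] by (simp add: sg_def)

lemma SS_tws: "SS (map (tws p) \<alpha>s) m f = SS \<alpha>s m (\<lambda>l. f (map (T p) l))"
proof (induction \<alpha>s arbitrary: m f)
  case Nil
  show ?case by (simp add: comp_def)
next
  case (Cons \<alpha> \<alpha>s)
  show ?case by (simp only: list.map SS.simps Cons map_append) (simp add: tws_def comp_def)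
qed

text \<open>A cut of the evaluated list distributes over the series by \<open>SS_deconcat\<close>,
  so inserting a cochain becomes inserting the series of its values. Twists pass to the series
  alone, since the \<open>v i\<close> are odd and fixed by every \<open>T p\<close>.\<close>

lemma SS_circ:
  assumes f: "multilinear scale f"
  shows "SS \<alpha>s m (circ f p \<phi>) =
    ss \<alpha>s (\<lambda>\<beta> y. ss y (\<lambda>\<gamma> \<delta>. SS (\<beta> @ (\<lambda>m. SS \<gamma> m \<phi>) # map (tws p) \<delta>) m f))"
proof -
  have push: "SS \<gamma> c (\<lambda>l2. f (l1 @ \<phi> l2 # l3)) = f (l1 @ SS \<gamma> c \<phi> # l3)" for \<gamma> c l1 l3
    by (rule SS_hom[of "\<lambda>x. f (l1 @ x # l3)", symmetric])
      (simp_all add: multilinear_zero[OF f] multilinear_add[OF f])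
  have E: "SS \<gamma> c (\<lambda>l2. SS \<delta> d (\<lambda>l3. f (l1 @ \<phi> l2 # map (T p) l3))) =
      SS \<delta> d (\<lambda>l3. f (l1 @ SS \<gamma> c \<phi> # map (T p) l3))" for \<gamma> c \<delta> d l1
    by (subst SS_SS) (simp only: push)
  have "SS \<alpha>s m (circ f p \<phi>) = ss \<alpha>s (\<lambda>\<beta> y. msum m (\<lambda>a b. SS \<beta> a (\<lambda>l1.
      ss y (\<lambda>\<gamma> \<delta>. msum b (\<lambda>c d. SS \<gamma> c (\<lambda>l2. SS \<delta> d (\<lambda>l3. f (l1 @ \<phi> l2 # map (T p) l3))))))))"
    unfolding circ_def[abs_def] by (simp only: SS_deconcat)
  also have "\<dots> = ss \<alpha>s (\<lambda>\<beta> y. ss y (\<lambda>\<gamma> \<delta>. msum m (\<lambda>a b. msum b (\<lambda>c d. SS \<beta> a (\<lambda>l1.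
      SS \<delta> d (\<lambda>l3. f (l1 @ SS \<gamma> c \<phi> # map (T p) l3)))))))"
    by (simp only: E SS_ss SS_msum ss_msum[symmetric])
  finally show ?thesis by (simp only: SS_concat SS_tws)
qed

text \<open>With no series inserted the only inputs are copies of b, which every twist fixes; the
  signs of the brace disappear.\<close>

lemma SS_brace:
  assumes f: "multilinear scale f"
  shows "SS [] m (brace f p \<phi> q \<psi>) = SS [\<lambda>m. SS [] m \<phi>, \<lambda>m. SS [] m \<psi>] m f"
proof -
  have tw_r: "SS [] c (\<lambda>r. f (l @ x # k @ y # map (T s) r)) = SS [] c (\<lambda>r. f (l @ x # k @ y # r))"
    for s c l x k y
    using SS_tws[of s "[]" c "\<lambda>r. f (l @ x # k @ y # r)"] by simp
  have tw_v: "SS [] c (\<lambda>u. SS [] d (\<lambda>r. f (l @ x # k @ \<psi> (map (T s) u) # r))) =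
      SS [] c (\<lambda>u. SS [] d (\<lambda>r. f (l @ x # k @ \<psi> u # r)))" for s c d l x k
    using SS_tws[of s "[]" c "\<lambda>u. SS [] d (\<lambda>r. f (l @ x # k @ \<psi> u # r))"] by simp
  have tw_m: "SS [] c (\<lambda>k. msum e (\<lambda>c d. SS [] d (\<lambda>r. f (l @ x # map (T s) k @ y c # r)))) =
      SS [] c (\<lambda>k. msum e (\<lambda>c d. SS [] d (\<lambda>r. f (l @ x # k @ y c # r))))" for s c e l x y
    using SS_tws[of s "[]" c "\<lambda>k. msum e (\<lambda>c d. SS [] d (\<lambda>r. f (l @ x # k @ y c # r)))"] by simp
  note f2 = multilinear_zero[OF f, of "_ @ _ # _", simplified] multilinear_add[OF f, of "_ @ _ # _", simplified]
  have E1: "SS [] c (\<lambda>u. SS [] d (\<lambda>r. f (l @ x # k @ \<psi> u # r))) =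
      SS [] d (\<lambda>r. f (l @ x # k @ SS [] c \<psi> # r))" for c d l x k
    by (rule SS_hom[of "\<lambda>z. SS [] d (\<lambda>r. f (l @ x # k @ z # r))", symmetric])
      (simp_all only: f2 SS_0 SS_add)
  have E2: "SS [] c (\<lambda>u. msum e (\<lambda>c d. SS [] c (\<lambda>k. msum d (\<lambda>c d. SS [] d (\<lambda>r. f (l @ \<phi> u # k @ y c # r)))))) =
      msum e (\<lambda>c' d. SS [] c' (\<lambda>k. msum d (\<lambda>c' d. SS [] d (\<lambda>r. f (l @ SS [] c \<phi> # k @ y c' # r)))))" for c e l y
    by (rule SS_hom[of "\<lambda>z. msum e (\<lambda>c' d. SS [] c' (\<lambda>k. msum d (\<lambda>c' d. SS [] d (\<lambda>r. f (l @ z # k @ y c' # r)))))", symmetric])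
      (simp_all only: multilinear_zero[OF f] multilinear_add[OF f] SS_0 SS_add msum_0 msum_add)
  have "SS [] m (brace f p \<phi> q \<psi>) = msum m (\<lambda>a b. SS [] a (\<lambda>l. msum b (\<lambda>c d. SS [] c (\<lambda>u.
      msum d (\<lambda>c d. SS [] c (\<lambda>m. msum d (\<lambda>c d. SS [] c (\<lambda>v. SS [] d (\<lambda>r.
      f (l @ \<phi> u # map (T p) m @ \<psi> (map (T p) v) # map (T (p + q)) r))))))))))"
    unfolding brace_def[abs_def] by (simp only: SS_deconcat ss.simps)
  also have "\<dots> = msum m (\<lambda>a b. SS [] a (\<lambda>l. msum b (\<lambda>c d.
      msum d (\<lambda>c' d. SS [] c' (\<lambda>k. msum d (\<lambda>c' d. SS [] d (\<lambda>r. f (l @ SS [] c \<phi> # k @ SS [] c' \<psi> # r))))))))"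
    by (simp only: tw_r tw_v E1 tw_m E2)
  finally show ?thesis by (simp only: SS.simps)
qed

definition smul :: "'r mfps => (nat multiset => 'a) => nat multiset => 'a" where
  "smul r \<alpha> m = msum m (\<lambda>a b. mfps_coeff r a *s \<alpha> b)"

definition cst :: "'a => nat multiset => 'a" where
  "cst a m = (if m = {#} then a else 0)"

lemma scale_msum: "c *s msum m f = msum m (\<lambda>a b. c *s f a b)"
  by (rule msum_hom) (simp_all add: scale_right_distrib)

lemma scale_SS: "c *s SS \<alpha>s m f = SS \<alpha>s m (\<lambda>l. c *s f l)"
  by (rule SS_hom) (simp_all add: scale_right_distrib)

lemma multilinear_msum: "multilinear scale f ==> f (l @ msum m g # r) = msum m (\<lambda>a b. f (l @ g a b # r))"
  by (rule msum_hom[of "\<lambda>x. f (l @ x # r)"]) (simp_all add: multilinear_zero multilinear_add)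

lemma SS_smul:
  assumes f: "multilinear scale f"
  shows "SS (\<alpha>s @ smul r \<alpha> # \<gamma>s) m f = smul r (\<lambda>m. SS (\<alpha>s @ \<alpha> # \<gamma>s) m f) m"
proof -
  have "SS (\<alpha>s @ smul r \<alpha> # \<gamma>s) m f = msum m (\<lambda>a x. msum x (\<lambda>c d. msum c (\<lambda>e c'. mfps_coeff r e *s
      SS \<alpha>s a (\<lambda>l. SS \<gamma>s d (\<lambda>l'. f (l @ \<alpha> c' # l'))))))"
    unfolding SS_concat
    by (simp only: smul_def multilinear_msum[OF f] multilinear_scale[OF f] SS_msum scale_SS)
  also have "\<dots> = msum m (\<lambda>a x. msum x (\<lambda>e y. msum y (\<lambda>c' d. mfps_coeff r e *s
      SS \<alpha>s a (\<lambda>l. SS \<gamma>s d (\<lambda>l'. f (l @ \<alpha> c' # l'))))))"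
    by (simp only: msum_assoc)
  also have "\<dots> = msum m (\<lambda>e x. msum x (\<lambda>a y. msum y (\<lambda>c' d. mfps_coeff r e *s
      SS \<alpha>s a (\<lambda>l. SS \<gamma>s d (\<lambda>l'. f (l @ \<alpha> c' # l'))))))"
    by (rule msum_exchange)
  finally show ?thesis by (simp only: smul_def SS_concat scale_msum)
qed

lemma SS_plus:
  assumes f: "multilinear scale f"
  shows "SS (\<alpha>s @ (\<lambda>m. \<alpha> m + \<beta> m) # \<gamma>s) m f = SS (\<alpha>s @ \<alpha> # \<gamma>s) m f + SS (\<alpha>s @ \<beta> # \<gamma>s) m f"
  unfolding SS_concat by (simp only: multilinear_add[OF f] SS_add msum_add)

lemma SS_cst:
  assumes f: "multilinear scale f"
  shows "SS (cst a # \<alpha>s) m f = msum m (\<lambda>x y. wsum x (\<lambda>u. SS \<alpha>s y (\<lambda>l. f (map v u @ a # l))))"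
proof -
  have "msum x (\<lambda>c d. SS \<alpha>s d (\<lambda>l. f (map v u @ cst a c # l))) = SS \<alpha>s x (\<lambda>l. f (map v u @ a # l))" for x u
  proof -
    have "(\<lambda>c d. SS \<alpha>s d (\<lambda>l. f (map v u @ cst a c # l))) =
        (\<lambda>c d. if c = {#} then SS \<alpha>s d (\<lambda>l. f (map v u @ a # l)) else 0)"
      by (auto simp: fun_eq_iff cst_def multilinear_zero[OF f])
    thus ?thesis by (simp only: msum_single)
  qed
  thus ?thesis by simp
qed

lemma sum_Sigma_fst:
  fixes G :: "'c => 'a"
  assumes "finite B" "\<And>w. w \<in> B ==> finite (C w)"
  shows "(\<Sum>z\<in>Sigma B C. G (fst z)) = (\<Sum>w\<in>B. of_nat (card (C w)) *s G w)"
proof -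
  have "(\<Sum>z\<in>Sigma B C. G (fst z)) = (\<Sum>w\<in>B. \<Sum>p\<in>C w. G w)"
    using sum.Sigma[of B C "\<lambda>w _. G w"] assms by (simp add: split_beta)
  thus ?thesis by (simp only: sum_constant_scale)
qed

text \<open>A word of content \<open>add_mset i m\<close> arises once for each of its letters
  \<open>i\<close>, that is, \<open>count m i + 1\<close> times: the coefficient of a partial
  derivative.\<close>

lemma wsum_mark:
  fixes G :: "nat list => 'a"
  shows "wsum m (\<lambda>w. ss w (\<lambda>u u'. G (u @ i # u'))) = of_nat (count m i + 1) *s wsum (add_mset i m) G"
proof -
  have "wsum m (\<lambda>w. ss w (\<lambda>u u'. G (u @ i # u'))) =
      (\<Sum>z\<in>(SIGMA w:{w. mset w = m}. {p. fst p @ snd p = w}). G (fst (snd z) @ i # snd (snd z)))"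
    unfolding wsum_def ss_sum by (subst sum.Sigma) (auto simp: finite_words finite_splits split_beta)
  also have "\<dots> = (\<Sum>z\<in>(SIGMA w:{w. mset w = add_mset i m}. {(u, u'). u @ i # u' = w}). G (fst z))"
    by (rule sum.reindex_bij_witness[where i = "\<lambda>(w, (u, u')). (u @ u', (u, u'))" and j = "\<lambda>(w, (u, u')). (u @ i # u', (u, u'))"]) auto
  also have "\<dots> = (\<Sum>w | mset w = add_mset i m. of_nat (card {(u, u'). u @ i # u' = w}) *s G w)"
    by (rule sum_Sigma_fst) (auto simp: finite_words card_splits_at)
  also have "\<dots> = (\<Sum>w | mset w = add_mset i m. of_nat (count m i + 1) *s G w)"
    by (rule sum.cong) (auto simp: card_splits_at)
  finally show ?thesis by (simp only: wsum_def scale_sum_right)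
qed

lemma wsum_mark2:
  fixes G :: "nat list => 'a"
  shows "wsum m (\<lambda>w. ss w (\<lambda>u x. ss x (\<lambda>u' u''. G (u @ i # u' @ j # u'')))) =
    wsum (add_mset i (add_mset j m)) (\<lambda>w. of_nat (card (splits_at2 i j w)) *s G w)"
proof -
  have "wsum m (\<lambda>w. ss w (\<lambda>u x. ss x (\<lambda>u' u''. G (u @ i # u' @ j # u'')))) =
      wsum m (\<lambda>w. \<Sum>(u, u', u'')\<in>splits3 w. G (u @ i # u' @ j # u''))"
    by (simp only: sum_splits3)
  also have "\<dots> = (\<Sum>z\<in>(SIGMA w:{w. mset w = m}. splits3 w). case z of (w, u, u', u'') => G (u @ i # u' @ j # u''))"
    unfolding wsum_def by (subst sum.Sigma) (auto simp: finite_words finite_splits3 split_beta)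
  also have "\<dots> = (\<Sum>z\<in>(SIGMA w:{w. mset w = add_mset i (add_mset j m)}. splits_at2 i j w). G (fst z))"
    by (rule sum.reindex_bij_witness[where i = "\<lambda>(w, (u, u', u'')). (u @ u' @ u'', (u, u', u''))"
          and j = "\<lambda>(w, (u, u', u'')). (u @ i # u' @ j # u'', (u, u', u''))"])
      (auto simp: splits3_def splits_at2_def)
  also have "\<dots> = (\<Sum>w | mset w = add_mset i (add_mset j m). of_nat (card (splits_at2 i j w)) *s G w)"
    by (rule sum_Sigma_fst) (auto simp: finite_words finite_splits_at2)
  finally show ?thesis by (simp only: wsum_def)
qed

lemma SS_v:
  assumes f: "multilinear scale f"
  shows "SS [cst (v i)] m f = of_nat (count m i + 1) *s wsum (add_mset i m) (\<lambda>w. f (map v w))"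
  unfolding wsum_mark[symmetric] SS_cst[OF f] wsum_ss by (simp only: SS.simps map_append list.map)

lemma SS_v_v:
  assumes f: "multilinear scale f"
  shows "SS [cst (v i), cst (v j)] m f =
    wsum (add_mset i (add_mset j m)) (\<lambda>w. of_nat (card (splits_at2 i j w)) *s f (map v w))"
proof -
  have "SS [cst (v j)] m (\<lambda>l. f (map v u @ v i # l)) =
      wsum m (\<lambda>w. ss w (\<lambda>u' u''. f (map v (u @ i # u' @ j # u''))))" for u m
  proof -
    have ml: "multilinear scale (\<lambda>l. f (map v u @ v i # l))"
      using multilinear_add[OF f, of "map v u @ v i # _", simplified]
        multilinear_scale[OF f, of "map v u @ v i # _", simplified]
      by (intro multilinearI) simp_all
    show ?thesis unfolding SS_cst[OF ml] by (simp add: wsum_ss)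
  qed
  thus ?thesis
    unfolding wsum_mark2[symmetric] SS_cst[OF f] by (simp add: wsum_ss)
qed

lemma SS_cong: "(\<And>l. length l \<ge> length \<alpha>s ==> f l = g l) ==> SS \<alpha>s m f = SS \<alpha>s m g"
proof (induction \<alpha>s arbitrary: m f g)
  case Nil
  thus ?case by simp
next
  case (Cons \<alpha> \<alpha>s)
  have "SS \<alpha>s d (\<lambda>l. f (map v u @ \<alpha> c # l)) = SS \<alpha>s d (\<lambda>l. g (map v u @ \<alpha> c # l))" for u c d
    by (rule Cons.IH) (auto intro: Cons.prems)
  thus ?case by simp
qed

lemma wsum_nil: "(\<And>w. w \<noteq> [] ==> G w = 0) ==> wsum m G = (if m = {#} then G [] else 0)"
proof -
  assume G: "\<And>w. w \<noteq> [] ==> G w = 0"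
  show ?thesis
  proof (cases "m = {#}")
    case True
    thus ?thesis by (simp add: wsum_def)
  next
    case False
    hence "w \<noteq> []" if "mset w = m" for w using that by auto
    with G False show ?thesis by (auto simp: wsum_def intro!: sum.neutral)
  qed
qed

lemma SS_single:
  assumes "\<And>l. length l \<noteq> 1 ==> g l = 0"
  shows "SS [\<alpha>] m g = g [\<alpha> m]"
proof -
  have 1: "wsum d (\<lambda>w. g (map v u @ \<alpha> c # map v w)) = (if d = {#} then g (map v u @ [\<alpha> c]) else 0)" for d u c
    by (subst wsum_nil) (auto intro: assms)
  have 2: "msum x (\<lambda>c d. if d = {#} then g (map v u @ [\<alpha> c]) else 0) = g (map v u @ [\<alpha> x])" for x u
    by (subst msum_commute) (rule msum_single)
  have 3: "wsum a (\<lambda>u. g (map v u @ [\<alpha> x])) = (if a = {#} then g [\<alpha> x] else 0)" for a x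
    by (subst wsum_nil) (auto intro: assms)
  show ?thesis by (simp only: SS.simps 1 2 3 msum_single)
qed

lemma \<mu>_unit: "unit \<in> set as ==> length as \<noteq> 2 ==> \<mu> as = 0"
  by (rule unit_strict)

text \<open>Strict unitality survives the insertion of copies of b, since the operation already has
  three inputs.\<close>

lemma SS_unit_many:
  assumes "length \<alpha>s + length \<gamma>s \<ge> 2"
  shows "SS (\<alpha>s @ cst unit # \<gamma>s) m \<mu> = 0"
proof -
  have "SS \<alpha>s a (\<lambda>l. SS \<gamma>s d (\<lambda>l'. \<mu> (l @ cst unit c # l'))) = 0" for a c d
  proof -
    have "SS \<alpha>s a (\<lambda>l. SS \<gamma>s d (\<lambda>l'. \<mu> (l @ cst unit c # l'))) = SS \<alpha>s a (\<lambda>l. SS \<gamma>s d (\<lambda>l'. 0))"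
      using assms
      by (intro SS_cong) (auto simp: cst_def multilinear_zero[OF multilinear] intro!: \<mu>_unit)
    thus ?thesis by simp
  qed
  thus ?thesis by (simp add: SS_concat)
qed

lemma \<mu>_unit_left: "\<mu> [unit, a] = - tw a"
proof -
  obtain b c where bc: "b \<in> X 0" "c \<in> X 1" "a = b + c" using grading_span by metis
  have "\<mu> [unit, b + c] = \<mu> [unit, b] + \<mu> [unit, c]"
    using multilinear_add[OF multilinear, of "[unit]" b c "[]"] by simp
  also have "\<dots> = b - c" using unit_left[OF bc(1)] unit_left[OF bc(2)] by (simp, metis add.inverse_inverse add_uminus_conv_diff)
  finally show ?thesis using bc by (simp add: twist_eq)
qed

lemma SS_unit_left: "SS [cst unit, \<alpha>] m \<mu> = - tw (\<alpha> m)"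
proof -
  have 1: "wsum x (\<lambda>u. SS [\<alpha>] y (\<lambda>l. \<mu> (map v u @ unit # l))) = (if x = {#} then SS [\<alpha>] y (\<lambda>l. \<mu> (unit # l)) else 0)" for x y
  proof (subst wsum_nil)
    fix u :: "nat list" assume "u \<noteq> []"
    hence "SS [\<alpha>] y (\<lambda>l. \<mu> (map v u @ unit # l)) = SS [\<alpha>] y (\<lambda>l. 0)"
      by (intro SS_cong) (cases u, auto intro!: \<mu>_unit)
    thus "SS [\<alpha>] y (\<lambda>l. \<mu> (map v u @ unit # l)) = 0" by simp
  qed auto
  have "SS [cst unit, \<alpha>] m \<mu> = SS [\<alpha>] m (\<lambda>l. \<mu> (unit # l))"
    unfolding SS_cst[OF multilinear] 1 by (rule msum_single)
  also have "\<dots> = \<mu> [unit, \<alpha> m]" by (rule SS_single) (auto intro!: \<mu>_unit)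
  finally show ?thesis by (simp only: \<mu>_unit_left)
qed

section \<open>The disc potential\<close>

abbreviation "pot \<equiv> disc_potential scale X F n \<mu> unit \<theta>"

lemma F_0_unit: "a \<in> F 0 ==> a = coord a {} *s unit"
proof -
  assume a: "a \<in> F 0"
  have "coord a S = 0" if "S \<subseteq> {..<n}" "S \<noteq> {}" for S
    using coord_F[OF a, of S] that finite_subset[of S "{..<n}"] by (auto simp: card_gt_0_iff)
  hence "comb (coord a) = (\<Sum>S\<in>{{}}. coord a S *s e S)"
    by (intro sum.mono_neutral_right) auto
  thus ?thesis by (simp add: coord_comb e_empty)
qed

lemma unit_scale_inj: "c *s unit = c' *s unit ==> c = c'"
proof -
  assume eq: "c *s unit = c' *s unit"
  have 1: "coord unit {} = 1" using coord_e[of "{}" "{}"] by (simp add: e_empty)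
  have "c * coord unit {} = c' * coord unit {}" by (simp only: coord_scale[symmetric] eq)
  thus "c = c'" unfolding 1 by simp
qed

lemma words_degree: "sum_list (map (\<lambda>_. 1) w) - int (length (map v w)) + 2 = 2"
proof -
  have "sum_list (map (\<lambda>_. 1) w) = int (length w)"
    by (induction w) (simp_all only: list.map sum_list.Nil sum_list.Cons list.size of_nat_0 of_nat_Suc of_nat_add of_nat_1 add.commute)
  thus ?thesis by (simp only: length_map diff_self add_0)
qed

text \<open>The sum is even and lies in \<open>F 2\<close>. Its leading term there vanishes:
  operations of other arities have none, and for two letters it is a wedge of two generators, which
  is zero for equal letters and otherwise cancels against the exchanged word. So the sum lies in
  \<open>F 1\<close>, and parity lowers it to \<open>F 0\<close>, the multiples of the unit.\<close>

lemma words_F_0: "wsum m (\<lambda>w. \<mu> (map v w)) \<in> F 0"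
proof -
  have m2: "\<mu> (map v w) \<in> F 2" "\<mu> (map v w) \<in> X 2" for w
  proof -
    have "list_all2 (\<lambda>a p. a \<in> F p) (map v w) (map (\<lambda>_. 1) w)" "list_all2 (\<lambda>a p. a \<in> X p) (map v w) (map (\<lambda>_. 1) w)"
      by (simp_all add: list_all2_conv_all_nth v_F v_X)
    from \<mu>_F[OF this(1)] \<mu>_X[OF this(2)] show "\<mu> (map v w) \<in> F 2" "\<mu> (map v w) \<in> X 2" by (simp_all only: words_degree)
  qed
  have S: "wsum m (\<lambda>w. \<mu> (map v w)) \<in> F 2" "wsum m (\<lambda>w. \<mu> (map v w)) \<in> X 2"
    unfolding wsum_def by (rule F_sum[OF m2(1)], rule X_sum[OF m2(2)])
  have "wsum m (\<lambda>w. \<mu> (map v w)) \<in> F 1"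
  proof (cases "size m = 2")
    case False
    have "\<mu> (map v w) \<in> F 1" if "mset w = m" for w
    proof -
        have len: "length (map v w) \<noteq> 2" using False that by auto
      have la: "list_all2 (\<lambda>a p. a \<in> F p) (map v w) (map (\<lambda>_. 1) w)"
        by (simp add: list_all2_conv_all_nth v_F)
      have r: "2 = sum_list (map (\<lambda>_. 1) w) - int (length (map v w)) + 2" by (simp only: words_degree)
      from leading_term_other[OF la len r] have "\<theta> 2 (gr_class F 2 (\<mu> (map v w))) = \<zero>\<^bsub>exterior_alg n\<^esub>" .
      hence "lead 2 (\<mu> (map v w)) = (\<lambda>S. 0)"
        by (intro lead_eqI m2 ext.FK_zero) (simp add: exterior_simps ext.J_zero)
      thus ?thesis using lead_zero_iff[OF m2(1)[of w]] by simp
    qed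
    thus ?thesis unfolding wsum_def by (rule F_sum) simp
  next
    case True
    obtain w where "mset w = m" using ex_mset by blast
    moreover from this True have "length w = 2" by auto
    then obtain i j where "w = [i, j]" by (auto simp: length_Suc_conv numeral_2_eq_2)
    ultimately have ij: "m = {#i, j#}" by simp
    have "lead 2 (wsum m (\<lambda>w. \<mu> (map v w))) = (\<lambda>S. 0)"
    proof (cases "i < n \<and> j < n")
      case True
      have l: "lead 2 (\<mu> [v i, v j]) = (\<lambda>S. - wedge i (wedge j (basis_fun {})) S)" if "i < n" "j < n" for i j
      proof -
        have "wedge j (basis_fun {}) = (basis_fun {j} :: nat set => 'r)"
          using cliff_basis[of "{}" j "\<lambda>_ _. 0 :: 'r"] by (simp add: cliff_0)
        with lead_mult(2)[OF v_F v_F, of i j] that show ?thesis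
          by (simp add: lead_v ext.star_basis_left cliff_0)
      qed
      show ?thesis
      proof (cases "i = j")
        case True
        hence "{w. mset w = m} = {[i, i]}"
          using mset_pair_words[of i j] ij by simp
        hence "wsum m (\<lambda>w. \<mu> (map v w)) = \<mu> [v i, v i]" by (simp add: wsum_def)
        with l[of i i] \<open>i < n \<and> j < n\<close> show ?thesis by (simp add: wedge_self)
      next
        case False
        hence "{w. mset w = m} = {[i, j], [j, i]}"
          using mset_pair_words[of i j] ij by simp
        hence "wsum m (\<lambda>w. \<mu> (map v w)) = \<mu> [v i, v j] + \<mu> [v j, v i]" using False by (simp add: wsum_def)
        with l[of i j] l[of j i] \<open>i < n \<and> j < n\<close> lead_add[OF m2(1)[of "[i, j]"] m2(1)[of "[j, i]"]]
        show ?thesis by (simp add: wedge_wedge[of i j])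
      qed
    next
      case False
      have "\<mu> (map v w) = 0" if "mset w = m" for w
      proof -
        from False ij obtain k where "k \<in># m" "\<not> k < n" by auto
        with that obtain u u' where "w = u @ k # u'" by (metis in_multiset_in_set split_list)
        with \<open>\<not> k < n\<close> show ?thesis by (simp add: v_def[of k] multilinear_zero[OF multilinear])
      qed
      thus ?thesis by (simp add: wsum_def lead_0)
    qed
    thus ?thesis using lead_zero_iff[OF S(1)] by simp
  qed
  thus ?thesis using F_X_step[of 1 2] S(2) by simp
qed

lemma pot_eq: "wsum m (\<lambda>w. \<mu> (map v w)) = mfps_coeff pot m *s unit"
proof (cases "size m \<ge> 2 \<and> set_mset m \<subseteq> {..<n}")
  case True
  have eq: "(\<Sum>w | mset w = m. \<mu> (map (basis_lift X F n \<theta>) w)) = wsum m (\<lambda>w. \<mu> (map v w))"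
    unfolding wsum_def
  proof (rule sum.cong[OF refl])
    fix w assume "w \<in> {w. mset w = m}"
    with True have "\<And>i. i \<in> set w ==> i < n" by auto
    thus "\<mu> (map (basis_lift X F n \<theta>) w) = \<mu> (map v w)"
      by (intro arg_cong[of _ _ \<mu>] map_cong refl) (simp add: v_def)
  qed
  let ?s = "wsum m (\<lambda>w. \<mu> (map v w))"
  have "(THE c. c *s unit = ?s) *s unit = ?s"
    by (rule theI[of "\<lambda>c. c *s unit = ?s" "coord ?s {}"])
      (use F_0_unit[OF words_F_0[of m]] unit_scale_inj in metis)+
  with True show ?thesis unfolding disc_potential_def mfps_coeff_Abs eq by simp
next
  case False
  have "\<mu> (map v w) = 0" if w: "mset w = m" for w
  proof (cases "size m \<ge> 2")
    case True
    with False obtain k where "k \<in># m" "\<not> k < n" by auto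
    with w obtain u u' where "w = u @ k # u'" by (metis in_multiset_in_set split_list)
    with \<open>\<not> k < n\<close> show ?thesis by (simp add: v_def[of k] multilinear_zero[OF multilinear])
  next
    case False
    with w have "length w < 2" by auto
    thus ?thesis using uncurved minimal by (cases w) (auto simp: less_2_cases_iff)
  qed
  hence "wsum m (\<lambda>w. \<mu> (map v w)) = 0" by (simp add: wsum_def)
  moreover have "mfps_coeff pot m = 0" unfolding disc_potential_def mfps_coeff_Abs using False by (simp only: if_False)
  ultimately show ?thesis by simp
qed

lemma smul_cst: "smul r (cst a) m = mfps_coeff r m *s a"
proof -
  have "smul r (cst a) m = msum m (\<lambda>b c. if b = {#} then mfps_coeff r c *s a else 0)"
    unfolding smul_def by (subst msum_commute) (auto simp: cst_def intro!: msum_cong)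
  thus ?thesis by (simp only: msum_single)
qed

lemma \<mu>_v: "SS [cst (v i)] m \<mu> = smul (mfps_deriv i pot) (cst unit) m"
  unfolding SS_v[OF multilinear] pot_eq smul_cst by (simp add: mfps_deriv_def)

lemma \<mu>_v_self: "SS [cst (v i), cst (v i)] m \<mu> = smul (mfps_half_deriv2 i pot) (cst unit) m"
proof -
  have "SS [cst (v i), cst (v i)] m \<mu> = wsum (add_mset i (add_mset i m))
      (\<lambda>w. of_nat ((count m i + 2) * (count m i + 1) div 2) *s \<mu> (map v w))"
    unfolding SS_v_v[OF multilinear] wsum_def
    by (rule sum.cong) (auto simp: card_splits_at2_self)
  also have "\<dots> = of_nat ((count m i + 2) * (count m i + 1) div 2) *s mfps_coeff pot (add_mset i (add_mset i m)) *s unit"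
    unfolding pot_eq[symmetric] by (simp only: wsum_def scale_sum_right)
  finally show ?thesis by (simp add: smul_cst mfps_half_deriv2_def)
qed

lemma \<mu>_v_pair:
  assumes "i \<noteq> j"
  shows "SS [cst (v i), cst (v j)] m \<mu> + SS [cst (v j), cst (v i)] m \<mu> =
    smul (mfps_deriv i (mfps_deriv j pot)) (cst unit) m"
proof -
  let ?N = "(count m i + 1) * (count m j + 1)"
  have "SS [cst (v i), cst (v j)] m \<mu> + SS [cst (v j), cst (v i)] m \<mu> =
      wsum (add_mset i (add_mset j m)) (\<lambda>w. of_nat ?N *s \<mu> (map v w))"
    unfolding SS_v_v[OF multilinear] add_mset_commute[of j i] wsum_def sum.distrib[symmetric]
      scale_left_distrib[symmetric] of_nat_add[symmetric] card_splits_at2_pair[OF assms]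
    using assms by (intro sum.cong) auto
  also have "\<dots> = of_nat ?N *s mfps_coeff pot (add_mset i (add_mset j m)) *s unit"
    unfolding pot_eq[symmetric] by (simp only: wsum_def scale_sum_right)
  finally show ?thesis using assms by (simp add: smul_cst mfps_deriv_def add_mset_commute algebra_simps)
qed

end

section \<open>Algebraic Morse theory\<close>

text \<open>The hypothesis \<open>step\<close> says that the matrix of \<open>D\<close> from the
  cells of \<open>Low\<close> to their partners is triangular for \<open>R\<close> with signs on the
  diagonal. Its kernel vanishes by well-founded induction.\<close>

lemma morse_unique:
  fixes D :: "('i => 'a::ab_group_add) => 'i => 'a"
  assumes wf: "wf R"
    and step: "\<And>T g. T \<in> Low ==> (\<And>U. G U (g U)) ==> (\<And>U. U \<notin> Low ==> g U = 0) ==>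
      (\<And>U. (U, T) \<in> R ==> g U = 0) ==> D g (m T) = sg (\<epsilon> T) (g T)"
    and G: "\<And>U. G U (\<psi> U)"
    and off: "\<And>U. U \<notin> Low ==> \<psi> U = 0" and zero: "\<And>T. T \<in> Low ==> D \<psi> (m T) = 0"
  shows "\<psi> T = 0"
  using wf
proof (induction T)
  case (less T)
  show ?case
  proof (cases "T \<in> Low")
    case True
    hence "sg (\<epsilon> T) (\<psi> T) = 0" using step[OF True G off less] zero by metis
    thus ?thesis by (simp add: sg_def split: if_splits)
  qed (rule off)
qed

lemma morse_ex:
  fixes D :: "('i => 'a::ab_group_add) => 'i => 'a"
  assumes wf: "wf R"
    and step: "\<And>T g. T \<in> Low ==> (\<And>U. G U (g U)) ==> (\<And>U. U \<notin> Low ==> g U = 0) ==>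
      (\<And>U. (U, T) \<in> R ==> g U = 0) ==> D g (m T) = sg (\<epsilon> T) (g T)"
    and diff: "\<And>g h T. D (\<lambda>U. g U - h U) T = D g T - D h T"
    and G_D: "\<And>g T. (\<And>U. G U (g U)) ==> T \<in> Low ==> G T (D g (m T))"
    and G_0: "\<And>T. G T 0" and G_diff: "\<And>T x y. G T x ==> G T y ==> G T (x - y)"
    and G_\<phi>: "\<And>T. T \<in> Low ==> G T (\<phi> T)"
  shows "\<exists>\<psi>. (\<forall>T. G T (\<psi> T)) \<and> (\<forall>T. T \<notin> Low \<longrightarrow> \<psi> T = 0) \<and> (\<forall>T\<in>Low. D \<psi> (m T) = \<phi> T)"
proof -
  define cut where "cut \<psi> T = (\<lambda>U. if (U, T) \<in> R then \<psi> U else (0 :: 'a))" for \<psi> T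
  have "\<exists>\<psi>. \<forall>T. \<psi> T = (if T \<in> Low then sg (\<epsilon> T) (\<phi> T - D (cut \<psi> T) (m T)) else 0)"
  proof (rule dependent_wf_choice[OF wf])
    fix \<psi> \<psi>' :: "'i => 'a" and T r
    assume "\<And>U. (U, T) \<in> R ==> \<psi> U = \<psi>' U"
    hence "cut \<psi> T = cut \<psi>' T" by (auto simp: cut_def fun_eq_iff)
    thus "(r = (if T \<in> Low then sg (\<epsilon> T) (\<phi> T - D (cut \<psi> T) (m T)) else 0)) =
        (r = (if T \<in> Low then sg (\<epsilon> T) (\<phi> T - D (cut \<psi>' T) (m T)) else 0))" by simp
  qed simp
  then obtain \<psi> where \<psi>: "\<And>T. \<psi> T = (if T \<in> Low then sg (\<epsilon> T) (\<phi> T - D (cut \<psi> T) (m T)) else 0)"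
    by metis
  have G: "G T (\<psi> T)" for T
    using wf
  proof (induction T)
    case (less T)
    have cutG: "G U (cut \<psi> T U)" for U using less G_0 by (simp add: cut_def)
    have neg: "G T x ==> G T (- x)" for x using G_diff[OF G_0, of T x] by simp
    show ?case
    proof (cases "T \<in> Low")
      case True
      from G_diff[OF G_\<phi>[OF True] G_D[OF cutG True]]
      have "G T (sg (\<epsilon> T) (\<phi> T - D (cut \<psi> T) (m T)))" using neg unfolding sg_def by presburger
      thus ?thesis using True by (subst \<psi>) simp
    next
      case False
      thus ?thesis using G_0 by (subst \<psi>) simp
    qed
  qed
  have "D \<psi> (m T) = \<phi> T" if T: "T \<in> Low" for T
  proof -
    let ?h = "\<lambda>U. \<psi> U - cut \<psi> T U"
    \<comment> \<open>The difference of the solution and its cut-off vanishes below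
      \<open>T\<close>, so the triangularity applies to it.\<close>
    have "D ?h (m T) = sg (\<epsilon> T) (?h T)"
    proof (rule step[OF T])
      show "G U (\<psi> U - cut \<psi> T U)" for U
        by (rule G_diff[OF G]) (simp add: cut_def G G_0)
      show "\<psi> U - cut \<psi> T U = 0" if "U \<notin> Low" for U using that \<psi>[of U] by (simp add: cut_def)
      show "\<psi> U - cut \<psi> T U = 0" if "(U, T) \<in> R" for U using that by (simp add: cut_def)
    qed
    moreover have c: "cut \<psi> T T = 0" using wf by (simp add: cut_def)
    ultimately have "D \<psi> (m T) - D (cut \<psi> T) (m T) = sg (\<epsilon> T) (\<psi> T)" by (simp add: diff c)
    also have "\<dots> = \<phi> T - D (cut \<psi> T) (m T)" using T by (subst \<psi>) (simp add: sg_def)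
    finally show ?thesis by simp
  qed
  moreover have "\<psi> T = 0" if "T \<notin> Low" for T using that \<psi>[of T] by simp
  ultimately show ?thesis using G by blast
qed

text \<open>For the terms of the differential in which \<mu>^2 multiplies a value of the cochain by
  the first or the last input.\<close>

lemma ss_ends:
  assumes T: "T = a # rest" "T = init @ [z]"
    and H: "\<And>l m r. l @ m @ r = T ==> length m + 1 \<noteq> length T ==> H l m r = 0"
  shows "ss T (\<lambda>l x. ss x (\<lambda>m r. H l m r)) = H [a] rest [] + (H [] init [z] :: 'b::comm_monoid_add)"
proof -
  have "(\<Sum>(l, m, r)\<in>splits3 T. H l m r) = (\<Sum>(l, m, r)\<in>{([a], rest, []), ([], init, [z])}. H l m r)"
  proof (rule sum.mono_neutral_right)
    show "{([a], rest, []), ([], init, [z])} \<subseteq> splits3 T" using T by (auto simp: splits3_def)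
    show "\<forall>x\<in>splits3 T - {([a], rest, []), ([], init, [z])}. (case x of (l, m, r) => H l m r) = 0"
    proof
      fix x assume x: "x \<in> splits3 T - {([a], rest, []), ([], init, [z])}"
      obtain l m r where xl: "x = (l, m, r)" by (cases x)
      with x have lmr: "(l, m, r) \<in> splits3 T" "(l, m, r) \<notin> {([a], rest, []), ([], init, [z])}" by blast+
      hence e: "l @ m @ r = T" by (simp add: splits3_def)
      have "length m + 1 \<noteq> length T"
      proof
        assume "length m + 1 = length T"
        with e have "length l + length r = 1" by auto
        then consider "l = []" "length r = 1" | "length l = 1" "r = []" by (cases l) auto
        thus False
        proof cases
          case 1
          then obtain y where "r = [y]" by (auto simp: length_Suc_conv)
          with 1 e T(2) lmr(2) show False by auto
        next
          case 2
          then obtain y where "l = [y]" by (auto simp: length_Suc_conv)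
          with 2 e T(1) lmr(2) show False by auto
        qed
      qed
      thus "(case x of (l, m, r) => H l m r) = 0" using H[OF e] xl by simp
    qed
  qed (rule finite_splits3)
  thus ?thesis by (simp add: sum_splits3)
qed

text \<open>For the terms of the differential in which \<mu>^2 multiplies two neighbouring
  inputs.\<close>

lemma ss_pairs:
  assumes H: "\<And>l m r. l @ m @ r = T ==> length m \<noteq> 2 ==> H l m r = 0" and k: "length T = Suc k"
  shows "ss T (\<lambda>l x. ss x (\<lambda>m r. H l m r)) =
    (\<Sum>i<k. H (take i T) [T ! i, T ! Suc i] (drop (i + 2) T) :: 'b::comm_monoid_add)"
proof -
  let ?f = "\<lambda>i. (take i T, [T ! i, T ! Suc i], drop (i + 2) T)"
  have d: "take i T @ [T ! i, T ! Suc i] @ drop (i + 2) T = T" if "i < k" for i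
    using that k id_take_nth_drop[of i T] Cons_nth_drop_Suc[of "Suc i" T] by simp
  have "(\<Sum>(l, m, r)\<in>splits3 T. H l m r) = (\<Sum>(l, m, r)\<in>?f ` {..<k}. H l m r)"
  proof (rule sum.mono_neutral_right)
    show "?f ` {..<k} \<subseteq> splits3 T" using d by (auto simp: splits3_def)
    show "\<forall>x\<in>splits3 T - ?f ` {..<k}. (case x of (l, m, r) => H l m r) = 0"
    proof
      fix x assume x: "x \<in> splits3 T - ?f ` {..<k}"
      obtain l m r where xl: "x = (l, m, r)" by (cases x)
      with x have lmr: "(l, m, r) \<in> splits3 T" "(l, m, r) \<notin> ?f ` {..<k}" by blast+
      hence e: "l @ m @ r = T" by (simp add: splits3_def)
      have "length m \<noteq> 2"
      proof
        assume "length m = 2"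
        then obtain x y where m: "m = [x, y]" by (auto simp: length_Suc_conv numeral_2_eq_2)
        with e k have "(l, m, r) = ?f (length l)" "length l < k" by (auto simp: nth_append)
        with lmr(2) show False by blast
      qed
      thus "(case x of (l, m, r) => H l m r) = 0" using H[OF e] xl by simp
    qed
  qed (rule finite_splits3)
  also have "\<dots> = (\<Sum>i<k. H (take i T) [T ! i, T ! Suc i] (drop (i + 2) T))"
  proof (subst sum.reindex)
    show "inj_on ?f {..<k}"
    proof (rule inj_onI)
      fix i j assume "i \<in> {..<k}" "j \<in> {..<k}" "?f i = ?f j"
      hence "length (take i T) = length (take j T)" "i < k" "j < k" by auto
      with k show "i = j" by simp
    qed
  qed simp
  finally show ?thesis by (simp add: sum_splits3)
qed

context superfiltered_deformation
begin

section \<open>Cochains and their values on basis elements\<close>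

text \<open>The multilinear extension of a function on words in the basis; the basis element
  \<open>e S\<close> is encoded by its index set. Cochains are thereby functions on a discrete set
  of cells, as the matchings require.\<close>

primrec cext :: "'a list => (nat set list => 'a) => 'a" where
  "cext [] g = g []"
| "cext (a # as) g = (\<Sum>S\<in>Pow {..<n}. coord a S *s cext as (\<lambda>Ts. g (S # Ts)))"

definition cx :: "(nat set list => 'a) => 'a list => 'a" where "cx g as = cext as g"

definition valid :: "nat set list => bool" where "valid Ts \<longleftrightarrow> set Ts \<subseteq> Pow {..<n}"

lemma cext_add: "cext (l @ (a + b) # r) g = cext (l @ a # r) g + cext (l @ b # r) g"
  by (induction l arbitrary: g) (simp_all add: coord_add scale_left_distrib scale_right_distrib sum.distrib)

lemma cext_scale: "cext (l @ (c *s a) # r) g = c *s cext (l @ a # r) g"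
  by (induction l arbitrary: g) (simp_all add: coord_scale scale_sum_right mult.commute)

lemma multilinear_cx: "multilinear scale (cx g)"
  unfolding cx_def by (rule multilinearI) (simp_all add: cext_add cext_scale)

lemma cext_e: "valid Ts ==> cext (map e Ts) g = g Ts"
proof (induction Ts arbitrary: g)
  case (Cons S Ts)
  have "cext (map e (S # Ts)) g = (\<Sum>W\<in>Pow {..<n}. if W = S then cext (map e Ts) (\<lambda>Ts. g (S # Ts)) else 0)"
    unfolding list.map cext.simps
    by (rule sum.cong[OF refl]) (use Cons.prems in \<open>auto simp: coord_e valid_def\<close>)
  also have "\<dots> = cext (map e Ts) (\<lambda>Ts. g (S # Ts))" using Cons.prems by (simp add: valid_def)
  also have "\<dots> = g (S # Ts)" using Cons.prems by (intro Cons.IH) (simp add: valid_def)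
  finally show ?case .
qed simp

lemma cx_e: "valid Ts ==> cx g (map e Ts) = g Ts"
  by (simp add: cx_def cext_e)

lemma multilinear_sum: "multilinear scale f ==> f (l @ sum g B # r) = (\<Sum>b\<in>B. f (l @ g b # r))"
  by (induction B rule: infinite_finite_induct) (simp_all add: multilinear_zero multilinear_add)

lemma multilinear_expand:
  "multilinear scale f ==> f (l @ a # r) = (\<Sum>S\<in>Pow {..<n}. coord a S *s f (l @ e S # r))"
  by (subst coord_comb[of a, symmetric]) (simp only: multilinear_sum multilinear_scale)

lemma multilinear_eqI:
  assumes f: "multilinear scale f" and g: "multilinear scale g"
    and eq: "\<And>Ts. valid Ts ==> f (map e Ts) = g (map e Ts)"
  shows "f = g"
proof
  fix as
  have "f (map e Ts @ as) = g (map e Ts @ as)" if "valid Ts" for Ts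
    using that
  proof (induction as arbitrary: Ts)
    case (Cons a as)
    have "f (map e Ts @ e S # as) = g (map e Ts @ e S # as)" if "S \<in> Pow {..<n}" for S
      using Cons.IH[of "Ts @ [S]"] Cons.prems that by (simp add: valid_def)
    thus ?case
      unfolding multilinear_expand[OF f, of "map e Ts" a as] multilinear_expand[OF g, of "map e Ts" a as]
      by (intro sum.cong refl) simp
  qed (simp add: eq)
  from this[of "[]"] show "f as = g as" by (simp add: valid_def)
qed

definition degs :: "nat set list => int" where
  "degs Ts = (\<Sum>S\<leftarrow>Ts. int (card S)) - int (length Ts)"

lemma degs_simps [simp]: "degs [] = 0" "degs (S # Ts) = int (card S) - 1 + degs Ts"
    "degs (Ts @ Us) = degs Ts + degs Us"
  by (simp_all add: degs_def)

definition homog :: "int => nat set list => 'a => bool" where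
  "homog t Ts x \<longleftrightarrow> (valid Ts \<longrightarrow> x \<in> X (degs Ts + t))"

lemma valid_e_X:
  "valid Ts ==> list_all2 (\<lambda>a p. a \<in> X p) (map e Ts) (map (\<lambda>S. int (card S)) Ts)"
proof (induction Ts)
  case (Cons S Ts)
  hence "finite S" using finite_subset[of S "{..<n}"] by (simp add: valid_def)
  with Cons show ?case by (simp add: valid_def e_X)
qed simp

lemma CC_e: "\<phi> \<in> CC t ==> homog t Ts (\<phi> (map e Ts))"
  unfolding homog_def
proof
  assume \<phi>: "\<phi> \<in> CC t" and V: "valid Ts"
  from CC_degree[OF \<phi> valid_e_X[OF V]] show "\<phi> (map e Ts) \<in> X (degs Ts + t)" by (simp add: degs_def)
qed

lemma cx_CC:
  assumes "\<And>Ts. homog t Ts (g Ts)"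
  shows "cx g \<in> CC t"
proof (rule CC_I[OF multilinear_cx])
  fix as ps assume "list_all2 (\<lambda>a p. a \<in> X p) as ps"
  thus "cx g as \<in> X (sum_list ps - int (length as) + t)"
    unfolding cx_def using assms
  proof (induction as ps arbitrary: g t rule: list_all2_induct)
    case Nil
    thus ?case by (auto simp: homog_def valid_def dest: meta_spec[of _ "[]"])
  next
    case (Cons a as p ps)
    have "coord a S *s cext as (\<lambda>Ts. g (S # Ts)) \<in> X (sum_list (p # ps) - int (length (a # as)) + t)"
      if "S \<in> Pow {..<n}" for S
    proof (cases "coord a S = 0")
      case False
      have "homog (int (card S) - 1 + t) Ts (g (S # Ts))" for Ts
        using Cons.prems[of "S # Ts"] that by (auto simp: homog_def valid_def algebra_simps)
      hence "cext as (\<lambda>Ts. g (S # Ts)) \<in> X (sum_list ps - int (length as) + (int (card S) - 1 + t))"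
        by (rule Cons.IH)
      moreover have "X (sum_list ps - int (length as) + (int (card S) - 1 + t)) = X (sum_list (p # ps) - int (length (a # as)) + t)"
        using coord_X[OF Cons.hyps(1) False] by (intro X_cong) simp
      ultimately show ?thesis by (auto intro: X_scale)
    qed (simp add: X_0)
    thus ?case by (auto intro: X_sum)
  qed
qed

lemma CC_eq_cx: "\<phi> \<in> CC t ==> \<phi> = cx (\<lambda>Ts. \<phi> (map e Ts))"
  by (rule multilinear_eqI[OF CC_multilinear multilinear_cx]) (simp_all add: cx_e)

lemma cx_0: "cx (\<lambda>Ts. 0) as = 0"
proof -
  have "cext as (\<lambda>Ts. 0) = 0" by (induction as) simp_all
  thus ?thesis by (simp add: cx_def)
qed

lemma cx_cong: "(\<And>Ts. valid Ts ==> g Ts = h Ts) ==> cx g = cx h"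
  by (rule multilinear_eqI[OF multilinear_cx multilinear_cx]) (simp add: cx_e)

lemma cx_diff: "cx (\<lambda>Ts. g Ts - h Ts) as = cx g as - cx h as"
proof -
  have "cext as (\<lambda>Ts. g Ts - h Ts) = cext as g - cext as h"
    by (induction as arbitrary: g h) (simp_all add: scale_right_diff_distrib sum_subtractf)
  thus ?thesis by (simp add: cx_def)
qed

lemma dH_diff: "dH t (\<lambda>as. \<phi> as - \<psi> as) as = dH t \<phi> as - dH t \<psi> as"
  by (simp add: dH_circ circ_diff_left circ_diff_right[OF multilinear] sg_diff)

lemma dH_0: "dH t (\<lambda>as. 0) as = 0"
  using dH_diff[of t "\<lambda>_. 0" "\<lambda>_. 0" as] by simp

abbreviation "DV t g Ts \<equiv> dH t (cx g) (map e Ts)"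

lemma DV_diff: "DV t (\<lambda>Ts. g Ts - h Ts) Ts = DV t g Ts - DV t h Ts"
  by (simp only: cx_diff[abs_def] dH_diff)

lemma DV_homog: "(\<And>Ts. homog t Ts (g Ts)) ==> homog (t + 1) Ts (DV t g Ts)"
  by (rule CC_e, rule dH_CC, rule cx_CC)

lemma cx_insert:
  assumes "valid l" "valid r"
  shows "cx g (map e l @ x # map tw (map e r)) =
    sg (degs r) (\<Sum>S\<in>Pow {..<n}. coord x S *s g (l @ S # r))"
proof -
  from homog_T_list[OF multilinear_cx valid_e_X[OF assms(2)], of g "map e l @ [x]" 1 "[]"]
  have "cx g (map e l @ x # map tw (map e r)) = sg (degs r) (cx g (map e l @ x # map e r))"
    by (simp add: degs_def)
  also have "cx g (map e l @ x # map e r) = (\<Sum>S\<in>Pow {..<n}. coord x S *s cx g (map e (l @ S # r)))"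
    by (subst multilinear_expand[OF multilinear_cx]) simp
  also have "\<dots> = (\<Sum>S\<in>Pow {..<n}. coord x S *s g (l @ S # r))"
    using assms by (intro sum.cong refl) (subst cx_e, auto simp: valid_def)
  finally show ?thesis .
qed

text \<open>The only terms of the differential that do not decrease the length by more than one.\<close>
lemma DV_eq:
  assumes W: "valid W" "length W = Suc k" "k \<ge> 1" and g: "\<And>U. length U < k ==> g U = 0"
  shows "DV t g W = \<mu> [e (hd W), g (tl W)] + \<mu> [g (butlast W), twist_by X (t - 1) (e (last W))]
    - sg (t - 1) (\<Sum>i<k. sg (degs (drop (i + 2) W))
        (\<Sum>S\<in>Pow {..<n}. coord (\<mu> [e (W ! i), e (W ! Suc i)]) S *s g (take i W @ S # drop (i + 2) W)))"
proof -
  have ne: "W \<noteq> []" using W by auto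
  have v: "valid l \<and> valid m \<and> valid r" if "l @ m @ r = W" for l m r
    using W(1) that by (auto simp: valid_def)
  let ?H = "\<lambda>l m r. \<mu> (map e l @ cx g (map e m) # map (twist_by X (t - 1)) (map e r))"
  \<comment> \<open>A cochain that takes fewer than k inputs vanishes by assumption, and if it takes
    all of them the outer operation has one input and is zero by minimality.\<close>
  have "ss W (\<lambda>l x. ss x (\<lambda>m r. ?H l m r)) = ?H [hd W] (tl W) [] + ?H [] (butlast W) [last W]"
  proof (rule ss_ends)
    fix l m r assume lmr: "l @ m @ r = W" "length m + 1 \<noteq> length W"
    show "?H l m r = 0"
    proof (cases "length m < k")
      case True
      thus ?thesis using v[OF lmr(1)] g[of m] by (simp add: cx_e multilinear_zero[OF multilinear])
    next
      case False
      have "length l + length m + length r = Suc k" using lmr(1) W(2) by (metis length_append add.assoc)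
      with False lmr(2) W(2) have "length l = 0" "length r = 0" by linarith+
      thus ?thesis by (simp add: minimal)
    qed
  qed (use ne in auto)
  moreover have "cx g (map e (tl W)) = g (tl W)" "cx g (map e (butlast W)) = g (butlast W)"
    using v[of "[hd W]" "tl W" "[]"] v[of "[]" "butlast W" "[last W]"] ne by (simp_all add: cx_e)
  moreover let ?K = "\<lambda>l m r. cx g (map e l @ \<mu> (map e m) # map tw (map e r))"
  have "ss W (\<lambda>l x. ss x (\<lambda>m r. ?K l m r)) = (\<Sum>i<k. ?K (take i W) [W ! i, W ! Suc i] (drop (i + 2) W))"
  proof (rule ss_pairs[OF _ W(2)])
    fix l m r assume lmr: "l @ m @ r = W" "length m \<noteq> 2"
    show "?K l m r = 0"
    proof (cases "length m < 2")
      case True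
      hence "\<mu> (map e m) = 0" using uncurved minimal by (cases m) (auto simp: less_2_cases_iff)
      thus ?thesis by (simp add: multilinear_zero[OF multilinear_cx])
    next
      case False
      \<comment> \<open>Merging three or more inputs leaves a word of length below k, where
        \<open>g\<close> vanishes.\<close>
      with lmr have "length m \<ge> 3" by simp
      hence "length (l @ S # r) < k" for S using lmr(1) W(2) by auto
      hence "g (l @ S # r) = 0" for S by (rule g)
      thus ?thesis using v[OF lmr(1)] by (simp only: cx_insert) simp
    qed
  qed
  moreover have "?K (take i W) [W ! i, W ! Suc i] (drop (i + 2) W) = sg (degs (drop (i + 2) W))
        (\<Sum>S\<in>Pow {..<n}. coord (\<mu> [e (W ! i), e (W ! Suc i)]) S *s g (take i W @ S # drop (i + 2) W))" for i
    using W(1) by (subst cx_insert) (auto simp: valid_def dest: in_set_takeD in_set_dropD)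
  ultimately show ?thesis
    by (simp add: dH_circ circ_def ss_map)
qed

end

lemma sort_lex: "sort xs = xs \<or> (sort xs, xs) \<in> lex less_than" for xs :: "nat list"
proof (induction xs)
  case (Cons x xs)
  show ?case
  proof (cases "\<forall>y\<in>set xs. x \<le> y")
    case True
    hence "sort (x # xs) = x # sort xs" by (simp add: insort_is_Cons)
    with Cons show ?thesis by auto
  next
    case False
    then obtain y where y: "y \<in> set xs" "y < x" by auto
    have "length (sort (x # xs)) = Suc (length xs)" by (simp only: length_sort list.size)
    then obtain z zs where z: "sort (x # xs) = z # zs" "length zs = length xs" by (metis length_Suc_conv)
    have "sorted (z # zs)" by (metis sorted_sort z(1))
    moreover have "y \<in> set (z # zs)" using y by (metis list.set_intros(2) set_sort z(1))
    ultimately have "z \<le> y" by auto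
    with y z show ?thesis by simp
  qed
qed simp

text \<open>Joining two disjoint blocks sorts their concatenated letters. Unless these were sorted
  already, the word becomes lexicographically smaller.\<close>

lemma sorted_union_lex:
  fixes B C :: "nat set"
  assumes "finite B" "finite C" "B \<inter> C = {}"
  shows "(\<forall>x\<in>B. \<forall>y\<in>C. x < y) \<or>
    (sorted_list_of_set (B \<union> C), sorted_list_of_set B @ sorted_list_of_set C) \<in> lex less_than"
proof -
  let ?xs = "sorted_list_of_set B @ sorted_list_of_set C"
  have d: "distinct ?xs" "set ?xs = B \<union> C" using assms by auto
  hence s: "sorted_list_of_set (B \<union> C) = sort ?xs"
    by (metis distinct_remdups_id sorted_list_of_set_sort_remdups)
  show ?thesis
  proof (cases "sort ?xs = ?xs")
    case True
    hence "sorted ?xs" by (metis sorted_sort)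
    hence "\<forall>x\<in>B. \<forall>y\<in>C. x \<le> y" using assms by (simp add: sorted_append)
    with assms(3) show ?thesis by (metis disjoint_iff le_neq_implies_less)
  qed (use sort_lex[of ?xs] s in auto)
qed

context superfiltered_deformation
begin

section \<open>The Koszul part of the Hochschild complex\<close>

text \<open>
  The matching on words in the monomials, encoded as sets of indices: the first monomial \<open>w\<close> of degree at
  least two, if its least index does not exceed those of the generators before it, is split into its
  least generator and the rest. The words in \<open>LowK\<close> are the shorter partners.
\<close>
definition flat :: "nat set list => nat list" where
  "flat U = concat (map sorted_list_of_set U)"

text \<open>The order records the ways in which a term of the differential can be smaller: a shorter
  word, fewer generators in total, that is lower filtration, and finally a lexicographically smaller
  sequence of letters. Splitting a block by \<open>mK\<close> leaves the flattened word
  unchanged.\<close>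

definition RK :: "(nat set list \<times> nat set list) set" where
  "RK = inv_image (less_than <*lex*> lenlex less_than) (\<lambda>U. (length U, flat U))"

definition LowK :: "nat set list set" where
  "LowK = {U. valid U \<and> {} \<notin> set U \<and> (\<exists>is w r. U = map (\<lambda>i. {i}) is @ w # r \<and>
      sorted_wrt (\<ge>) (is @ [Min w]) \<and> card w \<ge> 2)}"

definition mK :: "nat set list => nat set list" where
  "mK U = (let w = hd (dropWhile (\<lambda>S. card S = 1) U) in takeWhile (\<lambda>S. card S = 1) U @
      {Min w} # (w - {Min w}) # tl (dropWhile (\<lambda>S. card S = 1) U))"

lemma wf_RK: "wf RK"
  unfolding RK_def by (intro wf_inv_image wf_lex_prod wf_lenlex wf_less_than)

lemma RK_length: "length U < length V ==> (U, V) \<in> RK"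
  by (simp add: RK_def)

lemma RK_flat: "length U = length V ==> length (flat U) < length (flat V) ==> (U, V) \<in> RK"
  by (simp add: RK_def lenlex_conv)

lemma RK_lex: "length U = length V ==> (flat U, flat V) \<in> lex less_than ==> (U, V) \<in> RK"
  by (auto simp: RK_def lenlex_conv lex_conv)

lemma flat_simps [simp]: "flat [] = []" "flat (S # U) = sorted_list_of_set S @ flat U" "flat (U @ V) = flat U @ flat V"
  by (simp_all add: flat_def)

lemma mK_eq: "card w \<ge> 2 ==> mK (map (\<lambda>i. {i}) is @ w # r) = map (\<lambda>i. {i}) is @ {Min w} # (w - {Min w}) # r"
proof -
  assume "card w \<ge> 2"
  hence "takeWhile (\<lambda>S. card S = 1) (map (\<lambda>i. {i}) is @ w # r) = map (\<lambda>i. {i}) is"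
    "dropWhile (\<lambda>S. card S = 1) (map (\<lambda>i. {i}) is @ w # r) = w # r"
    by (induction "is") auto
  thus ?thesis by (simp add: mK_def)
qed

text \<open>In a word of \<open>LowK\<close> the singletons before the first larger block, followed
  by the minimum of that block, decrease weakly. Here the ascent from \<open>a\<close> to
  \<open>u\<close> violates this, whatever the block \<open>u\<close> and the rest are.\<close>

lemma not_LowK:
  assumes a: "\<And>b. b \<in> u ==> a < b" "u \<noteq> {}" "finite u"
  shows "map (\<lambda>i. {i}) x @ {a} # u # y \<notin> LowK"
proof
  assume "map (\<lambda>i. {i}) x @ {a} # u # y \<in> LowK"
  then obtain "is" w r where e: "map (\<lambda>i. {i}) x @ {a} # u # y = map (\<lambda>i. {i}) is @ w # r"
    and s: "sorted_wrt (\<ge>) (is @ [Min w])" and w: "card w \<ge> 2"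
    by (auto simp: LowK_def)
  from e s show False
  proof (induction x arbitrary: "is")
    case Nil
    hence "is \<noteq> []" using w by (cases "is") auto
    then obtain i js where "is": "is = i # js" by (cases "is") auto
    with Nil.prems(1) have i: "i = a" and e2: "u # y = map (\<lambda>i. {i}) js @ w # r" by auto
    show False
    proof (cases js)
      case Nil
      with e2 have "u = w" by simp
      with a have "a < Min w" by (auto simp: Min_gr_iff)
      with Nil.prems "is" Nil i show False using s \<open>sorted_wrt (\<ge>) (is @ [Min w])\<close> by auto
    next
      case (Cons j ks)
      with e2 have "u = {j}" by simp
      with a have "a < j" by simp
      with Nil.prems(2) "is" Cons i show False by auto
    qed
  next
    case (Cons z x)
    hence "is \<noteq> []" using w by (cases "is") auto
    then obtain i js where "is": "is = i # js" by (cases "is") auto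
    with Cons show False by (intro Cons.IH[of js]) auto
  qed
qed

lemma not_LowK_singles: "map (\<lambda>i. {i}) x \<notin> LowK"
proof
  assume "map (\<lambda>i. {i}) x \<in> LowK"
  then obtain "is" w r where e: "map (\<lambda>i. {i}) x = map (\<lambda>i. {i}) is @ w # r" and w: "card w \<ge> 2"
    by (auto simp: LowK_def)
  have "w \<in> set (map (\<lambda>i. {i}) x)" unfolding e by simp
  with w show False by auto
qed

text \<open>Every term of the differential at the split word gives a word outside
  \<open>LowK\<close> or below \<open>W\<close>, except the product of {a} and \<open>u\<close>,
  which restores \<open>W\<close> with a sign.\<close>

lemma DV_mK:
  assumes W: "W \<in> LowK"
  shows "\<exists>\<epsilon>. \<forall>g. (\<forall>U. U \<notin> LowK \<longrightarrow> g U = 0) \<longrightarrow> (\<forall>U. (U, W) \<in> RK \<longrightarrow> g U = 0) \<longrightarrow>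
    DV t g (mK W) = sg \<epsilon> (g W)"
proof -
  from W obtain "is" w r where We: "W = map (\<lambda>i. {i}) is @ w # r"
    and s: "sorted_wrt (\<ge>) (is @ [Min w])" and w: "card w \<ge> 2" and v: "valid W" and ne: "{} \<notin> set W"
    by (auto simp: LowK_def)
  define a where "a = Min w"
  define u where "u = w - {a}"
  have finw: "finite w" using w by (metis card.infinite not_numeral_le_zero)
  have aw: "a \<in> w" unfolding a_def using finw w by (intro Min_in) auto
  have u: "w = insert a u" "a \<notin> u" "finite u" using aw finw by (auto simp: u_def)
  have un: "u \<noteq> {}" using w u by auto
  have au: "a < b" if "b \<in> u" for b
    using that finw Min_le[of w b] u(1,2) unfolding a_def[symmetric] by (metis insertCI le_neq_implies_less)
  define V where "V = mK W"
  have V: "V = map (\<lambda>i. {i}) is @ {a} # u # r" unfolding V_def We mK_eq[OF w] a_def u_def ..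
  define k where "k = length W"
  have k: "k = length is + 1 + length r" by (simp add: k_def We)
  have lV: "length V = Suc k" by (simp add: V k)
  have flatV: "flat V = flat W"
  proof -
    have "sorted_list_of_set (insert a u) = a # sorted_list_of_set u"
      using au u
      by (intro sorted_list_of_set.sorted_key_list_of_set_unique[THEN iffD1])
        (auto simp: card_insert_if sorted_list_of_set.idem_if_sorted_distinct order.strict_implies_order)
    thus ?thesis by (simp add: V We u(1))
  qed
  have vV: "valid V" using v by (auto simp: V We valid_def u(1))
  have finV: "finite S" if "S \<in> set V" for S
    using vV that finite_subset[of S "{..<n}"] by (auto simp: valid_def)
  have neV: "S \<noteq> {}" if "S \<in> set V" for S using ne that un by (auto simp: V We)
  have main: "DV t g V = sg (t + degs r + int (card u)) (g W)"
    if off: "\<And>U. U \<notin> LowK ==> g U = 0" and below: "\<And>U. (U, W) \<in> RK ==> g U = 0" for g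
  proof -
    have short: "g U = 0" if "length U < k" for U using that below[OF RK_length] by (simp add: k_def)
    \<comment> \<open>If the first block is {a} itself, dropping it shortens the flattened word;
      otherwise the ascent from \<open>a\<close> to \<open>u\<close> persists.\<close>
    have tl: "g (tl V) = 0"
    proof (cases "is")
      case Nil
      have "length (flat (tl V)) < length (flat W)" unfolding flatV[symmetric] by (simp add: V Nil)
      thus ?thesis using lV by (intro below RK_flat) (simp_all add: k_def)
    next
      case (Cons i js)
      hence "tl V = map (\<lambda>i. {i}) js @ {a} # u # r" by (simp add: V)
      with not_LowK[OF au un u(3), of js r] show ?thesis using off by simp
    qed
    have bl: "g (butlast V) = 0"
    proof (cases "r = []")
      case True
      hence "butlast V = map (\<lambda>i. {i}) (is @ [a])" by (simp add: V butlast_append)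
      thus ?thesis using off not_LowK_singles by metis
    next
      case False
      hence "butlast V = map (\<lambda>i. {i}) is @ {a} # u # butlast r" by (simp add: V butlast_append)
      with not_LowK[OF au un u(3), of "is" "butlast r"] show ?thesis using off by simp
    qed
    \<comment> \<open>x\<close>
    let ?t = "\<lambda>i S. coord (\<mu> [e (V ! i), e (V ! Suc i)]) S *s g (take i V @ S # drop (i + 2) V)"
    \<comment> \<open>Any product of neighbours other than an increasing union loses a generator or
      lowers the flattened word lexicographically.\<close>
    have vanish: "?t i S = 0" if i: "i < k" and not: "\<not> ((\<forall>x\<in>V ! i. \<forall>y\<in>V ! Suc i. x < y) \<and> S = V ! i \<union> V ! Suc i)" for i S
    proof (cases "coord (\<mu> [e (V ! i), e (V ! Suc i)]) S = 0")
      case False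
      let ?U = "take i V @ S # drop (i + 2) V"
      have iV: "V ! i \<in> set V" "V ! Suc i \<in> set V" using i lV by simp_all
      have Vd: "V = take i V @ V ! i # V ! Suc i # drop (i + 2) V"
        using i lV id_take_nth_drop[of i V] Cons_nth_drop_Suc[of "Suc i" V] by simp
      have flatVd: "flat V = flat (take i V) @ (sorted_list_of_set (V ! i) @ sorted_list_of_set (V ! Suc i)) @ flat (drop (i + 2) V)"
        by (rule trans[OF arg_cong[OF Vd, of flat]]) (simp only: flat_simps append_assoc)
      have flatU: "flat ?U = flat (take i V) @ sorted_list_of_set S @ flat (drop (i + 2) V)"
        by (simp only: flat_simps)
      have len: "length ?U = length W" using i lV by (simp add: k_def[symmetric])
      have sub: "V ! i \<subseteq> {..<n}" "V ! Suc i \<subseteq> {..<n}" using vV iV by (auto simp: valid_def)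
      from coord_product[OF sub False]
      have "g ?U = 0"
      proof
        assume c: "card S < card (V ! i) + card (V ! Suc i)"
        have "length (flat ?U) < length (flat V)" unfolding flatVd flatU using c by simp
        thus ?thesis using len by (intro below RK_flat) (simp_all add: flatV)
      next
        assume S: "S = V ! i \<union> V ! Suc i \<and> V ! i \<inter> V ! Suc i = {}"
        with not have "(sorted_list_of_set S, sorted_list_of_set (V ! i) @ sorted_list_of_set (V ! Suc i)) \<in> lex less_than"
          using sorted_union_lex[OF finV[OF iV(1)] finV[OF iV(2)]] by blast
        hence "(flat ?U, flat V) \<in> lex less_than"
          unfolding flatVd flatU by (intro lex_append_leftI lex_append_rightI) simp_all
        thus ?thesis using len by (intro below RK_lex) (simp_all add: flatV)
      qed
      thus ?thesis by simp
    qed simp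
    have zero: "(\<Sum>S\<in>Pow {..<n}. ?t i S) = 0" if i: "i < k" "i \<noteq> length is" for i
    proof (rule sum.neutral, rule ballI, rule ccontr)
      fix S assume "?t i S \<noteq> 0"
      hence n: "\<forall>x\<in>V ! i. \<forall>y\<in>V ! Suc i. x < y" "S = V ! i \<union> V ! Suc i" and gne: "g (take i V @ S # drop (i + 2) V) \<noteq> 0"
        using vanish[OF i(1), of S] by auto
      consider "i < length is" | "i = Suc (length is)" | "i > Suc (length is)" using i by linarith
      thus False
      proof cases
        case 1
        have Vi: "V ! j = {(is @ [a]) ! j}" if "j \<le> length is" for j
          using that by (auto simp: V nth_append)
        \<comment> \<open>Up to the block {a} the indices decrease weakly, so no two neighbours form
          an increasing union.\<close>
        have "(is @ [a]) ! i \<ge> (is @ [a]) ! Suc i"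
          using s 1 sorted_wrt_nth_less[OF s, of i "Suc i"] by (simp add: a_def)
        with n(1) 1 show False by (simp add: Vi)
      next
        case 2
        hence r: "r \<noteq> []" using i k by auto
        then obtain b q where bq: "r = b # q" by (cases r) auto
        have "V ! i = u" "V ! Suc i = b" "take i V = map (\<lambda>i. {i}) is @ [{a}]" "drop (i + 2) V = q"
          using 2 by (simp_all add: V bq nth_append)
        with n have "S = u \<union> b" and ub: "\<forall>x\<in>u. \<forall>y\<in>b. x < y" by simp_all
        \<comment> \<open>The union of \<open>u\<close> with the next block still lies above
          \<open>a\<close>, so the forbidden ascent remains.\<close>
        have "\<And>c. c \<in> S ==> a < c" using au ub un \<open>S = u \<union> b\<close> by (metis Un_iff all_not_in_conv order_less_trans)
        moreover have "finite S" using finV[of b] u(3) \<open>S = u \<union> b\<close> by (simp add: V bq)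
        ultimately have "map (\<lambda>i. {i}) is @ {a} # S # q \<notin> LowK" using un \<open>S = u \<union> b\<close> by (intro not_LowK) auto
        with gne off show False using \<open>take i V = _\<close> \<open>drop (i + 2) V = q\<close> by simp
      next
        case 3
        define j where "j = i - Suc (Suc (length is))"
        have j: "i = Suc (Suc (length is)) + j" using 3 by (simp add: j_def)
        have "take i V @ S # drop (i + 2) V = map (\<lambda>i. {i}) is @ {a} # u # (take j r @ S # drop (i + 2) V)"
          unfolding j by (simp add: V)
        moreover have "map (\<lambda>i. {i}) is @ {a} # u # (take j r @ S # drop (i + 2) V) \<notin> LowK"
          by (rule not_LowK[OF au un u(3)])
        ultimately show False using off gne by simp
      qed
    qed
    have one: "(\<Sum>S\<in>Pow {..<n}. ?t (length is) S) = sg (int (card u)) (g W)"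
    proof -
      have V1: "V ! length is = {a}" "V ! Suc (length is) = u" "take (length is) V = map (\<lambda>i. {i}) is"
          "drop (length is + 2) V = r" by (simp_all add: V nth_append)
      have p: "\<mu> [e {a}, e u] = sg (int (card u)) (e w)" using e_insert[OF au u(3)] by (simp add: u(1))
      have ww: "w \<subseteq> {..<n}" using v by (simp add: We valid_def)
      have c: "coord (\<mu> [e {a}, e u]) S = (if S = w then (if even (card u) then 1 else -1) else 0)" for S
        unfolding p using coord_scale[of "-1" "e w" S] by (cases "S = w") (simp_all add: sg_def coord_e[OF ww])
      have "(\<Sum>S\<in>Pow {..<n}. ?t (length is) S) = (\<Sum>S\<in>{w}. ?t (length is) S)"
        using ww by (intro sum.mono_neutral_right) (auto simp: V1 c)
      also have "\<dots> = ?t (length is) w" by simp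
      finally show ?thesis unfolding V1 c by (simp add: We sg_def)
    qed
    have "DV t g V = \<mu> [e (hd V), g (tl V)] + \<mu> [g (butlast V), twist_by X (t - 1) (e (last V))]
      - sg (t - 1) (\<Sum>i<k. sg (degs (drop (i + 2) V)) (\<Sum>S\<in>Pow {..<n}. ?t i S))"
      using k by (intro DV_eq vV lV short) auto
    also have "(\<Sum>i<k. sg (degs (drop (i + 2) V)) (\<Sum>S\<in>Pow {..<n}. ?t i S)) =
        (\<Sum>i\<in>{length is}. sg (degs (drop (i + 2) V)) (\<Sum>S\<in>Pow {..<n}. ?t i S))"
      using k zero by (intro sum.mono_neutral_right) auto
    also have "\<dots> = sg (degs r) (sg (int (card u)) (g W))"
      using one by (simp add: V)
    finally show ?thesis
      using multilinear_zero[OF multilinear, of "[e (hd V)]" "[]"] multilinear_zero[OF multilinear, of "[]" "[twist_by X (t - 1) (e (last V))]"]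
      by (cases "even t"; cases "even (degs r)"; cases "even (card u)") (simp_all add: tl bl sg_def)
  qed
  show ?thesis unfolding V_def[symmetric] using main by blast
qed

end

section \<open>Decreasing words, reduced cochains and the unit\<close>

lemma ss_first: "(\<And>u w. u @ w = l ==> u \<noteq> [] ==> f u w = 0) ==> ss l f = f [] l"
proof (induction l arbitrary: f)
  case (Cons a l)
  have "ss l (\<lambda>u w. f (a # u) w) = ss l (\<lambda>u w. 0)" by (rule ss_cong) (auto intro: Cons.prems)
  thus ?case by simp
qed simp

lemma ss_last: "(\<And>u w. u @ w = l ==> w \<noteq> [] ==> f u w = 0) ==> ss l f = f l []"
proof (induction l arbitrary: f)
  case (Cons a l)
  have "ss l (\<lambda>u w. f (a # u) w) = f (a # l) []" by (rule Cons.IH) (auto intro: Cons.prems)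
  moreover have "f [] (a # l) = 0" by (rule Cons.prems) auto
  ultimately show ?case by simp
qed simp

lemma ss_butlast: "ss l (\<lambda>u w. if length w = 1 then f u w else 0) = (if l = [] then 0 else f (butlast l) [last l])"
proof (induction l arbitrary: f)
  case (Cons a l)
  have "ss l (\<lambda>u w. if length w = 1 then f (a # u) w else 0) = (if l = [] then 0 else f (a # butlast l) [last l])"
    by (rule Cons.IH)
  thus ?case by (cases "l = []") auto
qed simp

lemma ss_hd: "ss l (\<lambda>u w. if length u = 1 then f u w else 0) = (if l = [] then 0 else f [hd l] (tl l))"
proof (cases l)
  case (Cons a l')
  have "ss l' (\<lambda>u w. if length (a # u) = 1 then f (a # u) w else 0) = f [a] l'"
    by (subst ss_first) auto
  thus ?thesis by (simp add: Cons)
qed simp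

lemma not_descending:
  "\<not> sorted_wrt (\<ge>) w ==> \<exists>x a b y. w = x @ a # b # y \<and> sorted_wrt (\<ge>) (x @ [a]) \<and> a < (b :: nat)"
proof (induction w rule: rev_induct)
  case (snoc b w)
  show ?case
  proof (cases "sorted_wrt (\<ge>) w")
    case True
    with snoc.prems have "w \<noteq> []" by auto
    then obtain x a where w: "w = x @ [a]" by (metis append_butlast_last_id)
    with True have "\<And>z. z \<in> set w ==> z \<ge> a" by (auto simp: sorted_wrt_append)
    moreover from True snoc.prems obtain z where "z \<in> set w" "z < b" by (auto simp: sorted_wrt_append)
    ultimately have "a < b" by (meson le_less_trans)
    with True w show ?thesis by (intro exI[of _ x] exI[of _ a] exI[of _ b] exI[of _ "[]"]) simp
  next
    case False
    from snoc.IH[OF False] obtain x a b' y where "w = x @ a # b' # y" "sorted_wrt (\<ge>) (x @ [a])" "a < b'" by blast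
    thus ?thesis by (intro exI[of _ x] exI[of _ a] exI[of _ b'] exI[of _ "y @ [b]"]) simp
  qed
qed simp

definition desc :: "nat multiset => nat list" where
  "desc m = rev (sorted_list_of_multiset m)"

lemma sorted_wrt_desc: "sorted_wrt (\<ge>) (desc m)"
  by (simp add: desc_def sorted_wrt_rev)

lemma mset_desc [simp]: "mset (desc m) = m"
  by (simp add: desc_def)

lemma desc_unique: "sorted_wrt (\<ge>) w ==> desc (mset w) = (w :: nat list)"
proof -
  assume "sorted_wrt (\<ge>) w"
  hence "sorted (rev w)" by (simp add: sorted_wrt_rev)
  hence "sort w = rev w" by (intro properties_for_sort) simp_all
  thus ?thesis by (simp add: desc_def sorted_list_of_multiset_mset)
qed

context superfiltered_deformation
begin

definition reduced :: "('a list => 'a) => bool" where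
  "reduced \<phi> \<longleftrightarrow> (\<forall>l r. \<phi> (l @ unit # r) = 0)"

abbreviation ev :: "('a list => 'a) => nat multiset => 'a" where "ev \<phi> \<equiv> \<lambda>m. SS [] m \<phi>"

lemma tw_unit: "tw unit = - unit" by (rule tw_even[OF unit_degree]) simp

lemma T_unit: "T p unit = sg p unit"
  using T_homog[OF unit_degree, of p] by (simp add: sg_def)

lemma \<mu>_unit_sides:
  "length l + length r \<noteq> 1 ==> \<mu> (l @ unit # r) = 0"
  by (rule \<mu>_unit) auto

text \<open>The unit is an input either of \<phi>, which is reduced, or of \<mu>, where strict
  unitality leaves only the product of the unit with a value of \<phi>.\<close>

lemma circ_\<mu>_unit:
  assumes \<phi>: "reduced \<phi>"
  shows "circ \<mu> p \<phi> (l @ unit # r) =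
    (if l = [] then \<mu> [unit, \<phi> r] else 0) + (if r = [] then \<mu> [\<phi> l, T p unit] else 0)"
proof -
  have 1: "ss l (\<lambda>u w. ss r (\<lambda>a b. \<mu> (u @ \<phi> (w @ unit # a) # map (T p) b))) = 0"
    using \<phi> by (simp add: reduced_def multilinear_zero[OF multilinear])
  have 2: "ss l (\<lambda>u w. ss w (\<lambda>a b. \<mu> (u @ \<phi> a # map (T p) (b @ unit # r)))) = (if r = [] then \<mu> [\<phi> l, T p unit] else 0)"
  proof -
    have z: "\<mu> (u @ \<phi> a # map (T p) (b @ unit # r)) = 0" if "\<not> (u = [] \<and> b = [] \<and> r = [])" for u a b
      using that \<mu>_unit_sides[of "u @ \<phi> a # map (T p) b" "map (T p) r"]
      by (auto simp: T_unit multilinear_sg2[OF multilinear])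
    have "ss l (\<lambda>u w. ss w (\<lambda>a b. \<mu> (u @ \<phi> a # map (T p) (b @ unit # r)))) =
        ss l (\<lambda>a b. \<mu> (\<phi> a # map (T p) (b @ unit # r)))"
      by (subst ss_first) (simp_all add: z del: map_append list.map)
    also have "\<dots> = \<mu> (\<phi> l # map (T p) (unit # r))"
      using z[of "[]"] by (subst ss_last) (simp_all del: map_append list.map)
    also have "\<dots> = (if r = [] then \<mu> [\<phi> l, T p unit] else 0)"
      using \<mu>_unit_sides[of "[\<phi> l]" "map (T p) r"]
      by (auto simp: T_unit multilinear_sg2[OF multilinear, of "[]" _ "[]", simplified])
    finally show ?thesis .
  qed
  have 3: "ss r (\<lambda>u w. ss w (\<lambda>a b. \<mu> ((l @ unit # u) @ \<phi> a # map (T p) b))) = (if l = [] then \<mu> [unit, \<phi> r] else 0)"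
  proof -
    have z: "\<mu> (l @ unit # u @ \<phi> a # map (T p) b) = 0" if "\<not> (l = [] \<and> u = [] \<and> b = [])" for u a b
      using that by (intro \<mu>_unit_sides) auto
    have "ss r (\<lambda>u w. ss w (\<lambda>a b. \<mu> ((l @ unit # u) @ \<phi> a # map (T p) b))) =
        ss r (\<lambda>a b. \<mu> (l @ unit # \<phi> a # map (T p) b))"
      by (subst ss_first) (simp_all add: z)
    also have "\<dots> = \<mu> (l @ unit # \<phi> r # [])"
      using z[of "[]"] by (subst ss_last) simp_all
    also have "\<dots> = (if l = [] then \<mu> [unit, \<phi> r] else 0)"
      using \<mu>_unit_sides[of l "[\<phi> r]"] by auto
    finally show ?thesis .
  qed
  show ?thesis
    unfolding circ_def using 1 2 3 by (simp only: ss_append ss_add) (simp add: add_ac)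
qed

text \<open>Inside \<mu> the unit can only be multiplied with its left or its right neighbour. Both
  products leave the same list, with opposite signs, so they cancel unless the unit stands at an
  end.\<close>

lemma circ_unit_\<mu>:
  assumes \<phi>: "reduced \<phi>" and ml: "multilinear scale \<phi>"
  shows "circ \<phi> 1 \<mu> (l @ unit # r) =
    (if l = [] then 0 else \<phi> (l @ map tw r)) - (if r = [] then 0 else \<phi> (l @ map tw r))"
proof -
  have z: "\<phi> (l @ unit # r) = 0" for l r using \<phi> by (simp add: reduced_def)
  have z2: "\<phi> (l @ x # k @ unit # r) = 0" for l x k r using z[of "l @ x # k" r] by simp
  have 1: "ss l (\<lambda>u w. ss w (\<lambda>a b. \<phi> (u @ \<mu> a # map (T 1) (b @ unit # r)))) = 0"
    by (simp add: tw_unit multilinear_minus[OF ml, of "_ @ _ # _", simplified] z2)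
  have 2: "ss r (\<lambda>u w. ss w (\<lambda>a b. \<phi> ((l @ unit # u) @ \<mu> a # map (T 1) b))) = 0"
    by (simp add: z)
  have e: "\<phi> (u @ \<mu> (w @ unit # a) # map tw b) =
      (if length w = 1 then (if a = [] then \<phi> (u @ w @ map tw b) else 0) else 0)
      + (if length a = 1 then (if w = [] then - \<phi> (u @ map tw a @ map tw b) else 0) else 0)" for u w a b
  proof (cases "length w + length a = 1")
    case True
    then consider y where "w = [y]" "a = []" | y where "w = []" "a = [y]"
      by (cases w; cases a) auto
    thus ?thesis
      by cases (simp_all add: unit_right \<mu>_unit_left multilinear_minus[OF ml])
  next
    case False
    thus ?thesis by (auto simp: \<mu>_unit_sides multilinear_zero[OF ml])
  qed
  have "ss l (\<lambda>u w. ss r (\<lambda>a b. \<phi> (u @ \<mu> (w @ unit # a) # map tw b))) =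
      ss l (\<lambda>u w. if length w = 1 then \<phi> (u @ w @ map tw r) else 0)
      + ss l (\<lambda>u w. if r = [] then 0 else if w = [] then - \<phi> (u @ map tw [hd r] @ map tw (tl r)) else 0)"
  proof -
    have "ss r (\<lambda>a b. if a = [] then \<phi> (u @ w @ map tw b) else 0) = \<phi> (u @ w @ map tw r)" for u w
      by (subst ss_first) auto
    hence "ss r (\<lambda>a b. if length w = 1 then (if a = [] then \<phi> (u @ w @ map tw b) else 0) else 0) =
        (if length w = 1 then \<phi> (u @ w @ map tw r) else 0)" for u w by simp
    thus ?thesis by (simp only: e ss_add ss_hd)
  qed
  also have "ss l (\<lambda>u w. if length w = 1 then \<phi> (u @ w @ map tw r) else 0) =
      (if l = [] then 0 else \<phi> (l @ map tw r))"
    by (subst ss_butlast) (cases l rule: rev_cases, simp_all)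
  also have "ss l (\<lambda>u w. if r = [] then 0 else if w = [] then - \<phi> (u @ map tw [hd r] @ map tw (tl r)) else 0) =
      (if r = [] then 0 else - \<phi> (l @ map tw r))"
    by (cases r; subst ss_last) simp_all
  finally have 3: "ss l (\<lambda>u w. ss r (\<lambda>a b. \<phi> (u @ \<mu> (w @ unit # a) # map (T 1) b))) =
      (if l = [] then 0 else \<phi> (l @ map tw r)) - (if r = [] then 0 else \<phi> (l @ map tw r))"
    by (cases "r = []") simp_all
  show ?thesis
    unfolding circ_def using 1 2 3 by (simp only: ss_append ss_add) simp
qed

text \<open>The terms left over at each end of the list by \<open>circ_\<mu>_unit\<close> and
  \<open>circ_unit_\<mu>\<close> cancel.\<close>

lemma reduced_dH:
  assumes \<phi>: "\<phi> \<in> CC t" "reduced \<phi>"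
  shows "reduced (dH t \<phi>)"
  unfolding reduced_def
proof (intro allI)
  fix l r
  have "\<mu> [unit, \<phi> r] = - sg (t - 1) (\<phi> (map tw r))"
    using T_cochain[OF \<phi>(1), of 1 r] by (simp add: \<mu>_unit_left)
  moreover have "\<mu> [\<phi> l, T (t - 1) unit] = sg (t - 1) (\<phi> l)"
    by (simp add: T_unit \<mu>_sg unit_right)
  ultimately show "dH t \<phi> (l @ unit # r) = 0"
    unfolding dH_circ circ_\<mu>_unit[OF \<phi>(2)] circ_unit_\<mu>[OF \<phi>(2) CC_multilinear[OF \<phi>(1)]]
    by (cases "l = []"; cases "r = []") (auto simp: sg_def)
qed

lemma reduced_cx: "(\<And>Ts. {} \<in> set Ts ==> g Ts = 0) ==> reduced (cx g)"
  unfolding reduced_def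
proof (intro allI)
  fix l r assume "\<And>Ts. {} \<in> set Ts ==> g Ts = 0"
  thus "cx g (l @ unit # r) = 0"
    unfolding cx_def
  proof (induction l arbitrary: g)
    case Nil
    have "cext r (\<lambda>Ts. g ({} # Ts)) = 0" using cx_0[of r] Nil by (simp add: cx_def)
    hence "coord unit S *s cext r (\<lambda>Ts. g (S # Ts)) = 0" for S
      using coord_e[of "{}" S] by (simp add: e_empty)
    thus ?case by simp
  qed simp
qed

lemma reduced_e: "reduced \<phi> ==> {} \<in> set Ts ==> \<phi> (map e Ts) = 0"
  unfolding reduced_def by (auto dest!: split_list simp: e_empty)

section \<open>Evaluation on the bounding cochain\<close>

lemma v_word: "set w \<subseteq> {..<n} ==> map v w = map e (map (\<lambda>i. {i}) w)"
  by (simp add: e_single)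

lemma valid_word: "set w \<subseteq> {..<n} ==> valid (map (\<lambda>i. {i}) w)"
  by (auto simp: valid_def)

lemma word_out: "multilinear scale \<phi> ==> \<not> set w \<subseteq> {..<n} ==> \<phi> (map v w) = 0"
proof -
  assume ml: "multilinear scale \<phi>" and "\<not> set w \<subseteq> {..<n}"
  then obtain k where "k \<in> set w" "\<not> k < n" by auto
  then obtain x y where "w = x @ k # y" by (metis split_list)
  with \<open>\<not> k < n\<close> show ?thesis by (simp add: v_def[of k] multilinear_zero[OF ml])
qed

lemma ev_out: "multilinear scale \<phi> ==> \<not> set_mset m \<subseteq> {..<n} ==> ev \<phi> m = 0"
  by (auto simp: wsum_def intro!: sum.neutral word_out)

lemma ev_X: "\<phi> \<in> CC t ==> ev \<phi> m \<in> X t"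
proof -
  assume \<phi>: "\<phi> \<in> CC t"
  have "\<phi> (map v w) \<in> X t" for w
  proof (cases "set w \<subseteq> {..<n}")
    case True
    have "degs (map (\<lambda>i. {i}) w) = 0" by (induction w) simp_all
    with CC_e[OF \<phi>, of "map (\<lambda>i. {i}) w"] valid_word[OF True] show ?thesis
      by (simp add: v_word[OF True] homog_def del: map_map)
  qed (simp add: word_out[OF CC_multilinear[OF \<phi>]] X_0)
  thus ?thesis by (auto simp: wsum_def intro!: X_sum)
qed

lemma ev_\<mu>: "ev \<mu> = smul pot (cst unit)"
  by (rule ext) (simp add: pot_eq smul_cst)

text \<open>The part of the differential with \<mu> inside \<phi> evaluates to \<phi> with the
  curvature as an input. The curvature is a multiple of the unit, so a reduced cochain kills it, and
  only the twisted differential of the evaluation remains.\<close>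

lemma ev_dH:
  assumes \<phi>: "\<phi> \<in> CC t" "reduced \<phi>"
  shows "ev (dH t \<phi>) m = SS [ev \<phi>] m \<mu>"
proof -
  have ml: "multilinear scale \<phi>" by (rule CC_multilinear[OF \<phi>(1)])
  have "ev (circ \<phi> 1 \<mu>) m = SS ([] @ smul pot (cst unit) # []) m \<phi>"
    by (subst SS_circ[OF ml]) (simp only: ss.simps ev_\<mu> list.map)
  also have "\<dots> = smul pot (\<lambda>m. 0) m"
    unfolding SS_smul[OF ml] using \<phi>(2) by (simp only: SS_cst[OF ml] append_Nil) (simp add: reduced_def)
  also have "\<dots> = 0" by (simp add: smul_def)
  finally have 0: "ev (circ \<phi> 1 \<mu>) m = 0" .
  have "ev (dH t \<phi>) m = ev (circ \<mu> (t - 1) \<phi>) m - sg (t - 1) (ev (circ \<phi> 1 \<mu>) m)"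
    unfolding dH_circ[abs_def] SS_diff using SS_hom[of "sg (t - 1)" "[]" m "circ \<phi> 1 \<mu>"] by (simp add: sg_add del: SS.simps)
  also have "ev (circ \<mu> (t - 1) \<phi>) m = SS [ev \<phi>] m \<mu>"
    by (subst SS_circ[OF multilinear]) (simp only: ss.simps list.map append_Nil)
  finally show ?thesis by (simp only: 0) simp
qed

section \<open>Normalisation of Hochschild cochains\<close>

text \<open>
  The matching here lengthens the first run of units (empty sets) in a word when its length is odd.
\<close>
definition preN :: "nat set list => nat" where "preN U = length (takeWhile (\<lambda>S. S \<noteq> {}) U)"
definition runN :: "nat set list => nat" where
  "runN U = length (takeWhile (\<lambda>S. S = {}) (dropWhile (\<lambda>S. S \<noteq> {}) U))"
definition LowN :: "nat set list set" where "LowN = {U. valid U \<and> odd (runN U)}"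
definition mN :: "nat set list => nat set list" where
  "mN U = takeWhile (\<lambda>S. S \<noteq> {}) U @ {} # dropWhile (\<lambda>S. S \<noteq> {}) U"
text \<open>A word is smaller if it is shorter, if its first unit stands earlier, or if fewer
  letters follow its first run of units.\<close>

definition RN :: "(nat set list \<times> nat set list) set" where
  "RN = inv_image (less_than <*lex*> less_than <*lex*> less_than)
    (\<lambda>U. (length U, preN U, length U - preN U - runN U))"

lemma wf_RN: "wf RN"
  unfolding RN_def by (intro wf_inv_image wf_lex_prod wf_less_than)

lemma preN_eq: "{} \<notin> set p ==> preN (p @ {} # y) = length p"
  and runN_eq: "{} \<notin> set p ==> runN (p @ {} # y) = Suc (length (takeWhile (\<lambda>S. S = {}) y))"
  and mN_eq: "{} \<notin> set p ==> mN (p @ {} # y) = p @ {} # {} # y"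
proof -
  assume p: "{} \<notin> set p"
  have t: "takeWhile (\<lambda>S. S \<noteq> {}) (p @ {} # y) = p" using p by (subst takeWhile_append2) auto
  have d: "dropWhile (\<lambda>S. S \<noteq> {}) (p @ {} # y) = {} # y" using p by (subst dropWhile_append2) auto
  show "preN (p @ {} # y) = length p" "runN (p @ {} # y) = Suc (length (takeWhile (\<lambda>S. S = {}) y))"
    "mN (p @ {} # y) = p @ {} # {} # y"
    unfolding preN_def runN_def mN_def t d by simp_all
qed

lemma takeWhile_rep: "length (takeWhile (\<lambda>S. S = {}) (replicate r {} @ y)) = r + length (takeWhile (\<lambda>S. S = {}) y)"
  by (induction r) simp_all

lemma runN_rep: "{} \<notin> set p ==> runN (p @ replicate (Suc r) {} @ y) = Suc r + length (takeWhile (\<lambda>S. S = {}) y)"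
  using runN_eq[of p "replicate r {} @ y"] by (simp add: takeWhile_rep)

lemma N_off: "{} \<notin> set p ==> odd r ==> q = [] \<or> hd q \<noteq> {} ==> p @ replicate (Suc r) {} @ q \<notin> LowN"
proof -
  assume a: "{} \<notin> set p" "odd r" "q = [] \<or> hd q \<noteq> {}"
  have "length (takeWhile (\<lambda>S. S = {}) q) = 0" using a(3) by (cases q) auto
  thus ?thesis using runN_rep[OF a(1), of r q] a(2) by (simp add: LowN_def)
qed

lemma run_decomp:
  assumes "{} \<in> set U"
  obtains p r q where "U = p @ replicate (Suc r) {} @ q" "{} \<notin> set p" "q = [] \<or> hd q \<noteq> {}" "runN U = Suc r"
proof -
  from split_list_first[OF assms] obtain p y where p: "U = p @ {} # y" "{} \<notin> set p" by blast
  define r where "r = length (takeWhile (\<lambda>S. S = {}) y)"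
  define q where "q = dropWhile (\<lambda>S. S = {}) y"
  have "takeWhile (\<lambda>S. S = {}) y = replicate r {}"
    unfolding r_def by (rule replicate_length_same[symmetric]) (auto dest: set_takeWhileD)
  hence "y = replicate r {} @ q" unfolding q_def by (metis takeWhile_dropWhile_id)
  moreover have "q = [] \<or> hd q \<noteq> {}" unfolding q_def using hd_dropWhile[of "\<lambda>S. S = {}" y] by blast
  moreover have "runN U = Suc r" unfolding p(1) runN_eq[OF p(2)] r_def ..
  ultimately show ?thesis using p that[of p r q] by simp
qed

lemma no_run: "{} \<notin> set U ==> U \<notin> LowN"
proof -
  assume "{} \<notin> set U"
  hence d: "dropWhile (\<lambda>S. S \<noteq> {}) U = []" by auto
  show ?thesis unfolding LowN_def runN_def by (simp only: d mem_Collect_eq) simp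
qed

lemma coord_sg_e: "A \<subseteq> {..<n} ==> (\<Sum>S\<in>Pow {..<n}. coord (sg \<epsilon> (e A)) S *s h S) = sg \<epsilon> (h A)"
proof -
  assume A: "A \<subseteq> {..<n}"
  have "coord (sg \<epsilon> (e A)) S *s h S = (if S = A then sg \<epsilon> (h A) else 0)" for S
    using coord_scale[of "-1" "e A" S] by (cases "S = A") (simp_all add: sg_def coord_e[OF A])
  thus ?thesis using A by simp
qed

text \<open>These are the signs of multiplying neighbouring units in a run of r + 1 units: they
  alternate, and an odd number of them leaves one term.\<close>

lemma alternating_sum: "odd r ==> (\<Sum>j<r. sg (d - int (r - 1 - j)) x) = sg d x"
proof -
  have *: "(\<Sum>j<Suc (2 * l). sg (d - int j) x) = sg d x" for l
    by (induction l) (simp_all add: sg_def)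
  assume "odd r"
  then obtain l where r: "r = Suc (2 * l)" by (auto elim!: oddE)
  have "(\<Sum>j<r. sg (d - int (r - 1 - j)) x) = (\<Sum>j<r. sg (d - int j) x)"
    by (rule sum.reindex_bij_witness[where i = "\<lambda>j. r - 1 - j" and j = "\<lambda>j. r - 1 - j"]) auto
  with * show ?thesis by (simp only: r)
qed

text \<open>The products of neighbouring units inside the run all return \<open>U\<close>, with an
  alternating sum of one sign. Each of the two ends of the run contributes the opposite sign: by the
  product with the adjacent letter or, at an end of the word, by outer multiplication with the unit.
  In total one sign remains.\<close>

lemma DV_mN:
  assumes U: "U \<in> LowN"
  shows "\<exists>\<epsilon>. \<forall>g. (\<forall>U. homog t U (g U)) \<longrightarrow> (\<forall>U. U \<notin> LowN \<longrightarrow> g U = 0) \<longrightarrow> (\<forall>V. (V, U) \<in> RN \<longrightarrow> g V = 0) \<longrightarrow>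
    DV t g (mN U) = sg \<epsilon> (g U)"
proof -
  have "{} \<in> set U" using U no_run by blast
  then obtain p r' q where U': "U = p @ replicate (Suc r') {} @ q" and p: "{} \<notin> set p"
    and q: "q = [] \<or> hd q \<noteq> {}" and run': "runN U = Suc r'" by (rule run_decomp)
  define r where "r = Suc r'"
  have Ue: "U = p @ replicate r {} @ q" and run: "runN U = r" using U' run' by (simp_all add: r_def)
  have r: "odd r" "r \<ge> 1" using U run by (simp_all add: LowN_def r_def)
  have vU: "valid U" using U by (simp add: LowN_def)
  have preU: "preN U = length p" using preN_eq[OF p] by (simp add: U')
  define W where "W = mN U"
  have W: "W = p @ replicate (Suc r) {} @ q" using mN_eq[OF p] by (simp add: W_def U' r_def)
  define k where "k = length U"
  have k: "k = length p + r + length q" by (simp add: k_def Ue)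
  have lW: "length W = Suc k" by (simp add: W k)
  have vW: "valid W" using vU by (auto simp: W Ue valid_def)
  have main: "DV t g W = sg (t - 1 + degs q) (g U)"
    if hom: "\<And>U. homog t U (g U)" and off: "\<And>U. U \<notin> LowN ==> g U = 0" and below: "\<And>V. (V, U) \<in> RN ==> g V = 0" for g
  proof -
    define y where "y = g U"
    have short: "g V = 0" if "length V < k" for V
      by (rule below) (use that in \<open>simp add: RN_def k_def\<close>)
    let ?C = "\<lambda>i. sg (degs (drop (i + 2) W)) (\<Sum>S\<in>Pow {..<n}. coord (\<mu> [e (W ! i), e (W ! Suc i)]) S *s g (take i W @ S # drop (i + 2) W))"
    have C: "?C (length x) = sg (degs z) (\<Sum>S\<in>Pow {..<n}. coord (\<mu> [e A, e B]) S *s g (x @ S # z))"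
      if "W = x @ A # B # z" for x A B z
      by (simp add: that nth_append)
    have one: "(\<Sum>i<length p. ?C i) = (if p = [] then 0 else - sg (degs q) y)"
    proof (cases "p = []")
      case False
      define x where "x = butlast p"
      define A where "A = last p"
      have pe: "p = x @ [A]" using False by (simp add: x_def A_def)
      have A: "A \<subseteq> {..<n}" using vU by (simp add: Ue pe valid_def)
      \<comment> \<open>A product of two letters before the run either is a unit, which makes the
        first unit occur earlier, or leaves a first run of even length, outside
        \<open>LowN\<close>.\<close>
      have z: "?C i = 0" if i: "Suc i < length p" for i
      proof -
        have pd: "p = take i p @ p ! i # p ! Suc i # drop (i + 2) p"
          using i id_take_nth_drop[of i p] Cons_nth_drop_Suc[of "Suc i" p] by simp
        let ?z = "drop (i + 2) p @ replicate (Suc r) {} @ q"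
        have Wd: "W = take i p @ p ! i # p ! Suc i # ?z"
          unfolding W by (subst pd) (simp only: append_assoc append_Cons)
        have np: "{} \<notin> set (take i p)" "{} \<notin> set (drop (i + 2) p)" using p by (auto dest: in_set_takeD in_set_dropD)
        have "g (take i p @ S # ?z) = 0" for S
        proof (cases "S = {}")
          case True
          have pr: "preN (take i p @ S # ?z) = i" unfolding True using preN_eq[OF np(1)] i by simp
          have le: "length (take i p @ S # ?z) = length U" using i by (simp add: Ue)
          show ?thesis by (rule below) (use pr le i preU in \<open>simp add: RN_def\<close>)
        next
          case False
          have "(take i p @ S # drop (i + 2) p) @ replicate (Suc r) {} @ q \<notin> LowN"
            using False np by (intro N_off r q) simp
          thus ?thesis by (intro off) (simp only: append_assoc append_Cons simp_thms)
        qed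
        hence "(\<Sum>S\<in>Pow {..<n}. coord (\<mu> [e (p ! i), e (p ! Suc i)]) S *s g (take i p @ S # ?z)) = 0"
          by (simp only: scale_zero_right sum.neutral_const)
        thus ?thesis using C[OF Wd] i by simp
      qed
      have last: "?C (length x) = - sg (degs q) y"
      proof -
        have Wd: "W = x @ A # {} # (replicate r {} @ q)" by (simp add: W pe)
        have "\<mu> [e A, e {}] = sg 0 (e A)" by (simp add: e_empty unit_right sg_def)
        hence "?C (length x) = sg (degs (replicate r {} @ q)) (sg 0 (g (x @ A # replicate r {} @ q)))"
          unfolding C[OF Wd] by (simp only: coord_sg_e[OF A])
        moreover have "x @ A # replicate r {} @ q = U" by (simp add: Ue pe)
        moreover have "degs (replicate r {}) = - int r" by (induction r) simp_all
        ultimately show ?thesis using r(1) by (simp add: y_def sg_def)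
      qed
      have "(\<Sum>i<length p. ?C i) = (\<Sum>i<length x. ?C i) + ?C (length x)" by (simp add: pe)
      also have "(\<Sum>i<length x. ?C i) = 0" by (rule sum.neutral) (use z in \<open>simp add: pe\<close>)
      finally show ?thesis using False last by simp
    qed simp
    have two: "(\<Sum>j<r. ?C (length p + j)) = sg (degs q) y"
    proof -
      have "?C (length p + j) = sg (degs q - int (r - 1 - j)) y" if j: "j < r" for j
      proof -
        define s where "s = r - 1 - j"
        have s: "r = j + Suc s" "Suc r = j + Suc (Suc s)" using j by (simp_all add: s_def)
        have rep: "replicate r {} = replicate j {} @ {} # replicate s ({} :: nat set)"
          "replicate (Suc r) {} = replicate j {} @ {} # {} # replicate s ({} :: nat set)"
          by (simp only: s(1) replicate_add replicate_Suc) (simp only: s(2) replicate_add replicate_Suc)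
        have Wd: "W = (p @ replicate j {}) @ {} # {} # (replicate s {} @ q)"
          unfolding W rep(2) by simp
        have Ud: "(p @ replicate j {}) @ {} # (replicate s {} @ q) = U" unfolding Ue rep(1) by simp
        have "\<mu> [e {}, e {}] = sg 0 (e {})" by (simp add: e_empty unit_right sg_def)
        hence "?C (length (p @ replicate j {})) = sg (degs (replicate s {} @ q)) (sg 0 (g U))"
          unfolding C[OF Wd] by (simp only: coord_sg_e[of "{}" 0] empty_subsetI Ud)
        moreover have "degs (replicate s {}) = - int s" by (induction s) simp_all
        ultimately show ?thesis unfolding s_def[symmetric] by (simp add: y_def)
      qed
      hence "(\<Sum>j<r. ?C (length p + j)) = (\<Sum>j<r. sg (degs q - int (r - 1 - j)) y)"
        by (intro sum.cong refl) simp
      thus ?thesis using alternating_sum[OF r(1)] by simp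
    qed
    have three: "(\<Sum>j<length q. ?C (length p + r + j)) = (if q = [] then 0 else - sg (degs q) y)"
    proof (cases q)
      case (Cons B z)
      have B: "B \<subseteq> {..<n}" "finite B" using vU finite_subset[of B "{..<n}"] by (simp_all add: Ue Cons valid_def)
      have fst: "?C (length p + r) = - sg (degs q) y"
      proof -
        have Wd: "W = (p @ replicate r {}) @ {} # B # z"
          by (simp add: W Cons replicate_append_same[symmetric])
        have "\<mu> [e {}, e B] = - tw (e B)" by (simp add: e_empty \<mu>_unit_left)
        also have "\<dots> = sg (int (card B)) (e B)" using tw_sg[OF e_X[OF B(2)]] by (simp add: sg_def)
        finally have "?C (length (p @ replicate r {})) = sg (degs z) (sg (int (card B)) (g ((p @ replicate r {}) @ B # z)))"
          unfolding C[OF Wd] by (simp only: coord_sg_e[OF B(1)])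
        thus ?thesis by (simp add: y_def Ue Cons sg_def)
      qed
      \<comment> \<open>After the run, a product equal to the unit may prolong the run, which leaves
        fewer letters behind it; in all other cases the first run keeps its even length.\<close>
      have z: "?C (length p + r + Suc j) = 0" if j: "Suc j < length q" for j
      proof -
        have qd: "q = take j q @ q ! j # q ! Suc j # drop (j + 2) q"
          using j id_take_nth_drop[of j q] Cons_nth_drop_Suc[of "Suc j" q] by simp
        let ?x = "p @ replicate (Suc r) {} @ take j q"
        have Wd: "W = ?x @ q ! j # q ! Suc j # drop (j + 2) q"
          unfolding W by (subst qd) (simp only: append_assoc append_Cons)
        have lx: "length ?x = length p + r + Suc j" using j by simp
        have ev: "g (?x @ S # drop (j + 2) q) = 0" for S
        proof (cases "j = 0 \<and> S = {}")
          case True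
          let ?V = "?x @ S # drop (j + 2) q"
          have V: "?V = p @ replicate (Suc r) {} @ ({} # drop 2 q)" using True by (simp add: numeral_2_eq_2)
          have "preN ?V = length p" unfolding V using preN_eq[OF p] by simp
          moreover have "runN ?V \<ge> Suc (Suc r)" unfolding V runN_rep[OF p] by simp
          moreover have "length ?V = k" using True j k by simp
          moreover have "length U - preN U - runN U = length q" "length U = k" using run preU k by (simp_all add: k_def)
          ultimately show ?thesis using j by (intro below) (simp add: RN_def preU)
        next
          case False
          have "p @ replicate (Suc r) {} @ (take j q @ S # drop (j + 2) q) \<notin> LowN"
            using q False j Cons by (intro N_off p r) (cases j, auto)
          thus ?thesis by (intro off) (simp only: append_assoc simp_thms)
        qed
        hence "(\<Sum>S\<in>Pow {..<n}. coord (\<mu> [e (q ! j), e (q ! Suc j)]) S *s g (?x @ S # drop (j + 2) q)) = 0"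
          by (simp only: scale_zero_right sum.neutral_const)
        thus ?thesis using C[OF Wd] unfolding lx by simp
      qed
      have "(\<Sum>j<length q. ?C (length p + r + j)) = ?C (length p + r) + (\<Sum>j<length z. ?C (length p + r + Suc j))"
        by (simp only: Cons list.size sum.lessThan_Suc_shift add_0_right add_Suc_right One_nat_def)
      also have "(\<Sum>j<length z. ?C (length p + r + Suc j)) = 0"
        by (rule sum.neutral, rule ballI, rule z) (simp add: Cons)
      finally show ?thesis using fst Cons by simp
    qed simp
    have split: "(\<Sum>i<a + b. f i) = (\<Sum>i<a. f i) + (\<Sum>j<b. f (a + j))" for a b and f :: "nat => 'a"
      by (induction b) (simp_all add: add.assoc)
    have sum: "(\<Sum>i<k. ?C i) = (if p = [] then 0 else - sg (degs q) y) + sg (degs q) y + (if q = [] then 0 else - sg (degs q) y)"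
      unfolding k split one two three ..
    \<comment> \<open>If the word begins with the run, outer multiplication by the unit takes the
      place of the missing left neighbour. This is where the degree of the value enters.\<close>
    have left: "\<mu> [e (hd W), g (tl W)] = (if p = [] then sg (t - 1 + degs q) y else 0)"
    proof (cases p)
      case Nil
      have "y \<in> X (degs U + t)" using hom[of U] vU by (simp add: homog_def y_def)
      moreover have "degs (replicate r {}) = - int r" by (induction r) simp_all
      ultimately have "- tw y = sg (t - 1 + degs q) y"
        using tw_sg[of y "degs U + t"] r(1) by (simp add: Ue Nil sg_def)
      moreover have "hd W = {}" "tl W = U" by (simp_all add: W Ue Nil)
      ultimately show ?thesis by (simp add: Nil e_empty \<mu>_unit_left y_def)
    next
      case (Cons A x)
      have "tl W = x @ replicate (Suc r) {} @ q" by (simp add: W Cons)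
      moreover have "x @ replicate (Suc r) {} @ q \<notin> LowN" using p Cons by (intro N_off r q) simp
      ultimately have "g (tl W) = 0" by (simp only: off not_False_eq_True)
      thus ?thesis using multilinear_zero[OF multilinear, of "[e (hd W)]" "[]"] by (simp add: Cons)
    qed
    have right: "\<mu> [g (butlast W), twist_by X (t - 1) (e (last W))] = (if q = [] then sg (t - 1) y else 0)"
    proof (cases "q = []")
      case True
      have "W = U @ [{}]" by (simp add: W Ue True replicate_append_same)
      thus ?thesis using True by (simp add: e_empty T_unit \<mu>_sg unit_right y_def)
    next
      case False
      have "butlast W = p @ replicate (Suc r) {} @ butlast q" using False by (simp add: W butlast_append)
      moreover have "p @ replicate (Suc r) {} @ butlast q \<notin> LowN"
      proof (intro N_off p r)
        show "butlast q = [] \<or> hd (butlast q) \<noteq> {}" using q False by (cases q) auto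
      qed
      ultimately have "g (butlast W) = 0" by (simp only: off not_False_eq_True)
      thus ?thesis using False multilinear_zero[OF multilinear, of "[]" "[twist_by X (t - 1) (e (last W))]"] by simp
    qed
    have "DV t g W = \<mu> [e (hd W), g (tl W)] + \<mu> [g (butlast W), twist_by X (t - 1) (e (last W))] - sg (t - 1) (\<Sum>i<k. ?C i)"
      using k r(2) by (intro DV_eq vW lW short) auto
    thus ?thesis unfolding left right sum y_def[symmetric]
      by (cases "p = []"; cases "q = []") (simp_all add: sg_def)
  qed
  show ?thesis unfolding W_def[symmetric] using main by blast
qed

lemma mN_decomp:
  assumes "{} \<in> set U" "valid U" "U \<notin> LowN"
  shows "\<exists>V\<in>LowN. U = mN V"
proof -
  obtain p r q where U: "U = p @ replicate (Suc r) {} @ q" and p: "{} \<notin> set p" and q: "q = [] \<or> hd q \<noteq> {}"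
    and run: "runN U = Suc r" using assms(1) by (rule run_decomp)
  have "odd r" using assms run by (simp add: LowN_def)
  then obtain s where s: "r = Suc s" by (cases r) auto
  let ?V = "p @ replicate (Suc s) {} @ q"
  have "length (takeWhile (\<lambda>S. S = {}) q) = 0" using q by (cases q) auto
  hence "runN ?V = r" using runN_rep[OF p, of s q] s by simp
  moreover have "valid ?V" using assms(2) by (auto simp: U valid_def)
  ultimately have "?V \<in> LowN" using \<open>odd r\<close> by (simp add: LowN_def)
  moreover have "U = mN ?V" using mN_eq[OF p, of "replicate s {} @ q"] by (simp add: U s)
  ultimately show ?thesis by blast
qed

lemma LowN_mN: "U \<in> LowN ==> {} \<in> set (mN U) \<and> valid (mN U) \<and> degs (mN U) = degs U - 1"
proof -
  assume U: "U \<in> LowN"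
  have "{} \<in> set U" using U no_run by blast
  then obtain p r q where "U = p @ replicate (Suc r) {} @ q" "{} \<notin> set p" by (rule run_decomp)
  hence "U = p @ {} # replicate r {} @ q" "{} \<notin> set p" by simp_all
  with mN_eq[of p] U show ?thesis by (auto simp: LowN_def valid_def)
qed

lemma homog_diff: "homog t U x ==> homog t U y ==> homog t U (x - y)"
  unfolding homog_def using subspace_diff[OF grading_subspace] by blast

lemma homog_0: "homog t U 0" by (simp add: homog_def X_0)

lemma dH_add: "dH t (\<lambda>as. \<phi> as + \<psi> as) as = dH t \<phi> as + dH t \<psi> as"
  using dH_diff[of t "\<lambda>as. \<phi> as + \<psi> as" \<psi> as] by simp

lemma dH_dH': "\<phi> \<in> CC (t - 1) ==> dH t (dH (t - 1) \<phi>) as = 0"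
  using dH_dH[of \<phi> "t - 1" as] by simp

lemma DV_mN_choice:
  "\<exists>\<epsilon>. \<forall>U\<in>LowN. \<forall>g. (\<forall>U. homog t U (g U)) \<longrightarrow> (\<forall>U. U \<notin> LowN \<longrightarrow> g U = 0) \<longrightarrow> (\<forall>V. (V, U) \<in> RN \<longrightarrow> g V = 0) \<longrightarrow>
    DV t g (mN U) = sg (\<epsilon> U) (g U)"
  by (rule bchoice, rule ballI, rule DV_mN)

text \<open>Only \<open>dH t \<phi>\<close> is required to be reduced, so that the statement covers
  cocycles as well as primitives of reduced cocycles. The cochain \<psi> is chosen to make the
  difference vanish on the partner words; triangularity then removes the values on
  \<open>LowN\<close>.\<close>

lemma normalize:
  assumes \<phi>: "\<phi> \<in> CC t" and red: "reduced (dH t \<phi>)"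
  shows "\<exists>\<psi>\<in>CC (t - 1). reduced (\<lambda>as. \<phi> as - dH (t - 1) \<psi> as)"
proof -
  have "\<exists>\<psi>. (\<forall>U. homog (t - 1) U (\<psi> U)) \<and> (\<forall>U. U \<notin> LowN \<longrightarrow> \<psi> U = 0) \<and>
      (\<forall>U\<in>LowN. DV (t - 1) \<psi> (mN U) = \<phi> (map e (mN U)))"
  proof -
    obtain \<epsilon> where \<epsilon>:
      "\<forall>U\<in>LowN. \<forall>g. (\<forall>U. homog (t - 1) U (g U)) \<longrightarrow> (\<forall>U. U \<notin> LowN \<longrightarrow> g U = 0) \<longrightarrow> (\<forall>V. (V, U) \<in> RN \<longrightarrow> g V = 0) \<longrightarrow>
      DV (t - 1) g (mN U) = sg (\<epsilon> U) (g U)" using DV_mN_choice[of "t - 1"] ..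
    have hm: "homog (t - 1) U y" if "homog t (mN U) y" "U \<in> LowN" for U y
    proof -
      have "degs (mN U) + t = degs U + (t - 1)" using LowN_mN[OF that(2)] by linarith
      with that(1) LowN_mN[OF that(2)] show ?thesis unfolding homog_def by metis
    qed
    show ?thesis
    proof (rule morse_ex[where R = RN and \<epsilon> = \<epsilon> and G = "homog (t - 1)" and D = "DV (t - 1)" and m = mN and Low = LowN
          and \<phi> = "\<lambda>U. \<phi> (map e (mN U))"])
      show "DV (t - 1) g (mN T) = sg (\<epsilon> T) (g T)" if "T \<in> LowN" "\<And>U. homog (t - 1) U (g U)"
        "\<And>U. U \<notin> LowN ==> g U = 0" "\<And>U. (U, T) \<in> RN ==> g U = 0" for T g
        by (rule \<epsilon>[rule_format, OF that])
      show "homog (t - 1) T (DV (t - 1) g (mN T))" if "\<And>U. homog (t - 1) U (g U)" "T \<in> LowN" for T g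
        using DV_homog[of "t - 1" g "mN T"] that by (intro hm) simp_all
      show "homog (t - 1) T (\<phi> (map e (mN T)))" if "T \<in> LowN" for T
        using CC_e[OF \<phi>] that by (intro hm) simp_all
    qed (simp_all add: wf_RN DV_diff homog_0 homog_diff)
  qed
  then obtain g where g: "\<And>U. homog (t - 1) U (g U)" "\<And>U. U \<in> LowN ==> DV (t - 1) g (mN U) = \<phi> (map e (mN U))" by blast
  define \<psi> where "\<psi> = cx g"
  have \<psi>: "\<psi> \<in> CC (t - 1)" unfolding \<psi>_def by (rule cx_CC[OF g(1)])
  define \<phi>' where "\<phi>' = (\<lambda>as. \<phi> as - dH (t - 1) \<psi> as)"
  have \<phi>': "\<phi>' \<in> CC t" unfolding \<phi>'_def using dH_CC[OF \<psi>] by (intro CC_diff \<phi>) simp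
  have d\<phi>': "dH t \<phi>' = dH t \<phi>"
    unfolding \<phi>'_def by (rule ext) (simp add: dH_diff dH_dH'[OF \<psi>])
  have mz: "\<phi>' (map e (mN U)) = 0" if "U \<in> LowN" for U
    using g(2)[OF that] by (simp add: \<phi>'_def \<psi>_def)
  define h where "h U = (if valid U then \<phi>' (map e U) else 0)" for U
  have h: "homog t U (h U)" for U using CC_e[OF \<phi>', of U] by (simp add: h_def homog_def)
  have h_cx: "\<phi>' = cx h"
    by (rule trans[OF CC_eq_cx[OF \<phi>']], rule cx_cong) (simp add: h_def)
  define h' where "h' U = (if U \<in> LowN then h U else 0)" for U
  have h': "homog t U (h' U)" for U using h by (simp add: h'_def homog_0)
  have outside: "h U - h' U = 0" if "{} \<in> set U" for U
  proof (cases "U \<in> LowN")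
    case False
    show ?thesis
    proof (cases "valid U")
      case True
      from mN_decomp[OF that True False] mz show ?thesis by (auto simp: h_def h'_def False)
    qed (simp add: h_def h'_def)
  qed (simp add: h'_def)
  have "h' U = 0" for U
  proof -
    obtain \<epsilon> where \<epsilon>:
      "\<forall>U\<in>LowN. \<forall>g. (\<forall>U. homog t U (g U)) \<longrightarrow> (\<forall>U. U \<notin> LowN \<longrightarrow> g U = 0) \<longrightarrow> (\<forall>V. (V, U) \<in> RN \<longrightarrow> g V = 0) \<longrightarrow>
      DV t g (mN U) = sg (\<epsilon> U) (g U)" using DV_mN_choice[of t] ..
    show ?thesis
    proof (rule morse_unique[where R = RN and \<epsilon> = \<epsilon> and G = "homog t" and D = "DV t" and m = mN and Low = LowN])
      show "DV t g (mN T) = sg (\<epsilon> T) (g T)" if "T \<in> LowN" "\<And>U. homog t U (g U)"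
        "\<And>U. U \<notin> LowN ==> g U = 0" "\<And>U. (U, T) \<in> RN ==> g U = 0" for T g
        by (rule \<epsilon>[rule_format, OF that])
      \<comment> \<open>The differential of \<open>h\<close> is reduced by assumption. That of
        \<open>h - h'\<close> is reduced because this difference vanishes on words with a unit. Both
        are therefore zero at partner words, which contain a unit.\<close>
      show "DV t h' (mN T) = 0" if "T \<in> LowN" for T
      proof -
        have mT: "{} \<in> set (mN T)" using LowN_mN[OF that] by blast
        have "DV t h (mN T) = 0" using reduced_e[OF red mT] by (simp add: h_cx[symmetric] d\<phi>')
        moreover have "reduced (dH t (cx (\<lambda>U. h U - h' U)))"
          by (intro reduced_dH reduced_cx cx_CC homog_diff h h' outside)
        from reduced_e[OF this mT] have "DV t (\<lambda>U. h U - h' U) (mN T) = 0" .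
        ultimately show ?thesis by (simp add: DV_diff)
      qed
      show "h' U = 0" if "U \<notin> LowN" for U using that by (simp add: h'_def)
    qed (rule wf_RN, rule h')
  qed
  with outside have "h U = 0" if "{} \<in> set U" for U using that by fastforce
  hence "reduced \<phi>'" unfolding h_cx by (rule reduced_cx)
  with \<psi> show ?thesis unfolding \<phi>'_def by blast
qed

section \<open>Evaluation is a quasi-isomorphism on reduced cochains\<close>

abbreviation "sings \<equiv> map (\<lambda>i :: nat. {i})"

lemma LowK_I:
  "valid (sings is @ w # r) ==> {} \<notin> set (sings is @ w # r) ==> sorted_wrt (\<ge>) (is @ [Min w]) ==>
    card w \<ge> 2 ==> sings is @ w # r \<in> LowK"
  unfolding LowK_def by blast

text \<open>The unmatched words are the weakly decreasing words in generators, that is, the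
  monomials in the variables. In the longest prefix of singletons the first ascent, or else the
  first larger block, decides the case.\<close>

lemma K_trichotomy:
  assumes U: "valid U" "{} \<notin> set U"
  shows "U \<in> LowK \<or> (\<exists>W\<in>LowK. U = mK W) \<or> (\<exists>w. set w \<subseteq> {..<n} \<and> sorted_wrt (\<ge>) w \<and> U = sings w)"
proof -
  have "\<exists>x rest. U = sings x @ rest \<and> (rest = [] \<or> card (hd rest) \<noteq> 1)"
  proof (induction U)
    case (Cons S U)
    then obtain x rest where x: "U = sings x @ rest" "rest = [] \<or> card (hd rest) \<noteq> 1" by blast
    show ?case
    proof (cases "card S = 1")
      case True
      then obtain i where "S = {i}" by (rule card_1_singletonE)
      with x show ?thesis by (intro exI[of _ "i # x"] exI[of _ rest]) simp
    next
      case False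
      thus ?thesis by (intro exI[of _ "[]"] exI[of _ "S # U"]) simp
    qed
  qed simp
  then obtain x rest where Ue: "U = sings x @ rest" and rest: "rest = [] \<or> card (hd rest) \<noteq> 1" by blast
  show ?thesis
  proof (cases "sorted_wrt (\<ge>) x")
    case False
    from not_descending[OF False] obtain x' a b y' where
      x: "x = x' @ a # b # y'" "sorted_wrt (\<ge>) (x' @ [a])" "a < b" by blast
    \<comment> \<open>A first ascent from {a} to {b} is the split form of {a, b}.\<close>
    let ?W = "sings x' @ {a, b} # (sings y' @ rest)"
    have m: "Min {a, b} = a" using x(3) by simp
    have "?W \<in> LowK" using U x by (intro LowK_I) (auto simp: Ue valid_def m)
    moreover have "mK ?W = U" using x(3) by (subst mK_eq) (auto simp: Ue x(1) m insert_Diff_if)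
    ultimately show ?thesis by blast
  next
    case True
    show ?thesis
    proof (cases rest)
      case Nil
      with True U(1) show ?thesis by (auto simp: Ue valid_def)
    next
      case (Cons w r)
      have w: "w \<subseteq> {..<n}" "w \<noteq> {}" using U by (auto simp: Ue Cons valid_def)
      hence fw: "finite w" using finite_subset by blast
      have "card w \<noteq> 0" "card w \<noteq> 1" using w fw rest Cons by auto
      hence cw: "card w \<ge> 2" by linarith
      show ?thesis
      proof (cases "sorted_wrt (\<ge>) (x @ [Min w])")
        case s: True
        have "U \<in> LowK" unfolding Ue Cons using U s cw by (intro LowK_I) (simp_all add: Ue Cons)
        thus ?thesis ..
      next
        case False
        hence "x \<noteq> []" by auto
        then obtain x' a where x: "x = x' @ [a]" by (metis append_butlast_last_id)
        have "a < Min w"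
        proof (rule ccontr)
          assume "\<not> a < Min w"
          moreover have "\<forall>i\<in>set x. i \<ge> a" using True by (auto simp: x sorted_wrt_append)
          ultimately have "\<forall>i\<in>set x. i \<ge> Min w" by (meson le_trans linorder_not_less)
          with True False show False by (simp add: sorted_wrt_append)
        qed
        hence al: "\<And>b. b \<in> w ==> a < b" using fw w by (simp add: Min_gr_iff)
        hence an: "a \<notin> w" by blast
        have m: "Min (insert a w) = a" using fw al by (intro Min_eqI) (auto intro: less_imp_le)
        \<comment> \<open>The last singleton lies below the block \<open>w\<close>, so it was split
          off from \<open>insert a w\<close>.\<close>
        let ?W = "sings x' @ insert a w # r"
        have c: "card (insert a w) \<ge> 2" using fw an cw by simp
        have "?W \<in> LowK" using U True c by (intro LowK_I) (auto simp: Ue Cons x valid_def m)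
        moreover have "mK ?W = U" using an unfolding mK_eq[OF c] by (simp add: Ue Cons x m)
        ultimately show ?thesis by blast
      qed
    qed
  qed
qed

lemma LowK_mK: "U \<in> LowK ==> valid (mK U) \<and> degs (mK U) = degs U - 1"
proof -
  assume "U \<in> LowK"
  then obtain "is" w r where U: "U = sings is @ w # r" "valid U" "card w \<ge> 2" by (auto simp: LowK_def)
  have fw: "finite w" using U(3) by (metis card.infinite not_numeral_le_zero)
  have "Min w \<in> w" using U(3) fw by (intro Min_in) auto
  moreover have "int (card (w - {Min w})) = int (card w) - 1" using fw U(3) \<open>Min w \<in> w\<close> by (simp add: of_nat_diff)
  ultimately show ?thesis using U unfolding U(1) mK_eq[OF U(3)] by (auto simp: valid_def)
qed

lemma not_desc_mK:
  assumes "set w \<subseteq> {..<n}" "\<not> sorted_wrt (\<ge>) w"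
  shows "\<exists>W\<in>LowK. sings w = mK W"
proof -
  from not_descending[OF assms(2)] obtain x' a b y' where
    x: "w = x' @ a # b # y'" "sorted_wrt (\<ge>) (x' @ [a])" "a < b" by blast
  let ?W = "sings x' @ {a, b} # sings y'"
  have m: "Min {a, b} = a" using x(3) by simp
  have "?W \<in> LowK" using assms(1) x by (intro LowK_I) (auto simp: valid_def m)
  moreover have "mK ?W = sings w" using x(3) by (subst mK_eq) (auto simp: x(1) m insert_Diff_if)
  ultimately show ?thesis by metis
qed

text \<open>All words of content \<open>m\<close> other than the decreasing one are partners of
  words in \<open>LowK\<close>, where \<chi> vanishes.\<close>

lemma ev_desc:
  assumes \<chi>: "multilinear scale \<chi>" and z: "\<And>W. W \<in> LowK ==> \<chi> (map e (mK W)) = 0"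
  shows "ev \<chi> m = \<chi> (map v (desc m))"
proof -
  have "\<chi> (map v w) = 0" if "mset w = m" "w \<noteq> desc m" for w
  proof (cases "set w \<subseteq> {..<n}")
    case True
    have "\<not> sorted_wrt (\<ge>) w" using desc_unique[of w] that by auto
    from not_desc_mK[OF True this] z show ?thesis by (auto simp: v_word[OF True] simp del: map_map)
  qed (rule word_out[OF \<chi>])
  hence "(\<Sum>w | mset w = m. \<chi> (map v w)) = (\<Sum>w\<in>{desc m}. \<chi> (map v w))"
    by (intro sum.mono_neutral_right finite_words) auto
  thus ?thesis by (simp add: wsum_def)
qed

text \<open>The cochain takes the value \<open>\<alpha> m\<close> on the decreasing word of content
  \<open>m\<close> and zero on all other basis words.\<close>

lemma ev_surj:
  assumes \<alpha>: "\<And>m. \<alpha> m \<in> X t" "\<And>m. \<alpha> m \<noteq> 0 ==> set_mset m \<subseteq> {..<n}"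
  shows "\<exists>\<phi>\<in>CC t. reduced \<phi> \<and> ev \<phi> = \<alpha>"
proof -
  define g where "g U = (if \<exists>w. sorted_wrt (\<ge>) w \<and> U = sings w then \<alpha> (mset (map the_elem U)) else 0)" for U
  have "inj (\<lambda>i :: nat. {i})" by (rule injI) simp
  hence g: "g (sings w) = (if sorted_wrt (\<ge>) w then \<alpha> (mset w) else 0)" for w
    by (auto simp: g_def comp_def inj_map_eq_map)
  have hg: "homog t U (g U)" for U
  proof (cases "\<exists>w. sorted_wrt (\<ge>) w \<and> U = sings w")
    case True
    then obtain w where w: "U = sings w" by blast
    have "degs (sings w) = 0" by (induction w) simp_all
    thus ?thesis unfolding w g using \<alpha>(1) X_0 by (simp add: homog_def)
  qed (simp only: g_def if_False homog_0)
  have ml: "multilinear scale (cx g)" by (rule multilinear_cx)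
  have "ev (cx g) m = \<alpha> m" for m
  proof (cases "set_mset m \<subseteq> {..<n}")
    case True
    have *: "cx g (map v w) = (if w = desc m then \<alpha> m else 0)" if "mset w = m" for w
    proof -
      have w: "set w \<subseteq> {..<n}" using True that by auto
      have "cx g (map v w) = g (sings w)" unfolding v_word[OF w] by (rule cx_e[OF valid_word[OF w]])
      moreover have "sorted_wrt (\<ge>) w \<longleftrightarrow> w = desc m"
        using sorted_wrt_desc[of m] desc_unique[of w] unfolding that by metis
      ultimately show ?thesis unfolding g that by simp
    qed
    have "ev (cx g) m = (\<Sum>w | mset w = m. if w = desc m then \<alpha> m else 0)"
      unfolding SS.simps wsum_def by (rule sum.cong[OF refl]) (use * in simp)
    also have "\<dots> = \<alpha> m" using finite_words[of m] by simp
    finally show ?thesis .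
  next
    case False
    thus ?thesis using ev_out[OF ml False] \<alpha>(2)[of m] by auto
  qed
  moreover have "reduced (cx g)" by (rule reduced_cx) (auto simp: g_def)
  ultimately show ?thesis using cx_CC[OF hg] by blast
qed

lemma DV_mK_choice:
  "\<exists>\<epsilon>. \<forall>W\<in>LowK. \<forall>g. (\<forall>U. U \<notin> LowK \<longrightarrow> g U = 0) \<longrightarrow> (\<forall>U. (U, W) \<in> RK \<longrightarrow> g U = 0) \<longrightarrow>
    DV t g (mK W) = sg (\<epsilon> W) (g W)"
  by (rule bchoice, rule ballI, rule DV_mK)

text \<open>By the trichotomy \<chi> is supported on \<open>LowK\<close>: it vanishes on partners by
  assumption and on the unmatched words because its evaluation is zero. Triangularity of the cocycle
  equation then leaves nothing.\<close>

lemma ev_kernel: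
  assumes \<chi>: "\<chi> \<in> CC t" "reduced \<chi>" and d: "dH t \<chi> = (\<lambda>as. 0)"
    and z: "\<And>W. W \<in> LowK ==> \<chi> (map e (mK W)) = 0" and ev: "\<And>m. ev \<chi> m = 0"
  shows "\<chi> = (\<lambda>as. 0)"
proof -
  define h where "h U = (if U \<in> LowK then \<chi> (map e U) else 0)" for U
  have \<chi>h: "\<chi> (map e U) = h U" if U: "valid U" for U
  proof (cases "{} \<in> set U \<or> U \<in> LowK")
    case True
    thus ?thesis using reduced_e[OF \<chi>(2)] by (auto simp: h_def LowK_def)
  next
    case False
    hence "{} \<notin> set U" "U \<notin> LowK" by simp_all
    with K_trichotomy[OF U] consider W where "W \<in> LowK" "U = mK W" |
      w where "set w \<subseteq> {..<n}" "sorted_wrt (\<ge>) w" "U = sings w" by blast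
    thus ?thesis
    proof cases
      case 1
      thus ?thesis using z \<open>U \<notin> LowK\<close> by (simp add: h_def)
    next
      case 2
      have "ev \<chi> (mset w) = \<chi> (map v w)"
        using ev_desc[OF CC_multilinear[OF \<chi>(1)] z] desc_unique[OF 2(2)] by metis
      thus ?thesis using ev \<open>U \<notin> LowK\<close> unfolding 2(3) v_word[OF 2(1)] by (simp add: h_def)
    qed
  qed
  have \<chi>cx: "\<chi> = cx h"
    by (rule multilinear_eqI[OF CC_multilinear[OF \<chi>(1)] multilinear_cx]) (simp add: \<chi>h cx_e)
  have "h U = 0" for U
  proof -
    obtain \<epsilon> where \<epsilon>:
      "\<forall>W\<in>LowK. \<forall>g. (\<forall>U. U \<notin> LowK \<longrightarrow> g U = 0) \<longrightarrow> (\<forall>U. (U, W) \<in> RK \<longrightarrow> g U = 0) \<longrightarrow>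
      DV t g (mK W) = sg (\<epsilon> W) (g W)" using DV_mK_choice[of t] ..
    show ?thesis
    proof (rule morse_unique[where R = RK and \<epsilon> = \<epsilon> and G = "\<lambda>_ _. True" and D = "DV t" and m = mK and Low = LowK])
      show "DV t g (mK W) = sg (\<epsilon> W) (g W)" if "W \<in> LowK" 
        "\<And>U. U \<notin> LowK ==> g U = 0" "\<And>U. (U, W) \<in> RK ==> g U = 0" for W g
        by (rule \<epsilon>[rule_format, OF that])
      show "DV t h (mK W) = 0" for W using d by (simp add: \<chi>cx[symmetric])
    qed (simp_all add: wf_RK h_def)
  qed
  hence "h = (\<lambda>U. 0)" by (rule ext)
  thus ?thesis using \<chi>cx by (intro ext) (simp add: cx_0)
qed

lemma reduced_diff: "reduced \<phi> ==> reduced \<psi> ==> reduced (\<lambda>as. \<phi> as - \<psi> as)"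
  by (simp add: reduced_def)

text \<open>The equation for \<eta> is solved on the partner words with \<eta> supported on
  \<open>LowK\<close>. Such a cochain evaluates to zero, as \<open>LowK\<close> contains no words of
  singletons, so the remaining error falls under \<open>ev_kernel\<close>.\<close>

lemma ev_exact:
  assumes \<psi>: "\<psi> \<in> CC (t + 1)" "reduced \<psi>" and d: "dH (t + 1) \<psi> = (\<lambda>as. 0)" and ev: "\<And>m. ev \<psi> m = 0"
  shows "\<exists>\<eta>\<in>CC t. reduced \<eta> \<and> (\<forall>m. ev \<eta> m = 0) \<and> dH t \<eta> = \<psi>"
proof -
  have "\<exists>g. (\<forall>U. homog t U (g U)) \<and> (\<forall>U. U \<notin> LowK \<longrightarrow> g U = 0) \<and>
      (\<forall>U\<in>LowK. DV t g (mK U) = \<psi> (map e (mK U)))"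
  proof -
    obtain \<epsilon> where \<epsilon>:
      "\<forall>W\<in>LowK. \<forall>g. (\<forall>U. U \<notin> LowK \<longrightarrow> g U = 0) \<longrightarrow> (\<forall>U. (U, W) \<in> RK \<longrightarrow> g U = 0) \<longrightarrow>
      DV t g (mK W) = sg (\<epsilon> W) (g W)" using DV_mK_choice[of t] ..
    have hm: "homog t U y" if "homog (t + 1) (mK U) y" "U \<in> LowK" for U y
    proof -
      have "degs (mK U) + (t + 1) = degs U + t" using LowK_mK[OF that(2)] by linarith
      with that(1) LowK_mK[OF that(2)] show ?thesis unfolding homog_def by metis
    qed
    show ?thesis
    proof (rule morse_ex[where R = RK and \<epsilon> = \<epsilon> and G = "homog t" and D = "DV t" and m = mK and Low = LowK
          and \<phi> = "\<lambda>U. \<psi> (map e (mK U))"])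
      show "DV t g (mK W) = sg (\<epsilon> W) (g W)" if "W \<in> LowK"
        "\<And>U. U \<notin> LowK ==> g U = 0" "\<And>U. (U, W) \<in> RK ==> g U = 0" for W g
        by (rule \<epsilon>[rule_format, OF that])
      show "homog t W (DV t g (mK W))" if "\<And>U. homog t U (g U)" "W \<in> LowK" for W g
        using DV_homog[of t g "mK W"] that by (intro hm) simp_all
      show "homog t W (\<psi> (map e (mK W)))" if "W \<in> LowK" for W
        using CC_e[OF \<psi>(1)] that by (intro hm) simp_all
    qed (simp_all add: wf_RK DV_diff homog_0 homog_diff)
  qed
  then obtain g where hg: "\<And>U. homog t U (g U)" and off: "\<And>U. U \<notin> LowK ==> g U = 0"
    and g: "\<And>U. U \<in> LowK ==> DV t g (mK U) = \<psi> (map e (mK U))" by blast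
  define \<eta> where "\<eta> = cx g"
  have \<eta>: "\<eta> \<in> CC t" unfolding \<eta>_def by (rule cx_CC[OF hg])
  have r\<eta>: "reduced \<eta>" unfolding \<eta>_def by (rule reduced_cx) (rule off, simp add: LowK_def)
  have ml: "multilinear scale \<eta>" by (rule CC_multilinear[OF \<eta>])
  have "\<eta> (map v w) = 0" for w
  proof (cases "set w \<subseteq> {..<n}")
    case True
    show ?thesis unfolding v_word[OF True] \<eta>_def cx_e[OF valid_word[OF True]] by (rule off[OF not_LowK_singles])
  qed (rule word_out[OF ml])
  hence ev\<eta>: "ev \<eta> m = 0" for m by (simp add: wsum_def)
  define \<chi> where "\<chi> = (\<lambda>as. \<psi> as - dH t \<eta> as)"
  have "\<chi> = (\<lambda>as. 0)"
  proof (rule ev_kernel)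
    show "\<chi> \<in> CC (t + 1)" unfolding \<chi>_def by (intro CC_diff \<psi> dH_CC \<eta>)
    show "reduced \<chi>" unfolding \<chi>_def by (intro reduced_diff \<psi> reduced_dH[OF \<eta> r\<eta>])
    show "dH (t + 1) \<chi> = (\<lambda>as. 0)"
      unfolding \<chi>_def by (rule ext) (simp only: dH_diff d dH_dH[OF \<eta>] diff_self)
    show "\<chi> (map e (mK W)) = 0" if "W \<in> LowK" for W
      using g[OF that] by (simp add: \<chi>_def \<eta>_def)
    show "ev \<chi> m = 0" for m
    proof -
      have "ev \<eta> = (\<lambda>m. 0)" using ev\<eta> by (rule ext)
      hence "ev (dH t \<eta>) m = SS [\<lambda>m. 0] m \<mu>" by (subst ev_dH[OF \<eta> r\<eta>]) (simp only:)
      also have "\<dots> = 0" by (simp only: SS.simps multilinear_zero[OF multilinear] append_Cons append_Nil)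
          (simp add: msum_def wsum_def multilinear_zero[OF multilinear])
      finally show ?thesis unfolding \<chi>_def SS_diff using ev by simp
    qed
  qed
  hence "dH t \<eta> = \<psi>" by (simp add: \<chi>_def fun_eq_iff)
  with \<eta> r\<eta> ev\<eta> show ?thesis by blast
qed

text \<open>The differential of any reduced lift of \<alpha> evaluates to zero, and
  \<open>ev_exact\<close> corrects the lift without changing its evaluation.\<close>

lemma ev_cocycle_surj:
  assumes \<alpha>: "\<And>m. \<alpha> m \<in> X t" "\<And>m. \<alpha> m \<noteq> 0 ==> set_mset m \<subseteq> {..<n}" and d: "\<And>m. SS [\<alpha>] m \<mu> = 0"
  shows "\<exists>\<phi>\<in>CC t. reduced \<phi> \<and> ev \<phi> = \<alpha> \<and> dH t \<phi> = (\<lambda>as. 0)"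
proof -
  obtain \<phi> where \<phi>: "\<phi> \<in> CC t" "reduced \<phi>" "ev \<phi> = \<alpha>" using ev_surj[of \<alpha> t, OF \<alpha>] by blast
  have "ev (dH t \<phi>) m = 0" for m using ev_dH[OF \<phi>(1,2)] d unfolding \<phi>(3) by simp
  moreover have "dH (t + 1) (dH t \<phi>) = (\<lambda>as. 0)" by (rule ext) (rule dH_dH[OF \<phi>(1)])
  ultimately obtain \<eta> where \<eta>: "\<eta> \<in> CC t" "reduced \<eta>" "\<forall>m. ev \<eta> m = 0" "dH t \<eta> = dH t \<phi>"
    using ev_exact[OF dH_CC[OF \<phi>(1)] reduced_dH[OF \<phi>(1,2)]] by blast
  show ?thesis
  proof (intro bexI[of _ "\<lambda>as. \<phi> as - \<eta> as"] conjI)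
    show "ev (\<lambda>as. \<phi> as - \<eta> as) = \<alpha>" unfolding SS_diff using \<phi>(3) \<eta>(3) by (simp add: fun_eq_iff)
    show "dH t (\<lambda>as. \<phi> as - \<eta> as) = (\<lambda>as. 0)" by (rule ext) (simp add: dH_diff \<eta>(4))
  qed (simp_all add: reduced_diff CC_diff \<phi> \<eta>)
qed

lemma ev_coboundary:
  assumes \<phi>: "\<phi> \<in> CC (t + 1)" "reduced \<phi>" "dH (t + 1) \<phi> = (\<lambda>as. 0)" 
    and \<beta>: "\<And>m. \<beta> m \<in> X t" "\<And>m. \<beta> m \<noteq> 0 ==> set_mset m \<subseteq> {..<n}" and ev: "\<And>m. ev \<phi> m = SS [\<beta>] m \<mu>"
  shows "\<exists>\<psi>\<in>CC t. dH t \<psi> = \<phi>"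
proof -
  obtain \<psi> where \<psi>: "\<psi> \<in> CC t" "reduced \<psi>" "ev \<psi> = \<beta>" using ev_surj[of \<beta> t, OF \<beta>] by blast
  define \<chi> where "\<chi> = (\<lambda>as. \<phi> as - dH t \<psi> as)"
  have "\<exists>\<eta>\<in>CC t. reduced \<eta> \<and> (\<forall>m. ev \<eta> m = 0) \<and> dH t \<eta> = \<chi>"
  proof (rule ev_exact)
    show "\<chi> \<in> CC (t + 1)" unfolding \<chi>_def by (intro CC_diff \<phi> dH_CC \<psi>)
    show "reduced \<chi>" unfolding \<chi>_def by (intro reduced_diff \<phi> reduced_dH[OF \<psi>(1,2)])
    show "dH (t + 1) \<chi> = (\<lambda>as. 0)"
      unfolding \<chi>_def by (rule ext) (simp only: dH_diff \<phi>(3) dH_dH[OF \<psi>(1)] diff_self)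
    show "ev \<chi> m = 0" for m
      unfolding \<chi>_def SS_diff ev_dH[OF \<psi>(1,2)] \<psi>(3) using ev[of m] by simp
  qed
  then obtain \<eta> where "\<eta> \<in> CC t" "dH t \<eta> = \<chi>" by blast
  thus ?thesis using \<psi>(1)
    by (intro bexI[of _ "\<lambda>as. \<psi> as + \<eta> as"] CC_add) (simp_all add: fun_eq_iff dH_add \<chi>_def)
qed

end

lemma sorted_list_of_set_insert_least:
  assumes "\<And>s. s \<in> S ==> j < (s :: nat)" "finite S"
  shows "sorted_list_of_set (insert j S) = j # sorted_list_of_set S"
  by (intro sorted_list_of_set.sorted_key_list_of_set_unique[THEN iffD1])
    (use assms in \<open>auto simp: card_insert_if sorted_list_of_set.idem_if_sorted_distinct order.strict_implies_order\<close>)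

section \<open>Homotopy actions of Clifford algebras\<close>

text \<open>
  The operators \<open>L i\<close> satisfy the Clifford relations, and are multiplicative, only up to homotopies
  \<open>h i j\<close> and \<open>m i\<close>.
\<close>
locale clifford_action = clifford_data K n \<beta> Q + V: Modules.module smul
  for K :: "'k::comm_ring_1 set" and n \<beta> Q and smul :: "'k => 'b::ab_group_add => 'b" +
  fixes gg :: "nat => 'k" and D :: "'b => 'b" and L :: "nat => 'b => 'b" and one :: 'b
    and h :: "nat => nat => 'b => 'b" and mul :: "'b => 'b => 'b" and m :: "nat => 'b => 'b => 'b"
  assumes gg_K: "i < n ==> gg i \<in> K"
    and D_add: "D (a + b) = D a + D b" and D_smul: "D (smul r a) = smul r (D a)"
    and L_add: "L i (a + b) = L i a + L i b" and L_smul: "L i (smul r a) = smul r (L i a)"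
    and h_add: "h i j (a + b) = h i j a + h i j b" and h_smul: "h i j (smul r a) = smul r (h i j a)"
    and mul_add: "mul (a + b) c = mul a c + mul b c" and mul_smul: "mul (smul r a) c = smul r (mul a c)"
    and m_add: "m i (a + b) c = m i a c + m i b c" and m_smul: "m i (smul r a) c = smul r (m i a c)"
    and D_one: "D one = 0"
    and D_L: "i < n ==> D (L i a) = smul (gg i) a - L i (D a)"
    and L_L: "j < i ==> i < n ==> L i (L j a) + L j (L i a) = smul (\<beta> i j) a + (D (h i j a) + h i j (D a))"
    and L_square: "i < n ==> L i (L i a) = smul (\<beta> i i) a + (D (h i i a) + h i i (D a))"
    and mul_one: "mul one b = b"
    and mul_L: "D b = 0 ==> i < n ==> mul (L i a) b = L i (mul a b) + (D (m i a b) - m i (D a) b)"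
begin

lemma additive_0: "(\<And>x y. F (x + y) = F x + F y) ==> F 0 = 0"
  for F :: "'b => 'b"
proof -
  assume "\<And>x y. F (x + y) = F x + F y"
  from this[of 0 0] show ?thesis by simp
qed

lemma additive_minus: "(\<And>x y. F (x + y) = F x + F y) ==> F (x - y) = F x - F y"
  for F :: "'b => 'b"
proof -
  assume "\<And>x y. F (x + y) = F x + F y"
  from this[of "x - y" y] show ?thesis by simp
qed

lemma D_0: "D 0 = 0" by (rule additive_0) (rule D_add)
lemma D_minus: "D (a - b) = D a - D b" by (rule additive_minus) (rule D_add)
lemma L_0: "L i 0 = 0" by (rule additive_0) (rule L_add)
lemma L_minus: "L i (a - b) = L i a - L i b" by (rule additive_minus) (rule L_add)
definition lin :: "(nat set => 'b) => (nat set => 'k) => 'b" where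
  "lin \<kappa> f = (\<Sum>S\<in>Pow {..<n}. smul (f S) (\<kappa> S))"

lemma lin_minus: "lin \<kappa> (\<lambda>S. f S - f' S) = lin \<kappa> f - lin \<kappa> f'"
  by (simp add: lin_def V.scale_left_diff_distrib sum_subtractf)

lemma lin_add: "lin \<kappa> (\<lambda>S. f S + f' S) = lin \<kappa> f + lin \<kappa> f'"
  by (simp add: lin_def V.scale_left_distrib sum.distrib)

lemma lin_times: "lin \<kappa> (\<lambda>S. c * f S) = smul c (lin \<kappa> f)"
  by (simp add: lin_def V.scale_sum_right)

lemma lin_zero: "lin \<kappa> (\<lambda>_. 0) = 0"
  by (simp add: lin_def)

lemma lin_plus: "lin (\<lambda>S. \<kappa> S + \<kappa>' S) f = lin \<kappa> f + lin \<kappa>' f"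
  by (simp add: lin_def V.scale_right_distrib sum.distrib)

lemma lin_diff: "lin (\<lambda>S. \<kappa> S - \<kappa>' S) f = lin \<kappa> f - lin \<kappa>' f"
  by (simp add: lin_def V.scale_right_diff_distrib sum_subtractf)

lemma lin_smul: "lin (\<lambda>S. smul c (\<kappa> S)) f = smul c (lin \<kappa> f)"
  by (simp add: lin_def V.scale_sum_right mult.commute)

lemma lin_hom:
  assumes "\<And>x y. F (x + y) = F x + F y" "\<And>c x. F (smul c x) = smul c (F x)"
  shows "F (lin \<kappa> f) = lin (\<lambda>S. F (\<kappa> S)) f"
proof -
  have "F (sum g B) = (\<Sum>b\<in>B. F (g b))" for g and B :: "nat set set"
    by (induction B rule: infinite_finite_induct) (simp_all add: assms(1) additive_0[OF assms(1)])
  thus ?thesis by (simp add: lin_def assms(2))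
qed

lemma lin_basis: "S \<subseteq> {..<n} ==> lin \<kappa> (basis_fun S) = \<kappa> S"
proof -
  assume S: "S \<subseteq> {..<n}"
  have "smul (basis_fun S W) (\<kappa> W) = (if W = S then \<kappa> S else 0)" for W by (simp add: basis_fun_def)
  thus ?thesis using S by (simp add: lin_def)
qed

lemma lin_cong: "(\<And>S. S \<subseteq> {..<n} ==> f S \<noteq> 0 ==> \<kappa> S = \<kappa>' S) ==> lin \<kappa> f = lin \<kappa>' f"
proof -
  assume a: "\<And>S. S \<subseteq> {..<n} ==> f S \<noteq> 0 ==> \<kappa> S = \<kappa>' S"
  have "smul (f S) (\<kappa> S) = smul (f S) (\<kappa>' S)" if "S \<in> Pow {..<n}" for S
    using a[of S] that by (cases "f S = 0") auto
  thus ?thesis unfolding lin_def by (rule sum.cong[OF refl])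
qed

lemma lin_sum: "lin \<kappa> (\<lambda>W. \<Sum>S\<in>B. c S * u S W) = (\<Sum>S\<in>B. smul (c S) (lin \<kappa> (u S)))"
  by (induction B rule: infinite_finite_induct) (simp_all add: lin_zero lin_add lin_times)

lemma lin_op:
  assumes f: "f \<in> FK"
    and H: "\<And>c. H (\<lambda>W. \<Sum>S\<in>Pow {..<n}. c S * basis_fun S W) = (\<lambda>W. \<Sum>S\<in>Pow {..<n}. c S * H (basis_fun S) W)"
  shows "lin \<kappa> (H f) = lin (\<lambda>S. lin \<kappa> (H (basis_fun S))) f"
proof -
  have "H f = (\<lambda>W. \<Sum>S\<in>Pow {..<n}. f S * H (basis_fun S) W)"
    by (subst FK_expand[OF f]) (rule H)
  hence "lin \<kappa> (H f) = lin \<kappa> (\<lambda>W. \<Sum>S\<in>Pow {..<n}. f S * H (basis_fun S) W)" by (rule arg_cong)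
  thus ?thesis unfolding lin_sum by (simp only: lin_def[of "\<lambda>S. lin \<kappa> (H (basis_fun S))"])
qed

abbreviation "dC \<equiv> contr n gg"

lemma lin_contr: "f \<in> FK ==> lin \<kappa> (dC f) = lin (\<lambda>S. lin \<kappa> (dC (basis_fun S))) f"
  by (rule lin_op) (simp_all add: fun_eq_iff contr_sum contr_scale)

lemma lin_cliff_op: "f \<in> FK ==> lin \<kappa> (cliff \<beta> i f) = lin (\<lambda>S. lin \<kappa> (cliff \<beta> i (basis_fun S))) f"
  by (rule lin_op) (simp_all only: cliff_sum cliff_times)

lemma lin_star: "f \<in> FK ==> lin \<kappa> (star f f') = lin (\<lambda>S. lin \<kappa> (star (basis_fun S) f')) f"
  by (rule lin_op) (simp_all add: fun_eq_iff star_sum_left)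

lemma lin_cliff:
  assumes c: "c \<in> FK" and j: "j < n" and supp: "\<And>W s. c W \<noteq> 0 ==> s \<in> W ==> j < s"
  shows "lin \<kappa> (cliff \<beta> j c) = lin (\<lambda>W. \<kappa> (insert j W)) c"
  unfolding lin_cliff_op[OF c]
proof (rule lin_cong)
  fix S assume S: "S \<subseteq> {..<n}" "c S \<noteq> 0"
  have "cliff \<beta> j (basis_fun S) = basis_fun (insert j S)" by (rule cliff_basis) (rule supp[OF S(2)])
  thus "lin \<kappa> (cliff \<beta> j (basis_fun S)) = \<kappa> (insert j S)" using S j by (simp add: lin_basis)
qed

lemma FK_contr': "f \<in> FK ==> dC f \<in> FK"
  by (rule FK_contr) (rule gg_K)

lemma contr_support: "dC (basis_fun S) W \<noteq> 0 ==> W \<subseteq> S"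
proof -
  assume "dC (basis_fun S) W \<noteq> 0"
  then obtain j where "gg j * iota j (basis_fun S) W \<noteq> 0" unfolding contr_def by (rule sum.not_neutral_contains_not_neutral)
  hence "insert j W = S" by (auto simp: iota_def basis_fun_def split: if_splits)
  thus ?thesis by blast
qed

lemma contr_insert:
  "(\<And>s. s \<in> S ==> j < s) ==> j < n ==>
    dC (basis_fun (insert j S)) = (\<lambda>W. gg j * basis_fun S W - cliff \<beta> j (dC (basis_fun S)) W)"
  by (rule ext) (rule contr_cliff_insert)

text \<open>A discrepancy \<open>g\<close> that obeys this recursion in the least index is
  null-homotopic. The homotopy is built by the recursion with the sign of \<open>L j\<close>
  reversed, since \<open>D\<close> and \<open>L j\<close> anticommute up to the scalar
  \<open>gg j\<close>. The sign \<epsilon> is -1 for odd discrepancies and 1 for even ones.\<close>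

lemma homotopy_induct:
  assumes \<epsilon>: "\<epsilon> * \<epsilon> = 1" and g0: "g {} = 0"
    and g: "\<And>j S. j < n ==> S \<subseteq> {..<n} ==> (\<And>s. s \<in> S ==> j < s) ==>
      g (insert j S) = smul \<epsilon> (L j (g S)) + (D (k j S) - smul \<epsilon> (lin (k j) (dC (basis_fun S))))"
  shows "\<exists>\<kappa>. \<forall>S\<subseteq>{..<n}. g S = D (\<kappa> S) + smul \<epsilon> (lin \<kappa> (dC (basis_fun S)))"
proof -
  define \<kappa>l where "\<kappa>l = rec_list (0 :: 'b) (\<lambda>j w r. k j (set w) - smul \<epsilon> (L j r))"
  define \<kappa> where "\<kappa> S = \<kappa>l (sorted_list_of_set S)" for S
  have \<kappa>0: "\<kappa> {} = 0" by (simp add: \<kappa>_def \<kappa>l_def)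
  have \<kappa>: "\<kappa> (insert j S) = k j S - smul \<epsilon> (L j (\<kappa> S))" if "\<And>s. s \<in> S ==> j < s" "S \<subseteq> {..<n}" for j S
  proof -
    have "finite S" using that(2) finite_subset by blast
    hence "sorted_list_of_set (insert j S) = j # sorted_list_of_set S"
      using that(1) by (intro sorted_list_of_set_insert_least)
    thus ?thesis using \<open>finite S\<close> by (simp add: \<kappa>_def \<kappa>l_def del: sorted_list_of_set_insert_remove)
  qed
  have "g S = D (\<kappa> S) + smul \<epsilon> (lin \<kappa> (dC (basis_fun S)))" if "S \<subseteq> {..<n}" for S
    using that
  proof (induction S rule: sorted_basis_induct)
    case empty
    show ?case by (simp add: g0 \<kappa>0 D_0 contr_vac lin_zero)
  next
    case (insert j S)
    let ?c = "dC (basis_fun S)"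
    have c: "?c \<in> FK" by (intro FK_contr' FK_basis insert.hyps)
    have "lin \<kappa> (cliff \<beta> j ?c) = lin (\<lambda>W. \<kappa> (insert j W)) ?c"
      using contr_support insert.hyps(3) by (intro lin_cliff c insert.hyps(1)) blast
    also have "\<dots> = lin (\<lambda>W. k j W - smul \<epsilon> (L j (\<kappa> W))) ?c"
    proof (rule lin_cong)
      fix W assume "W \<subseteq> {..<n}" "?c W \<noteq> 0"
      thus "\<kappa> (Set.insert j W) = k j W - smul \<epsilon> (L j (\<kappa> W))"
        using contr_support[of S W] insert.hyps(3) by (intro \<kappa>) auto
    qed
    also have "\<dots> = lin (k j) ?c - smul \<epsilon> (L j (lin \<kappa> ?c))"
      by (simp only: lin_diff lin_smul lin_hom[of "L j", OF L_add L_smul])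
    finally have cl: "lin \<kappa> (cliff \<beta> j ?c) = lin (k j) ?c - smul \<epsilon> (L j (lin \<kappa> ?c))" .
    have ci: "dC (basis_fun (Set.insert j S)) = (\<lambda>W. gg j * basis_fun S W - cliff \<beta> j ?c W)"
      using insert.hyps by (intro contr_insert)
    have l: "lin \<kappa> (dC (basis_fun (Set.insert j S))) = smul (gg j) (\<kappa> S) - (lin (k j) ?c - smul \<epsilon> (L j (lin \<kappa> ?c)))"
      unfolding ci lin_minus lin_times lin_basis[OF insert.hyps(2)] cl ..
    have ins: "\<kappa> (Set.insert j S) = k j S - smul \<epsilon> (L j (\<kappa> S))" using insert.hyps by (intro \<kappa>)
    have gi: "g (Set.insert j S) = smul \<epsilon> (L j (g S)) + (D (k j S) - smul \<epsilon> (lin (k j) ?c))"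
      using insert.hyps by (intro g)
    show ?case
      unfolding l ins gi insert.IH
      by (simp add: D_minus D_smul D_L[OF insert.hyps(1)] L_add L_smul V.scale_right_distrib
          V.scale_right_diff_distrib \<epsilon>)
  qed
  thus ?thesis by blast
qed

definition eS :: "nat set => 'b" where "eS S = foldr L (sorted_list_of_set S) one"

abbreviation "\<Phi> \<equiv> lin eS"

lemma eS_empty: "eS {} = one" by (simp add: eS_def)

lemma eS_insert: "(\<And>s. s \<in> S ==> j < s) ==> S \<subseteq> {..<n} ==> eS (insert j S) = L j (eS S)"
proof -
  assume *: "\<And>s. s \<in> S ==> j < s" "S \<subseteq> {..<n}"
  have "finite S" using *(2) finite_subset by blast
  hence "sorted_list_of_set (insert j S) = j # sorted_list_of_set S"
    using *(1) by (intro sorted_list_of_set_insert_least)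
  thus ?thesis by (simp add: eS_def del: sorted_list_of_set_insert_remove)
qed

lemma \<Phi>_cliff:
  assumes c: "c \<in> FK" and j: "j < n" and supp: "\<And>W s. c W \<noteq> 0 ==> s \<in> W ==> j < s"
  shows "\<Phi> (cliff \<beta> j c) = L j (\<Phi> c)"
proof -
  have "\<Phi> (cliff \<beta> j c) = lin (\<lambda>W. eS (insert j W)) c" by (rule lin_cliff[OF c j supp])
  also have "\<dots> = lin (\<lambda>W. L j (eS W)) c"
    by (rule lin_cong) (intro eS_insert, auto dest: supp)
  finally show ?thesis by (simp only: lin_hom[of "L j", OF L_add L_smul])
qed

text \<open>Strict, with no homotopy: \<open>D_L\<close> and \<open>contr_insert\<close> are the
  same recursion, because Clifford multiplication by \<open>j\<close> on monomials with larger
  indices is mere insertion.\<close>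

lemma D_eS: "S \<subseteq> {..<n} ==> D (eS S) = \<Phi> (dC (basis_fun S))"
proof (induction S rule: sorted_basis_induct)
  case empty
  show ?case by (simp add: eS_empty D_one contr_vac lin_zero)
next
  case (insert j S)
  let ?c = "dC (basis_fun S)"
  have c: "?c \<in> FK" by (intro FK_contr' FK_basis insert.hyps)
  have "\<Phi> (cliff \<beta> j ?c) = L j (\<Phi> ?c)"
    using contr_support insert.hyps(3) by (intro \<Phi>_cliff c insert.hyps(1)) blast
  moreover have "dC (basis_fun (Set.insert j S)) = (\<lambda>W. gg j * basis_fun S W - cliff \<beta> j ?c W)"
    using insert.hyps by (intro contr_insert)
  moreover have "eS (Set.insert j S) = L j (eS S)" using insert.hyps by (intro eS_insert)
  ultimately show ?case
    by (simp only: D_L[OF insert.hyps(1)] insert.IH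
      lin_minus lin_times lin_basis[OF insert.hyps(2)])
qed

lemma D_\<Phi>: "f \<in> FK ==> D (\<Phi> f) = \<Phi> (dC f)"
proof -
  assume f: "f \<in> FK"
  have "D (\<Phi> f) = lin (\<lambda>S. D (eS S)) f" by (rule lin_hom[OF D_add D_smul])
  also have "\<dots> = lin (\<lambda>S. \<Phi> (dC (basis_fun S))) f" by (rule lin_cong) (rule D_eS)
  finally show ?thesis unfolding lin_contr[OF f] .
qed

text \<open>A generator below all indices of the monomial can be put in front, and the two sides
  agree. Otherwise it is moved inwards through the ordered product until it reaches its place, each
  exchange contributing a homotopy \<open>h i j\<close>.\<close>

lemma L_\<Phi>_homotopy:
  assumes i: "i < n"
  shows "\<exists>\<kappa>. \<forall>f\<in>FK. L i (\<Phi> f) - \<Phi> (cliff \<beta> i f) = D (lin \<kappa> f) - lin \<kappa> (dC f)"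
proof -
  define g where "g S = L i (eS S) - \<Phi> (cliff \<beta> i (basis_fun S))" for S
  \<comment> \<open>Indices above \<open>i\<close> contribute none, as \<open>i\<close> then goes in
    front.\<close>
  define k where "k j S = (if j \<le> i then h i j (eS S) else 0)" for j S
  have g_below: "g S = 0" if "\<And>s. s \<in> S ==> i < s" "S \<subseteq> {..<n}" for S
  proof -
    have "cliff \<beta> i (basis_fun S) = basis_fun (insert i S)" using that by (intro cliff_basis)
    moreover have "eS (insert i S) = L i (eS S)" using that by (intro eS_insert)
    ultimately show ?thesis using that(2) i by (simp add: g_def lin_basis)
  qed
  have lin_k: "lin (k j) c = (if j \<le> i then h i j (\<Phi> c) else 0)" for j c
    using lin_hom[of "h i j", OF h_add h_smul] by (simp add: k_def[abs_def] lin_def)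
  have "\<exists>\<kappa>. \<forall>S\<subseteq>{..<n}. g S = D (\<kappa> S) + smul (-1) (lin \<kappa> (dC (basis_fun S)))"
  proof (rule homotopy_induct)
    show "g {} = 0" by (rule g_below) simp_all
    fix j S assume j: "j < n" and S: "S \<subseteq> {..<n}" and jS: "\<And>s. s \<in> S ==> j < s"
    have bS: "basis_fun S \<in> FK" by (rule FK_basis[OF S])
    have e: "eS (insert j S) = L j (eS S)" using jS S by (intro eS_insert)
    have cb: "basis_fun (insert j S) = cliff \<beta> j (basis_fun S)" using jS by (intro cliff_basis[symmetric])
    show "g (insert j S) = smul (-1) (L j (g S)) + (D (k j S) - smul (-1) (lin (k j) (dC (basis_fun S))))"
    proof (cases i j rule: linorder_cases)
      case less
      hence "\<And>s. s \<in> insert j S ==> i < s" using jS order.strict_trans[of i j] by blast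
      hence "g (insert j S) = 0" "g S = 0" using S j by (intro g_below; simp)+
      with less show ?thesis by (simp add: k_def D_0 L_0 lin_k)
    next
      case equal
      have gS: "g S = 0" using jS S equal by (intro g_below) auto
      have "cliff \<beta> i (basis_fun (insert j S)) = (\<lambda>W. \<beta> i i * basis_fun S W)"
        unfolding cb equal by (rule ext) (rule cliff_square)
      hence "g (insert j S) = L i (L i (eS S)) - smul (\<beta> i i) (eS S)"
        unfolding g_def e by (simp add: lin_times lin_basis[OF S] equal)
      thus ?thesis unfolding L_square[OF i] gS lin_k
        by (simp add: k_def equal D_eS[OF S] L_0)
    next
      case greater
      have "cliff \<beta> i (basis_fun (insert j S)) = (\<lambda>W. \<beta> i j * basis_fun S W - cliff \<beta> j (cliff \<beta> i (basis_fun S)) W)"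
        unfolding cb using cliff_anticomm[of i j \<beta> "basis_fun S"] greater
        by (intro ext) (simp add: algebra_simps)
      moreover have "\<Phi> (cliff \<beta> j (cliff \<beta> i (basis_fun S))) = L j (\<Phi> (cliff \<beta> i (basis_fun S)))"
      proof (rule \<Phi>_cliff[OF FK_cliff[OF i bS] j])
        fix W s assume "cliff \<beta> i (basis_fun S) W \<noteq> 0" "s \<in> W"
        hence "s \<in> insert i S" using cliff_support[of "basis_fun S" S \<beta> i W] basis_fun_support by blast
        thus "j < s" using greater jS by auto
      qed
      ultimately have "g (insert j S) = L i (L j (eS S)) - (smul (\<beta> i j) (eS S) - L j (\<Phi> (cliff \<beta> i (basis_fun S))))"
        unfolding g_def e by (simp add: lin_minus lin_times lin_basis[OF S])
      moreover have "L i (L j (eS S)) = smul (\<beta> i j) (eS S) + (D (h i j (eS S)) + h i j (D (eS S))) - L j (L i (eS S))"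
        using L_L[OF greater i, of "eS S"] by (simp add: algebra_simps)
      ultimately show ?thesis using greater unfolding lin_k
        by (simp add: k_def D_eS[OF S] g_def L_minus)
    qed
  qed simp
  then obtain \<kappa> where \<kappa>: "\<And>S. S \<subseteq> {..<n} ==> g S = D (\<kappa> S) - lin \<kappa> (dC (basis_fun S))" by auto
  have "L i (\<Phi> f) - \<Phi> (cliff \<beta> i f) = D (lin \<kappa> f) - lin \<kappa> (dC f)" if f: "f \<in> FK" for f
  proof -
    have "L i (\<Phi> f) - \<Phi> (cliff \<beta> i f) = lin g f"
      unfolding g_def[abs_def] lin_diff lin_cliff_op[OF f] by (simp only: lin_hom[of "L i", OF L_add L_smul])
    also have "\<dots> = lin (\<lambda>S. D (\<kappa> S) - lin \<kappa> (dC (basis_fun S))) f" by (rule lin_cong) (rule \<kappa>)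
    finally show ?thesis unfolding lin_diff lin_contr[OF f] by (simp only: lin_hom[of D, OF D_add D_smul])
  qed
  thus ?thesis by blast
qed

text \<open>Closedness of the second factor makes the associator a homotopy and the contraction
  commute with right multiplication; closedness of the first kills the last correction term, so the
  discrepancy is a boundary.\<close>

theorem \<Phi>_multiplicative:
  assumes f: "f \<in> FK" "dC f = (\<lambda>_. 0)" and f': "f' \<in> FK" "dC f' = (\<lambda>_. 0)"
  shows "\<exists>b. mul (\<Phi> f) (\<Phi> f') - \<Phi> (star f f') = D b"
proof -
  let ?b = "\<Phi> f'"
  have b: "D ?b = 0" using D_\<Phi>[OF f'(1)] f'(2) by (simp add: lin_zero)
  have "\<forall>i. \<exists>\<kappa>. i < n \<longrightarrow> (\<forall>f\<in>FK. L i (\<Phi> f) - \<Phi> (cliff \<beta> i f) = D (lin \<kappa> f) - lin \<kappa> (dC f))"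
    using L_\<Phi>_homotopy by blast
  then obtain \<kappa> where \<kappa>: "\<And>i f. i < n ==> f \<in> FK ==>
      L i (\<Phi> f) - \<Phi> (cliff \<beta> i f) = D (lin (\<kappa> i) f) - lin (\<kappa> i) (dC f)" by metis
  define g where "g S = mul (eS S) ?b - \<Phi> (star (basis_fun S) f')" for S
  \<comment> \<open>One homotopy for reassociating past the generator \<open>j\<close>, one for
    replacing \<open>L j\<close> by Clifford multiplication.\<close>
  define k where "k j S = m j (eS S) ?b + lin (\<kappa> j) (star (basis_fun S) f')" for j S
  have contr_star': "dC (star (basis_fun S) f') = star (dC (basis_fun S)) f'" if S: "S \<subseteq> {..<n}" for S
  proof -
    have "star (basis_fun S) (\<lambda>_. 0) = (\<lambda>_. 0)"
      using star_times_right[of "basis_fun S" 0 "\<lambda>_. 0"] by (simp add: fun_eq_iff)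
    thus ?thesis
      using contr_star[where f = "basis_fun S" and t = "int (card S)" and g = gg and h = f', OF FK_basis[OF S] par_basis]
        gg_K by (simp add: fun_eq_iff f'(2))
  qed
  have "\<exists>\<kappa>. \<forall>S\<subseteq>{..<n}. g S = D (\<kappa> S) + smul 1 (lin \<kappa> (dC (basis_fun S)))"
  proof (rule homotopy_induct)
    show "g {} = 0" by (simp add: g_def eS_empty mul_one star_vac_left)
    fix j S assume j: "j < n" and S: "S \<subseteq> {..<n}" and jS: "\<And>s. s \<in> S ==> j < s"
    have bS: "basis_fun S \<in> FK" by (rule FK_basis[OF S])
    let ?h = "star (basis_fun S) f'"
    have h: "?h \<in> FK" by (rule star_FK[OF bS f'(1)])
    have e: "eS (insert j S) = L j (eS S)" using jS S by (intro eS_insert)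
    have cb: "basis_fun (insert j S) = cliff \<beta> j (basis_fun S)" using jS by (intro cliff_basis[symmetric])
    have lk: "lin (k j) (dC (basis_fun S)) = m j (D (eS S)) ?b + lin (\<kappa> j) (dC ?h)"
      unfolding k_def[abs_def] lin_plus contr_star'[OF S] lin_star[OF FK_contr'[OF bS], symmetric] D_eS[OF S]
      by (simp only: lin_hom[of "\<lambda>a. m j a ?b", OF m_add m_smul])
    have "g (insert j S) = mul (L j (eS S)) ?b - \<Phi> (cliff \<beta> j ?h)"
      unfolding g_def e cb star_cliff[OF j bS] ..
    moreover have "\<Phi> (cliff \<beta> j ?h) = L j (\<Phi> ?h) - (D (lin (\<kappa> j) ?h) - lin (\<kappa> j) (dC ?h))"
      using \<kappa>[OF j h] by (simp add: algebra_simps)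
    ultimately show "g (insert j S) = smul 1 (L j (g S)) + (D (k j S) - smul 1 (lin (k j) (dC (basis_fun S))))"
      unfolding lk mul_L[OF b j] by (simp add: g_def k_def L_minus D_add)
  qed simp
  then obtain \<eta> where \<eta>: "\<And>S. S \<subseteq> {..<n} ==> g S = D (\<eta> S) + lin \<eta> (dC (basis_fun S))" by auto
  have "mul (\<Phi> f) ?b - \<Phi> (star f f') = lin g f"
    unfolding g_def[abs_def] lin_diff lin_star[OF f(1)]
    by (simp only: lin_hom[of "\<lambda>a. mul a ?b", OF mul_add mul_smul])
  also have "\<dots> = lin (\<lambda>S. D (\<eta> S) + lin \<eta> (dC (basis_fun S))) f" by (rule lin_cong) (rule \<eta>)
  also have "\<dots> = D (lin \<eta> f)"
    unfolding lin_plus lin_contr[OF f(1), symmetric] f(2) lin_zero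
    by (simp add: lin_hom[of D, OF D_add D_smul])
  finally show ?thesis by blast
qed

end

section \<open>The twisted multiplication on power series\<close>

context superfiltered_deformation
begin

declare SS.simps [simp del]

definition M :: "(nat multiset => 'a) list => nat multiset => 'a" where "M \<alpha>s m = SS \<alpha>s m \<mu>"

abbreviation "tau \<equiv> tws 1"

lemma smul_add: "smul r (\<alpha> + \<beta>) = smul r \<alpha> + smul r \<beta>"
  by (rule ext) (simp add: smul_def scale_right_distrib msum_add)

lemma smul_add_left: "smul (r + s) \<alpha> = smul r \<alpha> + smul s \<alpha>"
  by (rule ext) (simp add: smul_def plus_mfps_def scale_left_distrib msum_add)

lemma smul_one: "smul 1 \<alpha> = \<alpha>"
proof
  fix m
  have "(\<lambda>a b. mfps_coeff 1 a *s \<alpha> b) = (\<lambda>a b. if a = {#} then \<alpha> b else 0)"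
    by (auto simp: fun_eq_iff one_mfps_def)
  thus "smul 1 \<alpha> m = \<alpha> m" by (simp add: smul_def msum_single)
qed

lemma smul_smul: "smul r (smul s \<alpha>) = smul (r * s) \<alpha>"
proof
  fix m
  have "mfps_coeff (r * s) a *s x = msum a (\<lambda>c d. mfps_coeff r c *s mfps_coeff s d *s x)" for a x
    by (simp add: times_mfps_def msum_def scale_sum_left)
  hence "smul (r * s) \<alpha> m = msum m (\<lambda>a b. msum a (\<lambda>c d. mfps_coeff r c *s mfps_coeff s d *s \<alpha> b))"
    by (simp add: smul_def)
  also have "\<dots> = msum m (\<lambda>c x. msum x (\<lambda>d b. mfps_coeff r c *s mfps_coeff s d *s \<alpha> b))" by (rule msum_assoc)
  finally show "smul r (smul s \<alpha>) m = smul (r * s) \<alpha> m" by (simp add: smul_def scale_msum)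
qed

sublocale ser: Modules.module smul
  by standard (simp_all add: smul_add smul_add_left smul_smul smul_one)

lemma M_add1: "M ((a + b) # \<gamma>s) = M (a # \<gamma>s) + M (b # \<gamma>s)"
  and M_add2: "M (c # (a + b) # \<gamma>s) = M (c # a # \<gamma>s) + M (c # b # \<gamma>s)"
  and M_add3: "M (c # d # (a + b) # \<gamma>s) = M (c # d # a # \<gamma>s) + M (c # d # b # \<gamma>s)"
  using SS_plus[OF multilinear, of "[]" a b \<gamma>s] SS_plus[OF multilinear, of "[c]" a b \<gamma>s]
    SS_plus[OF multilinear, of "[c, d]" a b \<gamma>s]
  by (simp_all add: M_def[abs_def] fun_eq_iff plus_fun_def)

lemma M_smul1: "M (smul r a # \<gamma>s) = smul r (M (a # \<gamma>s))"
  and M_smul2: "M (c # smul r a # \<gamma>s) = smul r (M (c # a # \<gamma>s))"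
  and M_smul3: "M (c # d # smul r a # \<gamma>s) = smul r (M (c # d # a # \<gamma>s))"
  using SS_smul[OF multilinear, of "[]" r a \<gamma>s] SS_smul[OF multilinear, of "[c]" r a \<gamma>s]
    SS_smul[OF multilinear, of "[c, d]" r a \<gamma>s]
  by (simp_all add: M_def[abs_def] fun_eq_iff)

lemma M_minus1: "M (- a # \<gamma>s) = - M (a # \<gamma>s)"
  and M_minus2: "M (c # - a # \<gamma>s) = - M (c # a # \<gamma>s)"
  and M_minus3: "M (c # d # - a # \<gamma>s) = - M (c # d # a # \<gamma>s)"
  using M_smul1[of "-1" a \<gamma>s] M_smul2[of c "-1" a \<gamma>s] M_smul3[of c d "-1" a \<gamma>s] by simp_all

lemma tau_add: "tau (a + b) = tau a + tau b"
  by (rule ext) (simp add: tws_def tw_add)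

lemma tau_smul: "tau (smul r a) = smul r (tau a)"
proof
  fix m
  have "tw (msum m (\<lambda>x y. mfps_coeff r x *s a y)) = msum m (\<lambda>x y. tw (mfps_coeff r x *s a y))"
    by (rule msum_hom) (simp_all add: tw_add)
  thus "tau (smul r a) m = smul r (tau a) m" by (simp add: tws_def smul_def tw_scale)
qed

lemma tau_minus: "tau (- a) = - tau a"
  using tau_smul[of "-1" a] by simp

lemma tau_tau: "tau (tau a) = a"
  by (rule ext) (simp add: tws_def)

lemma tau_v: "tau (cst (v i)) = cst (v i)"
  by (rule ext) (use T_v[of 1 i] in \<open>simp add: tws_def cst_def\<close>)

lemma tau_unit: "tau (cst unit) = - cst unit"
  by (rule ext) (simp add: tws_def cst_def tw_unit)

lemma tau_M: "tau (M \<alpha>s) = - M (map tau \<alpha>s)"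
proof
  fix m
  have neg: "- SS \<alpha>s m g = SS \<alpha>s m (\<lambda>l. - g l)" for g :: "'a list => 'a" by (rule SS_hom) simp_all
  have "T 1 (\<mu> l) = - \<mu> (map (T 1) l)" for l using T_cochain[OF \<mu>_CC, of 1 l] by (simp add: sg_def)
  hence "SS \<alpha>s m (\<lambda>l. tw (\<mu> l)) = - SS \<alpha>s m (\<lambda>l. \<mu> (map (T 1) l))" unfolding neg by simp
  moreover have "tw (SS \<alpha>s m \<mu>) = SS \<alpha>s m (\<lambda>l. tw (\<mu> l))" by (rule SS_hom) (simp_all add: tw_add)
  ultimately show "tau (M \<alpha>s) m = (- M (map tau \<alpha>s)) m"
    using SS_tws[of 1 \<alpha>s m \<mu>] by (simp add: tws_def M_def)
qed

lemma M_unit_many1: "length \<gamma>s \<ge> 2 ==> M (cst unit # \<gamma>s) = 0"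
  and M_unit_many2: "length \<gamma>s \<ge> 1 ==> M (a # cst unit # \<gamma>s) = 0"
  and M_unit_many3: "M (a # b # cst unit # \<gamma>s) = 0"
  using SS_unit_many[of "[]" \<gamma>s] SS_unit_many[of "[a]" \<gamma>s] SS_unit_many[of "[a, b]" \<gamma>s]
  by (auto simp: M_def[abs_def] fun_eq_iff)

lemma M_unit_left: "M [cst unit, a] = - tau a"
  by (rule ext) (simp add: M_def SS_unit_left tws_def)

text \<open>With one copy of b the products from the left and from the right cancel; with any other
  number strict unitality gives zero.\<close>

lemma M_unit: "M [cst unit] = 0"
proof
  fix m
  have "ss w (\<lambda>u u'. \<mu> (map v u @ unit # map v u')) = 0" for w
  proof (cases "length w = 1")
    case True
    then obtain i where "w = [i]" by (auto simp: length_Suc_conv)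
    moreover have "tw (v i) = v i" using T_v[of 1 i] by simp
    ultimately show ?thesis by (simp add: \<mu>_unit_left unit_right)
  next
    case False
    have "ss w (\<lambda>u u'. \<mu> (map v u @ unit # map v u')) = ss w (\<lambda>u u'. 0)"
      by (rule ss_cong) (use False in \<open>auto intro!: \<mu>_unit\<close>)
    thus ?thesis by simp
  qed
  thus "M [cst unit] m = 0 m"
    unfolding M_def SS_cst[OF multilinear] unfolding SS.simps unfolding wsum_ss[symmetric] by (simp add: wsum_def)
qed

lemma M_nil: "M [] = smul pot (cst unit)"
  using ev_\<mu> by (simp add: M_def[abs_def])

text \<open>The curvature is a multiple of the unit, so it drops out of every operation with at
  least three inputs. In the relations for two and three inputs used below no curvature term
  survives.\<close>

lemma M_curved: "length \<gamma>s \<ge> 2 ==> M (M [] # \<gamma>s) = 0"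
  "length \<gamma>s \<ge> 1 ==> M (a # M [] # \<gamma>s) = 0" "M (a # b # M [] # \<gamma>s) = 0" "M (a # b # c # M [] # \<gamma>s) = 0"
proof -
  have "SS ([a, b, c] @ smul pot (cst unit) # \<gamma>s) m \<mu> = 0" for m
    using SS_unit_many[of "[a, b, c]" \<gamma>s] unfolding SS_smul[OF multilinear] by (simp add: smul_def msum_def)
  thus "M (a # b # c # M [] # \<gamma>s) = 0" by (simp add: M_def[abs_def] M_nil[unfolded M_def[abs_def]] fun_eq_iff)
qed (simp_all add: M_nil M_smul1 M_smul2 M_smul3 M_unit_many1 M_unit_many2 M_unit_many3)

lemma M_A_infinity: "ss \<alpha>s (\<lambda>\<beta> y. ss y (\<lambda>\<gamma> \<delta>. M (\<beta> @ M \<gamma> # map tau \<delta>) m)) = 0"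
proof -
  have "SS \<alpha>s m (circ \<mu> 1 \<mu>) = 0" by (simp add: \<mu>_\<mu>)
  thus ?thesis unfolding SS_circ[OF multilinear] by (simp only: M_def[abs_def])
qed

lemma M_A_infinity2: "M [M [a, b]] = - M [M [a], tau b] - M [a, M [b]]"
proof
  fix m
  have "M [M [a, b]] m + M [M [a], tau b] m + M [a, M [b]] m = 0"
    using M_A_infinity[of "[a, b]" m] by (simp add: M_curved algebra_simps)
  thus "M [M [a, b]] m = (- M [M [a], tau b] - M [a, M [b]]) m"
    by (simp add: eq_neg_iff_add_eq_0 algebra_simps)
qed

lemma M_A_infinity3:
  "M [a, M [b, c]] = - M [M [a, b], tau c] - M [M [a, b, c]] - M [M [a], tau b, tau c] - M [a, M [b], tau c] - M [a, b, M [c]]"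
proof
  fix m
  have "M [a, M [b, c]] m + M [M [a, b], tau c] m + M [M [a, b, c]] m + M [M [a], tau b, tau c] m
      + M [a, M [b], tau c] m + M [a, b, M [c]] m = 0"
    using M_A_infinity[of "[a, b, c]" m] by (simp add: M_curved algebra_simps)
  thus "M [a, M [b, c]] m = (- M [M [a, b], tau c] - M [M [a, b, c]] - M [M [a], tau b, tau c] - M [a, M [b], tau c] - M [a, b, M [c]]) m"
    by (simp add: eq_neg_iff_add_eq_0 algebra_simps)
qed

lemma M_v: "M [cst (v i)] = smul (mfps_deriv i pot) (cst unit)"
  by (rule ext) (simp add: M_def \<mu>_v)

lemma M_v_self: "M [cst (v i), cst (v i)] = smul (mfps_half_deriv2 i pot) (cst unit)"
  by (rule ext) (simp add: M_def \<mu>_v_self)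

lemma M_v_pair: "i \<noteq> j ==> M [cst (v i), cst (v j)] + M [cst (v j), cst (v i)] =
    smul (mfps_deriv i (mfps_deriv j pot)) (cst unit)"
  by (rule ext) (simp add: M_def \<mu>_v_pair)

text \<open>The twists encode the signs (-1)^|a| and, in \<open>mulx\<close>, (-1)^|b|. With them
  the twisted differential is an odd derivation from the left, and \<open>mulx\<close> carries the
  sign of the Hochschild product.\<close>

definition "Dx a = - M [tau a]"
definition "mulx a b = - M [a, tau b]"
text \<open>The homotopies come from the twisted \<mu>^3 with two generators. For equal indices the
  single term is taken instead of its double, matching the halved second derivative.\<close>

definition "hx i j a = (if i = j then M [cst (v i), cst (v i), tau a]
    else M [cst (v i), cst (v j), tau a] + M [cst (v j), cst (v i), tau a])"
definition "mx j a b = - M [cst (v j), a, tau b]"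
abbreviation "Lx i a \<equiv> mulx (cst (v i)) a"
text \<open>The triangular polarisation of minus half the Hessian: halved derivatives on the
  diagonal, full mixed derivatives off it.\<close>

definition "\<beta>x i j = (if i = j then - mfps_half_deriv2 i pot else - mfps_deriv j (mfps_deriv i pot))"

lemmas M_simps = M_add1 M_add2 M_add3 M_smul1 M_smul2 M_smul3 M_minus1 M_minus2 M_minus3
  tau_add tau_smul tau_minus tau_tau tau_v tau_M

lemma Dx_Lx: "Dx (Lx i a) = smul (- mfps_deriv i pot) a - Lx i (Dx a)"
  using M_A_infinity2[of "cst (v i)" a]
  by (simp add: Dx_def mulx_def M_simps M_v M_unit_left)

text \<open>The A_\<infinity>-relation for two generators and \<open>a\<close>. The terms containing
  \<open>M\<close> of one generator vanish, being multiples of the unit inserted beside two other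
  inputs.\<close>

lemma Lx_Lx: "Lx j (Lx i a) = M [M [cst (v j), cst (v i)], tau a] + M [M [cst (v j), cst (v i), a]] + M [cst (v j), cst (v i), M [a]]"
  using M_A_infinity3[of "cst (v j)" "cst (v i)" a]
  by (simp add: mulx_def M_simps M_v M_unit_many1 M_unit_many2)

lemma Dx_hx: "Dx (M [c, d, tau a]) = M [M [tau c, tau d, a]]" "M [c, d, tau (Dx a)] = M [c, d, M [a]]"
  by (simp_all add: Dx_def M_simps)

lemma Dx_add: "Dx (a + b) = Dx a + Dx b" and Dx_smul: "Dx (smul r a) = smul r (Dx a)"
  by (simp_all add: Dx_def M_simps)

lemma clifford_relation_square: "Lx i (Lx i a) = smul (\<beta>x i i) a + (Dx (hx i i a) + hx i i (Dx a))"
  by (simp add: Lx_Lx hx_def Dx_hx M_v_self \<beta>x_def) (simp add: M_simps M_unit_left)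

lemma clifford_relation:
  assumes "j < i"
  shows "Lx i (Lx j a) + Lx j (Lx i a) = smul (\<beta>x i j) a + (Dx (hx i j a) + hx i j (Dx a))"
proof -
  have "Lx i (Lx j a) + Lx j (Lx i a) = M [M [cst (v j), cst (v i)] + M [cst (v i), cst (v j)], tau a]
      + (Dx (hx i j a) + hx i j (Dx a))"
    using assms by (simp add: Lx_Lx hx_def Dx_hx Dx_add M_add1 tau_v algebra_simps)
  also have "M [M [cst (v j), cst (v i)] + M [cst (v i), cst (v j)], tau a] = smul (\<beta>x i j) a"
    using assms by (simp add: M_v_pair \<beta>x_def M_smul1 M_unit_left tau_tau)
  finally show ?thesis .
qed

lemma Dx_M: "Dx a = 0 ==> M [a] = 0 \<and> M [tau a] = 0"
proof -
  assume "Dx a = 0"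
  hence 1: "M [tau a] = 0" by (simp add: Dx_def)
  have "tau (M [tau a]) = - M [a]" by (simp add: tau_M tau_tau)
  moreover have "tau (M [tau a]) = 0" unfolding 1 using tau_smul[of 0 0] by simp
  ultimately show ?thesis using 1 by simp
qed

text \<open>The A_\<infinity>-relation with three inputs. The term with \<open>M [cst (v j)]\<close>
  is a multiple of the unit beside two inputs and vanishes, and that with \<open>M [b]\<close>
  vanishes as \<open>b\<close> is closed.\<close>

lemma associator:
  assumes b: "Dx b = 0"
  shows "mulx (Lx j a) b = Lx j (mulx a b) + (Dx (mx j a b) - mx j (Dx a) b)"
proof -
  have "M [cst (v j), tau a, M [b]] = 0"
    using M_smul3[of "cst (v j)" "tau a" 0 0 "[]"] Dx_M[OF b] by simp
  thus ?thesis
    using M_A_infinity3[of "cst (v j)" "tau a" b]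
    by (simp add: mulx_def mx_def Dx_def M_simps M_v M_unit_many1)
qed

lemma Leibniz_x: "Dx (mulx a b) = mulx (Dx a) b + mulx (- tau a) (Dx b)"
  using M_A_infinity2[of "tau a" b] by (simp add: mulx_def Dx_def M_simps)

end

section \<open>The Hessian Clifford algebra\<close>

lemma mfps_varsI: "(\<And>m. \<not> set_mset m \<subseteq> {..<n} ==> mfps_coeff f m = 0) ==> f \<in> mfps_vars n"
  by (auto simp: mfps_vars_def)

lemma mfps_varsD: "f \<in> mfps_vars n ==> \<not> set_mset m \<subseteq> {..<n} ==> mfps_coeff f m = 0"
  by (auto simp: mfps_vars_def)

lemma mfps_vars_one: "1 \<in> mfps_vars n"
  by (auto simp: mfps_vars_def one_mfps_def split: if_splits)

lemma mfps_vars_add: "f \<in> mfps_vars n ==> g \<in> mfps_vars n ==> f + g \<in> mfps_vars n"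
  by (rule mfps_varsI) (simp add: plus_mfps_def mfps_varsD)

lemma mfps_vars_mult: "f \<in> mfps_vars n ==> g \<in> mfps_vars n ==> f * g \<in> mfps_vars n"
proof (rule mfps_varsI)
  fix m assume fg: "f \<in> mfps_vars n" "g \<in> mfps_vars n" and m: "\<not> set_mset m \<subseteq> {..<n}"
  have "mfps_coeff f a * mfps_coeff g (m - a) = 0" if "a \<subseteq># m" for a
  proof -
    have "set_mset m = set_mset a \<union> set_mset (m - a)"
      using that by (metis set_mset_union subset_mset.add_diff_inverse)
    with m fg show ?thesis by (metis mfps_varsD mult_zero_left mult_zero_right Un_least)
  qed
  thus "mfps_coeff (f * g) m = 0" by (auto simp: times_mfps_def intro!: sum.neutral)
qed

lemma mfps_vars_deriv: "f \<in> mfps_vars n ==> mfps_deriv i f \<in> mfps_vars n"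
  by (rule mfps_varsI) (auto simp: mfps_deriv_def mfps_varsD)

lemma mfps_vars_half_deriv2: "f \<in> mfps_vars n ==> mfps_half_deriv2 i f \<in> mfps_vars n"
  by (rule mfps_varsI) (auto simp: mfps_half_deriv2_def mfps_varsD)

lemma mfps_vars_uminus: "f \<in> mfps_vars n ==> - f \<in> mfps_vars n"
  by (rule mfps_varsI) (auto simp: uminus_mfps_def mfps_varsD)

context superfiltered_deformation
begin

lemma pot_vars: "pot \<in> mfps_vars n"
  by (rule mfps_varsI) (auto simp: disc_potential_def)

lemma clifford_data_x: "clifford_data (mfps_vars n) n \<beta>x (\<lambda>a. - half_Hess n pot a)"
proof
  show "- half_Hess n pot a = (\<Sum>i<n. \<Sum>j\<le>i. \<beta>x i j * (a i * a j))" for a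
  proof -
    have "(\<Sum>j\<le>i. \<beta>x i j * (a i * a j)) =
        - (a i * a i * mfps_half_deriv2 i pot) - (\<Sum>j<i. a j * a i * mfps_deriv j (mfps_deriv i pot))" for i
    proof -
      have "(\<Sum>j\<le>i. \<beta>x i j * (a i * a j)) = \<beta>x i i * (a i * a i) + (\<Sum>j<i. \<beta>x i j * (a i * a j))"
        by (simp add: lessThan_Suc_atMost[symmetric] add.commute)
      also have "(\<Sum>j<i. \<beta>x i j * (a i * a j)) = (\<Sum>j<i. - (a j * a i * mfps_deriv j (mfps_deriv i pot)))"
        by (rule sum.cong) (auto simp: \<beta>x_def mult_ac)
      finally show ?thesis by (simp add: \<beta>x_def sum_negf mult_ac)
    qed
    thus ?thesis by (simp add: half_Hess_def sum_subtractf sum_negf)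
  qed
  show "\<beta>x i j \<in> mfps_vars n" for i j
    using pot_vars by (auto simp: \<beta>x_def intro!: mfps_vars_uminus mfps_vars_deriv mfps_vars_half_deriv2)
qed (simp_all add: mfps_vars_one mfps_vars_add mfps_vars_mult mfps_vars_uminus)

sublocale act: clifford_action "mfps_vars n" n \<beta>x "\<lambda>a. - half_Hess n pot a" smul
  "\<lambda>i. - mfps_deriv i pot" Dx "\<lambda>i. mulx (cst (v i))" "cst unit" hx mulx mx
proof -
  interpret cd: clifford_data "mfps_vars n" n \<beta>x "\<lambda>a. - half_Hess n pot a" by (rule clifford_data_x)
  show "clifford_action (mfps_vars n) n \<beta>x (\<lambda>a. - half_Hess n pot a) smul
    (\<lambda>i. - mfps_deriv i pot) Dx (\<lambda>i. mulx (cst (v i))) (cst unit) hx mulx mx"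
  proof
    show "- mfps_deriv i pot \<in> mfps_vars n" for i by (intro mfps_vars_uminus mfps_vars_deriv pot_vars)
    show "hx i j (a + b) = hx i j a + hx i j b" "hx i j (smul r a) = smul r (hx i j a)" for i j a b r
      by (simp_all add: hx_def M_simps ser.scale_right_distrib)
    show "Dx (cst unit) = 0" by (simp add: Dx_def tau_unit M_minus1 M_unit)
    show "mulx (cst unit) b = b" for b by (simp add: mulx_def M_unit_left tau_tau)
  qed (simp_all add: Dx_add Dx_smul Dx_Lx clifford_relation clifford_relation_square associator,
      simp_all add: mulx_def mx_def M_simps)
qed

section \<open>Support and parity\<close>

definition supported :: "(nat multiset => 'a) => bool" where
  "supported \<alpha> \<longleftrightarrow> (\<forall>m. \<not> set_mset m \<subseteq> {..<n} \<longrightarrow> \<alpha> m = 0)"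

definition parity :: "int => (nat multiset => 'a) => bool" where
  "parity t \<alpha> \<longleftrightarrow> (\<forall>m. \<alpha> m \<in> X t)"

lemma SS_supported:
  assumes "\<And>\<alpha>. \<alpha> \<in> set \<alpha>s ==> supported \<alpha>" "\<not> set_mset m \<subseteq> {..<n}" "\<And>l r. f (l @ 0 # r) = (0 :: 'a)"
  shows "SS \<alpha>s m f = 0"
  using assms
proof (induction \<alpha>s arbitrary: m f)
  case Nil
  have "f (map v w) = 0" if "mset w = m" for w
  proof -
    have "set w = set_mset m" using that by auto
    then obtain i where "i \<in> set w" "\<not> i < n" using Nil.prems(2) by auto
    then obtain x y where "w = x @ i # y" by (metis split_list)
    with \<open>\<not> i < n\<close> show ?thesis by (simp add: v_def[of i] Nil.prems(3))
  qed
  thus ?case by (auto simp: SS.simps wsum_def intro!: sum.neutral)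
next
  case (Cons \<alpha> \<alpha>s)
  have "SS \<alpha>s d (\<lambda>l. f (map v u @ \<alpha> c # l)) = 0" if "a + x = m" "c + d = x" "mset u = a" for a x c d u
  proof -
    have "\<not> set_mset (a + c + d) \<subseteq> {..<n}" using Cons.prems(2) that by (simp add: add.assoc)
    then consider "\<not> set_mset a \<subseteq> {..<n}" | "\<not> set_mset c \<subseteq> {..<n}" | "\<not> set_mset d \<subseteq> {..<n}" by auto
    thus ?thesis
    proof cases
      case 1
      moreover have "set u = set_mset a" using that(3) by auto
      ultimately obtain i where "i \<in> set u" "\<not> i < n" by auto
      then obtain p q where u: "u = p @ i # q" by (metis split_list)
      have "f (map v u @ \<alpha> c # l) = 0" for l
        using Cons.prems(3)[of "map v p" "map v q @ \<alpha> c # l"] \<open>\<not> i < n\<close> by (simp add: u v_def[of i])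
      thus ?thesis by simp
    next
      case 2
      hence "\<alpha> c = 0" using Cons.prems(1)[of \<alpha>] by (simp add: supported_def)
      thus ?thesis by (simp add: Cons.prems(3))
    next
      case 3
      show ?thesis
      proof (rule Cons.IH[OF _ 3])
        show "f (map v u @ \<alpha> c # l @ 0 # r) = 0" for l r
          using Cons.prems(3)[of "map v u @ \<alpha> c # l" r] by simp
      qed (use Cons.prems(1) in simp)
    qed
  qed
  hence z: "SS \<alpha>s d (\<lambda>l. f (map v u @ \<alpha> c # l)) = 0" if "a + x = m" "c + d = x" "mset u = a" for a x c d u
    using that by blast
  show ?case
    unfolding SS.simps msum_def wsum_def
  proof (intro sum.neutral ballI)
    fix a u c assume "a \<in> {a. a \<subseteq># m}" "u \<in> {w. mset w = a}" "c \<in> {c. c \<subseteq># m - a}"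
    hence "a + (m - a) = m" "c + (m - a - c) = m - a" "mset u = a"
      by (simp_all only: subset_mset.add_diff_inverse mem_Collect_eq)
    thus "SS \<alpha>s (m - a - c) (\<lambda>l. f (map v u @ \<alpha> c # l)) = 0" by (rule z)
  qed
qed

lemma M_supported: "(\<And>\<alpha>. \<alpha> \<in> set \<alpha>s ==> supported \<alpha>) ==> supported (M \<alpha>s)"
  unfolding supported_def[of "M \<alpha>s"] M_def by (auto intro!: SS_supported multilinear_zero[OF multilinear])

lemma X_msum: "(\<And>a b. a + b = m ==> f a b \<in> X p) ==> msum m f \<in> X p"
  unfolding msum_def by (rule X_sum) auto

lemma SS_parity:
  assumes "list_all2 parity ps \<alpha>s"
    "\<And>as qs. list_all2 (\<lambda>a p. a \<in> X p) as qs ==> f as \<in> X (sum_list qs - int (length as) + t)"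
  shows "SS \<alpha>s m f \<in> X (sum_list ps - int (length \<alpha>s) + t)"
  using assms
proof (induction ps \<alpha>s arbitrary: m f t rule: list_all2_induct)
  case Nil
  have "list_all2 (\<lambda>a p. a \<in> X p) (map v w) (replicate (length w) 1)" for w
    by (induction w) (simp_all add: v_X)
  from Nil(1)[OF this] show ?case by (auto simp: SS.simps wsum_def sum_list_replicate intro!: X_sum)
next
  case (Cons p ps \<alpha> \<alpha>s)
  have z: "SS \<alpha>s d (\<lambda>l. f (map v u @ \<alpha> c # l)) \<in> X (sum_list ps - int (length \<alpha>s) + (t + p - 1))" for d u c
  proof (rule Cons.IH)
    fix as qs assume as: "list_all2 (\<lambda>a p. a \<in> X p) as qs"
    have "list_all2 (\<lambda>a p. a \<in> X p) (map v u) (replicate (length u) 1)"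
      by (induction u) (simp_all add: v_X)
    hence "list_all2 (\<lambda>a p. a \<in> X p) (map v u @ \<alpha> c # as) (replicate (length u) 1 @ p # qs)"
      using as Cons.hyps(1) by (intro list_all2_appendI) (simp_all add: parity_def)
    from Cons.prems[OF this] show "f (map v u @ \<alpha> c # as) \<in> X (sum_list qs - int (length as) + (t + p - 1))"
      by (simp add: sum_list_replicate algebra_simps)
  qed
  have eq: "sum_list (p # ps) - int (length (\<alpha> # \<alpha>s)) + t = sum_list ps - int (length \<alpha>s) + (t + p - 1)" by simp
  show ?case unfolding SS.simps wsum_def eq by (intro X_msum X_sum z)
qed

lemma M_parity: "list_all2 parity ps \<alpha>s ==> parity (sum_list ps - int (length \<alpha>s) + 2) (M \<alpha>s)"
proof -
  assume a: "list_all2 parity ps \<alpha>s"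
  have "SS \<alpha>s m \<mu> \<in> X (sum_list ps - int (length \<alpha>s) + 2)" for m
    using SS_parity[OF a, of \<mu> 2] \<mu>_X by blast
  thus ?thesis by (simp add: parity_def M_def)
qed

lemma parity_cong: "even (s - t) ==> parity s = parity t"
  unfolding parity_def[abs_def] using X_cong[of s t] by simp

lemma parity_2: "parity (t + 1 + 1) = parity t"
  by (rule parity_cong) simp

lemma parity_tau: "parity t \<alpha> ==> parity t (tau \<alpha>)"
  by (simp add: parity_def tws_def tw_X)

lemma parity_minus: "parity t \<alpha> ==> parity t (- \<alpha>)"
  unfolding parity_def using X_sg[of _ t 1] by (simp add: sg_def)

lemma parity_add: "parity t \<alpha> ==> parity t \<beta> ==> parity t (\<alpha> + \<beta>)"
  by (simp add: parity_def X_plus)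

lemma parity_tau_eq: "parity t \<alpha> ==> tau \<alpha> = (if even t then - \<alpha> else \<alpha>)"
  by (rule ext) (auto simp: parity_def tws_def dest: tw_even tw_odd)

lemma parity_unique: "parity t \<alpha> ==> parity (t + 1) \<alpha> ==> \<alpha> = 0"
  by (rule ext) (auto simp: parity_def intro: X_X_zero)

lemma parity_sum_zero: "parity t \<alpha> ==> parity (t + 1) \<beta> ==> \<alpha> + \<beta> = 0 ==> \<alpha> = 0"
proof -
  assume a: "parity t \<alpha>" "parity (t + 1) \<beta>" "\<alpha> + \<beta> = 0"
  hence "\<alpha> = - \<beta>" by (simp add: eq_neg_iff_add_eq_0)
  thus ?thesis using parity_unique[OF a(1)] parity_minus[OF a(2)] by simp
qed

lemma Dx_parity: "parity t \<alpha> ==> parity (t + 1) (Dx \<alpha>)"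
  unfolding Dx_def using M_parity[of "[t]" "[tau \<alpha>]"] by (intro parity_minus) (simp add: parity_tau add.commute)

lemma Dx_supported: "supported \<alpha> ==> supported (Dx \<alpha>)"
  unfolding Dx_def using M_supported[of "[tau \<alpha>]"] by (auto simp: supported_def tws_def)

lemma parity_split: "\<exists>\<beta> \<gamma>. \<alpha> = \<beta> + \<gamma> \<and> parity t \<beta> \<and> parity (t + 1) \<gamma>"
proof -
  have "\<forall>m. \<exists>b c. b \<in> X 0 \<and> c \<in> X 1 \<and> \<alpha> m = b + c" using grading_span by blast
  then obtain b c where bc: "\<And>m. b m \<in> X 0" "\<And>m. c m \<in> X 1" "\<And>m. \<alpha> m = b m + c m" by metis
  hence e: "\<alpha> = b + c" "parity 0 b" "parity 1 c" by (auto simp: parity_def)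
  show ?thesis
  proof (cases "even t")
    case True
    thus ?thesis using e parity_cong[of 0 t] parity_cong[of 1 "t + 1"] by auto
  next
    case False
    thus ?thesis using e parity_cong[of 1 t] parity_cong[of 0 "t + 1"]
      by (intro exI[of _ c] exI[of _ b]) (auto simp: add.commute)
  qed
qed

lemma SS_single_cong:
  assumes "\<And>c. c \<subseteq># m ==> \<alpha> c = \<alpha>' c"
  shows "SS [\<alpha>] m f = SS [\<alpha>'] m f"
proof -
  have "msum x (\<lambda>c d. SS [] d (\<lambda>l. f (map v u @ \<alpha> c # l))) = msum x (\<lambda>c d. SS [] d (\<lambda>l. f (map v u @ \<alpha>' c # l)))"
    if "a + x = m" for a x u
  proof (rule msum_cong)
    fix c d assume "c + d = x"
    hence "c \<subseteq># m" using that by (metis mset_subset_eq_add_left mset_subset_eq_add_right subset_mset.order_trans)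
    thus "SS [] d (\<lambda>l. f (map v u @ \<alpha> c # l)) = SS [] d (\<lambda>l. f (map v u @ \<alpha>' c # l))" using assms by simp
  qed
  thus ?thesis unfolding SS.simps(2) by (intro msum_cong) simp
qed

lemma Dx_preimage:
  assumes \<alpha>: "supported \<alpha>" "parity t \<alpha>" "\<alpha> = Dx \<beta>"
  shows "\<exists>\<gamma>. supported \<gamma> \<and> parity (t - 1) \<gamma> \<and> \<alpha> = Dx \<gamma>"
proof -
  obtain b c where bc: "\<beta> = b + c" "parity (t - 1) b" "parity t c" using parity_split[of \<beta> "t - 1"] by auto
  have "Dx c + (Dx b - \<alpha>) = 0" using \<alpha>(3) by (simp add: bc(1) Dx_add)
  moreover have "parity (t + 1) (Dx c)" using Dx_parity[OF bc(3)] .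
  moreover have "parity t (Dx b)" using Dx_parity[OF bc(2)] by simp
  hence "parity t (Dx b + - \<alpha>)" using \<alpha>(2) by (intro parity_add parity_minus)
  hence "parity (t + 1 + 1) (Dx b - \<alpha>)" unfolding parity_2 by simp
  ultimately have "Dx c = 0" by - (rule parity_sum_zero, assumption+)
  hence b: "\<alpha> = Dx b" using \<alpha>(3) by (simp add: bc(1) Dx_add)
  define \<gamma> where "\<gamma> m = (if set_mset m \<subseteq> {..<n} then b m else 0)" for m
  have g: "supported \<gamma>" "parity (t - 1) \<gamma>" using bc(2) by (auto simp: \<gamma>_def supported_def parity_def X_0)
  have "\<alpha> m = Dx \<gamma> m" for m
  proof (cases "set_mset m \<subseteq> {..<n}")
    case True
    have "SS [tau b] m \<mu> = SS [tau \<gamma>] m \<mu>"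
    proof (rule SS_single_cong)
      fix c assume "c \<subseteq># m"
      hence "set_mset c \<subseteq> {..<n}" using True set_mset_mono by blast
      thus "tau b c = tau \<gamma> c" by (simp add: tws_def \<gamma>_def)
    qed
    thus ?thesis by (simp add: b Dx_def M_def)
  next
    case False
    thus ?thesis using \<alpha>(1) Dx_supported[OF g(1)] by (simp add: supported_def)
  qed
  thus ?thesis using g by (intro exI[of _ \<gamma>]) auto
qed

section \<open>The Clifford model of the power series with coefficients in the deformation\<close>

lemma sum_fun: "(\<Sum>x\<in>B. G x) m = (\<Sum>x\<in>B. G x m)" for G :: "'i => nat multiset => 'a"
  by (induction B rule: infinite_finite_induct) simp_all

lemma SS_zero: "SS \<alpha>s {#} f = f (map (\<lambda>\<alpha>. \<alpha> {#}) \<alpha>s)" for f :: "'a list => 'a"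
proof (induction \<alpha>s arbitrary: f)
  case Nil
  have "{w. mset w = {#}} = {[] :: nat list}" by auto
  thus ?case by (simp add: SS.simps wsum_def)
next
  case (Cons \<alpha> \<alpha>s)
  have w: "{w. mset w = {#}} = {[] :: nat list}" by auto
  show ?case by (simp add: SS.simps wsum_def msum_def w Cons)
qed

lemma Lx_supported: "supported \<alpha> ==> supported (Lx j \<alpha>)"
proof -
  assume "supported \<alpha>"
  hence "supported (tau \<alpha>)" by (simp add: supported_def tws_def)
  moreover have "supported (cst (v j))" by (auto simp: supported_def cst_def)
  ultimately have "supported (M [cst (v j), tau \<alpha>])" by (intro M_supported) auto
  thus ?thesis by (simp add: mulx_def supported_def)
qed

lemma Lx_parity: "parity p \<alpha> ==> parity (p + 1) (Lx j \<alpha>)"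
proof -
  assume "parity p \<alpha>"
  moreover have "parity 1 (cst (v j))" by (auto simp: parity_def cst_def v_X X_0)
  ultimately show ?thesis
    unfolding mulx_def using M_parity[of "[1, p]" "[cst (v j), tau \<alpha>]"]
    by (intro parity_minus) (simp add: parity_tau add.commute)
qed

lemma Lx_zero: "Lx j \<alpha> {#} = - \<mu> [v j, tw (\<alpha> {#})]"
  by (simp add: mulx_def M_def SS_zero cst_def tws_def)

text \<open>Setting the variables to zero turns the twisted products into the ones that define
  \<open>e\<close>.\<close>

lemma eS_props: "S \<subseteq> {..<n} ==> supported (act.eS S) \<and> parity (int (card S)) (act.eS S) \<and> act.eS S {#} = e S"
proof (induction S rule: ext.sorted_basis_induct)
  case empty
  have "supported (cst unit)" "parity 0 (cst unit)" "cst unit {#} = unit"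
    by (auto simp: supported_def parity_def cst_def unit_degree X_0)
  thus ?case unfolding act.eS_empty by (simp add: e_empty)
next
  case (insert j S)
  have fS: "finite S" using insert.hyps(2) finite_subset by blast
  have jS: "j \<notin> S" using insert.hyps(3) by blast
  have E: "act.eS (Set.insert j S) = Lx j (act.eS S)" using insert.hyps by (intro act.eS_insert)
  have 1: "supported (Lx j (act.eS S))" using insert.IH by (intro Lx_supported) blast
  have "parity (int (card S) + 1) (Lx j (act.eS S))" using insert.IH by (intro Lx_parity) blast
  moreover have "int (card S) + 1 = int (card (Set.insert j S))" using fS jS by simp
  ultimately have 2: "parity (int (card (Set.insert j S))) (Lx j (act.eS S))" by metis
  have "Lx j (act.eS S) {#} = - \<mu> [v j, tw (e S)]" using insert.IH by (simp only: Lx_zero)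
  also have "\<dots> = - sg (int (card S) - 1) (\<mu> [e {j}, e S])"
    unfolding tw_sg[OF e_X[OF fS]] \<mu>_sg e_single ..
  also have "\<mu> [e {j}, e S] = sg (int (card S)) (e (Set.insert j S))" using insert.hyps fS by (intro e_insert)
  finally have 3: "Lx j (act.eS S) {#} = e (Set.insert j S)" by (simp add: sg_def)
  show ?case unfolding E using 1 2 3 by blast
qed

lemma \<Phi>_apply: "act.\<Phi> f m = (\<Sum>S\<in>Pow {..<n}. msum m (\<lambda>a b. mfps_coeff (f S) a *s act.eS S b))"
  by (simp add: act.lin_def sum_fun smul_def)

text \<open>The coefficients of \<open>f\<close> at \<open>m\<close> meet the constant terms
  \<open>e S\<close> of the ordered products; those at proper divisors meet higher terms. Hence the
  coefficients are found by induction over divisors, one basis expansion at a time.\<close>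

lemma \<Phi>_triangular: "act.\<Phi> f m = comb (\<lambda>S. mfps_coeff (f S) m)
    + (\<Sum>a | a \<subset># m. \<Sum>S\<in>Pow {..<n}. mfps_coeff (f S) a *s act.eS S (m - a))"
proof -
  have sub: "{a. a \<subseteq># m} = insert m {a. a \<subset># m}" by auto
  have fin: "finite {a. a \<subset># m}" by (rule finite_subset[OF _ finite_submultisets[of m]]) auto
  have "act.\<Phi> f m = (\<Sum>a | a \<subseteq># m. \<Sum>S\<in>Pow {..<n}. mfps_coeff (f S) a *s act.eS S (m - a))"
    unfolding \<Phi>_apply msum_def by (rule sum.swap)
  also have "\<dots> = (\<Sum>S\<in>Pow {..<n}. mfps_coeff (f S) m *s act.eS S {#})
      + (\<Sum>a | a \<subset># m. \<Sum>S\<in>Pow {..<n}. mfps_coeff (f S) a *s act.eS S (m - a))"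
    unfolding sub using fin by simp
  also have "(\<Sum>S\<in>Pow {..<n}. mfps_coeff (f S) m *s act.eS S {#}) = comb (\<lambda>S. mfps_coeff (f S) m)"
    by (rule sum.cong) (simp_all add: eS_props)
  finally show ?thesis .
qed

lemma \<Phi>_eq_0: "act.\<Phi> f = 0 ==> f \<in> act.FK ==> f = (\<lambda>_. 0)"
proof
  assume 0: "act.\<Phi> f = 0" and f: "f \<in> act.FK"
  have c: "\<forall>S. S \<subseteq> {..<n} \<longrightarrow> mfps_coeff (f S) m = 0" for m
  proof (induction m rule: wf_induct_rule[OF wfp_subset_mset[unfolded wfp_def]])
    case (1 m)
    have "(\<Sum>a | a \<subset># m. \<Sum>S\<in>Pow {..<n}. mfps_coeff (f S) a *s act.eS S (m - a)) = 0"
      using 1 by (intro sum.neutral ballI) auto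
    hence c0: "comb (\<lambda>S. mfps_coeff (f S) m) = comb (\<lambda>_. 0)" using \<Phi>_triangular[of f m] 0 by simp
    show ?case
    proof (intro allI impI)
      fix S :: "nat set" assume "S \<subseteq> {..<n}"
      from comb_unique[OF c0 this] show "mfps_coeff (f S) m = 0" .
    qed
  qed
  fix S
  show "f S = 0"
  proof (cases "S \<subseteq> {..<n}")
    case True
    thus ?thesis using c by (intro mfps_eqI) (simp add: zero_mfps_def)
  qed (use f in \<open>auto simp: act.FK_def\<close>)
qed

lemma \<Phi>_surj:
  assumes \<alpha>: "supported \<alpha>"
  shows "\<exists>f\<in>act.FK. act.\<Phi> f = \<alpha>"
proof -
  let ?rest = "\<lambda>c m. \<Sum>a | a \<subset># m. \<Sum>S\<in>Pow {..<n}. c a S *s act.eS S (m - a)"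
  have "\<exists>c. \<forall>m. c m = coord (\<alpha> m - ?rest c m)"
  proof (rule dependent_wf_choice[OF wfp_subset_mset[unfolded wfp_def]])
    fix c c' :: "nat multiset => nat set => 'r" and m r
    assume "\<And>a. (a, m) \<in> {(x, y). x \<subset># y} ==> c a = c' a"
    hence "?rest c m = ?rest c' m" by (intro sum.cong) auto
    thus "(r = coord (\<alpha> m - ?rest c m)) = (r = coord (\<alpha> m - ?rest c' m))" by simp
  qed blast
  then obtain c where c: "\<And>m. c m = coord (\<alpha> m - ?rest c m)" by blast
  define f where "f S = Abs_mfps (\<lambda>m. c m S)" for S
  have cf: "mfps_coeff (f S) m = c m S" for S m by (simp add: f_def)
  \<comment> \<open>A variable out of range divides either the proper divisor, where the induction
    applies, or its complement, where \<open>eS\<close> has no coefficient.\<close>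
  have supp: "c m S = 0" if "\<not> set_mset m \<subseteq> {..<n}" for m S
    using that
  proof (induction m arbitrary: S rule: wf_induct_rule[OF wfp_subset_mset[unfolded wfp_def]])
    case (1 m)
    have "c a W *s act.eS W (m - a) = 0" if "a \<subset># m" "W \<in> Pow {..<n}" for a W
    proof (cases "set_mset a \<subseteq> {..<n}")
      case True
      have "set_mset m = set_mset a \<union> set_mset (m - a)"
        using that(1) by (metis set_mset_union subset_mset.add_diff_inverse subset_mset.less_imp_le)
      hence "\<not> set_mset (m - a) \<subseteq> {..<n}" using True 1(2) by auto
      thus ?thesis using eS_props[of W] that(2) by (simp add: supported_def)
    next
      case False
      thus ?thesis using 1(1)[of a W] that(1) by simp
    qed
    hence "?rest c m = 0" by (intro sum.neutral ballI) auto
    moreover have "\<alpha> m = 0" using \<alpha> 1(2) by (simp add: supported_def)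
    ultimately show ?case using c[of m] by (simp add: coord_0)
  qed
  have "f \<in> act.FK"
    unfolding act.FK_def
  proof (intro CollectI allI conjI impI)
    show "f S \<in> mfps_vars n" for S by (rule mfps_varsI) (simp add: cf supp)
    show "S \<subseteq> {..<n}" if "f S \<noteq> 0" for S
    proof (rule ccontr)
      assume "\<not> S \<subseteq> {..<n}"
      hence "c m S = 0" for m by (subst c) (rule coord_out)
      hence "f S = 0" by (intro mfps_eqI) (simp add: cf zero_mfps_def)
      with that show False ..
    qed
  qed
  moreover have "act.\<Phi> f m = \<alpha> m" for m
  proof -
    have "comb (c m) = \<alpha> m - ?rest c m" by (subst c) (rule coord_comb)
    thus ?thesis unfolding \<Phi>_triangular cf by simp
  qed
  ultimately show ?thesis by blast
qed

lemma \<Phi>_inj: "act.\<Phi> f = act.\<Phi> g ==> f \<in> act.FK ==> g \<in> act.FK ==> f = g"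
proof -
  assume a: "act.\<Phi> f = act.\<Phi> g" "f \<in> act.FK" "g \<in> act.FK"
  have "(\<lambda>S. f S + (- 1) * g S) \<in> act.FK" using a act.K_uminus[OF act.K_one] by (intro act.FK_add act.FK_times)
  hence "(\<lambda>S. f S - g S) = (\<lambda>_. 0)" using a by (intro \<Phi>_eq_0) (simp_all add: act.lin_minus)
  thus ?thesis by (simp add: fun_eq_iff)
qed

lemma \<Phi>_supported: "f \<in> act.FK ==> supported (act.\<Phi> f)"
  unfolding supported_def
proof (intro allI impI)
  fix m assume f: "f \<in> act.FK" and m: "\<not> set_mset m \<subseteq> {..<n}"
  have "mfps_coeff (f S) a *s act.eS S b = 0" if "a + b = m" "S \<subseteq> {..<n}" for S a b
  proof (cases "set_mset a \<subseteq> {..<n}")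
    case True
    hence "\<not> set_mset b \<subseteq> {..<n}" using that(1) m by auto
    thus ?thesis using eS_props[OF that(2)] by (simp add: supported_def)
  next
    case False
    have "f S \<in> mfps_vars n" using f by (simp add: act.FK_def)
    thus ?thesis using False by (simp add: mfps_varsD)
  qed
  thus "act.\<Phi> f m = 0" unfolding \<Phi>_apply msum_def by (intro sum.neutral ballI) auto
qed

lemma \<Phi>_parity: "act.par t f ==> parity t (act.\<Phi> f)"
  unfolding parity_def
proof
  fix m assume f: "act.par t f"
  have "mfps_coeff (f S) a *s act.eS S b \<in> X t" if "S \<in> Pow {..<n}" for S a b
  proof (cases "f S = 0")
    case True
    thus ?thesis by (simp add: zero_mfps_def X_0)
  next
    case False
    hence "X (int (card S)) = X t" using f by (intro X_cong) (simp add: act.par_def)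
    thus ?thesis using eS_props[of S] that by (auto simp: parity_def intro: X_scale)
  qed
  thus "act.\<Phi> f m \<in> X t" unfolding \<Phi>_apply by (intro X_sum X_msum)
qed

definition pt :: "int => (nat set => 'r mfps) => nat set => 'r mfps" where
  "pt t f S = (if even (int (card S) - t) then f S else 0)"

lemma pt: "act.par t (pt t f)" "f \<in> act.FK ==> pt t f \<in> act.FK" "f = (\<lambda>S. pt t f S + pt (t + 1) f S)"
  by (auto simp: act.par_def pt_def act.FK_def act.K_zero fun_eq_iff)

lemma par_sum_zero: "act.par t f ==> act.par (t + 1) g ==> (\<And>S. f S + g S = 0) ==> f = (\<lambda>_. 0)"
proof
  fix S assume a: "act.par t f" "act.par (t + 1) g" "\<And>S. f S + g S = 0"
  show "f S = 0"
  proof (cases "f S = 0")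
    case False
    hence "even (int (card S) - t)" using a(1) by (simp add: act.par_def)
    hence "g S = 0" using a(2) by (auto simp: act.par_def)
    thus ?thesis using a(3)[of S] by simp
  qed
qed

lemma par_cong: "even (s - t) ==> act.par s = act.par t"
proof -
  assume "even (s - t)"
  hence "even (a - s) = even (a - t)" for a :: int using even_add[of "a - s" "s - t"] by simp
  thus ?thesis by (intro ext) (simp only: act.par_def)
qed

lemma \<Phi>_parity_iff: "f \<in> act.FK ==> parity t (act.\<Phi> f) ==> act.par t f"
proof -
  assume f: "f \<in> act.FK" "parity t (act.\<Phi> f)"
  have s: "act.\<Phi> f = act.\<Phi> (pt t f) + act.\<Phi> (pt (t + 1) f)"
    by (subst pt(3)[of f t]) (rule act.lin_add)
  have "act.\<Phi> (pt (t + 1) f) + (act.\<Phi> (pt t f) - act.\<Phi> f) = 0" using s by simp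
  moreover have "parity t (act.\<Phi> (pt t f) - act.\<Phi> f)"
    using parity_add[OF \<Phi>_parity[OF pt(1)[of t f]] parity_minus[OF f(2)]] by simp
  hence "parity (t + 1 + 1) (act.\<Phi> (pt t f) - act.\<Phi> f)" unfolding parity_2 .
  ultimately have "act.\<Phi> (pt (t + 1) f) = 0" by - (rule parity_sum_zero[OF \<Phi>_parity[OF pt(1)]], assumption+)
  hence "pt (t + 1) f = (\<lambda>_. 0)" by (rule \<Phi>_eq_0) (rule pt(2)[OF f(1)])
  hence "f = pt t f" by (subst pt(3)[of f t]) simp
  thus ?thesis using pt(1)[of t f] by simp
qed

lemma contr_preimage:
  assumes f: "f \<in> act.FK" "act.par t f" and g: "g \<in> act.FK" "f = act.dC g"
  shows "\<exists>g\<in>act.FK. act.par (t - 1) g \<and> f = act.dC g"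
proof -
  let ?a = "act.dC (pt (t - 1) g)" and ?b = "act.dC (pt t g)"
  have e: "f S = ?a S + ?b S" for S
    unfolding g(2) using contr_add[of n _ "pt (t - 1) g" "pt (t - 1 + 1) g" S] pt(3)[of g "t - 1"] by simp
  have a: "act.par t ?a" using act.par_contr[OF pt(2)[OF g(1)] pt(1), of "t - 1"] by simp
  have "act.par (t + 1) ?b" by (rule act.par_contr[OF pt(2)[OF g(1)] pt(1)])
  moreover have "act.par (t + 1 + 1) (\<lambda>S. ?a S - f S)"
  proof -
    have "act.par t (\<lambda>S. ?a S - f S)"
      unfolding act.par_def
    proof (intro allI impI)
      fix S assume "?a S - f S \<noteq> 0"
      hence "?a S \<noteq> 0 \<or> f S \<noteq> 0" by auto
      thus "even (int (card S) - t)" using a f(2) unfolding act.par_def by blast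
    qed
    thus ?thesis using par_cong[of "t + 1 + 1" t] by simp
  qed
  ultimately have "?b = (\<lambda>_. 0)" by (rule par_sum_zero) (simp add: e)
  hence "f = ?a" using e by (simp add: fun_eq_iff)
  thus ?thesis using pt(1)[of "t - 1" g] pt(2)[OF g(1), of "t - 1"] by blast
qed

section \<open>The product of Hochschild cochains\<close>

abbreviation "HP \<equiv> hochschild_product X \<mu>"

lemma HP_eq: "HP s t \<phi> \<psi> as = sg t (brace \<mu> (s - 1) \<phi> (t - 1) \<psi> as)"
proof -
  have "cup_product X \<mu> s t \<phi> \<psi> as = brace \<mu> (s - 1) \<phi> (t - 1) \<psi> as"
    unfolding cup_product_def brace_def by (subst sum_splits5) simp
  thus ?thesis by (simp add: hochschild_product_def sg_def)
qed

lemma HP_CC: "\<phi> \<in> CC s ==> \<psi> \<in> CC t ==> HP s t \<phi> \<psi> \<in> CC (s + t)"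
proof -
  assume "\<phi> \<in> CC s" "\<psi> \<in> CC t"
  from brace_CC[OF \<mu>_CC this, of "s - 1" "t - 1"] have "brace \<mu> (s - 1) \<phi> (t - 1) \<psi> \<in> CC (s + t)" by simp
  hence "(\<lambda>as. sg t (brace \<mu> (s - 1) \<phi> (t - 1) \<psi> as)) \<in> CC (s + t)" by (rule CC_sg)
  thus ?thesis unfolding HP_eq[abs_def] .
qed

lemma brace_zero_left: "brace \<mu> p (\<lambda>as. 0) q \<psi> as = 0"
  using brace_diff_left[OF multilinear, of p "\<lambda>_. 0" "\<lambda>_. 0" q \<psi> as] by simp

lemma brace_zero_right: "brace \<mu> p \<phi> q (\<lambda>as. 0) as = 0"
  using brace_diff_right[OF multilinear, of p \<phi> q "\<lambda>_. 0" "\<lambda>_. 0" as] by simp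

lemma HP_diff_left: "HP s t (\<lambda>as. \<phi> as - \<phi>' as) \<psi> as = HP s t \<phi> \<psi> as - HP s t \<phi>' \<psi> as"
  by (simp add: HP_eq brace_diff_left[OF multilinear] sg_diff)

lemma HP_diff_right: "HP s t \<phi> (\<lambda>as. \<psi> as - \<psi>' as) as = HP s t \<phi> \<psi> as - HP s t \<phi> \<psi>' as"
  by (simp add: HP_eq brace_diff_right[OF multilinear] sg_diff)

lemma HP_add_left: "HP s t (\<lambda>as. \<phi> as + \<phi>' as) \<psi> as = HP s t \<phi> \<psi> as + HP s t \<phi>' \<psi> as"
  using HP_diff_left[of s t "\<lambda>as. \<phi> as + \<phi>' as" \<phi>' \<psi> as] by simp

lemma HP_add_right: "HP s t \<phi> (\<lambda>as. \<psi> as + \<psi>' as) as = HP s t \<phi> \<psi> as + HP s t \<phi> \<psi>' as"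
  using HP_diff_right[of s t \<phi> "\<lambda>as. \<psi> as + \<psi>' as" \<psi>' as] by simp

lemma dH_sg: "dH t (\<lambda>as. sg p (\<phi> as)) as = sg p (dH t \<phi> as)"
  using dH_diff[of t "\<lambda>_. 0" \<phi> as] by (simp add: sg_def dH_0)

text \<open>The primitive is the brace with \<chi> in place of its differential; the other term of
  the Leibniz rule vanishes because \<psi> is closed.\<close>

lemma HP_exact_left:
  assumes \<chi>: "\<chi> \<in> CC (s - 1)" and \<psi>: "\<psi> \<in> CC t" "dH t \<psi> = (\<lambda>as. 0)"
  shows "\<exists>\<xi>\<in>CC (s + t - 1). HP s t (dH (s - 1) \<chi>) \<psi> = dH (s + t - 1) \<xi>"
proof (rule bexI)
  let ?\<xi> = "brace \<mu> (s - 2) \<chi> (t - 1) \<psi>"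
  from brace_CC[OF \<mu>_CC \<chi> \<psi>(1), of "s - 2" "t - 1"] show "?\<xi> \<in> CC (s + t - 1)" by simp
  have \<chi>': "\<chi> \<in> CC (s - 2 + 1)" using \<chi> by simp
  have \<psi>': "\<psi> \<in> CC (t - 1 + 1)" using \<psi>(1) by simp
  have "dH (s - 2 + (t - 1)) ?\<xi> as = - sg (t - 1) (brace \<mu> (s - 1) (dH (s - 1) \<chi>) (t - 1) \<psi> as)" for as
    using brace_\<mu>_Leibniz[OF \<chi>' \<psi>', of as] by (simp add: \<psi>(2) brace_zero_right)
  moreover have "dH (s - 2 + (t - 1)) = dH (s + t - 1)" by (rule dH_cong) simp
  ultimately show "HP s t (dH (s - 1) \<chi>) \<psi> = dH (s + t - 1) ?\<xi>"
    by (intro ext) (simp add: HP_eq sg_def)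
qed

lemma HP_exact_right:
  assumes \<phi>: "\<phi> \<in> CC s" "dH s \<phi> = (\<lambda>as. 0)" and \<omega>: "\<omega> \<in> CC (t - 1)"
  shows "\<exists>\<xi>\<in>CC (s + t - 1). HP s t \<phi> (dH (t - 1) \<omega>) = dH (s + t - 1) \<xi>"
proof (rule bexI)
  let ?b = "brace \<mu> (s - 1) \<phi> (t - 2) \<omega>"
  let ?\<xi> = "\<lambda>as. sg (t + 1) (?b as)"
  from brace_CC[OF \<mu>_CC \<phi>(1) \<omega>, of "s - 1" "t - 2"] have "?b \<in> CC (s + t - 1)" by simp
  thus "?\<xi> \<in> CC (s + t - 1)" by (rule CC_sg)
  have \<omega>': "\<omega> \<in> CC (t - 2 + 1)" using \<omega> by simp
  have \<phi>': "\<phi> \<in> CC (s - 1 + 1)" using \<phi>(1) by simp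
  have "dH (s - 1 + (t - 2)) ?b as = - brace \<mu> (s - 1) \<phi> (t - 1) (dH (t - 1) \<omega>) as" for as
    using brace_\<mu>_Leibniz[OF \<phi>' \<omega>', of as] by (simp add: \<phi>(2) brace_zero_left)
  moreover have "dH (s - 1 + (t - 2)) = dH (s + t - 1)" by (rule dH_cong) simp
  ultimately show "HP s t \<phi> (dH (t - 1) \<omega>) = dH (s + t - 1) ?\<xi>"
    by (intro ext) (simp add: HP_eq dH_sg, simp add: sg_def)
qed

lemma HP_cocycle:
  assumes \<phi>: "\<phi> \<in> CC s" "dH s \<phi> = (\<lambda>as. 0)" and \<psi>: "\<psi> \<in> CC t" "dH t \<psi> = (\<lambda>as. 0)"
  shows "dH (s + t) (HP s t \<phi> \<psi>) = (\<lambda>as. 0)"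
proof
  fix as
  have \<phi>': "\<phi> \<in> CC (s - 1 + 1)" using \<phi>(1) by simp
  have \<psi>': "\<psi> \<in> CC (t - 1 + 1)" using \<psi>(1) by simp
  have "dH (s - 1 + (t - 1)) (brace \<mu> (s - 1) \<phi> (t - 1) \<psi>) as = 0"
    using brace_\<mu>_Leibniz[OF \<phi>' \<psi>', of as] by (simp add: \<phi>(2) \<psi>(2) brace_zero_left brace_zero_right)
  moreover have "dH (s - 1 + (t - 1)) = dH (s + t)" by (rule dH_cong) simp
  ultimately show "dH (s + t) (HP s t \<phi> \<psi>) as = 0" by (simp add: HP_eq[abs_def] dH_sg)
qed

lemma reduced_unit: "reduced \<phi> ==> multilinear scale \<phi> ==> unit \<in> set l ==> \<phi> (map (T p) l) = 0"
proof -
  assume a: "reduced \<phi>" "multilinear scale \<phi>" "unit \<in> set l"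
  from a(3) obtain x y where "l = x @ unit # y" by (metis split_list)
  thus ?thesis using a(1) by (simp add: T_unit multilinear_sg[OF a(2)] reduced_def)
qed

lemma \<mu>_unit_T: "unit \<in> set l ==> length x + length l + length y \<ge> 3 ==> \<mu> (x @ map (T p) l @ y) = 0"
proof -
  assume a: "unit \<in> set l" "length x + length l + length y \<ge> 3"
  from a(1) obtain b c where l: "l = b @ unit # c" by (metis split_list)
  have "\<mu> ((x @ map (T p) b) @ unit # map (T p) c @ y) = 0" using a(2) by (intro \<mu>_unit_sides) (simp add: l)
  thus ?thesis using multilinear_sg[OF multilinear, of "x @ map (T p) b" p unit "map (T p) c @ y"]
    by (simp add: l T_unit)
qed

text \<open>A unit among the inputs lands in one of the reduced cochains or directly in \<mu>, which
  then has at least three inputs.\<close>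

lemma reduced_brace:
  assumes \<phi>: "reduced \<phi>" and \<psi>: "reduced \<psi>" "multilinear scale \<psi>"
  shows "reduced (brace \<mu> p \<phi> q \<psi>)"
  unfolding reduced_def
proof (intro allI)
  fix l0 r0
  define as where "as = l0 @ unit # r0"
  have z: "\<mu> (l @ \<phi> u # map (T p) m @ \<psi> (map (T p) v') # map (T (p + q)) r) = 0"
    if e: "l @ u @ m @ v' @ r = as" for l u m v' r
  proof -
    have "unit \<in> set (l @ u @ m @ v' @ r)" unfolding e as_def by simp
    then consider "unit \<in> set l" | "unit \<in> set u" | "unit \<in> set m" | "unit \<in> set v'" | "unit \<in> set r" by auto
    thus ?thesis
    proof cases
      case 1
      thus ?thesis by (intro \<mu>_unit) (auto dest: split_list)
    next
      case 2
      thus ?thesis using reduced_unit[of \<phi> u 0] \<phi> by (auto simp: reduced_def multilinear_zero[OF multilinear] dest!: split_list)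
    next
      case 3
      hence "length m \<ge> 1" by (cases m) auto
      thus ?thesis using \<mu>_unit_T[OF 3, of "l @ [\<phi> u]" "\<psi> (map (T p) v') # map (T (p + q)) r" p] by simp
    next
      case 4
      thus ?thesis using multilinear_zero[OF multilinear, of "l @ \<phi> u # map (T p) m" "map (T (p + q)) r"]
        by (simp add: reduced_unit[OF \<psi> 4])
    next
      case 5
      hence "length r \<ge> 1" by (cases r) auto
      thus ?thesis using \<mu>_unit_T[OF 5, of "l @ \<phi> u # map (T p) m @ [\<psi> (map (T p) v')]" "[]" "p + q"] by simp
    qed
  qed
  have "brace \<mu> p \<phi> q \<psi> as = ss as (\<lambda>l x. 0)"
    unfolding brace_def
  proof (rule ss_cong)
    fix l x assume 1: "l @ x = as"
    have "ss x (\<lambda>u x. ss x (\<lambda>m x. ss x (\<lambda>v r. \<mu> (l @ \<phi> u # map (T p) m @ \<psi> (map (T p) v) # map (T (p + q)) r)))) = ss x (\<lambda>u x. 0)"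
    proof (rule ss_cong)
      fix u y assume 2: "u @ y = x"
      have "ss y (\<lambda>m x. ss x (\<lambda>v r. \<mu> (l @ \<phi> u # map (T p) m @ \<psi> (map (T p) v) # map (T (p + q)) r))) = ss y (\<lambda>m x. 0)"
      proof (rule ss_cong)
        fix m z' assume 3: "m @ z' = y"
        have "ss z' (\<lambda>v r. \<mu> (l @ \<phi> u # map (T p) m @ \<psi> (map (T p) v) # map (T (p + q)) r)) = ss z' (\<lambda>v r. 0)"
          by (rule ss_cong, rule z) (use 1 2 3 in simp)
        thus "ss z' (\<lambda>v r. \<mu> (l @ \<phi> u # map (T p) m @ \<psi> (map (T p) v) # map (T (p + q)) r)) = 0" by simp
      qed
      thus "ss y (\<lambda>m x. ss x (\<lambda>v r. \<mu> (l @ \<phi> u # map (T p) m @ \<psi> (map (T p) v) # map (T (p + q)) r))) = 0" by simp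
    qed
    thus "ss x (\<lambda>u x. ss x (\<lambda>m x. ss x (\<lambda>v r. \<mu> (l @ \<phi> u # map (T p) m @ \<psi> (map (T p) v) # map (T (p + q)) r)))) = 0" by simp
  qed
  thus "brace \<mu> p \<phi> q \<psi> (l0 @ unit # r0) = 0" by (simp add: as_def)
qed

lemma ev_parity: "\<phi> \<in> CC t ==> parity t (ev \<phi>)"
  by (simp add: parity_def ev_X)

lemma ev_supported: "\<phi> \<in> CC t ==> supported (ev \<phi>)"
  by (simp add: supported_def ev_out[OF CC_multilinear])

text \<open>Evaluation turns the brace into the twisted \<mu>^2, and the sign of the Hochschild
  product is the twist in \<open>mulx\<close>.\<close>

lemma ev_HP: "\<psi> \<in> CC t ==> ev (HP s t \<phi> \<psi>) = mulx (ev \<phi>) (ev \<psi>)"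
proof
  fix m assume \<psi>: "\<psi> \<in> CC t"
  have "ev (HP s t \<phi> \<psi>) m = sg t (SS [] m (brace \<mu> (s - 1) \<phi> (t - 1) \<psi>))"
    unfolding HP_eq[abs_def] by (rule SS_hom[symmetric]) (simp_all add: sg_add)
  also have "\<dots> = sg t (M [ev \<phi>, ev \<psi>] m)" unfolding SS_brace[OF multilinear] M_def ..
  also have "\<dots> = mulx (ev \<phi>) (ev \<psi>) m"
    unfolding mulx_def parity_tau_eq[OF ev_parity[OF \<psi>]] by (simp add: M_minus2 sg_def)
  finally show "ev (HP s t \<phi> \<psi>) m = mulx (ev \<phi>) (ev \<psi>) m" .
qed

lemma M_ev: "\<phi> \<in> CC t ==> reduced \<phi> ==> ev (dH t \<phi>) = M [ev \<phi>]"
  by (rule ext) (simp add: M_def ev_dH)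

lemma Dx_parity_eq: "parity t \<alpha> ==> Dx \<alpha> = (if even t then M [\<alpha>] else - M [\<alpha>])"
  unfolding Dx_def by (simp add: parity_tau_eq M_minus1)

section \<open>The correspondence of cocycles\<close>

text \<open>A relation, since the reduced representative \<phi>' and the primitives are chosen. No
  degree or support is imposed on \<beta>; \<open>Dx_preimage\<close> supplies both where
  needed.\<close>

definition rel :: "int => ('a list => 'a) => (nat set => 'r mfps) => bool" where
  "rel t \<phi> f \<longleftrightarrow> \<phi> \<in> CC t \<and> dH t \<phi> = (\<lambda>as. 0) \<and> f \<in> act.FK \<and> act.dC f = (\<lambda>_. 0) \<and> act.par t f \<and>
    (\<exists>\<phi>' \<psi> \<beta>. \<phi>' \<in> CC t \<and> reduced \<phi>' \<and> \<psi> \<in> CC (t - 1) \<and> \<phi> = (\<lambda>as. \<phi>' as + dH (t - 1) \<psi> as) \<and>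
      ev \<phi>' - act.\<Phi> f = Dx \<beta>)"

lemma rel_E:
  assumes "rel t \<phi> f"
  obtains \<phi>' \<psi> \<beta> where "\<phi> \<in> CC t" "dH t \<phi> = (\<lambda>as. 0)" "f \<in> act.FK" "act.dC f = (\<lambda>_. 0)" "act.par t f"
    "\<phi>' \<in> CC t" "reduced \<phi>'" "dH t \<phi>' = (\<lambda>as. 0)" "\<psi> \<in> CC (t - 1)" "\<phi> = (\<lambda>as. \<phi>' as + dH (t - 1) \<psi> as)"
    "ev \<phi>' - act.\<Phi> f = Dx \<beta>"
proof -
  from assms obtain \<phi>' \<psi> \<beta> where r: "\<phi> \<in> CC t" "dH t \<phi> = (\<lambda>as. 0)" "f \<in> act.FK" "act.dC f = (\<lambda>_. 0)" "act.par t f"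
    "\<phi>' \<in> CC t" "reduced \<phi>'" "\<psi> \<in> CC (t - 1)" "\<phi> = (\<lambda>as. \<phi>' as + dH (t - 1) \<psi> as)" "ev \<phi>' - act.\<Phi> f = Dx \<beta>"
    unfolding rel_def by blast
  have "dH t \<phi>' as = 0" for as
    using fun_cong[OF r(2), of as] unfolding r(9) dH_add dH_dH'[OF r(8)] by simp
  hence "dH t \<phi>' = (\<lambda>as. 0)" by (rule ext)
  with r show ?thesis by (intro that)
qed

lemma rel_cong: "even (s - t) ==> rel s = rel t"
proof -
  assume e: "even (s - t)"
  hence e1: "even ((s - 1) - (t - 1))" by simp
  show ?thesis
    unfolding rel_def[abs_def] CC_cong[OF e] dH_cong[OF e] par_cong[OF e] CC_cong[OF e1] dH_cong[OF e1] ..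
qed

lemma ev_Dx:
  assumes "\<phi> \<in> CC t" "reduced \<phi>" "dH t \<phi> = (\<lambda>as. 0)"
  shows "Dx (ev \<phi>) = 0"
proof -
  have "M [ev \<phi>] = ev (\<lambda>as. 0)" using M_ev[OF assms(1,2)] assms(3) by simp
  hence "M [ev \<phi>] = 0" by (simp add: fun_eq_iff)
  thus ?thesis unfolding Dx_parity_eq[OF ev_parity[OF assms(1)]] by simp
qed

lemma dC_FK: "f \<in> act.FK ==> act.dC f \<in> act.FK" by (rule act.FK_contr')

lemma zero_FK: "(\<lambda>_. 0) \<in> act.FK" by (rule act.FK_zero)

text \<open>Normalise, evaluate, and invert \<Phi> on supported series. As \<Phi> is injective and
  compatible with the differentials and parities, the result is a cocycle of the right
  parity.\<close>

lemma rel_total: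
  assumes \<phi>: "\<phi> \<in> CC t" "dH t \<phi> = (\<lambda>as. 0)"
  shows "\<exists>f. rel t \<phi> f"
proof -
  have "reduced (dH t \<phi>)" unfolding \<phi>(2) by (simp add: reduced_def)
  with normalize[OF \<phi>(1)] obtain \<psi> where \<psi>: "\<psi> \<in> CC (t - 1)" "reduced (\<lambda>as. \<phi> as - dH (t - 1) \<psi> as)" by blast
  define \<phi>' where "\<phi>' = (\<lambda>as. \<phi> as - dH (t - 1) \<psi> as)"
  have "dH (t - 1) \<psi> \<in> CC t" using dH_CC[OF \<psi>(1)] by simp
  hence \<phi>': "\<phi>' \<in> CC t" "reduced \<phi>'" using \<phi>(1) \<psi>(2) unfolding \<phi>'_def by (simp_all add: CC_diff)
  have d: "dH t \<phi>' = (\<lambda>as. 0)" by (rule ext) (simp add: \<phi>'_def dH_diff dH_dH'[OF \<psi>(1)] \<phi>(2))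
  obtain f where f: "f \<in> act.FK" "act.\<Phi> f = ev \<phi>'" using \<Phi>_surj[OF ev_supported[OF \<phi>'(1)]] by blast
  have "act.\<Phi> (act.dC f) = 0" using act.D_\<Phi>[OF f(1)] ev_Dx[OF \<phi>' d] f(2) by simp
  hence "act.dC f = (\<lambda>_. 0)" by (rule \<Phi>_eq_0) (rule dC_FK[OF f(1)])
  moreover have "act.par t f" using \<Phi>_parity_iff[OF f(1)] ev_parity[OF \<phi>'(1)] f(2) by simp
  moreover have "\<phi> = (\<lambda>as. \<phi>' as + dH (t - 1) \<psi> as)" by (simp add: \<phi>'_def)
  moreover have "ev \<phi>' - act.\<Phi> f = Dx 0" unfolding f(2) using Dx_smul[of 0 0] by simp
  ultimately show ?thesis unfolding rel_def using \<phi> \<phi>' f(1) \<psi>(1) by blast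
qed

lemma rel_surj:
  assumes f: "f \<in> act.FK" "act.par t f" "act.dC f = (\<lambda>_. 0)"
  shows "\<exists>\<phi>. rel t \<phi> f"
proof -
  have "Dx (act.\<Phi> f) = 0" unfolding act.D_\<Phi>[OF f(1)] f(3) by (rule act.lin_zero)
  hence "M [act.\<Phi> f] = 0" using Dx_M by blast
  hence m: "SS [act.\<Phi> f] m \<mu> = 0" for m by (simp add: M_def fun_eq_iff)
  have x: "act.\<Phi> f m \<in> X t" for m using \<Phi>_parity[OF f(2)] by (simp add: parity_def)
  have s: "set_mset m \<subseteq> {..<n}" if "act.\<Phi> f m \<noteq> 0" for m using \<Phi>_supported[OF f(1)] that unfolding supported_def by blast
  obtain \<phi> where \<phi>: "\<phi> \<in> CC t" "reduced \<phi>" "ev \<phi> = act.\<Phi> f" "dH t \<phi> = (\<lambda>as. 0)"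
    using ev_cocycle_surj[of "act.\<Phi> f" t, OF x s m] by blast
  have "rel t \<phi> f"
    unfolding rel_def
  proof (intro conjI exI)
    show "\<phi> = (\<lambda>as. \<phi> as + dH (t - 1) (\<lambda>as. 0) as)" by (simp add: dH_0)
    show "ev \<phi> - act.\<Phi> f = Dx 0" unfolding \<phi>(3) using Dx_smul[of 0 0] by simp
  qed (use \<phi> f in \<open>simp_all add: CC_zero\<close>)
  thus ?thesis by (intro exI)
qed

text \<open>The primitive \<omega> of the reduced cocycle \<phi>' need not be reduced. Since its
  differential is, it can be normalised without changing that differential, and evaluation then
  exhibits \<Phi> f as exact.\<close>

lemma rel_exactD:
  assumes r: "rel t \<phi> f" and \<chi>: "\<chi> \<in> CC (t - 1)" "\<phi> = dH (t - 1) \<chi>"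
  shows "\<exists>g\<in>act.FK. act.par (t - 1) g \<and> f = act.dC g"
proof -
  from r obtain \<phi>' \<psi> \<beta> where f: "f \<in> act.FK" "act.par t f" and \<phi>': "\<phi>' \<in> CC t" "reduced \<phi>'"
    and \<psi>: "\<psi> \<in> CC (t - 1)" "\<phi> = (\<lambda>as. \<phi>' as + dH (t - 1) \<psi> as)" and \<beta>: "ev \<phi>' - act.\<Phi> f = Dx \<beta>" by (rule rel_E)
  define \<omega> where "\<omega> = (\<lambda>as. \<chi> as - \<psi> as)"
  have \<omega>: "\<omega> \<in> CC (t - 1)" unfolding \<omega>_def by (rule CC_diff[OF \<chi>(1) \<psi>(1)])
  have d\<omega>: "dH (t - 1) \<omega> = \<phi>'"
  proof
    fix as
    have "dH (t - 1) \<chi> as = \<phi>' as + dH (t - 1) \<psi> as" using fun_cong[OF \<chi>(2), of as] fun_cong[OF \<psi>(2), of as] by simp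
    thus "dH (t - 1) \<omega> as = \<phi>' as" by (simp add: \<omega>_def dH_diff)
  qed
  obtain \<eta> where \<eta>: "\<eta> \<in> CC (t - 1 - 1)" "reduced (\<lambda>as. \<omega> as - dH (t - 1 - 1) \<eta> as)"
    using normalize[OF \<omega>] \<phi>'(2) unfolding d\<omega> by blast
  define \<xi> where "\<xi> = (\<lambda>as. \<omega> as - dH (t - 1 - 1) \<eta> as)"
  have "dH (t - 1 - 1) \<eta> \<in> CC (t - 1)" using dH_CC[OF \<eta>(1)] by simp
  hence \<xi>: "\<xi> \<in> CC (t - 1)" "reduced \<xi>" using \<omega> \<eta>(2) unfolding \<xi>_def by (simp_all add: CC_diff)
  have "dH (t - 1) \<xi> = \<phi>'" by (rule ext) (simp only: \<xi>_def dH_diff dH_dH'[OF \<eta>(1)] d\<omega> diff_0_right)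
  hence "ev \<phi>' = M [ev \<xi>]" using M_ev[OF \<xi>] by simp
  also have "\<dots> = Dx (if even (t - 1) then ev \<xi> else - ev \<xi>)"
    using Dx_parity_eq[OF ev_parity[OF \<xi>(1)]] Dx_smul[of "-1" "ev \<xi>"] by simp
  finally obtain \<gamma>' where "ev \<phi>' = Dx \<gamma>'" by blast
  hence "act.\<Phi> f = Dx (\<gamma>' + (- \<beta>))" using \<beta> Dx_smul[of "-1" \<beta>] unfolding Dx_add by (simp add: algebra_simps)
  from Dx_preimage[OF \<Phi>_supported[OF f(1)] \<Phi>_parity[OF f(2)] this]
  obtain \<gamma> where \<gamma>: "supported \<gamma>" "act.\<Phi> f = Dx \<gamma>" by blast
  obtain g where g: "g \<in> act.FK" "act.\<Phi> g = \<gamma>" using \<Phi>_surj[OF \<gamma>(1)] by blast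
  have "act.\<Phi> f = act.\<Phi> (act.dC g)" unfolding \<gamma>(2) g(2)[symmetric] by (rule act.D_\<Phi>[OF g(1)])
  hence "f = act.dC g" by (rule \<Phi>_inj) (rule f(1), rule dC_FK[OF g(1)])
  thus ?thesis by (rule contr_preimage[OF f g(1)])
qed

text \<open>Once the primitive on the side of power series has support and parity,
  \<open>ev_coboundary\<close> lifts exactness back to cochains.\<close>

lemma rel_exactI:
  assumes r: "rel t \<phi> f" and g: "g \<in> act.FK" "f = act.dC g"
  shows "\<exists>\<chi>\<in>CC (t - 1). \<phi> = dH (t - 1) \<chi>"
proof -
  from r obtain \<phi>' \<psi> \<beta> where f: "f \<in> act.FK" "act.par t f" and \<phi>': "\<phi>' \<in> CC t" "reduced \<phi>'" "dH t \<phi>' = (\<lambda>as. 0)"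
    and \<psi>: "\<psi> \<in> CC (t - 1)" "\<phi> = (\<lambda>as. \<phi>' as + dH (t - 1) \<psi> as)" and \<beta>: "ev \<phi>' - act.\<Phi> f = Dx \<beta>" by (rule rel_E)
  have "ev \<phi>' = Dx (\<beta> + act.\<Phi> g)" using \<beta> act.D_\<Phi>[OF g(1)] by (simp add: Dx_add g(2) algebra_simps)
  from Dx_preimage[OF ev_supported[OF \<phi>'(1)] ev_parity[OF \<phi>'(1)] this]
  obtain \<gamma> where \<gamma>: "supported \<gamma>" "parity (t - 1) \<gamma>" "ev \<phi>' = Dx \<gamma>" by blast
  define \<delta> where "\<delta> = (if even (t - 1) then \<gamma> else - \<gamma>)"
  have \<delta>: "supported \<delta>" "parity (t - 1) \<delta>" using \<gamma> parity_minus[OF \<gamma>(2)] by (auto simp: \<delta>_def supported_def)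
  have "Dx \<gamma> = M [\<delta>]" using Dx_parity_eq[OF \<gamma>(2)] M_minus1[of \<gamma> "[]"] by (cases "even (t - 1)") (simp_all add: \<delta>_def)
  with \<gamma>(3) have "ev \<phi>' = M [\<delta>]" by (rule trans)
  hence e: "ev \<phi>' m = SS [\<delta>] m \<mu>" for m unfolding M_def[symmetric] by (rule fun_cong)
  have "\<exists>\<psi>'\<in>CC (t - 1). dH (t - 1) \<psi>' = \<phi>'"
  proof (rule ev_coboundary[OF _ \<phi>'(2)])
    show "\<phi>' \<in> CC (t - 1 + 1)" "dH (t - 1 + 1) \<phi>' = (\<lambda>as. 0)" using \<phi>' by simp_all
    show "\<delta> m \<in> X (t - 1)" for m using \<delta>(2) by (simp add: parity_def)
    show "set_mset m \<subseteq> {..<n}" if "\<delta> m \<noteq> 0" for m using \<delta>(1) that unfolding supported_def by blast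
    show "ev \<phi>' m = SS [\<delta>] m \<mu>" for m by (rule e)
  qed
  then obtain \<psi>' where \<psi>': "\<psi>' \<in> CC (t - 1)" "dH (t - 1) \<psi>' = \<phi>'" by blast
  show ?thesis
  proof (intro bexI[of _ "\<lambda>as. \<psi>' as + \<psi> as"] CC_add \<psi>'(1) \<psi>(1))
    show "\<phi> = dH (t - 1) (\<lambda>as. \<psi>' as + \<psi> as)" unfolding \<psi>(2) by (rule ext) (simp add: dH_add \<psi>'(2))
  qed
qed

lemma dH_scale: "dH t (\<lambda>as. c *s \<phi> as) as = c *s dH t \<phi> as"
proof -
  have sc: "ss l (\<lambda>u w. c *s G u w) = c *s ss l G" for l and G :: "'a list => 'a list => 'a"
    by (rule ss_hom[symmetric]) (simp_all add: scale_right_distrib)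
  show ?thesis
    unfolding dH_circ circ_def multilinear_scale[OF multilinear] sc by (simp add: sg_def scale_right_diff_distrib)
qed

lemma smul_const: "smul (mfps_const c) \<alpha> m = c *s \<alpha> m"
proof -
  have "(\<lambda>a b. mfps_coeff (mfps_const c) a *s \<alpha> b) = (\<lambda>a b. if a = {#} then c *s \<alpha> b else 0)"
    by (auto simp: fun_eq_iff mfps_const_def)
  thus ?thesis by (simp add: smul_def msum_single)
qed

lemma mfps_const_vars: "mfps_const c \<in> mfps_vars n"
  by (auto simp: mfps_vars_def mfps_const_def split: if_splits)

lemma rel_lin:
  assumes r: "rel t \<phi> f" and r2: "rel t \<phi>2 f2"
  shows "rel t (\<lambda>as. \<phi> as + c *s \<phi>2 as) (\<lambda>S. f S + mfps_const c * f2 S)"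
proof -
  from r obtain \<phi>' \<psi> \<beta> where a: "\<phi> \<in> CC t" "dH t \<phi> = (\<lambda>as. 0)" "f \<in> act.FK" "act.dC f = (\<lambda>_. 0)" "act.par t f"
    "\<phi>' \<in> CC t" "reduced \<phi>'" "dH t \<phi>' = (\<lambda>as. 0)" "\<psi> \<in> CC (t - 1)" "\<phi> = (\<lambda>as. \<phi>' as + dH (t - 1) \<psi> as)"
    "ev \<phi>' - act.\<Phi> f = Dx \<beta>" by (rule rel_E)
  from r2 obtain \<phi>2' \<psi>2 \<beta>2 where b: "\<phi>2 \<in> CC t" "dH t \<phi>2 = (\<lambda>as. 0)" "f2 \<in> act.FK" "act.dC f2 = (\<lambda>_. 0)" "act.par t f2"
    "\<phi>2' \<in> CC t" "reduced \<phi>2'" "dH t \<phi>2' = (\<lambda>as. 0)" "\<psi>2 \<in> CC (t - 1)" "\<phi>2 = (\<lambda>as. \<phi>2' as + dH (t - 1) \<psi>2 as)"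
    "ev \<phi>2' - act.\<Phi> f2 = Dx \<beta>2" by (rule rel_E)
  show ?thesis
    unfolding rel_def
  proof (intro conjI exI)
    show "(\<lambda>as. \<phi> as + c *s \<phi>2 as) \<in> CC t" by (intro CC_add CC_scale a b)
    show "dH t (\<lambda>as. \<phi> as + c *s \<phi>2 as) = (\<lambda>as. 0)" by (rule ext) (simp add: dH_add dH_scale a(2) b(2))
    show "(\<lambda>S. f S + mfps_const c * f2 S) \<in> act.FK" by (intro act.FK_add act.FK_times mfps_const_vars a b)
    show "act.dC (\<lambda>S. f S + mfps_const c * f2 S) = (\<lambda>_. 0)"
      by (rule ext) (simp add: contr_add contr_scale a(4) b(4))
    show "act.par t (\<lambda>S. f S + mfps_const c * f2 S)"
      unfolding act.par_def
    proof (intro allI impI)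
      fix S assume "f S + mfps_const c * f2 S \<noteq> 0"
      hence "f S \<noteq> 0 \<or> f2 S \<noteq> 0" by auto
      thus "even (int (card S) - t)" using a(5) b(5) unfolding act.par_def by blast
    qed
    show "(\<lambda>as. \<phi>' as + c *s \<phi>2' as) \<in> CC t" by (intro CC_add CC_scale a b)
    show "reduced (\<lambda>as. \<phi>' as + c *s \<phi>2' as)" using a(7) b(7) by (simp add: reduced_def)
    show "(\<lambda>as. \<psi> as + c *s \<psi>2 as) \<in> CC (t - 1)" by (intro CC_add CC_scale a b)
    show "(\<lambda>as. \<phi> as + c *s \<phi>2 as) = (\<lambda>as. (\<phi>' as + c *s \<phi>2' as) + dH (t - 1) (\<lambda>as. \<psi> as + c *s \<psi>2 as) as)"
      unfolding a(10) b(10) by (rule ext) (simp add: dH_add dH_scale scale_right_distrib)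
    have "ev (\<lambda>as. \<phi>' as + c *s \<phi>2' as) = ev \<phi>' + smul (mfps_const c) (ev \<phi>2')"
      by (rule ext) (simp add: SS_add scale_SS[symmetric] smul_const)
    moreover have "act.\<Phi> (\<lambda>S. f S + mfps_const c * f2 S) = act.\<Phi> f + smul (mfps_const c) (act.\<Phi> f2)"
      by (simp only: act.lin_add act.lin_times)
    ultimately show "ev (\<lambda>as. \<phi>' as + c *s \<phi>2' as) - act.\<Phi> (\<lambda>S. f S + mfps_const c * f2 S) =
        Dx (\<beta> + smul (mfps_const c) \<beta>2)"
      unfolding Dx_add Dx_smul a(11)[symmetric] b(11)[symmetric] by (simp add: ser.scale_right_diff_distrib)
  qed
qed

lemma rel_zero: "rel t (\<lambda>as. 0) (\<lambda>_. 0)"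
  unfolding rel_def
proof (intro conjI exI)
  show "dH t (\<lambda>as. 0) = (\<lambda>as. 0)" by (rule ext) (rule dH_0)
  show "(\<lambda>as. 0) = (\<lambda>as. 0 + dH (t - 1) (\<lambda>as. 0) as)" by (simp add: dH_0)
  show "ev (\<lambda>as. 0) - act.\<Phi> (\<lambda>_. 0) = Dx 0" using Dx_smul[of 0 0] by (simp add: act.lin_zero fun_eq_iff)
qed (simp_all add: CC_zero zero_FK act.contr_zero act.par_def reduced_def)

lemma rel_one: "rel 0 (\<lambda>as. if as = [] then unit else 0) (basis_fun {})"
proof -
  let ?one = "\<lambda>as :: 'a list. if as = [] then unit else 0"
  have C: "?one \<in> CC 0"
  proof (rule CC_I)
    show "multilinear scale ?one" by (simp add: multilinear_def)
    show "?one as \<in> X (sum_list ps - int (length as) + 0)" if "list_all2 (\<lambda>a p. a \<in> X p) as ps" for as ps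
      using that by (auto simp: unit_degree X_0)
  qed
  have d: "dH 0 ?one = (\<lambda>as. 0)"
  proof
    fix as
    have 0: "circ ?one 1 \<mu> as = 0"
    proof -
      have "(if l @ \<mu> m # r = [] then unit else 0) = 0" for l m r by simp
      thus ?thesis unfolding circ_def by simp
    qed
    \<comment> \<open>For a single input the products with the unit on its two sides cancel; for
      other lengths strict unitality applies.\<close>
    have "circ \<mu> (0 - 1) ?one as = 0"
    proof (cases "length as = 1")
      case True
      then obtain a where a: "as = [a]" by (auto simp: length_Suc_conv)
      have "T (- 1) a = tw a" by (simp add: T_odd)
      thus ?thesis
        using multilinear_zero[OF multilinear, of "[]" "[]"]
        by (simp add: circ_def a unit_right \<mu>_unit_left)
    next
      case False
      have "ss as (\<lambda>l x. ss x (\<lambda>m r. \<mu> (l @ ?one m # map (T (0 - 1)) r))) = ss as (\<lambda>l x. 0)"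
      proof (rule ss_cong)
        fix l x assume lx: "l @ x = as"
        have "ss x (\<lambda>m r. \<mu> (l @ ?one m # map (T (0 - 1)) r)) = ss x (\<lambda>m r. 0)"
        proof (rule ss_cong)
          fix m r assume "m @ r = x"
          with lx False show "\<mu> (l @ ?one m # map (T (0 - 1)) r) = 0"
            by (cases "m = []") (auto simp: multilinear_zero[OF multilinear] \<mu>_unit_sides)
        qed
        thus "ss x (\<lambda>m r. \<mu> (l @ ?one m # map (T (0 - 1)) r)) = 0" by simp
      qed
      thus ?thesis by (simp add: circ_def)
    qed
    thus "dH 0 ?one as = 0" unfolding dH_circ 0 by simp
  qed
  have ev: "ev ?one = cst unit"
  proof
    fix m
    show "ev ?one m = cst unit m"
      unfolding SS.simps by (subst wsum_nil) (auto simp: cst_def)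
  qed
  show ?thesis
    unfolding rel_def
  proof (intro conjI exI)
    show "?one = (\<lambda>as. ?one as + dH (0 - 1) (\<lambda>as. 0) as)" by (simp add: dH_0)
    show "ev ?one - act.\<Phi> (basis_fun {}) = Dx 0"
      unfolding ev using Dx_smul[of 0 0] by (simp add: act.lin_basis act.eS_empty)
    show "act.par 0 (basis_fun {})" using act.par_basis[of "{}"] by simp
    show "act.dC (basis_fun {}) = (\<lambda>_. 0)" by (rule act.contr_vac)
    show "basis_fun {} \<in> act.FK" by (rule act.FK_basis) simp
    show "reduced ?one" by (simp add: reduced_def)
  qed (simp_all add: C d CC_zero)
qed

lemma mulx_add_left: "mulx (a + b) c = mulx a c + mulx b c" by (simp add: mulx_def M_simps)
lemma mulx_add_right: "mulx a (b + c) = mulx a b + mulx a c" by (simp add: mulx_def M_simps)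
lemma mulx_zero: "mulx a 0 = 0" "mulx 0 a = 0"
  using mulx_add_right[of a 0 0] mulx_add_left[of 0 0 a] by simp_all

lemma mulx_exact_left: "Dx b = 0 ==> mulx (Dx a) b = Dx (mulx a b)"
  unfolding Leibniz_x by (simp add: mulx_zero)

lemma mulx_exact_right: "Dx a = 0 ==> mulx a (Dx b) = Dx (mulx (- tau a) b)"
proof -
  assume a: "Dx a = 0"
  have "Dx (- tau a) = M [a]" by (simp add: Dx_def tau_minus tau_tau M_minus1)
  hence "Dx (- tau a) = 0" using Dx_M[OF a] by simp
  thus ?thesis unfolding Leibniz_x by (simp add: mulx_zero tau_minus tau_tau)
qed

text \<open>The exact parts of the cochains are removed by the Leibniz rule for cochains, \<beta>
  and \<beta>2 by that for power series, and \<gamma> measures the failure of \<Phi> to be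
  multiplicative.\<close>

lemma rel_mult:
  assumes r: "rel s \<phi> f" and r2: "rel t \<phi>2 f2"
  shows "rel (s + t) (HP s t \<phi> \<phi>2) (act.star f f2)"
proof -
  from r obtain \<phi>' \<psi> \<beta> where a: "\<phi> \<in> CC s" "dH s \<phi> = (\<lambda>as. 0)" "f \<in> act.FK" "act.dC f = (\<lambda>_. 0)" "act.par s f"
    "\<phi>' \<in> CC s" "reduced \<phi>'" "dH s \<phi>' = (\<lambda>as. 0)" "\<psi> \<in> CC (s - 1)" "\<phi> = (\<lambda>as. \<phi>' as + dH (s - 1) \<psi> as)"
    "ev \<phi>' - act.\<Phi> f = Dx \<beta>" by (rule rel_E)
  from r2 obtain \<phi>2' \<psi>2 \<beta>2 where b: "\<phi>2 \<in> CC t" "dH t \<phi>2 = (\<lambda>as. 0)" "f2 \<in> act.FK" "act.dC f2 = (\<lambda>_. 0)" "act.par t f2"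
    "\<phi>2' \<in> CC t" "reduced \<phi>2'" "dH t \<phi>2' = (\<lambda>as. 0)" "\<psi>2 \<in> CC (t - 1)" "\<phi>2 = (\<lambda>as. \<phi>2' as + dH (t - 1) \<psi>2 as)"
    "ev \<phi>2' - act.\<Phi> f2 = Dx \<beta>2" by (rule rel_E)
  obtain \<xi>1 where \<xi>1: "\<xi>1 \<in> CC (s + t - 1)" "HP s t (dH (s - 1) \<psi>) \<phi>2 = dH (s + t - 1) \<xi>1"
    using HP_exact_left[OF a(9) b(1,2)] by blast
  obtain \<xi>2 where \<xi>2: "\<xi>2 \<in> CC (s + t - 1)" "HP s t \<phi>' (dH (t - 1) \<psi>2) = dH (s + t - 1) \<xi>2"
    using HP_exact_right[OF a(6,8) b(9)] by blast
  have D1: "Dx (ev \<phi>2') = 0" by (rule ev_Dx[OF b(6,7,8)])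
  have D2: "Dx (act.\<Phi> f) = 0" unfolding act.D_\<Phi>[OF a(3)] a(4) by (rule act.lin_zero)
  obtain \<gamma> where \<gamma>: "mulx (act.\<Phi> f) (act.\<Phi> f2) - act.\<Phi> (act.star f f2) = Dx \<gamma>"
    using act.\<Phi>_multiplicative[OF a(3,4) b(3,4)] by blast
  show ?thesis
    unfolding rel_def
  proof (intro conjI exI)
    show "HP s t \<phi> \<phi>2 \<in> CC (s + t)" by (rule HP_CC[OF a(1) b(1)])
    show "dH (s + t) (HP s t \<phi> \<phi>2) = (\<lambda>as. 0)" by (rule HP_cocycle[OF a(1,2) b(1,2)])
    show "act.star f f2 \<in> act.FK" by (rule act.star_FK[OF a(3) b(3)])
    have "act.star f (\<lambda>_. 0) S = 0" for S using act.star_times_right[of f 0 "\<lambda>_. 0" S] by simp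
    thus "act.dC (act.star f f2) = (\<lambda>_. 0)"
      using act.contr_star[where f = f and t = s and g = "\<lambda>i. - mfps_deriv i pot" and h = f2, OF a(3,5)] act.gg_K
      by (simp add: fun_eq_iff a(4) b(4) act.star_zero_left)
    show "act.par (s + t) (act.star f f2)" by (rule act.par_star[OF a(3) b(3) a(5) b(5)])
    show "HP s t \<phi>' \<phi>2' \<in> CC (s + t)" by (rule HP_CC[OF a(6) b(6)])
    show "reduced (HP s t \<phi>' \<phi>2')"
      using reduced_brace[OF a(7) b(7) CC_multilinear[OF b(6)], of "s - 1" "t - 1"]
      by (simp add: reduced_def HP_eq)
    show "(\<lambda>as. \<xi>1 as + \<xi>2 as) \<in> CC (s + t - 1)" by (rule CC_add[OF \<xi>1(1) \<xi>2(1)])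
    show "HP s t \<phi> \<phi>2 = (\<lambda>as. HP s t \<phi>' \<phi>2' as + dH (s + t - 1) (\<lambda>as. \<xi>1 as + \<xi>2 as) as)"
    proof
      fix as
      have "HP s t \<phi> \<phi>2 as = HP s t \<phi>' \<phi>2 as + HP s t (dH (s - 1) \<psi>) \<phi>2 as"
        unfolding a(10) by (rule HP_add_left)
      also have "HP s t \<phi>' \<phi>2 as = HP s t \<phi>' \<phi>2' as + HP s t \<phi>' (dH (t - 1) \<psi>2) as"
        unfolding b(10) by (rule HP_add_right)
      finally show "HP s t \<phi> \<phi>2 as = HP s t \<phi>' \<phi>2' as + dH (s + t - 1) (\<lambda>as. \<xi>1 as + \<xi>2 as) as"
        by (simp add: \<xi>1(2) \<xi>2(2) dH_add add_ac)
    qed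
    have e1: "ev \<phi>' = act.\<Phi> f + Dx \<beta>" using a(11) by (simp add: algebra_simps)
    have e2: "ev \<phi>2' = act.\<Phi> f2 + Dx \<beta>2" using b(11) by (simp add: algebra_simps)
    have "mulx (ev \<phi>') (ev \<phi>2') = mulx (act.\<Phi> f + Dx \<beta>) (ev \<phi>2')" by (rule arg_cong[OF e1])
    also have "\<dots> = mulx (act.\<Phi> f) (ev \<phi>2') + Dx (mulx \<beta> (ev \<phi>2'))"
      unfolding mulx_add_left mulx_exact_left[OF D1] ..
    also have "mulx (act.\<Phi> f) (ev \<phi>2') = mulx (act.\<Phi> f) (act.\<Phi> f2 + Dx \<beta>2)" by (rule arg_cong[OF e2])
    also have "\<dots> = mulx (act.\<Phi> f) (act.\<Phi> f2) + Dx (mulx (- tau (act.\<Phi> f)) \<beta>2)"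
      unfolding mulx_add_right mulx_exact_right[OF D2] ..
    also have "mulx (act.\<Phi> f) (act.\<Phi> f2) = act.\<Phi> (act.star f f2) + Dx \<gamma>" using \<gamma> by (simp add: algebra_simps)
    finally have mm: "mulx (ev \<phi>') (ev \<phi>2') =
      act.\<Phi> (act.star f f2) + Dx \<gamma> + Dx (mulx (- tau (act.\<Phi> f)) \<beta>2) + Dx (mulx \<beta> (ev \<phi>2'))" .
    show "ev (HP s t \<phi>' \<phi>2') - act.\<Phi> (act.star f f2) = Dx (\<gamma> + mulx (- tau (act.\<Phi> f)) \<beta>2 + mulx \<beta> (ev \<phi>2'))"
      unfolding diff_eq_eq by (rule trans[OF ev_HP[OF b(6)]], rule trans[OF mm]) (simp only: Dx_add add_ac)
  qed
qed

end

section \<open>Comparison of cohomology algebras\<close>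

text \<open>The axioms concern cocycles and cosets of coboundaries only, because the Hochschild
  product is associative just up to homotopy and cochains do not form a ring.\<close>

locale cohomology_data =
  fixes M :: "('r, 'c) module" (structure) and d :: "'c => 'c"
  assumes ab: "abelian_group M"
    and d_closed: "x \<in> carrier M ==> d x \<in> carrier M"
    and d_add: "x \<in> carrier M ==> y \<in> carrier M ==> d (x \<oplus> y) = d x \<oplus> d y"
    and one_cocycle: "\<one> \<in> cocycles M d"
    and mult_cocycle: "z \<in> cocycles M d ==> w \<in> cocycles M d ==> z \<otimes> w \<in> cocycles M d"
    and smult_cocycle: "z \<in> cocycles M d ==> c \<odot> z \<in> cocycles M d"
    and mult_class: "z \<in> cocycles M d ==> w \<in> cocycles M d ==> b \<in> coboundaries M d ==> b' \<in> coboundaries M d ==>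
      \<exists>b''\<in>coboundaries M d. (b \<oplus> z) \<otimes> (b' \<oplus> w) = b'' \<oplus> (z \<otimes> w)"
    and smult_class: "z \<in> cocycles M d ==> b \<in> coboundaries M d ==>
      \<exists>b'\<in>coboundaries M d. c \<odot> (b \<oplus> z) = b' \<oplus> (c \<odot> z)"
begin

interpretation abelian_group M by (rule ab)

abbreviation "Z \<equiv> cocycles M d"
abbreviation "B \<equiv> coboundaries M d"
abbreviation "cls \<equiv> cohomology_class M d"

lemma Z_closed: "z \<in> Z ==> z \<in> carrier M" by (simp add: cocycles_def)
lemma B_closed: "b \<in> B ==> b \<in> carrier M" by (auto simp: coboundaries_def d_closed)

lemma B_add: "b \<in> B ==> b' \<in> B ==> b \<oplus> b' \<in> B"
proof -
  assume "b \<in> B" "b' \<in> B"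
  then obtain x y where "x \<in> carrier M" "y \<in> carrier M" "b = d x" "b' = d y" by (auto simp: coboundaries_def)
  hence "b \<oplus> b' = d (x \<oplus> y)" "x \<oplus> y \<in> carrier M" using d_add by simp_all
  thus ?thesis unfolding coboundaries_def by blast
qed

lemma d_zero: "d \<zero> = \<zero>"
proof -
  have "d \<zero> \<oplus> d \<zero> = d \<zero>" using d_add[of "\<zero>" "\<zero>"] by simp
  moreover have c: "d \<zero> \<in> carrier M" by (intro d_closed zero_closed)
  hence "d \<zero> = (d \<zero> \<oplus> d \<zero>) \<oplus> (\<ominus> d \<zero>)" by (simp add: a_assoc r_neg)
  ultimately show ?thesis using r_neg[OF c] by simp
qed

lemma B_zero: "\<zero> \<in> B" unfolding coboundaries_def using d_zero by (metis imageI zero_closed)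

lemma B_minus: "b \<in> B ==> \<ominus> b \<in> B"
proof -
  assume "b \<in> B"
  then obtain x where x: "x \<in> carrier M" "b = d x" by (auto simp: coboundaries_def)
  have "d (\<ominus> x) \<oplus> d x = \<zero>" using d_add[of "\<ominus> x" x] x(1) by (simp add: l_neg d_zero)
  hence "\<ominus> b = d (\<ominus> x)" using x d_closed by (intro minus_equality) auto
  thus ?thesis unfolding coboundaries_def using x(1) by auto
qed

lemma cls_mem: "x \<in> cls z \<longleftrightarrow> (\<exists>b\<in>B. x = b \<oplus> z)"
  by (auto simp: cohomology_class_def a_r_coset_def')

lemma cls_cong:
  assumes "b \<in> B" "z \<in> carrier M"
  shows "cls (b \<oplus> z) = cls z"
proof (intro equalityI subsetI)
  fix x assume "x \<in> cls (b \<oplus> z)"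
  then obtain b' where "b' \<in> B" "x = b' \<oplus> (b \<oplus> z)" by (auto simp: cls_mem)
  hence "x = (b' \<oplus> b) \<oplus> z" using assms B_closed by (simp add: a_assoc)
  thus "x \<in> cls z" using B_add[OF \<open>b' \<in> B\<close> assms(1)] by (auto simp: cls_mem)
next
  fix x assume "x \<in> cls z"
  then obtain b' where b': "b' \<in> B" "x = b' \<oplus> z" by (auto simp: cls_mem)
  have "\<ominus> b \<oplus> (b \<oplus> z) = z" using assms B_closed by (simp add: r_neg2 r_neg1)
  hence "x = (b' \<oplus> \<ominus> b) \<oplus> (b \<oplus> z)" using assms B_closed b' by (simp add: a_assoc)
  thus "x \<in> cls (b \<oplus> z)" using B_add[OF b'(1) B_minus[OF assms(1)]] by (auto simp: cls_mem)
qed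

lemma cls_self: "z \<in> carrier M ==> z \<in> cls z"
  unfolding cls_mem by (rule bexI[OF _ B_zero]) simp

lemma cls_eq: "z \<in> carrier M ==> w \<in> carrier M ==> cls z = cls w \<longleftrightarrow> (\<exists>b\<in>B. z = b \<oplus> w)"
  using cls_self[of z] cls_mem[of z w] cls_cong[of _ w] by auto

lemma cls_add: "z \<in> Z ==> w \<in> Z ==> set_add M (cls z) (cls w) = cls (z \<oplus> w)"
proof (intro equalityI subsetI)
  fix x assume z: "z \<in> Z" "w \<in> Z" and "x \<in> set_add M (cls z) (cls w)"
  then obtain b b' where b: "b \<in> B" "b' \<in> B" "x = (b \<oplus> z) \<oplus> (b' \<oplus> w)"
    by (auto simp: set_add_def' cls_mem)
  hence "x = (b \<oplus> b') \<oplus> (z \<oplus> w)" using z Z_closed B_closed by (simp add: a_ac)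
  thus "x \<in> cls (z \<oplus> w)" using B_add[OF b(1,2)] by (auto simp: cls_mem)
next
  fix x assume z: "z \<in> Z" "w \<in> Z" and "x \<in> cls (z \<oplus> w)"
  then obtain b where b: "b \<in> B" "x = b \<oplus> (z \<oplus> w)" by (auto simp: cls_mem)
  hence "x = (b \<oplus> z) \<oplus> w" using z Z_closed B_closed by (simp add: a_assoc)
  moreover have "b \<oplus> z \<in> cls z" using b(1) by (auto simp: cls_mem)
  ultimately show "x \<in> set_add M (cls z) (cls w)" using cls_self[OF Z_closed[OF z(2)]] by (auto simp: set_add_def')
qed

lemma cls_mult: "z \<in> Z ==> w \<in> Z ==> rcoset_mult M B (cls z) (cls w) = cls (z \<otimes> w)"
proof -
  assume z: "z \<in> Z" "w \<in> Z"
  have "cls (x \<otimes> y) = cls (z \<otimes> w)" if xy: "x \<in> cls z" "y \<in> cls w" for x y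
  proof -
    from xy obtain b b' where "b \<in> B" "b' \<in> B" "x = b \<oplus> z" "y = b' \<oplus> w" by (auto simp: cls_mem)
    with mult_class[OF z, of b b'] obtain b'' where "b'' \<in> B" "x \<otimes> y = b'' \<oplus> (z \<otimes> w)" by blast
    thus ?thesis using cls_cong[of b''] Z_closed[OF mult_cocycle[OF z]] by simp
  qed
  hence "rcoset_mult M B (cls z) (cls w) = (\<Union>x\<in>cls z. \<Union>y\<in>cls w. cls (z \<otimes> w))"
    unfolding rcoset_mult_def cohomology_class_def[symmetric] by (intro SUP_cong refl)
  also have "\<dots> = cls (z \<otimes> w)"
    using cls_self[OF Z_closed[OF z(1)]] cls_self[OF Z_closed[OF z(2)]] by blast
  finally show ?thesis .
qed

lemma cls_smult: "z \<in> Z ==> (\<Union>x\<in>cls z. cls (c \<odot> x)) = cls (c \<odot> z)"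
proof -
  assume z: "z \<in> Z"
  have "cls (c \<odot> x) = cls (c \<odot> z)" if x: "x \<in> cls z" for x
  proof -
    from x obtain b where "b \<in> B" "x = b \<oplus> z" by (auto simp: cls_mem)
    with smult_class[OF z, of b c] obtain b' where "b' \<in> B" "c \<odot> x = b' \<oplus> (c \<odot> z)" by blast
    thus ?thesis using cls_cong[of b'] Z_closed[OF smult_cocycle[OF z]] by simp
  qed
  hence "(\<Union>x\<in>cls z. cls (c \<odot> x)) = (\<Union>x\<in>cls z. cls (c \<odot> z))" by (intro SUP_cong refl)
  also have "\<dots> = cls (c \<odot> z)" using cls_self[OF Z_closed[OF z]] by blast
  finally show ?thesis .
qed

lemma alg_simps:
  "carrier (cohomology_alg M d) = cls ` Z" "\<one>\<^bsub>cohomology_alg M d\<^esub> = cls \<one>"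
  "z \<in> Z ==> w \<in> Z ==> cls z \<otimes>\<^bsub>cohomology_alg M d\<^esub> cls w = cls (z \<otimes> w)"
  "z \<in> Z ==> w \<in> Z ==> cls z \<oplus>\<^bsub>cohomology_alg M d\<^esub> cls w = cls (z \<oplus> w)"
  "z \<in> Z ==> c \<odot>\<^bsub>cohomology_alg M d\<^esub> cls z = cls (c \<odot> z)"
  by (simp_all add: cohomology_alg_def cls_mult cls_add cls_smult)

end

text \<open>A correspondence of cocycles that is total on both sides and compatible with the
  operations induces the map; the equivalence \<open>exact\<close> gives its independence of choices
  and its injectivity at once.\<close>

lemma cohomology_iso:
  fixes M :: "('r, 'c) module" and N :: "('r, 'e) module"
  assumes "cohomology_data M d" "cohomology_data N d'"
    and dom: "\<And>z c. Rel z c ==> z \<in> cocycles M d \<and> c \<in> cocycles N d'"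
    and total: "\<And>z. z \<in> cocycles M d ==> \<exists>c. Rel z c" and surj: "\<And>c. c \<in> cocycles N d' ==> \<exists>z. Rel z c"
    and grade: "\<And>t z. z \<in> cocycles M d \<inter> G t ==> \<exists>c\<in>H t. Rel z c" "\<And>t c. c \<in> cocycles N d' \<inter> H t ==> \<exists>z\<in>G t. Rel z c"
    and exact: "\<And>z c w e. Rel z c ==> Rel w e ==>
      (\<exists>b\<in>coboundaries M d. z = b \<oplus>\<^bsub>M\<^esub> w) \<longleftrightarrow> (\<exists>b\<in>coboundaries N d'. c = b \<oplus>\<^bsub>N\<^esub> e)"
    and add: "\<And>z c w e. Rel z c ==> Rel w e ==> Rel (z \<oplus>\<^bsub>M\<^esub> w) (c \<oplus>\<^bsub>N\<^esub> e)"
    and mult: "\<And>z c w e. Rel z c ==> Rel w e ==> Rel (z \<otimes>\<^bsub>M\<^esub> w) (c \<otimes>\<^bsub>N\<^esub> e)"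
    and one: "Rel \<one>\<^bsub>M\<^esub> \<one>\<^bsub>N\<^esub>"
    and smult: "\<And>r z c. Rel z c ==> Rel (r \<odot>\<^bsub>M\<^esub> z) (r \<odot>\<^bsub>N\<^esub> c)"
  shows "\<exists>\<Psi>. \<Psi> \<in> graded_alg_iso (cohomology_alg M d) (cohomology_part M d G)
      (cohomology_alg N d') (cohomology_part N d' H)"
proof -
  interpret M: cohomology_data M d by fact
  interpret N: cohomology_data N d' by fact
  have cls: "M.cls z = M.cls w \<longleftrightarrow> N.cls c = N.cls e" if "Rel z c" "Rel w e" for z c w e
    using exact[OF that] M.cls_eq[of z w] N.cls_eq[of c e] dom[OF that(1)] dom[OF that(2)] M.Z_closed N.Z_closed by simp
  \<comment> \<open>Any related cocycle may be chosen, since all have the same class by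
    \<open>cls\<close>.\<close>
  define \<Psi> where "\<Psi> Z = N.cls (SOME c. \<exists>z. Rel z c \<and> Z = M.cls z)" for Z
  have \<Psi>: "\<Psi> (M.cls z) = N.cls c" if r: "Rel z c" for z c
  proof -
    have "\<exists>c z'. Rel z' c \<and> M.cls z = M.cls z'" using r by blast
    from someI_ex[OF this] obtain z' where
      "Rel z' (SOME c. \<exists>z'. Rel z' c \<and> M.cls z = M.cls z')" "M.cls z = M.cls z'" by blast
    with cls[OF r this(1)] show ?thesis by (simp add: \<Psi>_def)
  qed
  have hom: "\<Psi> \<in> ring_hom (cohomology_alg M d) (cohomology_alg N d')"
  proof (rule ring_hom_memI)
    show "\<Psi> x \<in> carrier (cohomology_alg N d')" if "x \<in> carrier (cohomology_alg M d)" for x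
    proof -
      from that obtain z where z: "z \<in> M.Z" "x = M.cls z" unfolding M.alg_simps by blast
      from total[OF z(1)] obtain c where c: "Rel z c" by blast
      hence "c \<in> N.Z" using dom by blast
      thus ?thesis unfolding z(2) \<Psi>[OF c] N.alg_simps by (rule imageI)
    qed
  next
    fix x y assume "x \<in> carrier (cohomology_alg M d)" "y \<in> carrier (cohomology_alg M d)"
    then obtain z w where zw: "z \<in> M.Z" "w \<in> M.Z" "x = M.cls z" "y = M.cls w" unfolding M.alg_simps by blast
    from total[OF zw(1)] total[OF zw(2)] obtain c e where ce: "Rel z c" "Rel w e" by blast
    hence ce': "c \<in> N.Z" "e \<in> N.Z" using dom by blast+
    show "\<Psi> (x \<otimes>\<^bsub>cohomology_alg M d\<^esub> y) = \<Psi> x \<otimes>\<^bsub>cohomology_alg N d'\<^esub> \<Psi> y"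
      "\<Psi> (x \<oplus>\<^bsub>cohomology_alg M d\<^esub> y) = \<Psi> x \<oplus>\<^bsub>cohomology_alg N d'\<^esub> \<Psi> y"
      unfolding zw(3,4) M.alg_simps(3,4)[OF zw(1,2)] \<Psi>[OF ce(1)] \<Psi>[OF ce(2)] N.alg_simps(3,4)[OF ce']
      by (rule \<Psi>[OF mult[OF ce]], rule \<Psi>[OF add[OF ce]])
  next
    show "\<Psi> \<one>\<^bsub>cohomology_alg M d\<^esub> = \<one>\<^bsub>cohomology_alg N d'\<^esub>"
      unfolding M.alg_simps N.alg_simps by (rule \<Psi>[OF one])
  qed
  have "bij_betw \<Psi> (carrier (cohomology_alg M d)) (carrier (cohomology_alg N d'))"
    unfolding bij_betw_def M.alg_simps N.alg_simps
  proof
    show "inj_on \<Psi> (M.cls ` M.Z)"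
    proof (rule inj_onI)
      fix x y assume "x \<in> M.cls ` M.Z" "y \<in> M.cls ` M.Z" "\<Psi> x = \<Psi> y"
      then obtain z w where zw: "z \<in> M.Z" "w \<in> M.Z" "x = M.cls z" "y = M.cls w" by blast
      from total[OF zw(1)] total[OF zw(2)] obtain c e where ce: "Rel z c" "Rel w e" by blast
      from \<open>\<Psi> x = \<Psi> y\<close> show "x = y" unfolding zw \<Psi>[OF ce(1)] \<Psi>[OF ce(2)] cls[OF ce] .
    qed
    show "\<Psi> ` M.cls ` M.Z = N.cls ` N.Z"
    proof (intro equalityI subsetI)
      fix y assume "y \<in> \<Psi> ` M.cls ` M.Z"
      then obtain z where "z \<in> M.Z" "y = \<Psi> (M.cls z)" by blast
      with total[of z] \<Psi> dom show "y \<in> N.cls ` N.Z" by (metis image_eqI)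
    next
      fix y assume "y \<in> N.cls ` N.Z"
      then obtain c where "c \<in> N.Z" "y = N.cls c" by blast
      with surj[of c] \<Psi> dom show "y \<in> \<Psi> ` M.cls ` M.Z" by (metis image_eqI)
    qed
  qed
  hence iso: "\<Psi> \<in> ring_iso (cohomology_alg M d) (cohomology_alg N d')" using hom by (simp add: ring_iso_def)
  have sm: "\<Psi> (r \<odot>\<^bsub>cohomology_alg M d\<^esub> x) = r \<odot>\<^bsub>cohomology_alg N d'\<^esub> \<Psi> x"
    if x: "x \<in> carrier (cohomology_alg M d)" for r x
  proof -
    from x obtain z where z: "z \<in> M.Z" "x = M.cls z" unfolding M.alg_simps by blast
    from total[OF z(1)] obtain c where c: "Rel z c" by blast
    hence "c \<in> N.Z" using dom by blast
    thus ?thesis unfolding z(2) M.alg_simps(5)[OF z(1)] \<Psi>[OF c] \<Psi>[OF smult[OF c]] by (simp add: N.alg_simps)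
  qed
  have gr: "\<Psi> ` cohomology_part M d G t = cohomology_part N d' H t" for t
    unfolding cohomology_part_def
  proof (intro equalityI subsetI)
    fix y assume "y \<in> \<Psi> ` M.cls ` (M.Z \<inter> G t)"
    then obtain z where "z \<in> M.Z \<inter> G t" "y = \<Psi> (M.cls z)" by blast
    with grade(1)[of z t] \<Psi> dom show "y \<in> N.cls ` (N.Z \<inter> H t)" by (metis IntI image_eqI)
  next
    fix y assume "y \<in> N.cls ` (N.Z \<inter> H t)"
    then obtain c where "c \<in> N.Z \<inter> H t" "y = N.cls c" by blast
    with grade(2)[of c t] \<Psi> dom show "y \<in> \<Psi> ` M.cls ` (M.Z \<inter> G t)" by (metis IntI image_eqI)
  qed
  show ?thesis unfolding graded_alg_iso_def using iso sm gr by blast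
qed

section \<open>The Hochschild and Clifford complexes as cohomology data\<close>

context superfiltered_deformation
begin

abbreviation "HA \<equiv> hochschild_alg scale X \<mu> unit"
abbreviation "dT \<equiv> hochschild_total_diff X \<mu>"
abbreviation "CA \<equiv> Hess_clifford_alg n pot"
abbreviation "dCl \<equiv> Hess_clifford_diff n pot"

lemma HA_simps: "carrier HA = CC 0 \<times> CC 1" "\<zero>\<^bsub>HA\<^esub> = (\<lambda>as. 0, \<lambda>as. 0)"
  "\<one>\<^bsub>HA\<^esub> = (\<lambda>as. if as = [] then unit else 0, \<lambda>as. 0)"
  "(\<phi>0, \<phi>1) \<oplus>\<^bsub>HA\<^esub> (\<psi>0, \<psi>1) = (\<lambda>as. \<phi>0 as + \<psi>0 as, \<lambda>as. \<phi>1 as + \<psi>1 as)"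
  "(\<phi>0, \<phi>1) \<otimes>\<^bsub>HA\<^esub> (\<psi>0, \<psi>1) = (\<lambda>as. HP 0 0 \<phi>0 \<psi>0 as + HP 1 1 \<phi>1 \<psi>1 as, \<lambda>as. HP 0 1 \<phi>0 \<psi>1 as + HP 1 0 \<phi>1 \<psi>0 as)"
  "c \<odot>\<^bsub>HA\<^esub> (\<phi>0, \<phi>1) = (\<lambda>as. c *s \<phi>0 as, \<lambda>as. c *s \<phi>1 as)"
  "dT (\<phi>0, \<phi>1) = (dH 1 \<phi>1, dH 0 \<phi>0)"
  by (simp_all add: hochschild_alg_def hochschild_total_diff_def)

lemma dH_CC_01: "\<phi> \<in> CC 0 ==> dH 0 \<phi> \<in> CC 1" "\<phi> \<in> CC 1 ==> dH 1 \<phi> \<in> CC 0"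
  using dH_CC[of \<phi> 0] dH_CC[of \<phi> 1] CC_cong[of 2 0] by simp_all

lemma HA_cocycles: "(\<phi>0, \<phi>1) \<in> cocycles HA dT \<longleftrightarrow>
    \<phi>0 \<in> CC 0 \<and> dH 0 \<phi>0 = (\<lambda>as. 0) \<and> \<phi>1 \<in> CC 1 \<and> dH 1 \<phi>1 = (\<lambda>as. 0)"
  by (auto simp: cocycles_def HA_simps)

lemma HA_coboundaries: "(\<phi>0, \<phi>1) \<in> coboundaries HA dT \<longleftrightarrow>
    (\<exists>\<chi>0\<in>CC 0. \<exists>\<chi>1\<in>CC 1. \<phi>0 = dH 1 \<chi>1 \<and> \<phi>1 = dH 0 \<chi>0)"
  by (force simp: coboundaries_def HA_simps)

lemma HP_class:
  assumes \<phi>: "\<phi> \<in> CC s" "dH s \<phi> = (\<lambda>as. 0)" and \<psi>: "\<psi> \<in> CC t" "dH t \<psi> = (\<lambda>as. 0)"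
    and \<chi>: "\<chi> \<in> CC (s - 1)" and \<omega>: "\<omega> \<in> CC (t - 1)"
  shows "\<exists>\<xi>\<in>CC (s + t - 1). \<forall>as. HP s t (\<lambda>as. dH (s - 1) \<chi> as + \<phi> as) (\<lambda>as. dH (t - 1) \<omega> as + \<psi> as) as
      = dH (s + t - 1) \<xi> as + HP s t \<phi> \<psi> as"
proof -
  let ?w = "\<lambda>as. dH (t - 1) \<omega> as + \<psi> as"
  have "dH (t - 1) \<omega> \<in> CC t" using dH_CC[OF \<omega>] by simp
  hence w: "?w \<in> CC t" by (rule CC_add[OF _ \<psi>(1)])
  have dw: "dH t ?w = (\<lambda>as. 0)" by (rule ext) (simp add: dH_add dH_dH'[OF \<omega>] \<psi>(2))
  obtain \<xi>1 where \<xi>1: "\<xi>1 \<in> CC (s + t - 1)" "HP s t (dH (s - 1) \<chi>) ?w = dH (s + t - 1) \<xi>1"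
    using HP_exact_left[OF \<chi> w dw] by blast
  obtain \<xi>2 where \<xi>2: "\<xi>2 \<in> CC (s + t - 1)" "HP s t \<phi> (dH (t - 1) \<omega>) = dH (s + t - 1) \<xi>2"
    using HP_exact_right[OF \<phi> \<omega>] by blast
  have "HP s t (\<lambda>as. dH (s - 1) \<chi> as + \<phi> as) ?w as = dH (s + t - 1) (\<lambda>as. \<xi>1 as + \<xi>2 as) as + HP s t \<phi> \<psi> as" for as
  proof -
    have "HP s t (\<lambda>as. dH (s - 1) \<chi> as + \<phi> as) ?w as = HP s t (dH (s - 1) \<chi>) ?w as + HP s t \<phi> ?w as"
      by (rule HP_add_left)
    also have "HP s t \<phi> ?w as = HP s t \<phi> (dH (t - 1) \<omega>) as + HP s t \<phi> \<psi> as" by (rule HP_add_right)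
    finally show ?thesis by (simp only: \<xi>1(2) \<xi>2(2) dH_add add.assoc)
  qed
  thus ?thesis using CC_add[OF \<xi>1(1) \<xi>2(1)] by blast
qed

lemma CC_m1: "CC (- 1) = CC 1" "CC 2 = CC 0" and dH_m1: "dH (- 1) = dH 1" "dH 2 = dH 0"
  by (rule CC_cong, simp)+ (rule dH_cong, simp)+

lemma HA_data: "cohomology_data HA dT"
proof (rule cohomology_data.intro)
  show "abelian_group HA"
  proof (rule abelian_groupI)
    fix x assume "x \<in> carrier HA"
    then obtain \<phi>0 \<phi>1 where x: "x = (\<phi>0, \<phi>1)" "\<phi>0 \<in> CC 0" "\<phi>1 \<in> CC 1" by (auto simp: HA_simps)
    have "(\<lambda>as. (-1) *s \<phi>0 as, \<lambda>as. (-1) *s \<phi>1 as) \<in> carrier HA"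
      "(\<lambda>as. (-1) *s \<phi>0 as, \<lambda>as. (-1) *s \<phi>1 as) \<oplus>\<^bsub>HA\<^esub> x = \<zero>\<^bsub>HA\<^esub>"
      using CC_scale[OF x(2), of "-1"] CC_scale[OF x(3), of "-1"] by (simp_all add: x HA_simps)
    thus "\<exists>y\<in>carrier HA. y \<oplus>\<^bsub>HA\<^esub> x = \<zero>\<^bsub>HA\<^esub>" by blast
  qed (auto simp: HA_simps CC_add CC_zero add_ac)
next
  show "dT x \<in> carrier HA" if "x \<in> carrier HA" for x
    using that dH_CC_01 by (auto simp: HA_simps)
  show "dT (x \<oplus>\<^bsub>HA\<^esub> y) = dT x \<oplus>\<^bsub>HA\<^esub> dT y" if "x \<in> carrier HA" "y \<in> carrier HA" for x y
    using that by (auto simp: HA_simps dH_add fun_eq_iff)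
  show "\<one>\<^bsub>HA\<^esub> \<in> cocycles HA dT"
    using rel_one dH_0 by (auto simp: HA_simps HA_cocycles CC_zero rel_def)
next
  fix z w assume zw: "z \<in> cocycles HA dT" "w \<in> cocycles HA dT"
  obtain \<phi>0 \<phi>1 \<psi>0 \<psi>1 where e: "z = (\<phi>0, \<phi>1)" "w = (\<psi>0, \<psi>1)" by (cases z; cases w) auto
  have a: "\<phi>0 \<in> CC 0" "dH 0 \<phi>0 = (\<lambda>as. 0)" "\<phi>1 \<in> CC 1" "dH 1 \<phi>1 = (\<lambda>as. 0)"
    "\<psi>0 \<in> CC 0" "dH 0 \<psi>0 = (\<lambda>as. 0)" "\<psi>1 \<in> CC 1" "dH 1 \<psi>1 = (\<lambda>as. 0)"
    using zw unfolding e HA_cocycles by blast+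
  show "z \<otimes>\<^bsub>HA\<^esub> w \<in> cocycles HA dT"
    using HP_CC[OF a(1,5)] HP_CC[OF a(3,7)] HP_CC[OF a(1,7)] HP_CC[OF a(3,5)]
      HP_cocycle[OF a(1,2,5,6)] HP_cocycle[OF a(3,4,7,8)] HP_cocycle[OF a(1,2,7,8)] HP_cocycle[OF a(3,4,5,6)]
    by (simp add: e HA_simps HA_cocycles CC_add fun_eq_iff dH_add CC_m1 dH_m1)
  fix b b' assume b: "b \<in> coboundaries HA dT" "b' \<in> coboundaries HA dT"
  obtain b0 b1 b0' b1' where be: "b = (b0, b1)" "b' = (b0', b1')" by (cases b; cases b') auto
  from b obtain \<chi>0 \<chi>1 \<omega>0 \<omega>1 where c: "\<chi>0 \<in> CC 0" "\<chi>1 \<in> CC 1" "\<omega>0 \<in> CC 0" "\<omega>1 \<in> CC 1"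
    "b0 = dH 1 \<chi>1" "b1 = dH 0 \<chi>0" "b0' = dH 1 \<omega>1" "b1' = dH 0 \<omega>0" unfolding be HA_coboundaries by blast
  obtain \<xi>00 where 00: "\<xi>00 \<in> CC 1" "\<And>as. HP 0 0 (\<lambda>as. dH 1 \<chi>1 as + \<phi>0 as) (\<lambda>as. dH 1 \<omega>1 as + \<psi>0 as) as = dH 1 \<xi>00 as + HP 0 0 \<phi>0 \<psi>0 as"
    using HP_class[OF a(1,2,5,6), of \<chi>1 \<omega>1] c by (auto simp: CC_m1 dH_m1)
  obtain \<xi>11 where 11: "\<xi>11 \<in> CC 1" "\<And>as. HP 1 1 (\<lambda>as. dH 0 \<chi>0 as + \<phi>1 as) (\<lambda>as. dH 0 \<omega>0 as + \<psi>1 as) as = dH 1 \<xi>11 as + HP 1 1 \<phi>1 \<psi>1 as"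
    using HP_class[OF a(3,4,7,8), of \<chi>0 \<omega>0] c by auto
  obtain \<xi>01 where 01: "\<xi>01 \<in> CC 0" "\<And>as. HP 0 1 (\<lambda>as. dH 1 \<chi>1 as + \<phi>0 as) (\<lambda>as. dH 0 \<omega>0 as + \<psi>1 as) as = dH 0 \<xi>01 as + HP 0 1 \<phi>0 \<psi>1 as"
    using HP_class[OF a(1,2,7,8), of \<chi>1 \<omega>0] c by (auto simp: CC_m1 dH_m1)
  obtain \<xi>10 where 10: "\<xi>10 \<in> CC 0" "\<And>as. HP 1 0 (\<lambda>as. dH 0 \<chi>0 as + \<phi>1 as) (\<lambda>as. dH 1 \<omega>1 as + \<psi>0 as) as = dH 0 \<xi>10 as + HP 1 0 \<phi>1 \<psi>0 as"
    using HP_class[OF a(3,4,5,6), of \<chi>0 \<omega>1] c by (auto simp: CC_m1 dH_m1)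
  let ?b = "(dH 1 (\<lambda>as. \<xi>00 as + \<xi>11 as), dH 0 (\<lambda>as. \<xi>01 as + \<xi>10 as))"
  have "?b \<in> coboundaries HA dT" unfolding HA_coboundaries using CC_add 00(1) 11(1) 01(1) 10(1) by blast
  moreover have "(b \<oplus>\<^bsub>HA\<^esub> z) \<otimes>\<^bsub>HA\<^esub> (b' \<oplus>\<^bsub>HA\<^esub> w) = ?b \<oplus>\<^bsub>HA\<^esub> (z \<otimes>\<^bsub>HA\<^esub> w)"
    by (simp add: e be c HA_simps 00(2) 11(2) 01(2) 10(2) dH_add) (simp add: add_ac)
  ultimately show "\<exists>b''\<in>coboundaries HA dT. (b \<oplus>\<^bsub>HA\<^esub> z) \<otimes>\<^bsub>HA\<^esub> (b' \<oplus>\<^bsub>HA\<^esub> w) = b'' \<oplus>\<^bsub>HA\<^esub> (z \<otimes>\<^bsub>HA\<^esub> w)" by blast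
next
  fix r z assume z: "z \<in> cocycles HA dT"
  obtain \<phi>0 \<phi>1 where e: "z = (\<phi>0, \<phi>1)" by (cases z)
  show "r \<odot>\<^bsub>HA\<^esub> z \<in> cocycles HA dT"
    using z by (auto simp: e HA_simps HA_cocycles CC_scale fun_eq_iff dH_scale)
  fix b assume b: "b \<in> coboundaries HA dT"
  obtain b0 b1 where be: "b = (b0, b1)" by (cases b)
  from b obtain \<chi>0 \<chi>1 where c: "\<chi>0 \<in> CC 0" "\<chi>1 \<in> CC 1" "b0 = dH 1 \<chi>1" "b1 = dH 0 \<chi>0" unfolding be HA_coboundaries by blast
  have "(dH 1 (\<lambda>as. r *s \<chi>1 as), dH 0 (\<lambda>as. r *s \<chi>0 as)) \<in> coboundaries HA dT"
    unfolding HA_coboundaries using CC_scale c(1,2) by blast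
  moreover have "r \<odot>\<^bsub>HA\<^esub> (b \<oplus>\<^bsub>HA\<^esub> z) = (dH 1 (\<lambda>as. r *s \<chi>1 as), dH 0 (\<lambda>as. r *s \<chi>0 as)) \<oplus>\<^bsub>HA\<^esub> (r \<odot>\<^bsub>HA\<^esub> z)"
    by (simp add: e be c HA_simps dH_scale scale_right_distrib)
  ultimately show "\<exists>b'\<in>coboundaries HA dT. r \<odot>\<^bsub>HA\<^esub> (b \<oplus>\<^bsub>HA\<^esub> z) = b' \<oplus>\<^bsub>HA\<^esub> (r \<odot>\<^bsub>HA\<^esub> z)" by blast
qed

lemma CA_simps: "carrier CA = act.J ` act.FK" "\<zero>\<^bsub>CA\<^esub> = act.J (\<lambda>_. 0)" "\<one>\<^bsub>CA\<^esub> = act.J (basis_fun {})"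
  "f \<in> act.FK ==> g \<in> act.FK ==> act.J f \<oplus>\<^bsub>CA\<^esub> act.J g = act.J (\<lambda>S. f S + g S)"
  "f \<in> act.FK ==> g \<in> act.FK ==> act.J f \<otimes>\<^bsub>CA\<^esub> act.J g = act.J (act.star f g)"
  "f \<in> act.FK ==> c \<odot>\<^bsub>CA\<^esub> act.J f = act.J (\<lambda>S. mfps_const c * f S)"
  "f \<in> act.FK ==> dCl (act.J f) = act.J (act.dC f)"
  "Hess_clifford_part n pot t = act.J ` {f \<in> act.FK. act.par t f}"
  by (simp_all add: Hess_clifford_alg_def clifford_alg_def Let_def act.J_carrier act.J_zero act.J_one act.J_add act.J_star
      act.J_scalar[OF mfps_const_vars] Hess_clifford_diff_def act.contraction_J[OF act.gg_K] Hess_clifford_part_def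
      act.clifford_part_J)

lemma CA_cocycles: "f \<in> act.FK ==> act.J f \<in> cocycles CA dCl \<longleftrightarrow> act.dC f = (\<lambda>_. 0)"
proof -
  assume f: "f \<in> act.FK"
  have "act.J (act.dC f) = act.J (\<lambda>_. 0) \<longleftrightarrow> act.dC f = (\<lambda>_. 0)"
    using act.J_inj[OF dC_FK[OF f] zero_FK] by metis
  thus ?thesis using f by (simp add: cocycles_def CA_simps)
qed

lemma CA_cocyclesE:
  assumes "c \<in> cocycles CA dCl"
  obtains f where "c = act.J f" "f \<in> act.FK" "act.dC f = (\<lambda>_. 0)"
proof -
  from assms obtain f where f: "c = act.J f" "f \<in> act.FK" by (auto simp: cocycles_def CA_simps)
  with assms CA_cocycles[OF f(2)] show ?thesis by (intro that) simp_all
qed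

lemma CA_coboundaries: "coboundaries CA dCl = (\<lambda>g. act.J (act.dC g)) ` act.FK"
  unfolding coboundaries_def CA_simps(1) image_image by (rule image_cong) (simp_all add: CA_simps)

lemma contr_pt: "f \<in> act.FK ==> act.dC f = (\<lambda>_. 0) ==> act.dC (pt t f) = (\<lambda>_. 0)"
proof -
  assume f: "f \<in> act.FK" "act.dC f = (\<lambda>_. 0)"
  have "act.dC (pt t f) S + act.dC (pt (t + 1) f) S = 0" for S
    using contr_add[of n _ "pt t f" "pt (t + 1) f" S] pt(3)[of f t] f(2) by (metis (no_types, lifting))
  thus ?thesis
    by (rule par_sum_zero[OF act.par_contr[OF pt(2)[OF f(1)] pt(1)] act.par_contr[OF pt(2)[OF f(1)] pt(1)]])
qed

lemma FK_uminus: "f \<in> act.FK ==> (\<lambda>S. - f S) \<in> act.FK"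
  using act.FK_times[of "-1" f] act.K_uminus[OF act.K_one] by simp

lemma contr_plus: "act.dC (\<lambda>S. f S + g S) = (\<lambda>S. act.dC f S + act.dC g S)"
  by (rule ext) (rule contr_add)

lemma contr_uminus: "act.dC (\<lambda>S. - f S) = (\<lambda>S. - act.dC f S)"
  using contr_scale[of n _ "-1" f] by (simp add: fun_eq_iff)

text \<open>The derivation rule, applied to the two parity components of \<open>g\<close>; its signs
  stand only at the terms with the contraction of \<open>h\<close>, which vanish.\<close>

lemma star_dC_left:
  assumes g: "g \<in> act.FK" and h: "h \<in> act.FK" "act.dC h = (\<lambda>_. 0)"
  shows "act.star (act.dC g) h = act.dC (act.star g h)"
proof -
  have z: "act.star g (\<lambda>_. 0) S = 0" for g S using act.star_times_right[of g 0 "\<lambda>_. 0" S] by simp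
  have p: "act.star (act.dC (pt t g)) h S = act.dC (act.star (pt t g) h) S" for t S
    using act.contr_star[where f = "pt t g" and t = t and g = "\<lambda>i. - mfps_deriv i pot" and h = h, OF pt(2)[OF g] pt(1)] act.gg_K
    by (simp add: h(2) z)
  have g01: "g = (\<lambda>S. pt 0 g S + pt 1 g S)" using pt(3)[of g 0] by simp
  have "act.star (act.dC g) h = act.star (act.dC (\<lambda>S. pt 0 g S + pt 1 g S)) h" using g01 by simp
  also have "\<dots> = (\<lambda>S. act.dC (act.star (pt 0 g) h) S + act.dC (act.star (pt 1 g) h) S)"
    unfolding contr_plus by (rule ext) (simp only: act.star_add_left p)
  also have "\<dots> = act.dC (act.star (\<lambda>S. pt 0 g S + pt 1 g S) h)"
    unfolding contr_plus[symmetric] act.star_add_left[abs_def] ..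
  finally show ?thesis using g01 by simp
qed

text \<open>Here the sign of the derivation rule depends on the parity of the first factor, so the
  primitive takes its odd component with a minus sign.\<close>

lemma star_dC_right:
  assumes f: "f \<in> act.FK" "act.dC f = (\<lambda>_. 0)" and g: "g \<in> act.FK"
  shows "\<exists>\<xi>\<in>act.FK. act.star f (act.dC g) = act.dC \<xi>"
proof -
  have p: "act.dC (act.star (pt t f) g) S = (if even t then 1 else - 1) * act.star (pt t f) (act.dC g) S" for t S
    using act.contr_star[where f = "pt t f" and t = t and g = "\<lambda>i. - mfps_deriv i pot" and h = g, OF pt(2)[OF f(1)] pt(1)] act.gg_K
    by (simp add: contr_pt[OF f] act.star_zero_left)
  have f01: "f = (\<lambda>S. pt 0 f S + pt 1 f S)" using pt(3)[of f 0] by simp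
  let ?\<xi> = "\<lambda>S. act.star (pt 0 f) g S + - act.star (pt 1 f) g S"
  have "act.star f (act.dC g) = act.star (\<lambda>S. pt 0 f S + pt 1 f S) (act.dC g)" using f01 by simp
  also have "\<dots> = act.dC ?\<xi>"
    unfolding contr_plus contr_uminus by (rule ext) (simp add: act.star_add_left p)
  finally have "act.star f (act.dC g) = act.dC ?\<xi>" .
  moreover have "?\<xi> \<in> act.FK" by (intro act.FK_add FK_uminus act.star_FK pt(2) f g)
  ultimately show ?thesis by blast
qed

lemma star_cocycle': 
  assumes f: "f \<in> act.FK" "act.dC f = (\<lambda>_. 0)" and g: "g \<in> act.FK" "act.dC g = (\<lambda>_. 0)"
  shows "act.dC (act.star f g) = (\<lambda>_. 0)"
  using star_dC_left[OF f(1) g] by (simp add: f(2) fun_eq_iff act.star_zero_left)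

lemma contr_contr: "contr n g (contr n g f) S = 0"
  unfolding contr_def[abs_def] iota_sum iota_scale sum_distrib_left mult.assoc[symmetric] by (rule sum_iota_iota_self) simp

lemma CA_data: "cohomology_data CA dCl"
proof (rule cohomology_data.intro)
  show "abelian_group CA"
  proof (rule abelian_groupI)
    fix x assume "x \<in> carrier CA"
    then obtain f where f: "x = act.J f" "f \<in> act.FK" by (auto simp: CA_simps)
    have "act.J (\<lambda>S. - f S) \<in> carrier CA" "act.J (\<lambda>S. - f S) \<oplus>\<^bsub>CA\<^esub> x = \<zero>\<^bsub>CA\<^esub>"
      using FK_uminus[OF f(2)] f by (simp_all add: CA_simps)
    thus "\<exists>y\<in>carrier CA. y \<oplus>\<^bsub>CA\<^esub> x = \<zero>\<^bsub>CA\<^esub>" by blast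
  qed (auto simp: CA_simps act.FK_add zero_FK add_ac)
next
  show "dCl x \<in> carrier CA" if "x \<in> carrier CA" for x
    using that by (auto simp: CA_simps dC_FK)
  show "dCl (x \<oplus>\<^bsub>CA\<^esub> y) = dCl x \<oplus>\<^bsub>CA\<^esub> dCl y" if "x \<in> carrier CA" "y \<in> carrier CA" for x y
    using that by (auto simp: CA_simps dC_FK act.FK_add contr_plus)
  have "basis_fun {} \<in> act.FK" by (rule act.FK_basis) simp
  thus "\<one>\<^bsub>CA\<^esub> \<in> cocycles CA dCl" by (simp add: CA_simps(3) CA_cocycles act.contr_vac)
next
  fix z w assume zw: "z \<in> cocycles CA dCl" "w \<in> cocycles CA dCl"
  from zw(1) obtain f where f: "z = act.J f" "f \<in> act.FK" "act.dC f = (\<lambda>_. 0)" by (rule CA_cocyclesE)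
  from zw(2) obtain g where g: "w = act.J g" "g \<in> act.FK" "act.dC g = (\<lambda>_. 0)" by (rule CA_cocyclesE)
  show "z \<otimes>\<^bsub>CA\<^esub> w \<in> cocycles CA dCl"
    using f g by (simp add: CA_simps CA_cocycles act.star_FK star_cocycle')
  fix b b' assume "b \<in> coboundaries CA dCl" "b' \<in> coboundaries CA dCl"
  then obtain p q where b: "b = act.J (act.dC p)" "p \<in> act.FK" "b' = act.J (act.dC q)" "q \<in> act.FK"
    by (auto simp: CA_coboundaries)
  have dd: "act.dC (act.dC q) = (\<lambda>_. 0)" by (rule ext) (rule contr_contr)
  have h: "(\<lambda>S. act.dC q S + g S) \<in> act.FK" "act.dC (\<lambda>S. act.dC q S + g S) = (\<lambda>_. 0)"
    using b g dd by (simp_all add: act.FK_add dC_FK contr_plus)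
  obtain \<xi> where \<xi>: "\<xi> \<in> act.FK" "act.star f (act.dC q) = act.dC \<xi>" using star_dC_right[OF f(2,3) b(4)] by blast
  let ?p = "\<lambda>S. act.star p (\<lambda>S. act.dC q S + g S) S + \<xi> S"
  have "act.star (\<lambda>S. act.dC p S + f S) (\<lambda>S. act.dC q S + g S) = (\<lambda>S. act.dC ?p S + act.star f g S)"
  proof
    fix S
    have "act.star (\<lambda>S. act.dC p S + f S) (\<lambda>S. act.dC q S + g S) S =
        act.star (act.dC p) (\<lambda>S. act.dC q S + g S) S + (act.star f (act.dC q) S + act.star f g S)"
      by (simp only: act.star_add_left act.star_add_right[of f "act.dC q" g])
    thus "act.star (\<lambda>S. act.dC p S + f S) (\<lambda>S. act.dC q S + g S) S = act.dC ?p S + act.star f g S"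
      by (simp only: star_dC_left[OF b(2) h] \<xi>(2) contr_plus add.assoc)
  qed
  moreover have p: "?p \<in> act.FK" by (intro act.FK_add act.star_FK b(2) h(1) \<xi>(1))
  ultimately have "(b \<oplus>\<^bsub>CA\<^esub> z) \<otimes>\<^bsub>CA\<^esub> (b' \<oplus>\<^bsub>CA\<^esub> w) = act.J (act.dC ?p) \<oplus>\<^bsub>CA\<^esub> (z \<otimes>\<^bsub>CA\<^esub> w)"
    using f g b h by (simp add: CA_simps dC_FK act.FK_add act.star_FK)
  moreover have "act.J (act.dC ?p) \<in> coboundaries CA dCl" unfolding CA_coboundaries using p by (rule imageI)
  ultimately show "\<exists>b''\<in>coboundaries CA dCl. (b \<oplus>\<^bsub>CA\<^esub> z) \<otimes>\<^bsub>CA\<^esub> (b' \<oplus>\<^bsub>CA\<^esub> w) = b'' \<oplus>\<^bsub>CA\<^esub> (z \<otimes>\<^bsub>CA\<^esub> w)" by blast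
next
  fix r z assume z: "z \<in> cocycles CA dCl"
  then obtain f where f: "z = act.J f" "f \<in> act.FK" "act.dC f = (\<lambda>_. 0)" by (rule CA_cocyclesE)
  have sc: "act.dC (\<lambda>S. mfps_const r * h S) = (\<lambda>S. mfps_const r * act.dC h S)" for h by (rule ext) (rule contr_scale)
  have K: "(\<lambda>S. mfps_const r * h S) \<in> act.FK" if "h \<in> act.FK" for h by (intro act.FK_times mfps_const_vars that)
  show "r \<odot>\<^bsub>CA\<^esub> z \<in> cocycles CA dCl" using f K[OF f(2)] by (simp add: CA_simps CA_cocycles sc)
  fix b assume "b \<in> coboundaries CA dCl"
  then obtain p where b: "b = act.J (act.dC p)" "p \<in> act.FK" by (auto simp: CA_coboundaries)
  have "r \<odot>\<^bsub>CA\<^esub> (b \<oplus>\<^bsub>CA\<^esub> z) = act.J (act.dC (\<lambda>S. mfps_const r * p S)) \<oplus>\<^bsub>CA\<^esub> (r \<odot>\<^bsub>CA\<^esub> z)"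
    using f b K[OF dC_FK[OF b(2)]] K[OF f(2)] by (simp add: CA_simps dC_FK act.FK_add sc distrib_left)
  moreover have "act.J (act.dC (\<lambda>S. mfps_const r * p S)) \<in> coboundaries CA dCl"
    unfolding CA_coboundaries using K[OF b(2)] by (rule imageI)
  ultimately show "\<exists>b'\<in>coboundaries CA dCl. r \<odot>\<^bsub>CA\<^esub> (b \<oplus>\<^bsub>CA\<^esub> z) = b' \<oplus>\<^bsub>CA\<^esub> (r \<odot>\<^bsub>CA\<^esub> z)" by blast
qed

section \<open>The isomorphism\<close>

definition Rel :: "('a list => 'a) \<times> ('a list => 'a) => (nat free_mon \<Rightarrow>\<^sub>0 'r mfps) set => bool" where
  "Rel z c \<longleftrightarrow> (\<exists>f0 f1. rel 0 (fst z) f0 \<and> rel 1 (snd z) f1 \<and> c = act.J (\<lambda>S. f0 S + f1 S))"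

lemma rel_FK: "rel t \<phi> f ==> f \<in> act.FK \<and> act.dC f = (\<lambda>_. 0) \<and> act.par t f \<and> \<phi> \<in> CC t \<and> dH t \<phi> = (\<lambda>as. 0)"
  unfolding rel_def by blast

lemma mfps_const_1: "mfps_const 1 = 1" "mfps_const (-1) = -1"
  by (simp_all add: mfps_const_def one_mfps_def uminus_mfps_def if_distrib cong: if_cong)

lemma rel_add: "rel t \<phi> f ==> rel t \<psi> g ==> rel t (\<lambda>as. \<phi> as + \<psi> as) (\<lambda>S. f S + g S)"
  using rel_lin[of t \<phi> f \<psi> g 1] by (simp add: mfps_const_1)

lemma rel_diff: "rel t \<phi> f ==> rel t \<psi> g ==> rel t (\<lambda>as. \<phi> as - \<psi> as) (\<lambda>S. f S - g S)"
  using rel_lin[of t \<phi> f \<psi> g "-1"] by (simp add: mfps_const_1)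

lemma rel_smult: "rel t \<phi> f ==> rel t (\<lambda>as. c *s \<phi> as) (\<lambda>S. mfps_const c * f S)"
  using rel_lin[OF rel_zero, of t \<phi> f c] by simp

text \<open>By linearity of \<open>rel\<close> the differences of the cocycles are related, and
  exactness is compared in each parity.\<close>

lemma Rel_exact:
  assumes z: "rel 0 \<phi>0 f0" "rel 1 \<phi>1 f1" and w: "rel 0 \<psi>0 g0" "rel 1 \<psi>1 g1"
  shows "(\<exists>b\<in>coboundaries HA dT. (\<phi>0, \<phi>1) = b \<oplus>\<^bsub>HA\<^esub> (\<psi>0, \<psi>1)) \<longleftrightarrow>
    (\<exists>b\<in>coboundaries CA dCl. act.J (\<lambda>S. f0 S + f1 S) = b \<oplus>\<^bsub>CA\<^esub> act.J (\<lambda>S. g0 S + g1 S))"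
proof -
  note d0 = rel_diff[OF z(1) w(1)] and d1 = rel_diff[OF z(2) w(2)]
  have F: "(\<lambda>S. f0 S + f1 S) \<in> act.FK" and G: "(\<lambda>S. g0 S + g1 S) \<in> act.FK"
    using rel_FK[OF z(1)] rel_FK[OF z(2)] rel_FK[OF w(1)] rel_FK[OF w(2)] by (simp_all add: act.FK_add)
  show ?thesis
  proof
    assume "\<exists>b\<in>coboundaries HA dT. (\<phi>0, \<phi>1) = b \<oplus>\<^bsub>HA\<^esub> (\<psi>0, \<psi>1)"
    then obtain \<chi>0 \<chi>1 where c: "\<chi>0 \<in> CC 0" "\<chi>1 \<in> CC 1" "\<phi>0 = (\<lambda>as. dH 1 \<chi>1 as + \<psi>0 as)" "\<phi>1 = (\<lambda>as. dH 0 \<chi>0 as + \<psi>1 as)"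
      by (auto simp: HA_coboundaries HA_simps)
    have "\<chi>1 \<in> CC (0 - 1)" "(\<lambda>as. \<phi>0 as - \<psi>0 as) = dH (0 - 1) \<chi>1" using c by (simp_all add: CC_m1 dH_m1)
    from rel_exactD[OF d0 this] obtain p where p: "p \<in> act.FK" "(\<lambda>S. f0 S - g0 S) = act.dC p" by blast
    have "\<chi>0 \<in> CC (1 - 1)" "(\<lambda>as. \<phi>1 as - \<psi>1 as) = dH (1 - 1) \<chi>0" using c by simp_all
    from rel_exactD[OF d1 this] obtain q where q: "q \<in> act.FK" "(\<lambda>S. f1 S - g1 S) = act.dC q" by blast
    let ?p = "\<lambda>S. p S + q S"
    have "(\<lambda>S. f0 S + f1 S) = (\<lambda>S. act.dC ?p S + (g0 S + g1 S))"
      unfolding contr_plus p(2)[symmetric] q(2)[symmetric] by (rule ext) simp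
    moreover have P: "?p \<in> act.FK" by (rule act.FK_add[OF p(1) q(1)])
    ultimately have "act.J (\<lambda>S. f0 S + f1 S) = act.J (act.dC ?p) \<oplus>\<^bsub>CA\<^esub> act.J (\<lambda>S. g0 S + g1 S)"
      using CA_simps(4)[OF dC_FK[OF P] G] by simp
    moreover have "act.J (act.dC ?p) \<in> coboundaries CA dCl" unfolding CA_coboundaries using P by (rule imageI)
    ultimately show "\<exists>b\<in>coboundaries CA dCl. act.J (\<lambda>S. f0 S + f1 S) = b \<oplus>\<^bsub>CA\<^esub> act.J (\<lambda>S. g0 S + g1 S)" by blast
  next
    assume "\<exists>b\<in>coboundaries CA dCl. act.J (\<lambda>S. f0 S + f1 S) = b \<oplus>\<^bsub>CA\<^esub> act.J (\<lambda>S. g0 S + g1 S)"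
    then obtain p where p: "p \<in> act.FK" "act.J (\<lambda>S. f0 S + f1 S) = act.J (act.dC p) \<oplus>\<^bsub>CA\<^esub> act.J (\<lambda>S. g0 S + g1 S)"
      unfolding CA_coboundaries by blast
    hence "act.J (\<lambda>S. f0 S + f1 S) = act.J (\<lambda>S. act.dC p S + (g0 S + g1 S))"
      using CA_simps(4)[OF dC_FK[OF p(1)] G] by simp
    from act.J_inj[OF F act.FK_add[OF dC_FK[OF p(1)] G] this]
    have e: "f0 S + f1 S = act.dC p S + (g0 S + g1 S)" for S by (simp add: fun_eq_iff)
    \<comment> \<open>The contraction shifts parity: the odd component of the primitive serves the
      even cocycle, and conversely.\<close>
    let ?p0 = "pt (-1) p" and ?p1 = "pt 0 p"
    have ps: "act.dC p S = act.dC ?p0 S + act.dC ?p1 S" for S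
      using contr_add[of n _ ?p0 ?p1 S] pt(3)[of p "-1"] by simp
    have pd: "act.par t (\<lambda>S. h S - k S)" if "act.par t h" "act.par t k" for t h k
      unfolding act.par_def
    proof (intro allI impI)
      fix S assume "h S - k S \<noteq> 0"
      hence "h S \<noteq> 0 \<or> k S \<noteq> 0" by auto
      thus "even (int (card S) - t)" using that unfolding act.par_def by blast
    qed
    have q0: "act.par 0 (act.dC ?p0)" using act.par_contr[OF pt(2)[OF p(1)] pt(1), of "-1"] by simp
    have q1: "act.par 1 (act.dC ?p1)" using act.par_contr[OF pt(2)[OF p(1)] pt(1), of 0] by simp
    have r0: "act.par 0 (\<lambda>S. (f0 S - g0 S) - act.dC ?p0 S)" using rel_FK[OF d0] by (intro pd[OF _ q0]) blast
    have r1: "act.par (0 + 1) (\<lambda>S. (f1 S - g1 S) - act.dC ?p1 S)" unfolding add_0 using rel_FK[OF d1] by (intro pd[OF _ q1]) blast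
    have s: "((f0 S - g0 S) - act.dC ?p0 S) + ((f1 S - g1 S) - act.dC ?p1 S) = 0" for S
      using e[of S] ps[of S] by (simp add: algebra_simps)
    have z0: "(\<lambda>S. (f0 S - g0 S) - act.dC ?p0 S) = (\<lambda>_. 0)" by (rule par_sum_zero[OF r0 r1 s])
    hence e0: "(\<lambda>S. f0 S - g0 S) = act.dC ?p0" by (simp add: fun_eq_iff)
    have e1: "(\<lambda>S. f1 S - g1 S) = act.dC ?p1" using s z0 by (simp add: fun_eq_iff)
    from rel_exactI[OF d0 pt(2)[OF p(1)] e0] obtain \<chi>1 where c1: "\<chi>1 \<in> CC 1" "(\<lambda>as. \<phi>0 as - \<psi>0 as) = dH 1 \<chi>1"
      by (auto simp: CC_m1 dH_m1)
    from rel_exactI[OF d1 pt(2)[OF p(1)] e1] obtain \<chi>0 where c0: "\<chi>0 \<in> CC 0" "(\<lambda>as. \<phi>1 as - \<psi>1 as) = dH 0 \<chi>0" by auto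
    have "(\<phi>0, \<phi>1) = (dH 1 \<chi>1, dH 0 \<chi>0) \<oplus>\<^bsub>HA\<^esub> (\<psi>0, \<psi>1)"
      by (simp add: HA_simps c0(2)[symmetric] c1(2)[symmetric])
    moreover have "(dH 1 \<chi>1, dH 0 \<chi>0) \<in> coboundaries HA dT" unfolding HA_coboundaries using c0(1) c1(1) by blast
    ultimately show "\<exists>b\<in>coboundaries HA dT. (\<phi>0, \<phi>1) = b \<oplus>\<^bsub>HA\<^esub> (\<psi>0, \<psi>1)" by blast
  qed
qed

text \<open>The map on classes is evaluation of a reduced representative at the bounding cochain,
  followed by the inverse of \<Phi>.\<close>

theorem HH_iso:
  "\<exists>\<Psi>. \<Psi> \<in> graded_alg_iso (HH_alg scale X \<mu> unit) (HH_part scale X \<mu> unit)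
    (cohomology_alg CA dCl) (cohomology_part CA dCl (Hess_clifford_part n pot))"
  unfolding HH_alg_def HH_part_def
proof (rule cohomology_iso[where Rel = Rel])
  show "cohomology_data HA dT" by (rule HA_data)
  show "cohomology_data CA dCl" by (rule CA_data)
next
  fix z c assume "Rel z c"
  then obtain f0 f1 where r: "rel 0 (fst z) f0" "rel 1 (snd z) f1" "c = act.J (\<lambda>S. f0 S + f1 S)" unfolding Rel_def by blast
  note F = rel_FK[OF r(1)] rel_FK[OF r(2)]
  have "z \<in> cocycles HA dT" using F HA_cocycles[of "fst z" "snd z"] by simp
  moreover have "c \<in> cocycles CA dCl" unfolding r(3) using F by (simp add: CA_cocycles act.FK_add contr_plus)
  ultimately show "z \<in> cocycles HA dT \<and> c \<in> cocycles CA dCl" ..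
next
  fix z assume "z \<in> cocycles HA dT"
  hence z: "fst z \<in> CC 0" "dH 0 (fst z) = (\<lambda>as. 0)" "snd z \<in> CC 1" "dH 1 (snd z) = (\<lambda>as. 0)"
    using HA_cocycles[of "fst z" "snd z"] by simp_all
  from rel_total[OF z(1,2)] rel_total[OF z(3,4)] show "\<exists>c. Rel z c" unfolding Rel_def by blast
next
  fix c assume "c \<in> cocycles CA dCl"
  then obtain f where f: "c = act.J f" "f \<in> act.FK" "act.dC f = (\<lambda>_. 0)" by (rule CA_cocyclesE)
  have "f = (\<lambda>S. pt 0 f S + pt 1 f S)" using pt(3)[of f 0] by simp
  hence c: "c = act.J (\<lambda>S. pt 0 f S + pt 1 f S)" using f(1) by simp
  have "\<exists>\<phi>. rel t \<phi> (pt t f)" for t by (rule rel_surj[OF pt(2)[OF f(2)] pt(1) contr_pt[OF f(2,3)]])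
  then obtain \<phi>0 \<phi>1 where "rel 0 \<phi>0 (pt 0 f)" "rel 1 \<phi>1 (pt 1 f)" by meson
  thus "\<exists>z. Rel z c" unfolding Rel_def using c by (intro exI[of _ "(\<phi>0, \<phi>1)"]) auto
next
  fix t z assume z: "z \<in> cocycles HA dT \<inter> hochschild_part scale X t"
  hence z': "fst z \<in> CC 0" "dH 0 (fst z) = (\<lambda>as. 0)" "snd z \<in> CC 1" "dH 1 (snd z) = (\<lambda>as. 0)"
    using HA_cocycles[of "fst z" "snd z"] by simp_all
  show "\<exists>c\<in>Hess_clifford_part n pot t. Rel z c"
  proof (cases "even t")
    case True
    hence s: "snd z = (\<lambda>as. 0)" using z by (auto simp: hochschild_part_def)
    from rel_total[OF z'(1,2)] obtain f where f: "rel 0 (fst z) f" by blast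
    have "Rel z (act.J f)" unfolding Rel_def s using f rel_zero[of 1] by (intro exI[of _ f] exI[of _ "\<lambda>_. 0"]) simp
    moreover have "act.J f \<in> Hess_clifford_part n pot t"
      using rel_FK[OF f] par_cong[of 0 t] True by (simp add: CA_simps)
    ultimately show ?thesis by blast
  next
    case False
    hence s: "fst z = (\<lambda>as. 0)" using z by (auto simp: hochschild_part_def)
    from rel_total[OF z'(3,4)] obtain f where f: "rel 1 (snd z) f" by blast
    have "Rel z (act.J f)" unfolding Rel_def s using f rel_zero[of 0] by (intro exI[of _ f] exI[of _ "\<lambda>_. 0"]) simp
    moreover have "act.J f \<in> Hess_clifford_part n pot t"
      using rel_FK[OF f] par_cong[of 1 t] False by (simp add: CA_simps)
    ultimately show ?thesis by blast
  qed
next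
  fix t c assume c: "c \<in> cocycles CA dCl \<inter> Hess_clifford_part n pot t"
  then obtain f where f: "c = act.J f" "f \<in> act.FK" "act.par t f" by (auto simp: CA_simps)
  hence d: "act.dC f = (\<lambda>_. 0)" using c CA_cocycles[OF f(2)] by simp
  from rel_surj[OF f(2,3) d] obtain \<phi> where \<phi>: "rel t \<phi> f" by blast
  show "\<exists>z\<in>hochschild_part scale X t. Rel z c"
  proof (cases "even t")
    case True
    hence r: "rel 0 \<phi> f" using \<phi> rel_cong[of t 0] by simp
    hence "Rel (\<phi>, \<lambda>as. 0) c" unfolding Rel_def f(1) using rel_zero[of 1] by (intro exI[of _ f] exI[of _ "\<lambda>_. 0"]) simp
    moreover have "(\<phi>, \<lambda>as. 0) \<in> hochschild_part scale X t" using rel_FK[OF r] True by (simp add: hochschild_part_def)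
    ultimately show ?thesis by blast
  next
    case False
    hence r: "rel 1 \<phi> f" using \<phi> rel_cong[of t 1] by simp
    hence "Rel (\<lambda>as. 0, \<phi>) c" unfolding Rel_def f(1) using rel_zero[of 0] by (intro exI[of _ "\<lambda>_. 0"] exI[of _ f]) simp
    moreover have "(\<lambda>as. 0, \<phi>) \<in> hochschild_part scale X t" using rel_FK[OF r] False by (simp add: hochschild_part_def)
    ultimately show ?thesis by blast
  qed
next
  fix z c w e assume "Rel z c" "Rel w e"
  then obtain f0 f1 g0 g1 where r: "rel 0 (fst z) f0" "rel 1 (snd z) f1" "c = act.J (\<lambda>S. f0 S + f1 S)"
    "rel 0 (fst w) g0" "rel 1 (snd w) g1" "e = act.J (\<lambda>S. g0 S + g1 S)" unfolding Rel_def by blast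
  note F = rel_FK[OF r(1)] rel_FK[OF r(2)] rel_FK[OF r(4)] rel_FK[OF r(5)]
  have FG: "(\<lambda>S. f0 S + f1 S) \<in> act.FK" "(\<lambda>S. g0 S + g1 S) \<in> act.FK" using F by (simp_all add: act.FK_add)
  show "(\<exists>b\<in>coboundaries HA dT. z = b \<oplus>\<^bsub>HA\<^esub> w) = (\<exists>b\<in>coboundaries CA dCl. c = b \<oplus>\<^bsub>CA\<^esub> e)"
    using Rel_exact[OF r(1,2,4,5)] by (simp add: r(3,6))
  have zw: "z \<oplus>\<^bsub>HA\<^esub> w = (\<lambda>as. fst z as + fst w as, \<lambda>as. snd z as + snd w as)"
    using HA_simps(4)[of "fst z" "snd z" "fst w" "snd w"] by simp
  have "c \<oplus>\<^bsub>CA\<^esub> e = act.J (\<lambda>S. (f0 S + g0 S) + (f1 S + g1 S))"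
    unfolding r(3,6) CA_simps(4)[OF FG] by (simp add: add_ac)
  thus "Rel (z \<oplus>\<^bsub>HA\<^esub> w) (c \<oplus>\<^bsub>CA\<^esub> e)"
    unfolding Rel_def zw using rel_add[OF r(1,4)] rel_add[OF r(2,5)] by (intro exI conjI) simp_all
  have zw: "z \<otimes>\<^bsub>HA\<^esub> w = (\<lambda>as. HP 0 0 (fst z) (fst w) as + HP 1 1 (snd z) (snd w) as,
      \<lambda>as. HP 0 1 (fst z) (snd w) as + HP 1 0 (snd z) (fst w) as)"
    using HA_simps(5)[of "fst z" "snd z" "fst w" "snd w"] by simp
  have "c \<otimes>\<^bsub>CA\<^esub> e = act.J (\<lambda>S. (act.star f0 g0 S + act.star f1 g1 S) + (act.star f0 g1 S + act.star f1 g0 S))"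
    unfolding r(3,6) CA_simps(5)[OF FG] by (rule arg_cong[of _ _ act.J], rule ext) (simp only: act.star_add_left act.star_add_right add_ac)
  moreover have "rel 0 (HP 1 1 (snd z) (snd w)) (act.star f1 g1)" using rel_mult[OF r(2,5)] rel_cong[of 2 0] by simp
  moreover have "rel 0 (HP 0 0 (fst z) (fst w)) (act.star f0 g0)" "rel 1 (HP 0 1 (fst z) (snd w)) (act.star f0 g1)"
    "rel 1 (HP 1 0 (snd z) (fst w)) (act.star f1 g0)"
    using rel_mult[OF r(1,4)] rel_mult[OF r(1,5)] rel_mult[OF r(2,4)] by simp_all
  ultimately show "Rel (z \<otimes>\<^bsub>HA\<^esub> w) (c \<otimes>\<^bsub>CA\<^esub> e)"
    unfolding Rel_def zw using rel_add by (intro exI conjI) simp_all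
next
  show "Rel \<one>\<^bsub>HA\<^esub> \<one>\<^bsub>CA\<^esub>"
    unfolding Rel_def HA_simps(3) CA_simps(3) using rel_one rel_zero[of 1]
    by (intro exI[of _ "basis_fun {}"] exI[of _ "\<lambda>_. 0"]) simp
next
  fix r z c assume "Rel z c"
  then obtain f0 f1 where f: "rel 0 (fst z) f0" "rel 1 (snd z) f1" "c = act.J (\<lambda>S. f0 S + f1 S)" unfolding Rel_def by blast
  have F: "(\<lambda>S. f0 S + f1 S) \<in> act.FK" using rel_FK[OF f(1)] rel_FK[OF f(2)] by (simp add: act.FK_add)
  have z: "r \<odot>\<^bsub>HA\<^esub> z = (\<lambda>as. r *s fst z as, \<lambda>as. r *s snd z as)" using HA_simps(6)[of r "fst z" "snd z"] by simp
  have c: "r \<odot>\<^bsub>CA\<^esub> c = act.J (\<lambda>S. mfps_const r * f0 S + mfps_const r * f1 S)"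
    unfolding f(3) CA_simps(6)[OF F] by (simp add: distrib_left)
  show "Rel (r \<odot>\<^bsub>HA\<^esub> z) (r \<odot>\<^bsub>CA\<^esub> c)"
    unfolding Rel_def z c using rel_smult[OF f(1)] rel_smult[OF f(2)] by (intro exI conjI) simp_all
qed

end

theorem theorem4:
  fixes scale :: "'r::comm_ring_1 \<Rightarrow> 'a::ab_group_add \<Rightarrow> 'a"
    and X F :: "int \<Rightarrow> 'a set"
    and n :: nat
    and \<mu> :: "'a list \<Rightarrow> 'a"
    and unit :: 'a
    and \<theta> :: "int \<Rightarrow> 'a set \<Rightarrow> (nat free_mon \<Rightarrow>\<^sub>0 'r) set"
    and P :: "'r mfps"
  assumes "superfiltered_deformation scale X F n \<mu> unit \<theta>"
    and "P = disc_potential scale X F n \<mu> unit \<theta>"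
  shows "\<exists>\<Psi>. \<Psi> \<in> graded_alg_iso
            (HH_alg scale X \<mu> unit) (HH_part scale X \<mu> unit)
            (cohomology_alg (Hess_clifford_alg n P) (Hess_clifford_diff n P))
            (cohomology_part (Hess_clifford_alg n P) (Hess_clifford_diff n P)
               (Hess_clifford_part n P))"
  unfolding assms(2) by (rule superfiltered_deformation.HH_iso[OF assms(1)])

end
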